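(* Let $X$ be an affine variety and let $L\subseteq\operatorname{Vec}(X)$ be a Lie subalgebra. Then $L\subseteq\operatorname{Lie}G$ for some algebraic subgroup $G\subseteq\operatorname{Aut}(X)$ if and only if $L$ is locally finite. If $L$ is locally finite and generated (as a Lie algebra) by locally nilpotent elements, then $L$ is algebraic, i.e. there is an algebraic subgroup $G\subseteq\operatorname{Aut}(X)$ such that $L=\operatorname{Lie}G$.
   Context: $\Bbbk$ is an algebraically closed field of characteristic zero; varieties are over $\Bbbk$, algebraic groups are affine. $\operatorname{Vec}(X)=\operatorname{Der}_\Bbbk(\mathcal O(X))$ is the Lie algebra of algebraic vector fields on $X$. A subset $S\subseteq\operatorname{Vec}(X)$ is locally finite if every $f\in\mathcal O(X)$ is contained in a finite dimensional subspace of $\mathcal O(X)$ that is invariant under all elements of $S$. A vector field $\delta$ is locally nilpotent if for every $f\in\mathcal O(X)$ there is $m$ with $\delta^m(f)=0$. An algebraic subgroup $G\subseteq\operatorname{Aut}(X)$ is a subgroup which is (the image of) a linear algebraic group acting faithfully and regularly on $X$. Its Lie algebra is identified with a subspace of $\operatorname{Vec}(X)$ via the injective anti-homomorphism $A\mapsto\xi_A$, $\xi_A(x)=(d\theta_x)_e(A)\in T_xX$, where $\theta_x\colon G\to X$, $g\mapsto gx$. *)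

theory Defs
  imports
    "HOL-Computational_Algebra.Polynomial"
    "HOL-Library.Function_Algebras"
    "HOL-Algebra.Group_Action"
begin

section \<open>Affine varieties\<close>

text \<open>
  A variety is a set of points together with its algebra of regular functions.  A function
  on a set of points is encoded as a total function that is \<open>0\<close> off this set, so that the
  pointwise operations of \<^theory>\<open>HOL-Library.Function_Algebras\<close> are the operations
  of the algebra (whose unit is the indicator function of the set of points).
\<close>

record ('a, 'k) variety =
  points :: "'a set"
  regular :: "('a \<Rightarrow> 'k) set"

definition pullback :: "'a set \<Rightarrow> ('a \<Rightarrow> 'b) \<Rightarrow> ('b \<Rightarrow> 'k::zero) \<Rightarrow> 'a \<Rightarrow> 'k"
  where "pullback A \<phi> f = (\<lambda>x. if x \<in> A then f (\<phi> x) else 0)"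

definition affine_space :: "nat \<Rightarrow> (nat \<Rightarrow> 'k::zero) set"
  where "affine_space n = {x. \<forall>i\<ge>n. x i = 0}"

inductive_set polynomial_functions :: "nat \<Rightarrow> ((nat \<Rightarrow> 'k::comm_ring_1) \<Rightarrow> 'k) set" for n
  where
    const: "(\<lambda>x. c) \<in> polynomial_functions n"
  | coord: "i < n \<Longrightarrow> (\<lambda>x. x i) \<in> polynomial_functions n"
  | add: "p \<in> polynomial_functions n \<Longrightarrow> q \<in> polynomial_functions n
      \<Longrightarrow> (\<lambda>x. p x + q x) \<in> polynomial_functions n"
  | mult: "p \<in> polynomial_functions n \<Longrightarrow> q \<in> polynomial_functions n
      \<Longrightarrow> (\<lambda>x. p x * q x) \<in> polynomial_functions n"

definition zariski_closed :: "nat \<Rightarrow> (nat \<Rightarrow> 'k::comm_ring_1) set \<Rightarrow> bool"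
  where "zariski_closed n Z \<longleftrightarrow>
    (\<exists>P \<subseteq> polynomial_functions n. Z = {x \<in> affine_space n. \<forall>p\<in>P. p x = 0})"

definition closed_subvariety :: "(nat \<Rightarrow> 'k::comm_ring_1) set \<Rightarrow> nat \<Rightarrow> (nat \<Rightarrow> 'k, 'k) variety"
  where "closed_subvariety Z n =
    \<lparr>points = Z, regular = pullback Z (\<lambda>x. x) ` polynomial_functions n\<rparr>"

text \<open>Varieties are not required to be irreducible.\<close>

definition affine_variety :: "('a, 'k::comm_ring_1) variety \<Rightarrow> bool"
  where "affine_variety X \<longleftrightarrow>
    (\<exists>n Z \<phi>. zariski_closed n Z \<and> bij_betw \<phi> (points X) Z \<and>
      regular X = pullback (points X) \<phi> ` regular (closed_subvariety Z n))"

definition morphism :: "('a, 'k::zero) variety \<Rightarrow> ('b, 'k) variety \<Rightarrow> ('a \<Rightarrow> 'b) \<Rightarrow> bool"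
  where "morphism X Y \<phi> \<longleftrightarrow>
    \<phi> \<in> points X \<rightarrow> points Y \<and> (\<forall>f \<in> regular Y. pullback (points X) \<phi> f \<in> regular X)"

definition scale_fun :: "'k::field \<Rightarrow> ('a \<Rightarrow> 'k) \<Rightarrow> 'a \<Rightarrow> 'k"
  where "scale_fun c f = (\<lambda>x. c * f x)"

global_interpretation fun_vs: vector_space "scale_fun :: 'k::field \<Rightarrow> ('a \<Rightarrow> 'k) \<Rightarrow> 'a \<Rightarrow> 'k"
  by unfold_locales (auto simp: scale_fun_def fun_eq_iff algebra_simps)

text \<open>The regular functions on a product are the finite sums of products of regular
  functions on the factors, i.e. the image of the tensor product of the two algebras.\<close>

definition product_variety ::
    "('a, 'k::field) variety \<Rightarrow> ('b, 'k) variety \<Rightarrow> ('a \<times> 'b, 'k) variety"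
  where "product_variety X Y =
    \<lparr>points = points X \<times> points Y,
     regular = fun_vs.span {(\<lambda>(x, y). f x * g y) | f g. f \<in> regular X \<and> g \<in> regular Y}\<rparr>"


section \<open>Vector fields\<close>

text \<open>Operators on the algebra of regular functions are extended by \<open>0\<close> to all functions, so
  that equality of operators is equality on regular functions.\<close>

definition Vec :: "('a, 'k::field) variety \<Rightarrow> (('a \<Rightarrow> 'k) \<Rightarrow> ('a \<Rightarrow> 'k)) set"
  where "Vec X = {\<delta>.
    (\<forall>f \<in> regular X. \<delta> f \<in> regular X) \<and>
    (\<forall>f. f \<notin> regular X \<longrightarrow> \<delta> f = 0) \<and>
    (\<forall>f \<in> regular X. \<forall>g \<in> regular X. \<delta> (f + g) = \<delta> f + \<delta> g) \<and>
    (\<forall>c. \<forall>f \<in> regular X. \<delta> (scale_fun c f) = scale_fun c (\<delta> f)) \<and>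
    (\<forall>f \<in> regular X. \<forall>g \<in> regular X. \<delta> (f * g) = f * \<delta> g + \<delta> f * g)}"

definition lie_bracket :: "('v \<Rightarrow> 'v::minus) \<Rightarrow> ('v \<Rightarrow> 'v) \<Rightarrow> 'v \<Rightarrow> 'v"
  where "lie_bracket \<delta> \<epsilon> = (\<lambda>f. \<delta> (\<epsilon> f) - \<epsilon> (\<delta> f))"

definition lie_subalgebra ::
    "('a, 'k::field) variety \<Rightarrow> (('a \<Rightarrow> 'k) \<Rightarrow> ('a \<Rightarrow> 'k)) set \<Rightarrow> bool"
  where "lie_subalgebra X L \<longleftrightarrow>
    L \<subseteq> Vec X \<and>
    0 \<in> L \<and>
    (\<forall>\<delta> \<in> L. \<forall>\<epsilon> \<in> L. \<delta> + \<epsilon> \<in> L) \<and>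
    (\<forall>c. \<forall>\<delta> \<in> L. (\<lambda>f. scale_fun c (\<delta> f)) \<in> L) \<and>
    (\<forall>\<delta> \<in> L. \<forall>\<epsilon> \<in> L. lie_bracket \<delta> \<epsilon> \<in> L)"

definition generated_lie_subalgebra ::
    "('a, 'k::field) variety \<Rightarrow> (('a \<Rightarrow> 'k) \<Rightarrow> ('a \<Rightarrow> 'k)) set
      \<Rightarrow> (('a \<Rightarrow> 'k) \<Rightarrow> ('a \<Rightarrow> 'k)) set"
  where "generated_lie_subalgebra X S = \<Inter>{L. lie_subalgebra X L \<and> S \<subseteq> L}"

definition locally_finite ::
    "('a, 'k::field) variety \<Rightarrow> (('a \<Rightarrow> 'k) \<Rightarrow> ('a \<Rightarrow> 'k)) set \<Rightarrow> bool"
  where "locally_finite X S \<longleftrightarrow>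
    (\<forall>f \<in> regular X. \<exists>W \<subseteq> regular X.
      f \<in> W \<and> (\<exists>B. finite B \<and> W = fun_vs.span B) \<and>
      (\<forall>\<delta> \<in> S. \<forall>w \<in> W. \<delta> w \<in> W))"

definition locally_nilpotent ::
    "('a, 'k::field) variety \<Rightarrow> (('a \<Rightarrow> 'k) \<Rightarrow> ('a \<Rightarrow> 'k)) \<Rightarrow> bool"
  where "locally_nilpotent X \<delta> \<longleftrightarrow> (\<forall>f \<in> regular X. \<exists>m. (\<delta> ^^ m) f = 0)"


section \<open>Algebraic groups and regular actions\<close>

definition linear_algebraic_group :: "'g monoid \<Rightarrow> ('g, 'k::field) variety \<Rightarrow> bool"
  where "linear_algebraic_group M V \<longleftrightarrow>
    group M \<and> affine_variety V \<and> points V = carrier M \<and>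
    morphism (product_variety V V) V (\<lambda>(g, h). g \<otimes>\<^bsub>M\<^esub> h) \<and>
    morphism V V (\<lambda>g. inv\<^bsub>M\<^esub> g)"

definition regular_action ::
    "'g monoid \<Rightarrow> ('g, 'k::field) variety \<Rightarrow> ('a, 'k) variety \<Rightarrow> ('g \<Rightarrow> 'a \<Rightarrow> 'a) \<Rightarrow> bool"
  where "regular_action M V X \<theta> \<longleftrightarrow>
    group_action M (points X) \<theta> \<and> morphism (product_variety V X) X (\<lambda>(g, x). \<theta> g x)"

text \<open>Tangent vectors at a point are the point derivations of the algebra of regular
  functions, again extended by \<open>0\<close> to all functions.\<close>

definition tangent_space :: "('a, 'k::field) variety \<Rightarrow> 'a \<Rightarrow> (('a \<Rightarrow> 'k) \<Rightarrow> 'k) set"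
  where "tangent_space X x = {A.
    (\<forall>f. f \<notin> regular X \<longrightarrow> A f = 0) \<and>
    (\<forall>f \<in> regular X. \<forall>g \<in> regular X. A (f + g) = A f + A g) \<and>
    (\<forall>c. \<forall>f \<in> regular X. A (scale_fun c f) = c * A f) \<and>
    (\<forall>f \<in> regular X. \<forall>g \<in> regular X. A (f * g) = f x * A g + A f * g x)}"

definition differential ::
    "('a, 'k::field) variety \<Rightarrow> ('b, 'k) variety \<Rightarrow> ('a \<Rightarrow> 'b)
      \<Rightarrow> (('a \<Rightarrow> 'k) \<Rightarrow> 'k) \<Rightarrow> ('b \<Rightarrow> 'k) \<Rightarrow> 'k"
  where "differential X Y \<phi> A =
    (\<lambda>f. if f \<in> regular Y then A (pullback (points X) \<phi> f) else 0)"

text \<open>The vector field \<open>\<xi>\<^sub>A\<close> with \<open>\<xi>\<^sub>A(x) = (d\<theta>\<^sub>x)\<^sub>e(A)\<close>, where \<open>\<theta>\<^sub>x(g) = \<theta> g x\<close>: as a derivation it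
  sends \<open>f\<close> to the function whose value at \<open>x\<close> is the tangent vector \<open>\<xi>\<^sub>A(x)\<close> applied to \<open>f\<close>.\<close>

definition fundamental_field ::
    "('g, 'k::field) variety \<Rightarrow> ('a, 'k) variety \<Rightarrow> ('g \<Rightarrow> 'a \<Rightarrow> 'a)
      \<Rightarrow> (('g \<Rightarrow> 'k) \<Rightarrow> 'k) \<Rightarrow> ('a \<Rightarrow> 'k) \<Rightarrow> 'a \<Rightarrow> 'k"
  where "fundamental_field V X \<theta> A =
    (\<lambda>f x. if x \<in> points X then differential V X (\<lambda>g. \<theta> g x) A f else 0)"

definition lie_of_action ::
    "'g monoid \<Rightarrow> ('g, 'k::field) variety \<Rightarrow> ('a, 'k) variety \<Rightarrow> ('g \<Rightarrow> 'a \<Rightarrow> 'a)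
      \<Rightarrow> (('a \<Rightarrow> 'k) \<Rightarrow> ('a \<Rightarrow> 'k)) set"
  where "lie_of_action M V X \<theta> = fundamental_field V X \<theta> ` tangent_space V \<one>\<^bsub>M\<^esub>"


section \<open>Algebraic subgroups of the automorphism group\<close>

definition Aut :: "('a, 'k::field) variety \<Rightarrow> ('a \<Rightarrow> 'a) monoid"
  where "Aut X = (BijGroup (points X))
    \<lparr>carrier := {\<phi> \<in> Bij (points X). morphism X X \<phi> \<and> morphism X X (inv_into (points X) \<phi>)}\<rparr>"

text \<open>An algebraic subgroup is given by a subgroup of the automorphism group together with
  a structure of linear algebraic group on it for which the tautological (hence faithful)
  action is regular.  By \<open>algebraic_subgroup_image\<close> below, the image of any faithful regular
  action of a linear algebraic group is of this kind, with the same Lie algebra.\<close>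

definition algebraic_subgroup :: "('a, 'k::field) variety \<Rightarrow> ('a \<Rightarrow> 'a, 'k) variety \<Rightarrow> bool"
  where "algebraic_subgroup X G \<longleftrightarrow>
    subgroup (points G) (Aut X) \<and>
    linear_algebraic_group ((Aut X)\<lparr>carrier := points G\<rparr>) G \<and>
    regular_action ((Aut X)\<lparr>carrier := points G\<rparr>) G X (\<lambda>g. g)"

definition Lie ::
    "('a, 'k::field) variety \<Rightarrow> ('a \<Rightarrow> 'a, 'k) variety \<Rightarrow> (('a \<Rightarrow> 'k) \<Rightarrow> ('a \<Rightarrow> 'k)) set"
  where "Lie X G = lie_of_action ((Aut X)\<lparr>carrier := points G\<rparr>) G X (\<lambda>g. g)"


section \<open>Consistency of the definitions\<close>

lemma regular_affine:
  fixes X :: "('a, 'k::field) variety"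
  assumes "affine_variety X"
  shows subspace_regular: "fun_vs.subspace (regular X)"
    and mult_regular: "\<lbrakk>f \<in> regular X; g \<in> regular X\<rbrakk> \<Longrightarrow> f * g \<in> regular X"
    and regular_off_points: "\<lbrakk>f \<in> regular X; x \<notin> points X\<rbrakk> \<Longrightarrow> f x = 0"
proof -
  obtain n Z \<phi> where bij: "bij_betw \<phi> (points X) Z"
    and reg: "regular X = pullback (points X) \<phi> ` regular (closed_subvariety Z n)"
    using assms unfolding affine_variety_def by blast
  have \<phi>: "\<phi> x \<in> Z" if "x \<in> points X" for x
    using bij that by (auto simp: bij_betw_def)
  have eq: "regular X = pullback (points X) \<phi> ` polynomial_functions n"
    unfolding reg closed_subvariety_def by (auto simp: image_image pullback_def \<phi> cong: if_cong)
  let ?p = "pullback (points X) \<phi>"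
  have sum: "?p p + ?p q = ?p (\<lambda>x. p x + q x)" and mult: "?p p * ?p q = ?p (\<lambda>x. p x * q x)"
    and scale: "scale_fun c (?p p) = ?p (\<lambda>x. c * p x)" and zero: "0 = ?p (\<lambda>x. 0)" for p q c
    by (auto simp: pullback_def scale_fun_def fun_eq_iff)
  show "fun_vs.subspace (regular X)"
    unfolding fun_vs.subspace_def eq
    by (auto simp: sum scale intro!: imageI polynomial_functions.intros)
      (metis zero polynomial_functions.const image_eqI)
  show "f * g \<in> regular X" if "f \<in> regular X" "g \<in> regular X"
    using that unfolding eq by (auto simp: mult intro!: imageI polynomial_functions.intros)
  show "f x = 0" if "f \<in> regular X" "x \<notin> points X"
    using that unfolding eq by (auto simp: pullback_def)
qed

lemma morphism_cong:
  fixes X :: "('a, 'k::zero) variety"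
  assumes "morphism X Y \<phi>" "\<And>x. x \<in> points X \<Longrightarrow> \<phi> x = \<psi> x"
  shows "morphism X Y \<psi>"
proof -
  have "pullback (points X) \<phi> f = pullback (points X) \<psi> f" for f :: "_ \<Rightarrow> 'k"
    using assms(2) by (auto simp: pullback_def)
  then show ?thesis using assms unfolding morphism_def by (auto simp: Pi_iff) 
qed

lemma morphism_comp:
  fixes X :: "('a, 'k::zero) variety"
  assumes "morphism X Y \<phi>" "morphism Y Z \<psi>"
  shows "morphism X Z (\<psi> \<circ> \<phi>)"
proof -
  have "pullback (points X) (\<psi> \<circ> \<phi>) f = pullback (points X) \<phi> (pullback (points Y) \<psi> f)"
    for f :: "_ \<Rightarrow> 'k"
    using assms(1) by (auto simp: pullback_def morphism_def Pi_iff fun_eq_iff)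
  then show ?thesis using assms unfolding morphism_def by (auto simp: Pi_iff)
qed

lemma morphism_id:
  fixes X :: "('a, 'k::field) variety"
  assumes "affine_variety X"
  shows "morphism X X (\<lambda>x. x)"
proof -
  have "pullback (points X) (\<lambda>x. x) f = f" if "f \<in> regular X" for f
    using regular_off_points[OF assms that] by (auto simp: pullback_def)
  then show ?thesis by (auto simp: morphism_def)
qed

lemma span_image_subset:
  fixes T :: "('a \<Rightarrow> 'k::field) \<Rightarrow> ('b \<Rightarrow> 'k)"
  assumes "\<And>f g. T (f + g) = T f + T g" "\<And>c f. T (scale_fun c f) = scale_fun c (T f)"
    and "fun_vs.subspace W" "\<And>f. f \<in> S \<Longrightarrow> T f \<in> W" "f \<in> fun_vs.span S"
  shows "T f \<in> W"
proof -
  have "T 0 = 0" using assms(1)[of 0 0] by simp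
  then have "fun_vs.subspace {f. T f \<in> W}"
    using assms(1-3) by (auto simp: fun_vs.subspace_def)
  with assms(4) have "fun_vs.span S \<subseteq> {f. T f \<in> W}"
    by (intro fun_vs.span_minimal) auto
  then show ?thesis using assms(5) by auto
qed

lemma pullback_add: "pullback A \<phi> (f + g) = pullback A \<phi> f + pullback A \<phi> g"
  for f :: "'a \<Rightarrow> 'k::field" by (auto simp: pullback_def fun_eq_iff)
lemma pullback_mult: "pullback A \<phi> (f * g) = pullback A \<phi> f * pullback A \<phi> g"
  for f :: "'a \<Rightarrow> 'k::field" by (auto simp: pullback_def fun_eq_iff)
lemma pullback_scale: "pullback A \<phi> (scale_fun c f) = scale_fun c (pullback A \<phi> f)"
  for f :: "'a \<Rightarrow> 'k::field" by (auto simp: pullback_def scale_fun_def fun_eq_iff)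

lemma morphism_product:
  fixes X :: "('a, 'k::field) variety" and Y :: "('b, 'k) variety"
  assumes "morphism X X' \<phi>" "morphism Y Y' \<psi>"
  shows "morphism (product_variety X Y) (product_variety X' Y') (map_prod \<phi> \<psi>)"
proof -
  let ?S = "{(\<lambda>(x, y). f x * g y) | f g. f \<in> regular X \<and> g \<in> regular Y}"
  let ?S' = "{(\<lambda>(x, y). f x * g y) | f g. f \<in> regular X' \<and> g \<in> regular Y'}"
  have "pullback (points X \<times> points Y) (map_prod \<phi> \<psi>) f \<in> fun_vs.span ?S"
    if "f \<in> fun_vs.span ?S'" for f
  proof (rule span_image_subset[OF pullback_add pullback_scale fun_vs.subspace_span _ that])
    fix h assume "h \<in> ?S'"
    then obtain f g where h: "h = (\<lambda>(x, y). f x * g y)" and fg: "f \<in> regular X'" "g \<in> regular Y'"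
      by auto
    have "pullback (points X \<times> points Y) (map_prod \<phi> \<psi>) h =
      (\<lambda>(x, y). pullback (points X) \<phi> f x * pullback (points Y) \<psi> g y)"
      by (auto simp: h pullback_def fun_eq_iff)
    also have "\<dots> \<in> ?S" using assms fg unfolding morphism_def by blast
    finally show "pullback (points X \<times> points Y) (map_prod \<phi> \<psi>) h \<in> fun_vs.span ?S"
      by (rule fun_vs.span_base)
  qed
  then show ?thesis using assms by (auto simp: morphism_def product_variety_def Pi_iff)
qed

lemma morphism_slice:
  fixes V :: "('g, 'k::field) variety" and X :: "('a, 'k) variety"
  assumes "affine_variety X" "g \<in> points V" 
  shows "morphism X (product_variety V X) (\<lambda>x. (g, x))"
proof -
  let ?S = "{(\<lambda>(x, y). f x * h y) | f h. f \<in> regular V \<and> h \<in> regular X}"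
  have "pullback (points X) (\<lambda>x. (g, x)) f \<in> regular X"
    if "f \<in> fun_vs.span ?S" for f
  proof (rule span_image_subset[OF pullback_add pullback_scale subspace_regular[OF assms(1)] _ that])
    fix u assume "u \<in> ?S"
    then obtain f h where u: "u = (\<lambda>(x, y). f x * h y)" and fh: "f \<in> regular V" "h \<in> regular X"
      by auto
    have "pullback (points X) (\<lambda>x. (g, x)) u = scale_fun (f g) h"
      using regular_off_points[OF assms(1) fh(2)]
      by (auto simp: u pullback_def scale_fun_def fun_eq_iff)
    then show "pullback (points X) (\<lambda>x. (g, x)) u \<in> regular X"
      using fh(2) subspace_regular[OF assms(1)] by (simp add: fun_vs.subspace_def)
  qed
  then show ?thesis using assms by (auto simp: morphism_def product_variety_def Pi_iff)
qed

lemma morphism_slice':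
  fixes V :: "('g, 'k::field) variety" and X :: "('a, 'k) variety"
  assumes "affine_variety V" "x \<in> points X" 
  shows "morphism V (product_variety V X) (\<lambda>g. (g, x))"
proof -
  let ?S = "{(\<lambda>(x, y). f x * h y) | f h. f \<in> regular V \<and> h \<in> regular X}"
  have "pullback (points V) (\<lambda>g. (g, x)) f \<in> regular V"
    if "f \<in> fun_vs.span ?S" for f
  proof (rule span_image_subset[OF pullback_add pullback_scale subspace_regular[OF assms(1)] _ that])
    fix u assume "u \<in> ?S"
    then obtain f h where u: "u = (\<lambda>(x, y). f x * h y)" and fh: "f \<in> regular V" "h \<in> regular X"
      by auto
    have "pullback (points V) (\<lambda>g. (g, x)) u = scale_fun (h x) f"
      using regular_off_points[OF assms(1) fh(1)]
      by (auto simp: u pullback_def scale_fun_def fun_eq_iff)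
    then show "pullback (points V) (\<lambda>g. (g, x)) u \<in> regular V"
      using fh(1) subspace_regular[OF assms(1)] by (simp add: fun_vs.subspace_def)
  qed
  then show ?thesis using assms by (auto simp: morphism_def product_variety_def Pi_iff)
qed

lemma action_morphism:
  fixes V :: "('g, 'k::field) variety"
  assumes "affine_variety X" "regular_action M V X \<theta>" "g \<in> points V"
  shows "morphism X X (\<theta> g)"
proof -
  have "morphism X X ((\<lambda>(g, x). \<theta> g x) \<circ> (\<lambda>x. (g, x)))"
    using assms(2) morphism_slice[OF assms(1,3)] morphism_comp unfolding regular_action_def by blast
  then show ?thesis by (simp add: comp_def)
qed

lemma orbit_morphism:
  fixes V :: "('g, 'k::field) variety"
  assumes "affine_variety V" "regular_action M V X \<theta>" "x \<in> points X"
  shows "morphism V X (\<lambda>g. \<theta> g x)"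
proof -
  have "morphism V X ((\<lambda>(g, x). \<theta> g x) \<circ> (\<lambda>g. (g, x)))"
    using assms(2) morphism_slice'[OF assms(1,3)] morphism_comp unfolding regular_action_def by blast
  then show ?thesis by (simp add: comp_def)
qed

lemma carrier_Aut: "carrier (Aut X) =
    {\<phi> \<in> Bij (points X). morphism X X \<phi> \<and> morphism X X (inv_into (points X) \<phi>)}"
  by (simp add: Aut_def)

lemma subgroup_Aut:
  fixes X :: "('a, 'k::field) variety"
  assumes "affine_variety X"
  shows "subgroup (carrier (Aut X)) (BijGroup (points X))"
proof -
  interpret B: group "BijGroup (points X)" by (rule group_BijGroup)
  have inv: "morphism X X (inv_into (points X) (restrict (inv_into (points X) \<phi>) (points X)))"
    if "\<phi> \<in> Bij (points X)" "morphism X X \<phi>" for \<phi>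
  proof (rule morphism_cong[OF that(2)])
    fix x assume x: "x \<in> points X"
    let ?i = "restrict (inv_into (points X) \<phi>) (points X)"
    have i: "?i \<in> Bij (points X)" by (rule restrict_inv_into_Bij[OF that(1)])
    have p: "\<phi> x \<in> points X" using that(1) x Bij_imp_funcset by blast
    have "?i (\<phi> x) = x" using p x that(1) by (simp add: Bij_def bij_betw_def)
    moreover have "inj_on ?i (points X)" using i by (auto simp only: Bij_def bij_betw_def)
    ultimately show "\<phi> x = inv_into (points X) ?i x"
      using inv_into_f_f[of ?i "points X" "\<phi> x"] p by simp
  qed
  show ?thesis
  proof (rule B.subgroupI)
    show "carrier (Aut X) \<subseteq> carrier (BijGroup (points X))"
      by (auto simp: carrier_Aut BijGroup_def)
    have "(\<lambda>x\<in>points X. x) \<in> carrier (Aut X)"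
      unfolding carrier_Aut 
    proof (intro CollectI conjI id_Bij)
      show "morphism X X (\<lambda>x\<in>points X. x)"
        by (rule morphism_cong[OF morphism_id[OF assms]]) simp
      show "morphism X X (inv_into (points X) (\<lambda>x\<in>points X. x))"
        by (rule morphism_cong[OF morphism_id[OF assms]])
          (use inv_into_f_f[of "\<lambda>x\<in>points X. x" "points X"] in \<open>simp add: inj_on_def\<close>)
    qed
    then show "carrier (Aut X) \<noteq> {}" by auto
  next
    fix \<phi> assume "\<phi> \<in> carrier (Aut X)"
    then show "inv\<^bsub>BijGroup (points X)\<^esub> \<phi> \<in> carrier (Aut X)"
      by (auto simp: carrier_Aut inv_BijGroup restrict_inv_into_Bij inv
          intro: morphism_cong[of X X "inv_into (points X) \<phi>"])
  next
    fix \<phi> \<psi> assume a: "\<phi> \<in> carrier (Aut X)" "\<psi> \<in> carrier (Aut X)"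
    then have b: "\<phi> \<in> Bij (points X)" "\<psi> \<in> Bij (points X)" by (auto simp: carrier_Aut)
    have c: "\<phi> \<otimes>\<^bsub>BijGroup (points X)\<^esub> \<psi> = compose (points X) \<phi> \<psi>"
      using b by (simp add: BijGroup_def)
    have d: "compose (points X) \<phi> \<psi> \<in> Bij (points X)" using b by (rule compose_Bij)
    have "morphism X X (compose (points X) \<phi> \<psi>)"
      using a by - (rule morphism_cong[OF morphism_comp[of X X \<psi> X \<phi>]],
        auto simp: carrier_Aut compose_def)
    moreover have "morphism X X (inv_into (points X) (compose (points X) \<phi> \<psi>))"
    proof (rule morphism_cong)
      show "morphism X X (inv_into (points X) \<psi> \<circ> inv_into (points X) \<phi>)"
        using a by - (rule morphism_comp[of X X _ X], auto simp: carrier_Aut)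
      fix x assume x: "x \<in> points X"
      let ?y = "inv_into (points X) \<psi> (inv_into (points X) \<phi> x)"
      have im: "\<phi> ` points X = points X" "\<psi> ` points X = points X"
        using b by (auto simp only: Bij_def bij_betw_def)
      have y: "?y \<in> points X" "compose (points X) \<phi> \<psi> ?y = x"
        using x b im by (simp_all add: compose_def Bij_inv_into_mem f_inv_into_f)
      then show "(inv_into (points X) \<psi> \<circ> inv_into (points X) \<phi>) x
          = inv_into (points X) (compose (points X) \<phi> \<psi>) x"
        using inv_into_f_f[of "compose (points X) \<phi> \<psi>" "points X" ?y] d
        by (simp add: Bij_def bij_betw_def)
    qed
    ultimately show "\<phi> \<otimes>\<^bsub>BijGroup (points X)\<^esub> \<psi> \<in> carrier (Aut X)"
      using d unfolding c by (simp add: carrier_Aut)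
  qed
qed

lemma Aut_eq: "Aut X = (BijGroup (points X))\<lparr>carrier := carrier (Aut X)\<rparr>"
  by (simp add: Aut_def)

lemma group_Aut:
  fixes X :: "('a, 'k::field) variety"
  assumes "affine_variety X" 
  shows "group (Aut X)"
  using subgroup.subgroup_is_group[OF subgroup_Aut[OF assms] group_BijGroup] by (simp flip: Aut_eq)

lemma differential_tangent:
  fixes V :: "('a, 'k::field) variety" and W :: "('b, 'k) variety"
  assumes "affine_variety W" "morphism V W \<phi>" "x \<in> points V" "A \<in> tangent_space V x"
  shows "differential V W \<phi> A \<in> tangent_space W (\<phi> x)"
proof -
  have p: "pullback (points V) \<phi> f \<in> regular V" if "f \<in> regular W" for f
    using assms(2) that by (auto simp: morphism_def)
  have q: "pullback (points V) \<phi> f x = f (\<phi> x)" for f :: "'b \<Rightarrow> 'k"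
    using assms(3) by (simp add: pullback_def)
  have s: "f + g \<in> regular W" "scale_fun c f \<in> regular W" if "f \<in> regular W" "g \<in> regular W"
    for f g c using that subspace_regular[OF assms(1)] by (auto simp: fun_vs.subspace_def)
  show ?thesis
    using assms(4) p s mult_regular[OF assms(1)]
    by (simp add: tangent_space_def differential_def pullback_add pullback_scale pullback_mult q)
qed

lemma fundamental_field_differential:
  fixes V :: "('a, 'k::field) variety" and W :: "('b, 'k) variety" and X :: "('c, 'k) variety"
  assumes "morphism V W \<alpha>" "\<And>x. x \<in> points X \<Longrightarrow> morphism W X (\<lambda>g. \<rho> g x)"
    and "\<And>g. g \<in> points V \<Longrightarrow> \<rho> (\<alpha> g) = \<theta> g"
  shows "fundamental_field W X \<rho> (differential V W \<alpha> A) = fundamental_field V X \<theta> A"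
proof (intro ext)
  fix f :: "'c \<Rightarrow> 'k" and x
  have "pullback (points V) \<alpha> (pullback (points W) (\<lambda>g. \<rho> g x) f) = pullback (points V) (\<lambda>g. \<theta> g x) f"
    using assms(1,3) by (auto simp: pullback_def morphism_def Pi_iff fun_eq_iff)
  then show "fundamental_field W X \<rho> (differential V W \<alpha> A) f x = fundamental_field V X \<theta> A f x"
    using assms(2) by (auto simp: fundamental_field_def differential_def morphism_def)
qed

theorem algebraic_subgroup_image:
  fixes V :: "('g, 'k::field) variety" and X :: "('a, 'k) variety"
  assumes X: "affine_variety X" and V: "linear_algebraic_group M V"
    and act: "regular_action M V X \<theta>" and faithful: "faithful_action M (points X) \<theta>"
  obtains G where "algebraic_subgroup X G" "points G = \<theta> ` carrier M"
    "Lie X G = lie_of_action M V X \<theta>"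
proof -
  let ?C = "carrier M"
  define \<tau> where "\<tau> = inv_into ?C \<theta>"
  define G where "G = \<lparr>points = \<theta> ` ?C, regular = pullback (\<theta> ` ?C) \<tau> ` regular V\<rparr>"
  define N where "N = (Aut X)\<lparr>carrier := points G\<rparr>"
  have inj: "inj_on \<theta> ?C" using faithful by (rule faithful_action.faithful)
  have ptV: "points V = ?C" and affV: "affine_variety V" and grM: "group M"
    using V by (auto simp: linear_algebraic_group_def)
  have ptG: "points G = \<theta> ` ?C" by (simp add: G_def)
  have \<tau>\<theta>: "\<tau> (\<theta> g) = g" if "g \<in> ?C" for g using that inj by (simp add: \<tau>_def)
  interpret A: group_action M "points X" \<theta> using act by (simp add: regular_action_def)
  interpret H: group_hom M "BijGroup (points X)" \<theta> by (rule A.group_hom)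
  have mor\<tau>: "morphism G V \<tau>"
    by (auto simp: morphism_def G_def ptV \<tau>\<theta>)
  have mor\<theta>: "morphism V G \<theta>"
  proof -
    have "pullback ?C \<theta> (pullback (\<theta> ` ?C) \<tau> f) = f" if "f \<in> regular V" for f
      using regular_off_points[OF affV that] \<tau>\<theta> by (auto simp: pullback_def fun_eq_iff ptV)
    then show ?thesis by (auto simp: morphism_def G_def ptV)
  qed
  have affG: "affine_variety G"
  proof -
    obtain n Z \<phi> where Z: "zariski_closed n Z" "bij_betw \<phi> ?C Z"
      and reg: "regular V = pullback ?C \<phi> ` regular (closed_subvariety Z n)"
      using affV unfolding affine_variety_def ptV by blast
    have "bij_betw \<tau> (points G) ?C"
      unfolding ptG \<tau>_def using inj by (simp add: bij_betw_inv_into inj_on_imp_bij_betw)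
    then have "bij_betw (\<phi> \<circ> \<tau>) (points G) Z" using Z(2) bij_betw_trans by blast
    moreover have "pullback (\<theta> ` ?C) \<tau> (pullback ?C \<phi> f) = pullback (points G) (\<phi> \<circ> \<tau>) f" for f :: "_ \<Rightarrow> 'k"
      by (auto simp: pullback_def fun_eq_iff ptG \<tau>\<theta>)
    then have "regular G = pullback (points G) (\<phi> \<circ> \<tau>) ` regular (closed_subvariety Z n)"
      by (simp add: G_def reg image_image)
    ultimately show ?thesis using Z(1) unfolding affine_variety_def by blast
  qed
  have mX: "morphism X X (\<theta> g)" if "g \<in> ?C" for g
    using action_morphism[OF X act] that ptV by simp
  have inAut: "\<theta> g \<in> carrier (Aut X)" if g: "g \<in> ?C" for g
  proof -
    have "\<theta> (inv\<^bsub>M\<^esub> g) = (\<lambda>x\<in>points X. inv_into (points X) (\<theta> g) x)"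
      using g A.bij_prop0 inv_BijGroup H.hom_inv by metis
    then have "morphism X X (inv_into (points X) (\<theta> g))"
      using mX[of "inv\<^bsub>M\<^esub> g"] g by (auto intro: morphism_cong)
    then show ?thesis using g mX A.bij_prop0 by (simp add: carrier_Aut)
  qed
  have subB: "subgroup (\<theta> ` ?C) (BijGroup (points X))" by (rule H.img_is_subgroup)
  have sub: "subgroup (points G) (Aut X)"
    unfolding ptG 
    by (subst Aut_eq)
      (use group.subgroup_incl[OF group_BijGroup subB subgroup_Aut[OF X]] inAut in auto)
  have grN: "group N" unfolding N_def by (rule subgroup.subgroup_is_group[OF sub group_Aut[OF X]])
  have N: "carrier N = \<theta> ` ?C" "mult N = mult (BijGroup (points X))" "one N = one (BijGroup (points X))"
    by (auto simp: N_def ptG Aut_def)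
  have mulN: "\<theta> g \<otimes>\<^bsub>N\<^esub> \<theta> h = \<theta> (g \<otimes>\<^bsub>M\<^esub> h)" if "g \<in> ?C" "h \<in> ?C" for g h
    using that by (simp add: N)
  have oneN: "\<one>\<^bsub>N\<^esub> = \<theta> \<one>\<^bsub>M\<^esub>" by (simp add: N)
  have invN: "inv\<^bsub>N\<^esub> (\<theta> g) = \<theta> (inv\<^bsub>M\<^esub> g)" if "g \<in> ?C" for g
    using that grN H.G.l_inv[OF that]
    by (intro group.inv_equality) (auto simp: mulN oneN N(1) simp del: H.hom_inv)
  have "morphism (product_variety G G) G (\<lambda>(g, h). g \<otimes>\<^bsub>N\<^esub> h)"
  proof (rule morphism_cong)
    show "morphism (product_variety G G) G (\<theta> \<circ> ((\<lambda>(g, h). g \<otimes>\<^bsub>M\<^esub> h) \<circ> map_prod \<tau> \<tau>))"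
      using V mor\<theta> mor\<tau> unfolding linear_algebraic_group_def
      by (blast intro: morphism_comp morphism_product)
  qed (auto simp: product_variety_def ptG \<tau>\<theta> mulN)
  moreover have "morphism G G (\<lambda>g. inv\<^bsub>N\<^esub> g)"
  proof (rule morphism_cong)
    show "morphism G G (\<theta> \<circ> ((\<lambda>g. inv\<^bsub>M\<^esub> g) \<circ> \<tau>))"
      using V mor\<theta> mor\<tau> unfolding linear_algebraic_group_def
      by (blast intro: morphism_comp)
  qed (auto simp: ptG \<tau>\<theta> invN)
  ultimately have lagN: "linear_algebraic_group N G"
    using grN affG by (simp add: linear_algebraic_group_def N(1) ptG)
  have "morphism (product_variety G X) X (\<lambda>(g, x). g x)"
  proof (rule morphism_cong)
    show "morphism (product_variety G X) X ((\<lambda>(g, x). \<theta> g x) \<circ> map_prod \<tau> (\<lambda>x. x))"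
      using act mor\<tau> morphism_id[OF X] unfolding regular_action_def
      by (blast intro: morphism_comp morphism_product)
  qed (auto simp: product_variety_def ptG \<tau>\<theta>)
  moreover have "group_action N (points X) (\<lambda>g. g)"
    using grN subgroup.subset[OF subB]
    by (auto simp: group_action_def group_hom_def group_hom_axioms_def hom_def N group_BijGroup)
  ultimately have actN: "regular_action N G X (\<lambda>g. g)" by (simp add: regular_action_def)
  have "algebraic_subgroup X G"
    using sub lagN actN by (simp add: algebraic_subgroup_def N_def)
  moreover have "Lie X G = lie_of_action M V X \<theta>"
  proof (intro equalityI subsetI)
    fix \<xi> assume "\<xi> \<in> Lie X G"
    then obtain A where A: "A \<in> tangent_space G (\<theta> \<one>\<^bsub>M\<^esub>)" and \<xi>: "\<xi> = fundamental_field G X (\<lambda>g. g) A"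
      unfolding Lie_def lie_of_action_def N_def[symmetric] oneN by blast
    have "differential G V \<tau> A \<in> tangent_space V \<one>\<^bsub>M\<^esub>"
      using differential_tangent[OF affV mor\<tau> _ A] by (simp add: ptG \<tau>\<theta> del: H.hom_one)
    moreover have "fundamental_field V X \<theta> (differential G V \<tau> A) = \<xi>"
      unfolding \<xi>
      by (rule fundamental_field_differential[OF mor\<tau> orbit_morphism[OF affV act]])
        (auto simp: ptG \<tau>\<theta>)
    ultimately show "\<xi> \<in> lie_of_action M V X \<theta>" by (auto simp: lie_of_action_def)
  next
    fix \<xi> assume "\<xi> \<in> lie_of_action M V X \<theta>"
    then obtain A where A: "A \<in> tangent_space V \<one>\<^bsub>M\<^esub>" and \<xi>: "\<xi> = fundamental_field V X \<theta> A"
      by (auto simp: lie_of_action_def)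
    have "differential V G \<theta> A \<in> tangent_space G \<one>\<^bsub>N\<^esub>"
      using differential_tangent[OF affG mor\<theta> _ A] by (simp add: ptV oneN del: H.hom_one)
    moreover have "fundamental_field G X (\<lambda>g. g) (differential V G \<theta> A) = \<xi>"
      unfolding \<xi>
      by (rule fundamental_field_differential[OF mor\<theta> orbit_morphism[OF affG actN]]) auto
    ultimately show "\<xi> \<in> Lie X G" 
      unfolding Lie_def lie_of_action_def N_def[symmetric] by blast
  qed
  ultimately show thesis using that ptG by blast
qed

theorem Lie_subset_Vec:
  fixes X :: "('a, 'k::field) variety"
  assumes X: "affine_variety X" and G: "algebraic_subgroup X G"
  shows "Lie X G \<subseteq> Vec X"
proof
  fix \<xi> assume "\<xi> \<in> Lie X G"
  define N where "N = (Aut X)\<lparr>carrier := points G\<rparr>"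
  have affG: "affine_variety G" and act: "regular_action N G X (\<lambda>g. g)"
    using G by (auto simp: algebraic_subgroup_def linear_algebraic_group_def N_def)
  obtain A where A: "A \<in> tangent_space G \<one>\<^bsub>N\<^esub>" and \<xi>: "\<xi> = fundamental_field G X (\<lambda>g. g) A"
    using \<open>\<xi> \<in> Lie X G\<close> unfolding Lie_def lie_of_action_def N_def[symmetric] by blast
  have oneN: "\<one>\<^bsub>N\<^esub> = (\<lambda>x\<in>points X. x)" by (simp add: N_def Aut_def BijGroup_def)
  have one: "\<one>\<^bsub>N\<^esub> \<in> points G" 
    using G subgroup.one_closed by (fastforce simp: algebraic_subgroup_def N_def)
  have o: "pullback (points G) (\<lambda>g. g x) f \<in> regular G" if "x \<in> points X" "f \<in> regular X" for x f
    using orbit_morphism[OF affG act that(1)] that(2) by (simp add: morphism_def)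
  have Ascale: "A (scale_fun c f) = c * A f" if "f \<in> regular G" for f c
    using that A by (auto simp: tangent_space_def)
  have Alin: "A (f + g) = A f + A g"
    "A (f * g) = f \<one>\<^bsub>N\<^esub> * A g + A f * g \<one>\<^bsub>N\<^esub>"
    if "f \<in> regular G" "g \<in> regular G" for f g
    using that A by (auto simp: tangent_space_def)
  have sG: "f \<in> regular G \<Longrightarrow> g \<in> regular G \<Longrightarrow> f + g \<in> regular G"
    "f \<in> regular G \<Longrightarrow> scale_fun c f \<in> regular G" for f g c
    using subspace_regular[OF affG] by (auto simp: fun_vs.subspace_def)
  have s: "f \<in> regular X \<Longrightarrow> g \<in> regular X \<Longrightarrow> f + g \<in> regular X"
    "f \<in> regular X \<Longrightarrow> scale_fun c f \<in> regular X" for f g c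
    using subspace_regular[OF X] by (auto simp: fun_vs.subspace_def)
  have val: "\<xi> f x = A (pullback (points G) (\<lambda>g. g x) f)" if "x \<in> points X" "f \<in> regular X" for f x
    using that by (simp add: \<xi> fundamental_field_def differential_def)
  have off: "\<xi> f x = 0" if "x \<notin> points X" for f x
    using that by (simp add: \<xi> fundamental_field_def)
  have off': "\<xi> f = 0" if "f \<notin> regular X" for f
    using that by (auto simp: \<xi> fundamental_field_def differential_def fun_eq_iff)
  have ev: "pullback (points G) (\<lambda>g. g x) f \<one>\<^bsub>N\<^esub> = f x" if "x \<in> points X" for f :: "'a \<Rightarrow> 'k" and x
    using that one by (simp add: pullback_def oneN)
  have "\<xi> f \<in> regular X" if f: "f \<in> regular X" for f
  proof -
    let ?S = "{(\<lambda>(g, x). a g * b x) | a b. a \<in> regular G \<and> b \<in> regular X}"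
    let ?F = "pullback (points G \<times> points X) (\<lambda>(g, x). g x) f"
    let ?T = "\<lambda>F x. A (\<lambda>g. F (g, x))"
    let ?P = "{F. (\<forall>x. (\<lambda>g. F (g, x)) \<in> regular G) \<and> ?T F \<in> regular X}"
    have zero: "A 0 = 0" and z: "0 \<in> regular G" "0 \<in> regular X"
      using Ascale[of 0 0] subspace_regular[OF affG] subspace_regular[OF X]
      by (auto simp: fun_vs.subspace_def)
    have "fun_vs.subspace ?P"
    proof (rule fun_vs.subspaceI)
      show "0 \<in> ?P" using zero z by (auto simp: zero_fun_def)
    next
      fix F F' assume F: "F \<in> ?P" "F' \<in> ?P"
      have e: "(\<lambda>g. (F + F') (g, x)) = (\<lambda>g. F (g, x)) + (\<lambda>g. F' (g, x))" for x by (simp add: fun_eq_iff)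
      have "?T (F + F') = ?T F + ?T F'" unfolding e using F by (auto simp: Alin Ascale fun_eq_iff)
      moreover have "(\<lambda>g. (F + F') (g, x)) \<in> regular G" for x unfolding e using F sG by auto
      ultimately show "F + F' \<in> ?P" using F s by auto
    next
      fix c F assume F: "F \<in> ?P"
      have e: "(\<lambda>g. scale_fun c F (g, x)) = scale_fun c (\<lambda>g. F (g, x))" for x
        by (simp add: fun_eq_iff scale_fun_def)
      have "?T (scale_fun c F) = scale_fun c (?T F)"
        unfolding e using F by (auto simp: Alin Ascale fun_eq_iff scale_fun_def[of _ "?T F"])
      moreover have "(\<lambda>g. scale_fun c F (g, x)) \<in> regular G" for x unfolding e using F sG by auto
      ultimately show "scale_fun c F \<in> ?P" using F s by auto
    qed
    moreover have "?S \<subseteq> ?P"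
    proof 
      fix F assume "F \<in> ?S"
      then obtain a b where F: "F = (\<lambda>(g, x). a g * b x)" and ab: "a \<in> regular G" "b \<in> regular X"
        by auto
      have e: "(\<lambda>g. F (g, x)) = scale_fun (b x) a" for x by (auto simp: F scale_fun_def)
      have "?T F = scale_fun (A a) b" unfolding e using ab by (auto simp: Alin Ascale scale_fun_def[of _ b])
      moreover have "(\<lambda>g. F (g, x)) \<in> regular G" for x unfolding e using ab sG by auto
      ultimately show "F \<in> ?P" using ab s by auto
    qed
    moreover have "?F \<in> fun_vs.span ?S"
      using act f by (auto simp: regular_action_def morphism_def product_variety_def)
    ultimately have "?F \<in> ?P" using fun_vs.span_minimal by blast
    moreover have "?T ?F = \<xi> f"
    proof
      fix x show "?T ?F x = \<xi> f x"
      proof (cases "x \<in> points X")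
        case True
        have "(\<lambda>g. ?F (g, x)) = pullback (points G) (\<lambda>g. g x) f"
          using True by (auto simp: pullback_def)
        then show ?thesis using True f by (simp add: val)
      next
        case False
        then have "(\<lambda>g. ?F (g, x)) = 0" by (auto simp: pullback_def fun_eq_iff)
        then show ?thesis using False by (simp add: off zero)
      qed
    qed
    ultimately show ?thesis by simp
  qed
  moreover have "\<xi> (f + g) = \<xi> f + \<xi> g" if "f \<in> regular X" "g \<in> regular X" for f g
    using that o s by (intro ext, case_tac "x \<in> points X") (auto simp: val off pullback_add Alin Ascale)
  moreover have "\<xi> (scale_fun c f) = scale_fun c (\<xi> f)" if "f \<in> regular X" for f c
    using that o s by (intro ext, case_tac "x \<in> points X")
      (auto simp: val off pullback_scale Alin Ascale scale_fun_def[of _ "\<xi> f"])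
  moreover have "\<xi> (f * g) = f * \<xi> g + \<xi> f * g" if "f \<in> regular X" "g \<in> regular X" for f g
    using that o mult_regular[OF X] by (intro ext, case_tac "x \<in> points X")
      (auto simp: val off pullback_mult Alin Ascale ev)
  ultimately show "\<xi> \<in> Vec X" using off' by (simp add: Vec_def)
qed

end

theory Submission
  imports Defs "HOL-Computational_Algebra.Formal_Power_Series"
begin

text \<open>The idea is to reduce everything to linear algebra on a finite-dimensional space of regular
  functions. If \<open>L\<close> is locally finite, finitely many generators of the coordinate algebra lie in a
  finite-dimensional \<open>L\<close>-stable space \<open>U\<close> of regular functions (\<open>locally_finite_stab\<close>). The
  automorphisms \<open>g\<close> for which \<open>g\<close> and its inverse pull \<open>U\<close> back into itself form a group \<open>S\<close>, and
  the matrix entries of \<open>g\<close> and of its inverse on \<open>U\<close> generate an algebra of functions on \<open>S\<close>. A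
  character of this algebra defines, through the matrix entries, an automorphism in \<open>S\<close>
  (\<open>G0_character\<close>), and a finitely generated algebra of functions that separates points and whose
  characters are all point evaluations is the coordinate algebra of an affine variety
  (\<open>affine_varietyI\<close>). So \<open>S\<close> is an algebraic subgroup \<open>G0\<close>.

  Every vector field \<open>D\<close> that preserves \<open>U\<close> lies in \<open>Lie G0\<close> (\<open>derivation_tangent\<close>). By the Jordan
  decomposition, \<open>D\<close> is the sum of a locally nilpotent field \<open>N\<close>, which is the velocity of the
  polynomial one-parameter group \<open>exp (t N)\<close>, and of a field that acts by the scalar \<open>l\<close> on the
  generalized eigenspace of \<open>l\<close>. The eigenvalues lie in a finitely generated group of scalars, so
  their integer coordinates (\<open>rational_coordinates\<close>) write the second field as a linear
  combination of fields that act by integers; each of these is the velocity of an action of the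
  multiplicative group (\<open>grading_tangent\<close>). Conversely, the translates of a regular function under
  an algebraic group span a finite-dimensional space, and the Lie algebra of the group preserves
  it (\<open>Lie_locally_finite\<close>). This proves the equivalence.

  Now let \<open>L\<close> be generated by locally nilpotent fields \<open>s\<close>. The groups \<open>exp (t s)\<close> lie in \<open>G0\<close> and
  preserve \<open>L\<close> under conjugation, because \<open>exp (t ad s)\<close> is a finite sum on \<open>L\<close> (\<open>Ad_expansion\<close>).
  Take the family of all conjugates of these one-parameter groups by elements of \<open>G0\<close> that
  preserve \<open>L\<close>, let \<open>H\<close> be the group that they generate and \<open>K\<close> its Zariski closure. The heart of
  the proof is that the tangent space of \<open>K\<close> at the identity is no larger than the span of the
  velocities of the family (\<open>closure_tangent_eq_span\<close>). Hence \<open>Lie K\<close> is spanned by conjugates of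
  the fields \<open>s\<close> and is contained in \<open>L\<close>; it is stable under conjugation by \<open>exp (t s)\<close>, so by
  differentiation under the bracket with \<open>s\<close>, so under the bracket with \<open>L\<close>; and it contains the
  generators. Therefore \<open>Lie K = L\<close> (\<open>nilpotently_generated_algebraic\<close>).

  The tangent space of \<open>K\<close> is bounded without dimension theory. A product of members of the
  family, taken as a map from affine \<open>e\<close>-space to \<open>K\<close>, has at each point the velocities of certain
  conjugates as its partial derivatives, after translation to the identity. Choose a product and a
  point for which \<open>e\<close> such velocities are independent and \<open>e\<close> is maximal. For generic parameters
  they span the velocities of the whole family, so the functions that vanish on the image are
  stable under differentiation along the family, hence under translation by \<open>H\<close>, and vanish on \<open>K\<close>
  (\<open>image_ideal_eq\<close>). So the coordinate algebra of \<open>K\<close> embeds into the polynomials in \<open>e\<close>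
  variables. If the tangent space of \<open>K\<close> had dimension greater than \<open>e\<close>, then \<open>e + 1\<close> functions
  dual to tangent vectors would have linearly independent monomials on \<open>K\<close>
  (\<open>monomials_independent\<close>), and there are more such monomials of bounded degree than the
  polynomials in \<open>e\<close> variables have room for (\<open>closure_tangent_dim_bound\<close>).\<close>

section \<open>Finite-dimensional spaces of functions\<close>

lemma sum_fun_apply: "(\<Sum>i\<in>I. f i) x = (\<Sum>i\<in>I. f i x)"
  for f :: "'i \<Rightarrow> 'a \<Rightarrow> 'b::comm_monoid_add"
  by (induction I rule: infinite_finite_induct) auto

lemma scale_fun_apply [simp]: "scale_fun c f x = c * f x"
  by (simp add: scale_fun_def)

lemma sum_scale_apply: "(\<Sum>i\<in>I. scale_fun (c i) (f i)) x = (\<Sum>i\<in>I. c i * f i x)"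
  by (simp add: sum_fun_apply)

text \<open>Coordinates on a finite-dimensional function space are taken to be values at points: \<open>w\<close> is the
  basis dual to the evaluations at \<open>x 0, ..., x (n - 1)\<close>. Then all matrix entries of an operator
  on \<open>U\<close> are values of functions.\<close>

definition dual_basis ::
    "('a \<Rightarrow> 'k::field) set \<Rightarrow> nat \<Rightarrow> (nat \<Rightarrow> 'a \<Rightarrow> 'k) \<Rightarrow> (nat \<Rightarrow> 'a) \<Rightarrow> bool"
  where "dual_basis U n w x \<longleftrightarrow>
    (\<forall>i<n. w i \<in> U) \<and>
    (\<forall>i<n. \<forall>j<n. w i (x j) = (if i = j then 1 else 0)) \<and>
    (\<forall>f\<in>U. f = (\<Sum>i<n. scale_fun (f (x i)) (w i)))"

lemma dual_basis_expand:
  assumes "dual_basis U n w x" "f \<in> U"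
  shows "f y = (\<Sum>i<n. f (x i) * w i y)"
proof -
  have "f = (\<Sum>i<n. scale_fun (f (x i)) (w i))"
    using assms by (simp add: dual_basis_def)
  from fun_cong[OF this, of y] show ?thesis by (simp add: sum_scale_apply)
qed

text \<open>One point of \<open>E\<close> is added at a time. If some function of \<open>U\<close> does not vanish at the new point,
  one normalized such function completes a dual basis of the subspace of functions that vanish
  there.\<close>

lemma dual_basis_of_separating:
  fixes U :: "('a \<Rightarrow> 'k::field) set"
  assumes "finite E" "fun_vs.subspace U" "\<And>f. f \<in> U \<Longrightarrow> (\<And>x. x \<in> E \<Longrightarrow> f x = 0) \<Longrightarrow> f = 0"
  shows "\<exists>n w x. dual_basis U n w x"
  using assms
proof (induction E arbitrary: U rule: finite_induct)
  case empty
  then have "f = 0" if "f \<in> U" for f using that by blast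
  then show ?case by (intro exI[of _ 0]) (simp add: dual_basis_def)
next
  case (insert p E U)
  have Usub: "fun_vs.subspace U" by (rule insert.prems(1))
  define U' where "U' = {f \<in> U. f p = 0}"
  have U'sub: "fun_vs.subspace U'"
    using Usub by (auto simp: U'_def fun_vs.subspace_def)
  have "\<exists>n w x. dual_basis U' n w x"
    by (rule insert.IH[OF U'sub]) (use insert.prems(2) in \<open>auto simp: U'_def\<close>)
  then obtain n w' x' where d: "dual_basis U' n w' x'" by blast
  show ?case
  proof (cases "\<forall>f\<in>U. f p = 0")
    case True
    then have "U' = U" by (auto simp: U'_def)
    then show ?thesis using d by auto
  next
    case False
    then obtain f0 where f0: "f0 \<in> U" "f0 p \<noteq> 0" by blast
    define f1 where "f1 = scale_fun (1 / f0 p) f0"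
    have f1: "f1 \<in> U" "f1 p = 1"
      using f0 Usub by (auto simp: f1_def fun_vs.subspace_def)
    have w'U: "w' i \<in> U" "w' i p = 0" if "i < n" for i
      using d that by (auto simp: dual_basis_def U'_def)
    define wn where "wn = f1 - (\<Sum>i<n. scale_fun (f1 (x' i)) (w' i))"
    have wnU: "wn \<in> U" unfolding wn_def
      using Usub f1 w'U
      by (intro fun_vs.subspace_diff fun_vs.subspace_sum fun_vs.subspace_scale) auto
    have wnv: "wn y = f1 y - (\<Sum>i<n. f1 (x' i) * w' i y)" for y
      by (simp add: wn_def sum_scale_apply)
    have wnp: "wn p = 1" using f1 w'U by (simp add: wnv)
    have w'd: "w' i (x' j) = (if i = j then 1 else 0)" if "i < n" "j < n" for i j
      using d that by (auto simp: dual_basis_def)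
    have wnx: "wn (x' j) = 0" if "j < n" for j
    proof -
      have "(\<Sum>i<n. f1 (x' i) * w' i (x' j)) = (\<Sum>i<n. if i = j then f1 (x' j) else 0)"
        by (rule sum.cong) (use that w'd in auto)
      then show ?thesis using that by (simp add: wnv)
    qed
    define w where "w = w'(n := wn)"
    define x where "x = x'(n := p)"
    have "dual_basis U (Suc n) w x"
      unfolding dual_basis_def
    proof (intro conjI allI impI ballI)
      fix i assume "i < Suc n" then show "w i \<in> U" using w'U wnU by (auto simp: w_def less_Suc_eq)
    next
      fix i j assume "i < Suc n" "j < Suc n"
      then show "w i (x j) = (if i = j then 1 else 0)"
        using w'U wnp wnx w'd by (auto simp: w_def x_def less_Suc_eq)
    next
      fix f assume f: "f \<in> U"
      define g where "g = f - scale_fun (f p) wn"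
      have "g \<in> U'" using f wnU Usub wnp
        by (auto simp: U'_def g_def intro!: fun_vs.subspace_diff fun_vs.subspace_scale)
      then have g: "g = (\<Sum>i<n. scale_fun (g (x' i)) (w' i))"
        using d by (simp add: dual_basis_def)
      have gx: "g (x' i) = f (x' i)" if "i < n" for i
        using that wnx by (simp add: g_def)
      have "f = g + scale_fun (f p) wn" by (simp add: g_def)
      also have "g = (\<Sum>i<n. scale_fun (f (x' i)) (w' i))"
        by (subst g) (simp add: gx)
      also have "(\<Sum>i<n. scale_fun (f (x' i)) (w' i)) + scale_fun (f p) wn
          = (\<Sum>i<Suc n. scale_fun (f (x i)) (w i))"
        by (simp add: w_def x_def)
      finally show "f = (\<Sum>i<Suc n. scale_fun (f (x i)) (w i))" .
    qed
    then show ?thesis by blast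
  qed
qed

text \<open>A new spanning vector enlarges the space of functions that vanish on the points chosen so far by
  at most one dimension, and one further point kills it.\<close>

lemma finite_span_separating:
  fixes B :: "('a \<Rightarrow> 'k::field) set"
  assumes "finite B"
  shows "\<exists>E. finite E \<and> (\<forall>f\<in>fun_vs.span B. (\<forall>x\<in>E. f x = 0) \<longrightarrow> f = 0)"
  using assms
proof (induction B rule: finite_induct)
  case empty
  have "f = 0" if "f \<in> fun_vs.span {}" for f :: "'a \<Rightarrow> 'k" using that by simp
  then show ?case by (intro exI[of _ "{}"]) blast
next
  case (insert b B)
  then obtain E where E: "finite E" "\<And>f. f \<in> fun_vs.span B \<Longrightarrow> (\<forall>x\<in>E. f x = 0) \<Longrightarrow> f = 0" by blast
  show ?case
  proof (cases "\<exists>f0\<in>fun_vs.span (insert b B). f0 \<noteq> 0 \<and> (\<forall>x\<in>E. f0 x = 0)")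
    case False
    then show ?thesis using E(1) by blast
  next
    case True
    then obtain f0 where f0: "f0 \<in> fun_vs.span (insert b B)" "f0 \<noteq> 0" "\<And>x. x \<in> E \<Longrightarrow> f0 x = 0" by blast
    then obtain p where p: "f0 p \<noteq> 0" by (auto simp: fun_eq_iff)
    have "f = 0" if f: "f \<in> fun_vs.span (insert b B)" "\<forall>x\<in>insert p E. f x = 0" for f
    proof -
      obtain c where c: "f - scale_fun c b \<in> fun_vs.span B" 
        using f(1) by (auto simp: fun_vs.span_breakdown_eq)
      obtain c0 where c0: "f0 - scale_fun c0 b \<in> fun_vs.span B" 
        using f0(1) by (auto simp: fun_vs.span_breakdown_eq)
      have c0nz: "c0 \<noteq> 0"
      proof
        assume "c0 = 0"
        then have "f0 \<in> fun_vs.span B" using c0 by simp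
        then show False using E(2) f0 by blast
      qed
      \<comment> \<open>the component of the new vector b cancels in this combination\<close>
      define h where "h = scale_fun c0 f - scale_fun c f0"
      have "h = scale_fun c0 (f - scale_fun c b) - scale_fun c (f0 - scale_fun c0 b)"
        by (simp add: h_def fun_eq_iff algebra_simps)
      then have "h \<in> fun_vs.span B"
        using c c0 by (auto intro: fun_vs.span_diff fun_vs.span_scale)
      moreover have "\<forall>x\<in>E. h x = 0" using f f0 by (simp add: h_def)
      ultimately have "h = 0" using E(2) by blast
      then have eq: "c0 * f y = c * f0 y" for y by (auto simp: h_def fun_eq_iff)
      have "c = 0" using eq[of p] f(2) p by auto
      then show "f = 0" using eq c0nz by (auto simp: fun_eq_iff)
    qed
    then show ?thesis using E(1) by (intro exI[of _ "insert p E"] conjI ballI impI) (blast, blast)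
  qed
qed

lemma dual_basis_of_finite_span:
  fixes U :: "('a \<Rightarrow> 'k::field) set"
  assumes "finite B" "fun_vs.subspace U" "U \<subseteq> fun_vs.span B"
  shows "\<exists>n w x. dual_basis U n w x"
proof -
  obtain E where "finite E" "\<forall>f\<in>fun_vs.span B. (\<forall>x\<in>E. f x = 0) \<longrightarrow> f = 0"
    using finite_span_separating[OF assms(1)] by blast
  then show ?thesis using dual_basis_of_separating[of E U] assms by blast
qed

definition lin_indep :: "nat \<Rightarrow> (nat \<Rightarrow> 'a \<Rightarrow> 'k::field) \<Rightarrow> bool"
  where "lin_indep n a \<longleftrightarrow>
    (\<forall>c. (\<Sum>i<n. scale_fun (c i) (a i)) = 0 \<longrightarrow> (\<forall>i<n. c i = 0))"

lemma card_le_of_independent_family: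
  fixes a :: "'i \<Rightarrow> 'a \<Rightarrow> 'k::field"
  assumes fin: "finite I" "finite B" and a: "\<And>i. i \<in> I \<Longrightarrow> a i \<in> fun_vs.span B"
    and ind: "\<And>c. (\<Sum>i\<in>I. scale_fun (c i) (a i)) = 0 \<Longrightarrow> \<forall>i\<in>I. c i = 0"
  shows "card I \<le> card B"
proof -
  have inj: "inj_on a I"
  proof (rule inj_onI)
    fix i j assume ij: "i \<in> I" "j \<in> I" "a i = a j"
    show "i = j"
    proof (rule ccontr)
      assume ne: "i \<noteq> j"
      define c :: "'i \<Rightarrow> 'k" where "c = (\<lambda>l. if l = i then 1 else if l = j then -1 else 0)"
      have "(\<Sum>l\<in>I. scale_fun (c l) (a l)) = (\<Sum>l\<in>{i,j}. scale_fun (c l) (a l))"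
        by (rule sum.mono_neutral_right) (use ij fin in \<open>auto simp: c_def\<close>)
      also have "\<dots> = 0" using ne ij(3) by (auto simp: c_def fun_eq_iff)
      finally have "c i = 0" using ind ij by blast
      then show False by (simp add: c_def)
    qed
  qed
  have "fun_vs.independent (a ` I)"
  proof (rule ccontr)
    assume "\<not> fun_vs.independent (a ` I)"
    then obtain u v where u: "v \<in> a ` I" "u v \<noteq> 0" "(\<Sum>v\<in>a ` I. scale_fun (u v) v) = 0"
      using fun_vs.dependent_finite[of "a ` I"] fin by auto
    from u(3) have "(\<Sum>i\<in>I. scale_fun (u (a i)) (a i)) = 0"
      by (simp add: sum.reindex[OF inj])
    from ind[OF this] u show False by auto
  qed
  then have "card (a ` I) \<le> card B"
    using fun_vs.independent_span_bound[OF fin(2)] a by blast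
  then show ?thesis by (simp add: card_image[OF inj])
qed

lemma lin_indep_le_card:
  assumes "lin_indep n a" "finite B" "\<And>i. i < n \<Longrightarrow> a i \<in> fun_vs.span B"
  shows "n \<le> card B"
  using card_le_of_independent_family[of "{..<n}" B a] assms by (auto simp: lin_indep_def)

lemma dual_basis_span:
  assumes "dual_basis U n w x" "f \<in> U"
  shows "f \<in> fun_vs.span (w ` {..<n})"
proof -
  have "f = (\<Sum>i<n. scale_fun (f (x i)) (w i))" using assms by (simp add: dual_basis_def)
  also have "\<dots> \<in> fun_vs.span (w ` {..<n})"
    by (intro fun_vs.span_sum fun_vs.span_scale fun_vs.span_base) auto
  finally show ?thesis .
qed

lemma dual_basis_bound:
  assumes "dual_basis U n w x" "lin_indep m a" "\<And>i. i < m \<Longrightarrow> a i \<in> U"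
  shows "m \<le> n"
proof -
  have "m \<le> card (w ` {..<n})"
    by (rule lin_indep_le_card[OF assms(2)]) (use assms(3) dual_basis_span[OF assms(1)] in auto)
  also have "\<dots> \<le> n" using card_image_le[of "{..<n}" w] by simp
  finally show ?thesis .
qed

lemma lin_indep_extend:
  assumes "lin_indep n a" "\<not> lin_indep (Suc n) a"
  shows "\<exists>c. a n = (\<Sum>i<n. scale_fun (c i) (a i))"
proof -
  obtain c j where c: "(\<Sum>i<Suc n. scale_fun (c i) (a i)) = 0" "j < Suc n" "c j \<noteq> 0"
    using assms(2) unfolding lin_indep_def by blast
  have cn: "c n \<noteq> 0"
  proof
    assume "c n = 0"
    then have "(\<Sum>i<n. scale_fun (c i) (a i)) = 0" using c(1) by simp
    then have "\<forall>i<n. c i = 0" using assms(1) unfolding lin_indep_def by blast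
    with c \<open>c n = 0\<close> show False by (auto simp: less_Suc_eq)
  qed
  have "a n y = (\<Sum>i<n. scale_fun (- c i / c n) (a i)) y" for y
  proof -
    have "(\<Sum>i<n. c i * a i y) + c n * a n y = 0"
      using fun_cong[OF c(1), of y] by (simp add: sum_scale_apply)
    then have "a n y = - (\<Sum>i<n. c i * a i y) / c n"
      using cn by (simp add: field_simps eq_neg_iff_add_eq_0)
    also have "\<dots> = (\<Sum>i<n. - c i / c n * a i y)"
      by (simp add: sum_negf[symmetric] sum_divide_distrib)
    finally show ?thesis by (simp only: sum_scale_apply)
  qed
  then have "a n = (\<Sum>i<n. scale_fun (- c i / c n) (a i))" by (rule ext)
  then show ?thesis by (rule exI[of _ "\<lambda>i. - c i / c n"])
qed

text \<open>Linear independence is an open condition: the induction step is one step of Gaussian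
  elimination over the polynomials in the parameter.\<close>

lemma lin_indep_poly_cofinite:
  fixes a :: "nat \<Rightarrow> 'k::field \<Rightarrow> 'a \<Rightarrow> 'k"
  assumes "\<And>i x. i < n \<Longrightarrow> \<exists>p. \<forall>u. a i u x = poly p u" "lin_indep n (\<lambda>i. a i u0)"
  shows "finite {u. \<not> lin_indep n (\<lambda>i. a i u)}"
  using assms
proof (induction n arbitrary: a)
  case 0 then show ?case by (simp add: lin_indep_def)
next
  case (Suc n a)
  have "\<exists>x. a n u0 x \<noteq> 0"
  proof (rule ccontr)
    assume "\<not> ?thesis"
    then have "a n u0 = 0" by (simp add: fun_eq_iff)
    then have "(\<Sum>i<Suc n. scale_fun ((\<lambda>i. if i = n then 1 else 0) i) (a i u0)) = 0" by simp
    from Suc.prems(2)[unfolded lin_indep_def, rule_format, OF this, of n] show False by simp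
  qed
  then obtain x where x: "a n u0 x \<noteq> 0" by blast
  \<comment> \<open>eliminate the value at the pivot point x without dividing\<close>
  define b where "b = (\<lambda>i u. scale_fun (a n u x) (a i u) - scale_fun (a i u x) (a n u))"
  have sum_b: "(\<Sum>i<n. scale_fun (c i) (b i u)) =
      scale_fun (a n u x) (\<Sum>i<n. scale_fun (c i) (a i u)) - scale_fun (\<Sum>i<n. c i * a i u x) (a n u)"
    for c u
  proof
    fix y
    have "c i * b i u y = a n u x * (c i * a i u y) - c i * a i u x * a n u y" for i
      by (simp add: b_def algebra_simps)
    then show "(\<Sum>i<n. scale_fun (c i) (b i u)) y =
      (scale_fun (a n u x) (\<Sum>i<n. scale_fun (c i) (a i u)) - scale_fun (\<Sum>i<n. c i * a i u x) (a n u)) y"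
      by (simp add: sum_scale_apply sum_distrib_left sum_distrib_right sum_subtractf)
  qed
  have "finite {u. \<not> lin_indep n (\<lambda>i. b i u)}"
  proof (rule Suc.IH)
    fix i y assume i: "i < n"
    obtain p q r s where "\<forall>u. a n u x = poly p u" "\<forall>u. a i u x = poly q u"
      "\<forall>u. a i u y = poly r u" "\<forall>u. a n u y = poly s u"
      using Suc.prems(1)[of n x] Suc.prems(1)[of n y] Suc.prems(1)[of i x] Suc.prems(1)[of i y] i by auto
    then show "\<exists>p. \<forall>u. b i u y = poly p u"
      by (intro exI[of _ "p * r - q * s"]) (simp add: b_def)
  next
    show "lin_indep n (\<lambda>i. b i u0)"
      unfolding lin_indep_def
    proof (intro allI impI)
      fix c i assume c: "(\<Sum>i<n. scale_fun (c i) (b i u0)) = 0" and i: "i < n"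
      define d where "d = (\<lambda>i. if i = n then - (\<Sum>i<n. c i * a i u0 x) else a n u0 x * c i)"
      have "(\<Sum>i<Suc n. scale_fun (d i) (a i u0)) y = (\<Sum>i<n. scale_fun (c i) (b i u0)) y" for y
        unfolding sum_b by (simp add: d_def sum_scale_apply sum_distrib_left mult.assoc)
      then have "(\<Sum>i<Suc n. scale_fun (d i) (a i u0)) = 0" using c by (simp add: fun_eq_iff)
      then have "d i = 0" using Suc.prems(2) i unfolding lin_indep_def by (meson less_SucI)
      then show "c i = 0" using i x by (simp add: d_def)
    qed
  qed
  moreover have "finite {u. a n u x = 0}"
  proof -
    obtain p where p: "\<forall>u. a n u x = poly p u" using Suc.prems(1)[of n x] by auto
    then have "p \<noteq> 0" using x by auto
    then show ?thesis using poly_roots_finite[of p] p by simp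
  qed
  moreover have "{u. \<not> lin_indep (Suc n) (\<lambda>i. a i u)} \<subseteq> {u. \<not> lin_indep n (\<lambda>i. b i u)} \<union> {u. a n u x = 0}"
  proof
    fix u assume "u \<in> {u. \<not> lin_indep (Suc n) (\<lambda>i. a i u)}"
    moreover have "lin_indep (Suc n) (\<lambda>i. a i u)" if b: "lin_indep n (\<lambda>i. b i u)" and nz: "a n u x \<noteq> 0"
      unfolding lin_indep_def
    proof (intro allI impI)
      fix c i assume c: "(\<Sum>i<Suc n. scale_fun (c i) (a i u)) = 0" and i: "i < Suc n"
      have s: "(\<Sum>i<n. c i * a i u y) = - (c n * a n u y)" for y
        using fun_cong[OF c, of y] by (simp add: sum_scale_apply eq_neg_iff_add_eq_0)
      have "(\<Sum>i<n. scale_fun (c i) (b i u)) y = 0" for y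
        unfolding sum_b by (simp add: sum_scale_apply s)
      then have "(\<Sum>i<n. scale_fun (c i) (b i u)) = 0" by (simp add: fun_eq_iff)
      then have c0: "\<forall>i<n. c i = 0" using b unfolding lin_indep_def by blast
      then have "c n = 0" using s[of x] nz by simp
      then show "c i = 0" using c0 i by (auto simp: less_Suc_eq)
    qed
    ultimately show "u \<in> {u. \<not> lin_indep n (\<lambda>i. b i u)} \<union> {u. a n u x = 0}" by auto
  qed
  ultimately show ?case by (meson finite_UnI finite_subset)
qed

section \<open>Algebras of functions, characters and affine varieties\<close>

definition const_on :: "'a set \<Rightarrow> 'k \<Rightarrow> 'a \<Rightarrow> 'k::zero"
  where "const_on A c = (\<lambda>x. if x \<in> A then c else 0)"

inductive_set gen_algebra :: "'a set \<Rightarrow> ('a \<Rightarrow> 'k::comm_ring_1) set \<Rightarrow> ('a \<Rightarrow> 'k) set" for A S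
  where
    const: "const_on A c \<in> gen_algebra A S"
  | gen: "f \<in> S \<Longrightarrow> f \<in> gen_algebra A S"
  | add: "f \<in> gen_algebra A S \<Longrightarrow> g \<in> gen_algebra A S \<Longrightarrow> f + g \<in> gen_algebra A S"
  | mult: "f \<in> gen_algebra A S \<Longrightarrow> g \<in> gen_algebra A S \<Longrightarrow> f * g \<in> gen_algebra A S"

locale function_algebra =
  fixes A :: "'a set" and R :: "('a \<Rightarrow> 'k::field) set"
  assumes add_closed: "f \<in> R \<Longrightarrow> g \<in> R \<Longrightarrow> f + g \<in> R"
    and mult_closed: "f \<in> R \<Longrightarrow> g \<in> R \<Longrightarrow> f * g \<in> R"
    and const_closed: "const_on A c \<in> R"
    and vanish: "f \<in> R \<Longrightarrow> x \<notin> A \<Longrightarrow> f x = 0"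
begin

lemma scale_eq: "f \<in> R \<Longrightarrow> scale_fun c f = const_on A c * f"
  by (rule ext) (use vanish in \<open>auto simp: scale_fun_def const_on_def\<close>)

lemma scale_closed: "f \<in> R \<Longrightarrow> scale_fun c f \<in> R"
  by (simp add: scale_eq mult_closed const_closed)

lemma zero_closed: "0 \<in> R"
  using const_closed[of 0] by (simp add: const_on_def zero_fun_def)

lemma subspace: "fun_vs.subspace R"
  by (simp add: fun_vs.subspace_def zero_closed add_closed scale_closed)

lemma sum_closed: "(\<And>i. i \<in> I \<Longrightarrow> f i \<in> R) \<Longrightarrow> (\<Sum>i\<in>I. f i) \<in> R"
  by (rule fun_vs.subspace_sum[OF subspace])

lemma diff_closed: "f \<in> R \<Longrightarrow> g \<in> R \<Longrightarrow> f - g \<in> R"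
  by (rule fun_vs.subspace_diff[OF subspace])

lemma span_closed: "B \<subseteq> R \<Longrightarrow> fun_vs.span B \<subseteq> R"
  by (rule fun_vs.span_minimal[OF _ subspace])

end

lemma function_algebra_gen:
  assumes "\<And>f x. f \<in> S \<Longrightarrow> x \<notin> A \<Longrightarrow> f x = 0"
  shows "function_algebra A (gen_algebra A S)"
proof
  show "f x = 0" if "f \<in> gen_algebra A S" "x \<notin> A" for f x
    using that by (induction) (auto simp: const_on_def assms)
qed (auto intro: gen_algebra.intros)

definition character :: "'a set \<Rightarrow> ('a \<Rightarrow> 'k::field) set \<Rightarrow> (('a \<Rightarrow> 'k) \<Rightarrow> 'k) \<Rightarrow> bool"
  where "character A R \<chi> \<longleftrightarrow> (\<forall>c. \<chi> (const_on A c) = c) \<and>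
    (\<forall>f\<in>R. \<forall>g\<in>R. \<chi> (f + g) = \<chi> f + \<chi> g) \<and> (\<forall>f\<in>R. \<forall>g\<in>R. \<chi> (f * g) = \<chi> f * \<chi> g)"

lemma affine_variety_regular:
  assumes "affine_variety X"
  obtains n Z \<phi> where "zariski_closed n Z" "bij_betw \<phi> (points X) Z"
    "regular X = pullback (points X) \<phi> ` polynomial_functions n"
proof -
  obtain n Z \<phi> where Z: "zariski_closed n Z" and bij: "bij_betw \<phi> (points X) Z"
    and reg: "regular X = pullback (points X) \<phi> ` regular (closed_subvariety Z n)"
    using assms unfolding affine_variety_def by blast
  have \<phi>: "\<phi> x \<in> Z" if "x \<in> points X" for x
    using bij that by (auto simp: bij_betw_def)
  have "regular X = pullback (points X) \<phi> ` polynomial_functions n"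
    unfolding reg closed_subvariety_def by (auto simp: image_image pullback_def \<phi> cong: if_cong)
  then show thesis using that Z bij by blast
qed

lemma pullback_poly_gen_algebra:
  assumes "\<And>i. i < n \<Longrightarrow> pullback A \<phi> (\<lambda>z. z i) \<in> S" "p \<in> polynomial_functions n"
  shows "pullback A \<phi> p \<in> gen_algebra A S"
  using assms(2)
proof (induction)
  case (const c)
  have "pullback A \<phi> (\<lambda>z. c) = const_on A c" by (simp add: pullback_def const_on_def)
  then show ?case by (simp add: gen_algebra.const)
next
  case (coord i) then show ?case by (simp add: assms(1) gen_algebra.gen)
next
  case (add p q)
  have "pullback A \<phi> (\<lambda>x. p x + q x) = pullback A \<phi> p + pullback A \<phi> q"
    by (auto simp: pullback_def)
  then show ?case using add.IH gen_algebra.add by metis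
next
  case (mult p q)
  have "pullback A \<phi> (\<lambda>x. p x * q x) = pullback A \<phi> p * pullback A \<phi> q"
    by (auto simp: pullback_def)
  then show ?case using mult.IH gen_algebra.mult by metis
qed

lemma affine_varietyE:
  fixes X :: "('a, 'k::field) variety"
  assumes "affine_variety X"
  obtains S where "finite S" "regular X = gen_algebra (points X) S"
    "\<And>f x. f \<in> S \<Longrightarrow> x \<notin> points X \<Longrightarrow> f x = 0"
proof -
  obtain n Z \<phi> where Z: "zariski_closed n Z" and bij: "bij_betw \<phi> (points X) Z"
    and reg: "regular X = pullback (points X) \<phi> ` polynomial_functions n"
    using affine_variety_regular[OF assms] .
  let ?A = "points X"
  define S where "S = (\<lambda>i. pullback ?A \<phi> (\<lambda>z. z i)) ` {..<n}"
  have "regular X = gen_algebra ?A S"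
  proof (intro equalityI subsetI)
    fix f assume "f \<in> regular X"
    then obtain p where "p \<in> polynomial_functions n" "f = pullback ?A \<phi> p" unfolding reg by blast
    then show "f \<in> gen_algebra ?A S"
      using pullback_poly_gen_algebra[of n ?A \<phi> S p] by (auto simp: S_def)
  next
    fix f assume "f \<in> gen_algebra ?A S"
    then show "f \<in> regular X"
    proof induction
      case (const c)
      have "const_on ?A c = pullback ?A \<phi> (\<lambda>z. c)" by (simp add: pullback_def const_on_def)
      then show ?case unfolding reg by (simp add: polynomial_functions.const)
    next
      case (gen f) then show ?case unfolding reg S_def by (auto intro: polynomial_functions.coord)
    next
      case (add f g) then show ?case by (intro fun_vs.subspace_add[OF subspace_regular[OF assms]])
    next
      case (mult f g) then show ?case by (intro mult_regular[OF assms])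
    qed
  qed
  then show thesis by (intro that[of S]) (auto simp: S_def pullback_def)
qed

lemma function_algebra_regular:
  fixes X :: "('a, 'k::field) variety"
  assumes "affine_variety X"
  shows "function_algebra (points X) (regular X)"
proof -
  obtain S where "regular X = gen_algebra (points X) S"
    "\<And>f x. f \<in> S \<Longrightarrow> x \<notin> points X \<Longrightarrow> f x = 0"
    using affine_varietyE[OF assms] by metis
  then show ?thesis using function_algebra_gen by metis
qed

lemma affine_points_eqI:
  assumes "affine_variety X" "x \<in> points X" "y \<in> points X"
    "\<And>f. f \<in> regular X \<Longrightarrow> f x = f y"
  shows "x = y"
proof -
  obtain n Z \<phi> where Z: "zariski_closed n Z" and bij: "bij_betw \<phi> (points X) Z"
    and reg: "regular X = pullback (points X) \<phi> ` polynomial_functions n"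
    using affine_variety_regular[OF assms(1)] .
  have "\<phi> x i = \<phi> y i" for i
  proof (cases "i < n")
    case True
    then have "pullback (points X) \<phi> (\<lambda>z. z i) \<in> regular X"
      unfolding reg by (auto intro: polynomial_functions.coord)
    from assms(4)[OF this] show ?thesis using assms by (simp add: pullback_def)
  next
    case False
    have "\<phi> x \<in> Z" "\<phi> y \<in> Z" using bij assms by (auto simp: bij_betw_def)
    then show ?thesis using Z False by (auto simp: zariski_closed_def affine_space_def)
  qed
  then have "\<phi> x = \<phi> y" by blast
  then show ?thesis using bij assms by (auto simp: bij_betw_def inj_on_def)
qed

text \<open>The coordinates of the point are the values of the character at the coordinate functions; the
  equations of the closed set are respected because the character is a ring homomorphism.\<close>

lemma affine_character_point:
  fixes X :: "('a, 'k::field) variety"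
  assumes X: "affine_variety X" and \<chi>: "character (points X) (regular X) \<chi>"
  shows "\<exists>x\<in>points X. \<forall>f\<in>regular X. \<chi> f = f x"
proof -
  obtain n Z \<phi> where Z: "zariski_closed n Z" and bij: "bij_betw \<phi> (points X) Z"
    and reg: "regular X = pullback (points X) \<phi> ` polynomial_functions n"
    using affine_variety_regular[OF assms(1)] .
  let ?A = "points X"
  define z where "z = (\<lambda>i. if i < n then \<chi> (pullback ?A \<phi> (\<lambda>z. z i)) else 0)"
  have ev: "\<chi> (pullback ?A \<phi> p) = p z" if "p \<in> polynomial_functions n" for p
    using that
  proof induction
    case (const c)
    have "const_on ?A c = pullback ?A \<phi> (\<lambda>z. c)" by (simp add: pullback_def const_on_def)
    then show ?case using \<chi> by (metis character_def)
  next
    case (coord i) then show ?case by (simp add: z_def)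
  next
    case (add p q)
    have "pullback ?A \<phi> (\<lambda>x. p x + q x) = pullback ?A \<phi> p + pullback ?A \<phi> q"
      by (auto simp: pullback_def)
    moreover have "pullback ?A \<phi> p \<in> regular X" "pullback ?A \<phi> q \<in> regular X"
      using add unfolding reg by auto
    ultimately show ?case using \<chi> add.IH unfolding character_def by metis
  next
    case (mult p q)
    have "pullback ?A \<phi> (\<lambda>x. p x * q x) = pullback ?A \<phi> p * pullback ?A \<phi> q"
      by (auto simp: pullback_def)
    moreover have "pullback ?A \<phi> p \<in> regular X" "pullback ?A \<phi> q \<in> regular X"
      using mult unfolding reg by auto
    ultimately show ?case using \<chi> mult.IH unfolding character_def by metis
  qed
  obtain P where P: "P \<subseteq> polynomial_functions n" "Z = {x \<in> affine_space n. \<forall>p\<in>P. p x = 0}"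
    using Z unfolding zariski_closed_def by blast
  have \<phi>Z: "\<phi> x \<in> Z" if "x \<in> ?A" for x using bij that by (auto simp: bij_betw_def)
  have "z \<in> Z"
    unfolding P(2)
  proof (intro CollectI conjI ballI)
    show "z \<in> affine_space n" by (simp add: z_def affine_space_def)
    fix p assume p: "p \<in> P"
    have "pullback ?A \<phi> p = const_on ?A 0"
      using \<phi>Z p P(2) by (auto simp: pullback_def const_on_def)
    then have "p z = \<chi> (const_on ?A 0)" using ev[of p] p P(1) by auto
    then show "p z = 0" using \<chi> by (simp add: character_def)
  qed
  then obtain x where x: "x \<in> ?A" "z = \<phi> x" using bij by (auto simp: bij_betw_def)
  have "\<chi> f = f x" if "f \<in> regular X" for f
    using that ev x unfolding reg by (auto simp: pullback_def)
  then show ?thesis using x by blast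
qed

text \<open>Embed \<open>A\<close> by the generators. The image is the set of common zeros of all polynomial relations
  between them, since evaluation at a common zero is a character of the algebra, and characters
  come from points. This criterion exhibits a group of automorphisms and a closed subgroup as
  affine varieties without writing equations.\<close>

lemma affine_varietyI:
  fixes S :: "('a \<Rightarrow> 'k::field) set"
  assumes fin: "finite S" and van: "\<And>f x. f \<in> S \<Longrightarrow> x \<notin> A \<Longrightarrow> f x = 0"
    and sep: "\<And>x y. x \<in> A \<Longrightarrow> y \<in> A \<Longrightarrow> (\<And>f. f \<in> S \<Longrightarrow> f x = f y) \<Longrightarrow> x = y"
    and chars: "\<And>\<chi>. character A (gen_algebra A S) \<chi> \<Longrightarrow> \<exists>x\<in>A. \<forall>f\<in>S. \<chi> f = f x"
  shows "affine_variety \<lparr>points = A, regular = gen_algebra A S\<rparr>"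
proof -
  interpret fa: function_algebra A "gen_algebra A S" by (rule function_algebra_gen) (rule van)
  obtain n and f :: "nat \<Rightarrow> _" where f: "S = f ` {..<n}"
    using fin by (metis finite_imp_nat_seg_image_inj_on lessThan_def)
  define \<phi> where "\<phi> = (\<lambda>x i. if i < n then f i x else 0)"
  have co: "pullback A \<phi> (\<lambda>z. z i) = f i" if "i < n" for i
    using that van f by (auto simp: pullback_def \<phi>_def fun_eq_iff)
  have gen: "gen_algebra A S = pullback A \<phi> ` polynomial_functions n"
  proof (intro equalityI subsetI)
    fix h assume "h \<in> gen_algebra A S"
    then show "h \<in> pullback A \<phi> ` polynomial_functions n"
    proof induction
      case (const c)
      have "const_on A c = pullback A \<phi> (\<lambda>z. c)" by (simp add: pullback_def const_on_def)
      then show ?case by (simp add: polynomial_functions.const)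
    next
      case (gen h)
      then obtain i where "i < n" "h = f i" using f by auto
      then show ?case using co[of i] polynomial_functions.coord[of i n] by (intro image_eqI[of _ _ "\<lambda>z. z i"]) simp_all
    next
      case (add g h)
      then obtain p q where pq: "p \<in> polynomial_functions n" "q \<in> polynomial_functions n"
        "g = pullback A \<phi> p" "h = pullback A \<phi> q" by blast
      then have "g + h = pullback A \<phi> (\<lambda>x. p x + q x)" by (auto simp: pullback_def)
      then show ?case using pq polynomial_functions.add by blast
    next
      case (mult g h)
      then obtain p q where pq: "p \<in> polynomial_functions n" "q \<in> polynomial_functions n"
        "g = pullback A \<phi> p" "h = pullback A \<phi> q" by blast
      then have "g * h = pullback A \<phi> (\<lambda>x. p x * q x)" by (auto simp: pullback_def)
      then show ?case using pq polynomial_functions.mult by blast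
    qed
  next
    fix h assume "h \<in> pullback A \<phi> ` polynomial_functions n"
    then obtain p where "p \<in> polynomial_functions n" "h = pullback A \<phi> p" by blast
    then show "h \<in> gen_algebra A S"
      using co f pullback_poly_gen_algebra[of n A \<phi> S p] by simp
  qed
  define Z where "Z = \<phi> ` A"
  have bij: "bij_betw \<phi> A Z"
    unfolding bij_betw_def Z_def
  proof (intro conjI refl inj_onI)
    fix x y assume xy: "x \<in> A" "y \<in> A" "\<phi> x = \<phi> y"
    show "x = y"
    proof (rule sep[OF xy(1,2)])
      fix h assume "h \<in> S"
      then obtain i where "i < n" "h = f i" using f by auto
      then show "h x = h y" using fun_cong[OF xy(3), of i] by (simp add: \<phi>_def)
    qed
  qed
  define P where "P = {p \<in> polynomial_functions n. \<forall>x\<in>A. p (\<phi> x) = 0}"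
  have "Z = {x \<in> affine_space n. \<forall>p\<in>P. p x = 0}"
  proof (intro equalityI subsetI)
    fix z assume "z \<in> Z"
    then show "z \<in> {x \<in> affine_space n. \<forall>p\<in>P. p x = 0}"
      by (auto simp: Z_def P_def affine_space_def \<phi>_def)
  next
    fix z assume z: "z \<in> {x \<in> affine_space n. \<forall>p\<in>P. p x = 0}"
    define \<chi> where "\<chi> = (\<lambda>h. (SOME p. p \<in> polynomial_functions n \<and> pullback A \<phi> p = h) z)"
    have ev: "\<chi> (pullback A \<phi> p) = p z" if p: "p \<in> polynomial_functions n" for p
    proof -
      define q where "q = (SOME q. q \<in> polynomial_functions n \<and> pullback A \<phi> q = pullback A \<phi> p)"
      have q: "q \<in> polynomial_functions n" "pullback A \<phi> q = pullback A \<phi> p"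
        using someI[of "\<lambda>q. q \<in> polynomial_functions n \<and> pullback A \<phi> q = pullback A \<phi> p" p] p
        by (auto simp: q_def)
      have "q (\<phi> x) = p (\<phi> x)" if "x \<in> A" for x
        using fun_cong[OF q(2), of x] that by (simp add: pullback_def)
      then have "(\<lambda>x. q x + (-1) * p x) \<in> P"
        unfolding P_def using p q
          polynomial_functions.add[OF q(1) polynomial_functions.mult[OF polynomial_functions.const[of "-1"] p]]
        by auto
      then have "q z + (-1) * p z = 0" using z by auto
      then show ?thesis by (simp add: \<chi>_def q_def)
    qed
    have "character A (gen_algebra A S) \<chi>"
      unfolding character_def
    proof (intro conjI allI ballI)
      fix c :: 'k
      have "const_on A c = pullback A \<phi> (\<lambda>z. c)" by (simp add: pullback_def const_on_def)
      then show "\<chi> (const_on A c) = c" using ev polynomial_functions.const by metis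
    next
      fix g h assume "g \<in> gen_algebra A S" "h \<in> gen_algebra A S"
      then obtain p q where pq: "p \<in> polynomial_functions n" "q \<in> polynomial_functions n"
        "g = pullback A \<phi> p" "h = pullback A \<phi> q" unfolding gen by blast
      have "g + h = pullback A \<phi> (\<lambda>x. p x + q x)" "g * h = pullback A \<phi> (\<lambda>x. p x * q x)"
        using pq by (auto simp: pullback_def)
      then show "\<chi> (g + h) = \<chi> g + \<chi> h" "\<chi> (g * h) = \<chi> g * \<chi> h"
        using pq ev polynomial_functions.add[OF pq(1,2)] polynomial_functions.mult[OF pq(1,2)] by metis+
    qed
    then obtain x where x: "x \<in> A" "\<And>h. h \<in> S \<Longrightarrow> \<chi> h = h x" using chars by blast
    have "z i = \<phi> x i" for i
    proof (cases "i < n")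
      case True
      have "z i = \<chi> (f i)" using ev[of "\<lambda>z. z i"] co True by (simp add: polynomial_functions.coord)
      also have "\<dots> = f i x" using x f True by simp
      finally show ?thesis using True by (simp add: \<phi>_def)
    next
      case False then show ?thesis using z by (auto simp: \<phi>_def affine_space_def)
    qed
    then have "z = \<phi> x" by blast
    then show "z \<in> Z" using x(1) by (simp add: Z_def)
  qed
  then have "zariski_closed n Z" unfolding zariski_closed_def P_def by blast
  moreover have "pullback A \<phi> ` polynomial_functions n = pullback A \<phi> ` regular (closed_subvariety Z n)"
    unfolding closed_subvariety_def by (auto simp: image_image pullback_def Z_def cong: if_cong)
  ultimately show ?thesis
    unfolding affine_variety_def using bij gen by (intro exI[of _ n] exI[of _ Z] exI[of _ \<phi>]) simp
qed

text \<open>A family of characters indexed by \<open>B\<close> is the same as a map from \<open>B\<close> to the points.\<close>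

lemma comorphism_point_map:
  fixes X :: "('a, 'k::field) variety"
  assumes X: "affine_variety X"
    and c: "\<And>c y. y \<in> B \<Longrightarrow> T (const_on (points X) c) y = c"
    and add: "\<And>f g y. f \<in> regular X \<Longrightarrow> g \<in> regular X \<Longrightarrow> y \<in> B \<Longrightarrow> T (f + g) y = T f y + T g y"
    and mult: "\<And>f g y. f \<in> regular X \<Longrightarrow> g \<in> regular X \<Longrightarrow> y \<in> B \<Longrightarrow> T (f * g) y = T f y * T g y"
  shows "\<exists>\<phi>. \<forall>y\<in>B. \<phi> y \<in> points X \<and> (\<forall>f\<in>regular X. f (\<phi> y) = T f y)"
proof (rule bchoice, rule ballI)
  fix y assume y: "y \<in> B"
  then have "character (points X) (regular X) (\<lambda>f. T f y)"
    using c add mult by (simp add: character_def)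
  from affine_character_point[OF X this] show "\<exists>x. x \<in> points X \<and> (\<forall>f\<in>regular X. f x = T f y)"
    by force
qed

section \<open>Regular functions on products\<close>

definition tensors :: "('a \<Rightarrow> 'k::field) set \<Rightarrow> ('b \<Rightarrow> 'k) set \<Rightarrow> ('a \<times> 'b \<Rightarrow> 'k) set"
  where "tensors R S = fun_vs.span {(\<lambda>(x, y). f x * g y) | f g. f \<in> R \<and> g \<in> S}"

lemma regular_product: "regular (product_variety X Y) = tensors (regular X) (regular Y)"
  by (simp add: product_variety_def tensors_def)

lemma points_product: "points (product_variety X Y) = points X \<times> points Y"
  by (simp add: product_variety_def)

lemma sum_lessThan_add_split: "(\<Sum>i<n + m. h i) = (\<Sum>i<n. h i) + (\<Sum>i<m. h (n + i))"
  for h :: "nat \<Rightarrow> 'b::comm_monoid_add"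
  by (induction m) (auto simp: add.assoc)

lemma tensors_pure: "f \<in> R \<Longrightarrow> g \<in> S \<Longrightarrow> (\<lambda>(x, y). f x * g y) \<in> tensors R S"
  unfolding tensors_def by (rule fun_vs.span_base) blast

lemma tensors_add: "F \<in> tensors R S \<Longrightarrow> G \<in> tensors R S \<Longrightarrow> F + G \<in> tensors R S"
  unfolding tensors_def by (rule fun_vs.span_add)

lemma tensors_sum: "(\<And>i. i \<in> I \<Longrightarrow> F i \<in> tensors R S) \<Longrightarrow> (\<Sum>i\<in>I. F i) \<in> tensors R S"
  unfolding tensors_def by (rule fun_vs.span_sum)

lemma tensorsI:
  assumes "\<And>i. i \<in> I \<Longrightarrow> a i \<in> R" "\<And>i. i \<in> I \<Longrightarrow> b i \<in> S"
    "\<And>x y. F (x, y) = (\<Sum>i\<in>I. a i x * b i y)"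
  shows "F \<in> tensors R S"
proof -
  have "F = (\<Sum>i\<in>I. (\<lambda>(x, y). a i x * b i y))"
    using assms(3) by (auto simp: fun_eq_iff sum_fun_apply)
  then show ?thesis using assms by (auto intro!: tensors_sum tensors_pure)
qed

text \<open>The sum has pure tensors only, because scalars can be absorbed into the first factor.\<close>

lemma tensorsE:
  fixes F :: "'a \<times> 'b \<Rightarrow> 'k::field"
  assumes "F \<in> tensors R S" "fun_vs.subspace R"
  obtains n :: nat and a b where "\<And>i. i < n \<Longrightarrow> a i \<in> R" "\<And>i. i < n \<Longrightarrow> b i \<in> S"
    "\<And>x y. F (x, y) = (\<Sum>i<n. a i x * b i y)"
proof -
  let ?P = "{F. \<exists>(n::nat) a b. (\<forall>i<n. a i \<in> R) \<and> (\<forall>i<n. b i \<in> S) \<and> (\<forall>x y. F (x, y) = (\<Sum>i<n. a i x * b i y))}"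
  have "fun_vs.subspace ?P"
  proof (rule fun_vs.subspaceI)
    show "0 \<in> ?P" by (intro CollectI exI[of _ 0]) auto
  next
    fix F G assume "F \<in> ?P" "G \<in> ?P"
    then obtain n m :: nat and a b a' b' where
      F: "\<forall>i<n. a i \<in> R" "\<forall>i<n. b i \<in> S" "\<forall>x y. F (x, y) = (\<Sum>i<n. a i x * b i y)" and
      G: "\<forall>i<m. a' i \<in> R" "\<forall>i<m. b' i \<in> S" "\<forall>x y. G (x, y) = (\<Sum>i<m. a' i x * b' i y)"
      by blast
    let ?a = "\<lambda>i. if i < n then a i else a' (i - n)" and ?b = "\<lambda>i. if i < n then b i else b' (i - n)"
    have "\<forall>i<n + m. ?a i \<in> R" "\<forall>i<n + m. ?b i \<in> S" using F G by auto
    moreover have "\<forall>x y. (F + G) (x, y) = (\<Sum>i<n + m. ?a i x * ?b i y)"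
      using F G by (simp add: sum_lessThan_add_split)
    ultimately show "F + G \<in> ?P"
      by (intro CollectI exI[of _ "n + m"] exI[of _ ?a] exI[of _ ?b]) simp
  next
    fix c F assume "F \<in> ?P"
    then obtain n :: nat and a b where
      F: "\<forall>i<n. a i \<in> R" "\<forall>i<n. b i \<in> S" "\<forall>x y. F (x, y) = (\<Sum>i<n. a i x * b i y)" by blast
    have "\<forall>i<n. scale_fun c (a i) \<in> R" using F assms(2) by (simp add: fun_vs.subspace_def)
    moreover have "\<forall>x y. scale_fun c F (x, y) = (\<Sum>i<n. scale_fun c (a i) x * b i y)"
      using F by (simp add: sum_distrib_left mult.assoc)
    ultimately show "scale_fun c F \<in> ?P" using F by (intro CollectI exI[of _ n] exI[of _ "\<lambda>i. scale_fun c (a i)"] exI[of _ b]) simp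
  qed
  moreover have "{(\<lambda>(x, y). f x * g y) | f g. f \<in> R \<and> g \<in> S} \<subseteq> ?P"
  proof
    fix h assume "h \<in> {(\<lambda>(x, y). f x * g y) | f g. f \<in> R \<and> g \<in> S}"
    then obtain f g where "f \<in> R" "g \<in> S" "h = (\<lambda>(x, y). f x * g y)" by blast
    then show "h \<in> ?P"
      by (intro CollectI exI[of _ 1] exI[of _ "\<lambda>_. f"] exI[of _ "\<lambda>_. g"]) simp
  qed
  ultimately have "F \<in> ?P" using assms(1) unfolding tensors_def using fun_vs.span_minimal by blast
  then show thesis using that by blast
qed

lemma tensors_mult:
  fixes F :: "'a \<times> 'b \<Rightarrow> 'k::field"
  assumes "F \<in> tensors R S" "G \<in> tensors R S" "fun_vs.subspace R"
    and "\<And>f g. f \<in> R \<Longrightarrow> g \<in> R \<Longrightarrow> f * g \<in> R" "\<And>f g. f \<in> S \<Longrightarrow> g \<in> S \<Longrightarrow> f * g \<in> S"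
  shows "F * G \<in> tensors R S"
proof -
  obtain n :: nat and a b where F: "\<And>i. i < n \<Longrightarrow> a i \<in> R" "\<And>i. i < n \<Longrightarrow> b i \<in> S"
    "\<And>x y. F (x, y) = (\<Sum>i<n. a i x * b i y)" using tensorsE[OF assms(1,3)] by blast
  obtain m :: nat and a' b' where G: "\<And>i. i < m \<Longrightarrow> a' i \<in> R" "\<And>i. i < m \<Longrightarrow> b' i \<in> S"
    "\<And>x y. G (x, y) = (\<Sum>i<m. a' i x * b' i y)" using tensorsE[OF assms(2,3)] by blast
  show ?thesis
  proof (rule tensorsI[of "{..<n} \<times> {..<m}" "\<lambda>(i, j). a i * a' j" _ "\<lambda>(i, j). b i * b' j"])
    show "(F * G) (x, y) = (\<Sum>p\<in>{..<n} \<times> {..<m}. (case p of (i, j) \<Rightarrow> a i * a' j) x * (case p of (i, j) \<Rightarrow> b i * b' j) y)" for x y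
    proof -
      have "(F * G) (x, y) = (\<Sum>i<n. \<Sum>j<m. (a i x * b i y) * (a' j x * b' j y))"
        using F(3) G(3) by (simp add: sum_product)
      also have "\<dots> = (\<Sum>(i, j)\<in>{..<n} \<times> {..<m}. (a i x * b i y) * (a' j x * b' j y))"
        by (simp add: sum.cartesian_product)
      also have "\<dots> = (\<Sum>p\<in>{..<n} \<times> {..<m}. (case p of (i, j) \<Rightarrow> a i * a' j) x * (case p of (i, j) \<Rightarrow> b i * b' j) y)"
        by (rule sum.cong) (auto simp: mult_ac)
      finally show ?thesis .
    qed
  qed (use F G assms in auto)
qed

section \<open>Vector fields and their exponentials\<close>

lemma pascal_sum:
  fixes a :: "nat \<Rightarrow> 'w::comm_ring_1"
  shows "(\<Sum>k\<le>n. of_nat (n choose k) * a (Suc k)) + (\<Sum>k\<le>n. of_nat (n choose k) * a k)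
    = (\<Sum>k\<le>Suc n. of_nat (Suc n choose k) * a k)"
proof -
  have "(\<Sum>k\<le>n. of_nat (n choose k) * a k) = (\<Sum>k\<le>Suc n. of_nat (n choose k) * a k)"
    by (simp add: binomial_eq_0)
  also have "\<dots> = a 0 + (\<Sum>k\<le>n. of_nat (n choose Suc k) * a (Suc k))"
    by (subst sum.atMost_Suc_shift) simp
  finally have e: "(\<Sum>k\<le>n. of_nat (n choose k) * a k) = a 0 + (\<Sum>k\<le>n. of_nat (n choose Suc k) * a (Suc k))" .
  have "(\<Sum>k\<le>Suc n. of_nat (Suc n choose k) * a k)
      = a 0 + (\<Sum>k\<le>n. of_nat (Suc n choose Suc k) * a (Suc k))"
    by (subst sum.atMost_Suc_shift) simp
  also have "(\<Sum>k\<le>n. of_nat (Suc n choose Suc k) * a (Suc k)) =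
      (\<Sum>k\<le>n. of_nat (n choose k) * a (Suc k)) + (\<Sum>k\<le>n. of_nat (n choose Suc k) * a (Suc k))"
    by (simp add: sum.distrib[symmetric] distrib_right)
  finally show ?thesis unfolding e by (simp add: add_ac)
qed

text \<open>One statement serves products of functions (with the same derivation throughout, or with
  different shifts on the two factors), hence the unrelated operators \<open>P\<close>, \<open>Q\<close>, \<open>S\<close> and the
  bilinear \<open>B\<close>.\<close>

lemma iterated_leibniz:
  fixes S :: "'w::comm_ring_1 \<Rightarrow> 'w"
  assumes P: "\<And>f. f \<in> U \<Longrightarrow> P f \<in> U" and Q: "\<And>g. g \<in> V \<Longrightarrow> Q g \<in> V"
    and B: "\<And>f g. f \<in> U \<Longrightarrow> g \<in> V \<Longrightarrow> B f g \<in> W"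
    and SB: "\<And>f g. f \<in> U \<Longrightarrow> g \<in> V \<Longrightarrow> S (B f g) = B (P f) g + B f (Q g)"
    and S: "\<And>x. x \<in> W \<Longrightarrow> S x \<in> W" "\<And>x y. x \<in> W \<Longrightarrow> y \<in> W \<Longrightarrow> S (x + y) = S x + S y"
    and fg: "f \<in> U" "g \<in> V"
  shows "(S ^^ n) (B f g) = (\<Sum>k\<le>n. of_nat (n choose k) * B ((P ^^ k) f) ((Q ^^ (n - k)) g))"
  using fg
proof (induction n arbitrary: f g)
  case 0 then show ?case by simp
next
  case (Suc n f g)
  have SW: "(S ^^ m) x \<in> W" if "x \<in> W" for x m using that by (induction m) (auto intro: S)
  have Sadd: "(S ^^ m) (x + y) = (S ^^ m) x + (S ^^ m) y" if "x \<in> W" "y \<in> W" for x y m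
    using that by (induction m) (auto simp: S SW)
  define a where "a = (\<lambda>k. B ((P ^^ k) f) ((Q ^^ (Suc n - k)) g))"
  have "(S ^^ Suc n) (B f g) = (S ^^ n) (B (P f) g + B f (Q g))"
    by (simp only: funpow_Suc_right comp_apply SB[OF Suc.prems])
  also have "\<dots> = (S ^^ n) (B (P f) g) + (S ^^ n) (B f (Q g))"
    by (intro Sadd B P Q Suc.prems)
  also have "(S ^^ n) (B (P f) g) = (\<Sum>k\<le>n. of_nat (n choose k) * a (Suc k))"
    unfolding a_def using Suc.IH[OF P[OF Suc.prems(1)] Suc.prems(2)]
    by (simp only: funpow_Suc_right comp_apply diff_Suc_Suc)
  also have "(S ^^ n) (B f (Q g)) = (\<Sum>k\<le>n. of_nat (n choose k) * a k)"
    unfolding a_def Suc.IH[OF Suc.prems(1) Q[OF Suc.prems(2)]]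
    by (rule sum.cong) (simp_all add: Suc_diff_le funpow_Suc_right del: funpow.simps)
  finally show ?case unfolding pascal_sum by (simp only: a_def)
qed

text \<open>Regroups the product of two finite exponential series by total degree.\<close>

lemma double_sum_triangle:
  fixes a :: "nat \<Rightarrow> nat \<Rightarrow> 'b::comm_monoid_add"
  assumes "\<And>i j. m \<le> i \<or> m \<le> j \<Longrightarrow> a i j = 0"
  shows "(\<Sum>i<m. \<Sum>j<m. a i j) = (\<Sum>n<2 * m. \<Sum>k\<le>n. a k (n - k))"
proof -
  have fin: "finite {(i, j). i + j < 2 * m}"
    by (rule finite_subset[of _ "{..<2 * m} \<times> {..<2 * m}"]) auto
  have "(\<Sum>i<m. \<Sum>j<m. a i j) = (\<Sum>(i, j)\<in>{..<m} \<times> {..<m}. a i j)"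
    by (simp add: sum.cartesian_product)
  also have "\<dots> = (\<Sum>(i, j)\<in>{(i, j). i + j < 2 * m}. a i j)"
  proof (rule sum.mono_neutral_left[OF fin])
    show "\<forall>p\<in>{(i, j). i + j < 2 * m} - {..<m} \<times> {..<m}. (case p of (i, j) \<Rightarrow> a i j) = 0"
      using assms by (auto simp: not_less) (meson not_less)+
  qed auto
  also have "\<dots> = (\<Sum>n<2 * m. \<Sum>k\<le>n. a k (n - k))"
    by (rule sum.triangle_reindex)
  finally show ?thesis .
qed

locale affine =
  fixes X :: "('a, 'k::field_char_0) variety"
  assumes affine: "affine_variety X"
begin

sublocale function_algebra "points X" "regular X"
  by (rule function_algebra_regular[OF affine])

lemma Vec_closed: "D \<in> Vec X \<Longrightarrow> D f \<in> regular X"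
  by (cases "f \<in> regular X") (auto simp: Vec_def zero_closed)

lemma Vec_off: "D \<in> Vec X \<Longrightarrow> f \<notin> regular X \<Longrightarrow> D f = 0"
  by (auto simp: Vec_def)

lemma Vec_add: "D \<in> Vec X \<Longrightarrow> f \<in> regular X \<Longrightarrow> g \<in> regular X \<Longrightarrow> D (f + g) = D f + D g"
  by (auto simp: Vec_def)

lemma Vec_scale: "D \<in> Vec X \<Longrightarrow> f \<in> regular X \<Longrightarrow> D (scale_fun c f) = scale_fun c (D f)"
  by (auto simp: Vec_def)

lemma Vec_mult: "D \<in> Vec X \<Longrightarrow> f \<in> regular X \<Longrightarrow> g \<in> regular X \<Longrightarrow> D (f * g) = D f * g + f * D g"
  by (auto simp: Vec_def)

lemma Vec_0: "D \<in> Vec X \<Longrightarrow> D 0 = 0"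
  using Vec_scale[of D 0 0] zero_closed by simp

lemma Vec_diff: "D \<in> Vec X \<Longrightarrow> f \<in> regular X \<Longrightarrow> g \<in> regular X \<Longrightarrow> D (f - g) = D f - D g"
  using Vec_add[of D "f - g" g] diff_closed[of f g] by simp

lemma Vec_const: 
  assumes D: "D \<in> Vec X"
  shows "D (const_on (points X) c) = 0"
proof -
  let ?u = "const_on (points X) 1 :: 'a \<Rightarrow> 'k"
  have "?u * ?u = ?u" by (auto simp: const_on_def)
  then have e: "D ?u = D ?u * ?u + ?u * D ?u" using Vec_mult[OF D const_closed const_closed, of 1 1] by simp
  have "D ?u x = 0" for x
  proof (cases "x \<in> points X")
    case True
    then show ?thesis using fun_cong[OF e, of x] by (simp add: const_on_def)
  next
    case False then show ?thesis using vanish Vec_closed[OF D] by blast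
  qed
  then have "D ?u = 0" by (simp add: fun_eq_iff)
  moreover have "const_on (points X) c = scale_fun c ?u" by (auto simp: const_on_def)
  ultimately show ?thesis using Vec_scale[OF D const_closed, of c 1] by simp
qed

lemma Vec_sum:
  assumes "D \<in> Vec X" "\<And>i. i \<in> I \<Longrightarrow> f i \<in> regular X"
  shows "D (\<Sum>i\<in>I. f i) = (\<Sum>i\<in>I. D (f i))"
  using assms(2)
proof (induction I rule: infinite_finite_induct)
  case (insert i I)
  have "D (f i + sum f I) = D (f i) + D (sum f I)"
    by (rule Vec_add) (use assms insert sum_closed[of I f] in auto)
  then show ?case using insert by (simp only: sum.insert[OF insert.hyps(1,2)]) simp
qed (simp_all add: Vec_0[OF assms(1)])

lemma Vec_pow_closed: "D \<in> Vec X \<Longrightarrow> f \<in> regular X \<Longrightarrow> (D ^^ n) f \<in> regular X"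
  by (induction n) (auto intro: Vec_closed)

lemma Vec_pow_add: "D \<in> Vec X \<Longrightarrow> f \<in> regular X \<Longrightarrow> g \<in> regular X \<Longrightarrow> (D ^^ n) (f + g) = (D ^^ n) f + (D ^^ n) g"
  by (induction n) (simp_all only: funpow.simps comp_apply id_apply Vec_add Vec_pow_closed)

lemma Vec_pow_scale: "D \<in> Vec X \<Longrightarrow> f \<in> regular X \<Longrightarrow> (D ^^ n) (scale_fun c f) = scale_fun c ((D ^^ n) f)"
  by (induction n) (simp_all only: funpow.simps comp_apply id_apply Vec_scale Vec_pow_closed)

lemma Vec_pow_0: "D \<in> Vec X \<Longrightarrow> (D ^^ n) 0 = 0"
  by (induction n) (simp_all only: funpow.simps comp_apply id_apply Vec_0)

lemma Vec_pow_sum: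
  assumes "D \<in> Vec X" "\<And>i. i \<in> I \<Longrightarrow> f i \<in> regular X"
  shows "(D ^^ n) (\<Sum>i\<in>I. f i) = (\<Sum>i\<in>I. (D ^^ n) (f i))"
proof (induction n)
  case (Suc n)
  then show ?case using Vec_sum[OF assms(1), of I "\<lambda>i. (D ^^ n) (f i)"] Vec_pow_closed[OF assms(1)] assms(2)
    by simp
qed simp

lemma Vec_pow_eq_0: "D \<in> Vec X \<Longrightarrow> (D ^^ m) f = 0 \<Longrightarrow> m \<le> n \<Longrightarrow> (D ^^ n) f = 0"
proof -
  assume a: "D \<in> Vec X" "(D ^^ m) f = 0" "m \<le> n"
  have "(D ^^ n) f = (D ^^ (n - m)) ((D ^^ m) f)"
    using a(3) by (simp flip: funpow_add comp_apply[of "D ^^ (n - m)" "D ^^ m" f])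
  then show ?thesis using a Vec_pow_0 by simp
qed

lemma Vec_pow_mult:
  assumes D: "D \<in> Vec X" and fg: "f \<in> regular X" "g \<in> regular X"
  shows "(D ^^ n) (f * g) x = (\<Sum>k\<le>n. of_nat (n choose k) * ((D ^^ k) f x * (D ^^ (n - k)) g x))"
proof -
  have "(D ^^ n) (f * g) = (\<Sum>k\<le>n. of_nat (n choose k) * ((D ^^ k) f * (D ^^ (n - k)) g))"
    by (rule iterated_leibniz[of "regular X" D "regular X" D "(*)" "regular X"])
      (use D fg in \<open>auto intro: Vec_closed mult_closed simp: Vec_mult Vec_add\<close>)
  then show ?thesis by (simp add: sum_fun_apply)
qed

lemma Vec_eqI:
  assumes D: "D \<in> Vec X" "E \<in> Vec X" and gen: "regular X = gen_algebra (points X) S"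
    and eq: "\<And>f. f \<in> S \<Longrightarrow> D f = E f"
  shows "D = E"
proof
  fix f show "D f = E f"
  proof (cases "f \<in> regular X")
    case True
    then have "f \<in> gen_algebra (points X) S" using gen by simp
    then show ?thesis
    proof induction
      case (const c) then show ?case using Vec_const D by metis
    next
      case (gen f) then show ?case by (rule eq)
    next
      case (add f g) then show ?case using Vec_add D unfolding assms(3) by metis
    next
      case (mult f g) then show ?case using Vec_mult D unfolding assms(3) by metis
    qed
  next
    case False then show ?thesis using D Vec_off by metis
  qed
qed

lemma lie_bracket_Vec:
  assumes D: "D \<in> Vec X" and E: "E \<in> Vec X"
  shows "lie_bracket D E \<in> Vec X"
proof -
  have sc: "scale_fun c (f - g) = scale_fun c f - scale_fun c g" for c and f g :: "'a \<Rightarrow> 'k"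
    by (simp add: fun_eq_iff algebra_simps)
  have "lie_bracket D E (f * g) = f * lie_bracket D E g + lie_bracket D E f * g"
    if "f \<in> regular X" "g \<in> regular X" for f g
    unfolding lie_bracket_def
    using that by (simp add: Vec_mult[OF D] Vec_mult[OF E] Vec_add[OF D] Vec_add[OF E] Vec_closed[OF D] Vec_closed[OF E]
        mult_closed algebra_simps)
  moreover have "lie_bracket D E (f + g) = lie_bracket D E f + lie_bracket D E g"
    if "f \<in> regular X" "g \<in> regular X" for f g
    unfolding lie_bracket_def
    using that by (simp add: Vec_add[OF D] Vec_add[OF E] Vec_closed[OF D] Vec_closed[OF E])
  moreover have "lie_bracket D E (scale_fun c f) = scale_fun c (lie_bracket D E f)"
    if "f \<in> regular X" for c f
    unfolding lie_bracket_def sc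
    using that by (simp add: Vec_scale[OF D] Vec_scale[OF E] Vec_closed[OF D] Vec_closed[OF E])
  moreover have "lie_bracket D E f \<in> regular X" for f
    unfolding lie_bracket_def by (intro diff_closed Vec_closed[OF D] Vec_closed[OF E])
  moreover have "lie_bracket D E f = 0" if "f \<notin> regular X" for f
    unfolding lie_bracket_def using that by (simp add: Vec_off[OF D] Vec_off[OF E] Vec_0[OF D] Vec_0[OF E])
  ultimately show ?thesis unfolding Vec_def by blast
qed

lemma Vec_plus: "D \<in> Vec X \<Longrightarrow> E \<in> Vec X \<Longrightarrow> D + E \<in> Vec X"
  unfolding Vec_def by (auto simp: add_closed fun_vs.scale_right_distrib algebra_simps)

lemma Vec_smult: "D \<in> Vec X \<Longrightarrow> (\<lambda>f. scale_fun c (D f)) \<in> Vec X"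
proof -
  assume D: "D \<in> Vec X"
  have "scale_fun c (D (f * g)) = f * scale_fun c (D g) + scale_fun c (D f) * g"
    if "f \<in> regular X" "g \<in> regular X" for f g
    using that by (simp add: Vec_mult[OF D] fun_eq_iff algebra_simps)
  moreover have "scale_fun c (D (f + g)) = scale_fun c (D f) + scale_fun c (D g)"
    if "f \<in> regular X" "g \<in> regular X" for f g
    using that by (simp add: Vec_add[OF D] fun_vs.scale_right_distrib)
  moreover have "scale_fun c (D (scale_fun d f)) = scale_fun d (scale_fun c (D f))"
    if "f \<in> regular X" for d f
    using that by (simp add: Vec_scale[OF D] mult.commute)
  ultimately show ?thesis
    unfolding Vec_def using Vec_closed[OF D] Vec_off[OF D] scale_closed by auto
qed

end

definition taylor :: "(('a \<Rightarrow> 'k) \<Rightarrow> 'a \<Rightarrow> 'k::field_char_0) \<Rightarrow> ('a \<Rightarrow> 'k) \<Rightarrow> 'a \<Rightarrow> nat \<Rightarrow> 'k"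
  where "taylor D f x n = (D ^^ n) f x / fact n"

text \<open>The exponential series of \<open>t D\<close>, cut off where the powers of \<open>D\<close> start to annihilate \<open>f\<close>; by
  \<open>expo_eq\<close> any later cut-off gives the same function.\<close>

definition expo :: "(('a \<Rightarrow> 'k) \<Rightarrow> 'a \<Rightarrow> 'k::field_char_0) \<Rightarrow> 'k \<Rightarrow> ('a \<Rightarrow> 'k) \<Rightarrow> 'a \<Rightarrow> 'k"
  where "expo D t f = (\<Sum>n<(LEAST m. (D ^^ m) f = 0). scale_fun (t ^ n / fact n) ((D ^^ n) f))"

context affine
begin

lemma taylor_mult:
  assumes D: "D \<in> Vec X" and fg: "f \<in> regular X" "g \<in> regular X"
  shows "taylor D (f * g) x n = (\<Sum>k\<le>n. taylor D f x k * taylor D g x (n - k))"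
proof -
  have "taylor D (f * g) x n = (\<Sum>k\<le>n. of_nat (n choose k) * ((D ^^ k) f x * (D ^^ (n - k)) g x) / fact n)"
    unfolding taylor_def Vec_pow_mult[OF assms] by (simp add: sum_divide_distrib)
  also have "\<dots> = (\<Sum>k\<le>n. taylor D f x k * taylor D g x (n - k))"
    by (rule sum.cong) (simp_all add: taylor_def binomial_fact field_simps)
  finally show ?thesis .
qed

lemma expo_eq:
  assumes "D \<in> Vec X" "(D ^^ m) f = 0"
  shows "expo D t f = (\<Sum>n<m. scale_fun (t ^ n / fact n) ((D ^^ n) f))"
proof -
  let ?l = "LEAST m. (D ^^ m) f = 0"
  have l: "(D ^^ ?l) f = 0" using assms(2) by (rule LeastI)
  have le: "?l \<le> m" using assms(2) by (rule Least_le)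
  show ?thesis unfolding expo_def
  proof (rule sum.mono_neutral_left)
    show "\<forall>i\<in>{..<m} - {..<?l}. scale_fun (t ^ i / fact i) ((D ^^ i) f) = 0"
      using Vec_pow_eq_0[OF assms(1) l] by auto
  qed (use le in auto)
qed

lemma expo_apply:
  assumes "D \<in> Vec X" "(D ^^ m) f = 0"
  shows "expo D t f x = (\<Sum>n<m. taylor D f x n * t ^ n)"
  unfolding expo_eq[OF assms] by (simp add: sum_scale_apply taylor_def field_simps)

lemma expo_closed:
  assumes "D \<in> Vec X" "f \<in> regular X"
  shows "expo D t f \<in> regular X"
  unfolding expo_def by (intro sum_closed scale_closed Vec_pow_closed assms)

lemma expo_in_subspace:
  assumes "fun_vs.subspace V" "\<And>v. v \<in> V \<Longrightarrow> D v \<in> V" "f \<in> V"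
  shows "expo D t f \<in> V"
proof -
  have "(D ^^ n) f \<in> V" for n by (induction n) (auto intro: assms)
  then show ?thesis unfolding expo_def
    by (intro fun_vs.subspace_sum[OF assms(1)] fun_vs.subspace_scale[OF assms(1)])
qed

lemma expo_poly:
  assumes "D \<in> Vec X" "locally_nilpotent X D" "f \<in> regular X"
  shows "\<exists>p. (\<forall>t. expo D t f x = poly p t) \<and> coeff p 0 = f x \<and> coeff p 1 = D f x"
proof -
  obtain m where m: "(D ^^ m) f = 0" using assms by (auto simp: locally_nilpotent_def)
  have m2: "(D ^^ (m + 2)) f = 0" by (rule Vec_pow_eq_0[OF assms(1) m]) simp
  let ?p = "\<Sum>n<m + 2. monom (taylor D f x n) n"
  have "expo D t f x = poly ?p t" for t
    unfolding expo_apply[OF assms(1) m2] by (simp add: poly_sum poly_monom)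
  moreover have "coeff ?p n = (\<Sum>i<m + 2. if i = n then taylor D f x n else 0)" for n
    unfolding coeff_sum by (rule sum.cong) (auto)
  then have c: "coeff ?p n = taylor D f x n" if "n < 2" for n using that by (simp del: sum.lessThan_Suc add_2_eq_Suc')
  have "coeff ?p 0 = f x" "coeff ?p 1 = D f x" using c[of 0] c[of 1] by (simp_all only: taylor_def) simp_all
  ultimately show ?thesis by blast
qed

lemma expo_add:
  assumes D: "D \<in> Vec X" "locally_nilpotent X D" and fg: "f \<in> regular X" "g \<in> regular X"
  shows "expo D t (f + g) = expo D t f + expo D t g"
proof -
  obtain m m' where "(D ^^ m) f = 0" "(D ^^ m') g = 0" using assms unfolding locally_nilpotent_def by blast
  then have z: "(D ^^ (max m m')) f = 0" "(D ^^ (max m m')) g = 0"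
    using Vec_pow_eq_0[OF D(1)] by (meson max.cobounded1 max.cobounded2)+
  moreover have "(D ^^ (max m m')) (f + g) = 0" using Vec_pow_add[OF D(1) fg, of "max m m'"] z by simp
  ultimately show ?thesis
    by (simp add: expo_eq[OF D(1), of "max m m'"] Vec_pow_add[OF D(1) fg] fun_vs.scale_right_distrib sum.distrib)
qed

lemma expo_const:
  assumes D: "D \<in> Vec X"
  shows "expo D t (const_on (points X) c) = const_on (points X) c"
proof -
  have "(D ^^ 1) (const_on (points X) c) = 0" using Vec_const[OF D] by simp
  from expo_eq[OF D this] show ?thesis by simp
qed

lemma expo_mult:
  assumes D: "D \<in> Vec X" "locally_nilpotent X D" and fg: "f \<in> regular X" "g \<in> regular X"
  shows "expo D t (f * g) = expo D t f * expo D t g"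
proof
  fix x
  obtain m1 m2 where "(D ^^ m1) f = 0" "(D ^^ m2) g = 0" using assms unfolding locally_nilpotent_def by blast
  then have z: "(D ^^ n) f = 0" "(D ^^ n) g = 0" if "max m1 m2 \<le> n" for n
    using Vec_pow_eq_0[OF D(1)] that by (meson max.bounded_iff)+
  define m where "m = max m1 m2"
  have z2: "(D ^^ (2 * m)) (f * g) = 0"
  proof
    fix y
    have "(D ^^ k) f y * (D ^^ (2 * m - k)) g y = 0" for k
    proof (cases "m \<le> k")
      case False then have "m \<le> 2 * m - k" by simp
      then show ?thesis using z(2)[of "2 * m - k"] by (simp add: m_def)
    qed (use z(1)[of k] in \<open>simp add: m_def\<close>)
    then show "(D ^^ (2 * m)) (f * g) y = 0 y" unfolding Vec_pow_mult[OF D(1) fg] by (simp only: mult_zero_right sum.neutral_const zero_fun_apply)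
  qed
  have "expo D t f x * expo D t g x = (\<Sum>i<m. \<Sum>j<m. (taylor D f x i * t ^ i) * (taylor D g x j * t ^ j))"
    using z[of m] by (simp add: expo_apply[OF D(1), of m] sum_product m_def)
  also have "\<dots> = (\<Sum>n<2 * m. \<Sum>k\<le>n. (taylor D f x k * t ^ k) * (taylor D g x (n - k) * t ^ (n - k)))"
    by (rule double_sum_triangle) (use z in \<open>auto simp: taylor_def m_def\<close>)
  also have "\<dots> = (\<Sum>n<2 * m. taylor D (f * g) x n * t ^ n)"
  proof (rule sum.cong[OF refl])
    fix n
    have "(\<Sum>k\<le>n. (taylor D f x k * t ^ k) * (taylor D g x (n - k) * t ^ (n - k)))
      = (\<Sum>k\<le>n. taylor D f x k * taylor D g x (n - k) * t ^ n)"
      by (rule sum.cong) (auto simp: power_add[symmetric] mult_ac)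
    then show "(\<Sum>k\<le>n. (taylor D f x k * t ^ k) * (taylor D g x (n - k) * t ^ (n - k))) = taylor D (f * g) x n * t ^ n"
      by (simp add: taylor_mult[OF D(1) fg] sum_distrib_right)
  qed
  also have "\<dots> = expo D t (f * g) x" by (rule expo_apply[OF D(1) z2, symmetric])
  finally show "expo D t (f * g) x = (expo D t f * expo D t g) x" by simp
qed

lemma Vec_pow_comp: "(D ^^ i) ((D ^^ j) f) = (D ^^ (i + j)) f"
  by (simp add: funpow_add)

lemma expo_plus:
  assumes D: "D \<in> Vec X" "locally_nilpotent X D" and f: "f \<in> regular X"
  shows "expo D s (expo D t f) = expo D (s + t) f"
proof
  fix x
  obtain m where m: "(D ^^ m) f = 0" using assms by (auto simp: locally_nilpotent_def)
  have z: "(D ^^ n) f = 0" if "m \<le> n" for n by (rule Vec_pow_eq_0[OF D(1) m that])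
  have pow: "(D ^^ i) (expo D t f) = (\<Sum>j<m. scale_fun (t ^ j / fact j) ((D ^^ (i + j)) f))" for i
    unfolding expo_eq[OF D(1) m]
    by (simp add: Vec_pow_sum[OF D(1)] scale_closed Vec_pow_closed[OF D(1) f] Vec_pow_scale[OF D(1)] Vec_pow_comp)
  then have "(D ^^ m) (expo D t f) = 0" using z by simp
  then have "expo D s (expo D t f) x = (\<Sum>i<m. \<Sum>j<m. s ^ i / fact i * (t ^ j / fact j) * (D ^^ (i + j)) f x)"
    by (simp add: expo_eq[OF D(1)] pow sum_scale_apply sum_distrib_left mult.assoc)
  also have "\<dots> = (\<Sum>n<2 * m. \<Sum>k\<le>n. s ^ k / fact k * (t ^ (n - k) / fact (n - k)) * (D ^^ (k + (n - k))) f x)"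
    by (rule double_sum_triangle) (use z in auto)
  also have "\<dots> = (\<Sum>n<2 * m. taylor D f x n * (s + t) ^ n)"
  proof (rule sum.cong[OF refl])
    fix n
    have "(\<Sum>k\<le>n. s ^ k / fact k * (t ^ (n - k) / fact (n - k)) * (D ^^ (k + (n - k))) f x)
      = (\<Sum>k\<le>n. taylor D f x n * (of_nat (n choose k) * s ^ k * t ^ (n - k)))"
      by (rule sum.cong) (auto simp: taylor_def binomial_fact)
    then show "(\<Sum>k\<le>n. s ^ k / fact k * (t ^ (n - k) / fact (n - k)) * (D ^^ (k + (n - k))) f x) = taylor D f x n * (s + t) ^ n"
      by (simp add: binomial_ring sum_distrib_left)
  qed
  also have "\<dots> = expo D (s + t) f x"
    by (rule expo_apply[symmetric]) (use D z in auto)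
  finally show "expo D s (expo D t f) x = expo D (s + t) f x" .
qed

lemma expo_0:
  assumes D: "D \<in> Vec X" "locally_nilpotent X D" and f: "f \<in> regular X"
  shows "expo D 0 f = f"
proof
  fix x
  obtain p where "\<forall>t. expo D t f x = poly p t" "coeff p 0 = f x" using expo_poly[OF D f, of x] by blast
  then show "expo D 0 f x = f x" by (simp add: poly_0_coeff_0)
qed

text \<open>The bracket with \<open>s\<close> is the difference of right and left multiplication by \<open>s\<close>, which commute.\<close>

lemma bracket_pow:
  assumes s: "s \<in> Vec X" and l: "l \<in> Vec X" and f: "f \<in> regular X"
  shows "((\<lambda>E. lie_bracket E s) ^^ n) l f x =
    (\<Sum>k\<le>n. of_nat (n choose k) * ((-1) ^ k * (s ^^ k) (l ((s ^^ (n - k)) f)) x))"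
proof -
  define Ad where "Ad = (\<lambda>E. lie_bracket E s)"
  define B where "B = (\<lambda>(u::('a \<Rightarrow> 'k) \<Rightarrow> 'a \<Rightarrow> 'k) (v::('a \<Rightarrow> 'k) \<Rightarrow> 'a \<Rightarrow> 'k) f. u (l (v f)))"
  define P where "P = (\<lambda>(u::('a \<Rightarrow> 'k) \<Rightarrow> 'a \<Rightarrow> 'k) f. - s (u f))"
  define Q where "Q = (\<lambda>(v::('a \<Rightarrow> 'k) \<Rightarrow> 'a \<Rightarrow> 'k) f. v (s f))"
  define U where "U = {u :: ('a \<Rightarrow> 'k) \<Rightarrow> 'a \<Rightarrow> 'k. \<forall>f. f \<in> regular X \<longrightarrow> u f \<in> regular X}"
  define W where "W = {T :: ('a \<Rightarrow> 'k) \<Rightarrow> 'a \<Rightarrow> 'k. \<forall>f. T f \<in> regular X}"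
  have neg: "- f \<in> regular X" if "f \<in> regular X" for f
    using diff_closed[OF zero_closed that] by simp
  let ?id = "id :: ('a \<Rightarrow> 'k) \<Rightarrow> 'a \<Rightarrow> 'k"
  have "(Ad ^^ n) (B ?id ?id) = (\<Sum>k\<le>n. of_nat (n choose k) * B ((P ^^ k) ?id) ((Q ^^ (n - k)) ?id))"
  proof (rule iterated_leibniz[of U P UNIV Q B W])
    fix u assume "u \<in> U" then show "P u \<in> U"
      using neg Vec_closed[OF s] by (auto simp: P_def U_def)
  next
    fix u v assume "u \<in> U" then show "B u v \<in> W"
      using Vec_closed[OF l] by (auto simp: B_def U_def W_def)
  next
    fix u v assume "u \<in> U" then show "Ad (B u v) = B (P u) v + B u (Q v)"
      by (auto simp: B_def P_def Q_def Ad_def lie_bracket_def fun_eq_iff)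
  next
    fix T assume "T \<in> W" then show "Ad T \<in> W"
      using Vec_closed[OF s] diff_closed by (auto simp: W_def Ad_def lie_bracket_def)
  next
    fix T T' assume "T \<in> W" "T' \<in> W" then show "Ad (T + T') = Ad T + Ad T'"
      by (auto simp: W_def Ad_def lie_bracket_def Vec_add[OF s] fun_eq_iff)
  qed (auto simp: U_def)
  moreover have "B ?id ?id = l" by (simp add: B_def)
  moreover have "(P ^^ k) id g = scale_fun ((-1) ^ k) ((s ^^ k) g)" if "g \<in> regular X" for k g
  proof (induction k)
    case (Suc k)
    have "(P ^^ Suc k) id g = - s ((P ^^ k) id g)" by (simp add: P_def)
    also have "\<dots> = scale_fun ((-1) ^ Suc k) ((s ^^ Suc k) g)"
      unfolding Suc by (simp add: Vec_scale[OF s] Vec_pow_closed[OF s that] fun_eq_iff)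
    finally show ?case .
  qed simp
  moreover have "(Q ^^ k) v g = v ((s ^^ k) g)" for k g v
    by (induction k arbitrary: v g) (simp_all add: Q_def funpow_swap1)
  ultimately show ?thesis
    unfolding Ad_def[symmetric] using Vec_closed[OF l]
    by (simp add: B_def sum_fun_apply Vec_pow_closed[OF s f])
qed

text \<open>The identity \<open>exp (-t s) l exp (t s) = exp (t ad) l\<close>, where \<open>ad\<close> is the bracket with \<open>s\<close> on the
  right. On \<open>V\<close> both exponentials stop before degree \<open>m\<close>, so their product has degree less than
  \<open>2 m\<close>.\<close>

lemma expo_conj:
  assumes s: "s \<in> Vec X" "locally_nilpotent X s" and l: "l \<in> Vec X"
    and V: "V \<subseteq> regular X" "fun_vs.subspace V" "\<And>v. v \<in> V \<Longrightarrow> l v \<in> V" "\<And>v. v \<in> V \<Longrightarrow> (s ^^ m) v = 0"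
       "\<And>v. v \<in> V \<Longrightarrow> s v \<in> V"
    and f: "f \<in> V"
  shows "expo s (- t) (l (expo s t f)) = (\<Sum>n<2 * m. scale_fun (t ^ n / fact n) (((\<lambda>E. lie_bracket E s) ^^ n) l f))"
proof
  fix x
  have fr: "f \<in> regular X" using V(1) f by blast
  have sV: "(s ^^ n) v \<in> V" if "v \<in> V" for n v using that by (induction n) (auto intro: V)
  have z: "(s ^^ n) v = 0" if "m \<le> n" "v \<in> V" for n v by (rule Vec_pow_eq_0[OF s(1) V(4)[OF that(2)] that(1)])
  have lV: "l ((s ^^ n) f) \<in> V" for n by (intro V(3) sV f)
  have l1: "l (expo s t f) = (\<Sum>j<m. scale_fun (t ^ j / fact j) (l ((s ^^ j) f)))"
    unfolding expo_eq[OF s(1) V(4)[OF f]]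
    by (simp add: Vec_sum[OF l] scale_closed Vec_pow_closed[OF s(1) fr] Vec_scale[OF l])
  have l1V: "l (expo s t f) \<in> V"
    unfolding l1 by (intro fun_vs.subspace_sum[OF V(2)] fun_vs.subspace_scale[OF V(2)] lV)
  have pow: "(s ^^ i) (l (expo s t f)) = (\<Sum>j<m. scale_fun (t ^ j / fact j) ((s ^^ i) (l ((s ^^ j) f))))" for i
    unfolding l1
    by (simp add: Vec_pow_sum[OF s(1)] scale_closed Vec_closed[OF l] Vec_pow_scale[OF s(1)])
  have "expo s (- t) (l (expo s t f)) x =
    (\<Sum>i<m. \<Sum>j<m. (- t) ^ i / fact i * (t ^ j / fact j) * (s ^^ i) (l ((s ^^ j) f)) x)"
    by (simp add: expo_eq[OF s(1) V(4)[OF l1V]] pow sum_scale_apply sum_distrib_left mult.assoc)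
  also have "\<dots> = (\<Sum>n<2 * m. \<Sum>k\<le>n. (- t) ^ k / fact k * (t ^ (n - k) / fact (n - k)) * (s ^^ k) (l ((s ^^ (n - k)) f)) x)"
    by (rule double_sum_triangle) (use z f lV Vec_0[OF l] Vec_pow_0[OF s(1)] in auto)
  also have "\<dots> = (\<Sum>n<2 * m. t ^ n / fact n * ((\<lambda>E. lie_bracket E s) ^^ n) l f x)"
  proof (rule sum.cong[OF refl])
    fix n
    have "(- t) ^ k / fact k * (t ^ (n - k) / fact (n - k)) * (s ^^ k) (l ((s ^^ (n - k)) f)) x =
      t ^ n / fact n * (of_nat (n choose k) * ((-1) ^ k * (s ^^ k) (l ((s ^^ (n - k)) f)) x))" if "k \<le> n" for k
    proof -
      have "(- t) ^ k = (-1) ^ k * t ^ k" by (metis mult_minus1 power_mult_distrib)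
      moreover have "t ^ k * t ^ (n - k) = t ^ n" using that by (simp flip: power_add)
      ultimately show ?thesis using that by (simp add: binomial_fact flip: \<open>t ^ k * t ^ (n - k) = t ^ n\<close>)
    qed
    then show "(\<Sum>k\<le>n. (- t) ^ k / fact k * (t ^ (n - k) / fact (n - k)) * (s ^^ k) (l ((s ^^ (n - k)) f)) x)
       = t ^ n / fact n * ((\<lambda>E. lie_bracket E s) ^^ n) l f x"
      unfolding bracket_pow[OF s(1) l fr] sum_distrib_left by (intro sum.cong) auto
  qed
  finally show "expo s (- t) (l (expo s t f)) x =
    (\<Sum>n<2 * m. scale_fun (t ^ n / fact n) (((\<lambda>E. lie_bracket E s) ^^ n) l f)) x"
    by (simp add: sum_scale_apply)
qed

end

section \<open>Polynomial functions of several variables\<close>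

lemma poly_eqI_all:
  fixes p q :: "'k::field_char_0 poly"
  assumes "\<And>t. poly p t = poly q t"
  shows "p = q"
  using assms by (simp add: poly_eq_poly_eq_iff[symmetric] fun_eq_iff)

lemma poly_eq_0_cofinite:
  fixes p :: "'k::field_char_0 poly"
  assumes "finite B" "\<And>t. t \<notin> B \<Longrightarrow> poly p t = 0"
  shows "p = 0"
proof (rule ccontr)
  assume "p \<noteq> 0"
  then have "finite ({t. poly p t = 0} \<union> B)" using assms(1) poly_roots_finite by auto
  moreover have "{t. poly p t = 0} \<union> B = UNIV" using assms(2) by auto
  ultimately show False using infinite_UNIV_char_0[where 'a='k] by simp
qed

lemma polynomial_functions_sum:
  "(\<And>i. i \<in> I \<Longrightarrow> f i \<in> polynomial_functions n) \<Longrightarrow> (\<lambda>x. \<Sum>i\<in>I. f i x) \<in> polynomial_functions n"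
  by (induction I rule: infinite_finite_induct)
    (auto intro: polynomial_functions.const polynomial_functions.add)

lemma polynomial_functions_power:
  "f \<in> polynomial_functions n \<Longrightarrow> (\<lambda>x. f x ^ k) \<in> polynomial_functions n"
  by (induction k) (auto intro: polynomial_functions.const polynomial_functions.mult)

lemma polynomial_functions_poly:
  "f \<in> polynomial_functions n \<Longrightarrow> (\<lambda>x. poly q (f x)) \<in> polynomial_functions n"
  unfolding poly_altdef
  by (intro polynomial_functions_sum polynomial_functions.mult polynomial_functions.const polynomial_functions_power)

lemma polynomial_functions_mono:
  assumes "f \<in> polynomial_functions n" "n \<le> m"
  shows "f \<in> polynomial_functions m"
  using assms(1) by induction (use assms(2) in \<open>auto intro: polynomial_functions.intros\<close>)

lemma polynomial_function_on_line:
  fixes f :: "(nat \<Rightarrow> 'k::field_char_0) \<Rightarrow> 'k"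
  assumes "f \<in> polynomial_functions n"
  shows "\<exists>p. \<forall>u. f (\<lambda>i. a i + u * b i) = poly p u"
  using assms
proof induction
  case (const c) then show ?case by (intro exI[of _ "[:c:]"]) simp
next
  case (coord i) then show ?case by (intro exI[of _ "[:a i, b i:]"]) simp
next
  case (add p q)
  then obtain p' q' where "\<forall>u. p (\<lambda>i. a i + u * b i) = poly p' u" "\<forall>u. q (\<lambda>i. a i + u * b i) = poly q' u" by blast
  then show ?case by (intro exI[of _ "p' + q'"]) simp
next
  case (mult p q)
  then obtain p' q' where "\<forall>u. p (\<lambda>i. a i + u * b i) = poly p' u" "\<forall>u. q (\<lambda>i. a i + u * b i) = poly q' u" by blast
  then show ?case by (intro exI[of _ "p' * q'"]) simp
qed

text \<open>The polynomials in \<open>n\<close> variables of degree at most \<open>N\<close> in each variable, spanned by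
  \<open>(N + 1) ^ n\<close> monomials.\<close>

definition bounded_polys :: "nat \<Rightarrow> nat \<Rightarrow> ((nat \<Rightarrow> 'k::field) \<Rightarrow> 'k) set"
  where "bounded_polys n N =
    fun_vs.span ((\<lambda>\<beta> t. \<Prod>i<n. t i ^ \<beta> i) ` (PiE {..<n} (\<lambda>_. {..N})))"

lemma bounded_polys_monom:
  assumes "\<And>i. i < n \<Longrightarrow> \<beta> i \<le> N"
  shows "(\<lambda>t. \<Prod>i<n. t i ^ \<beta> i) \<in> bounded_polys n N"
proof -
  have "(\<lambda>t. \<Prod>i<n. t i ^ \<beta> i) = (\<lambda>t. \<Prod>i<n. t i ^ (restrict \<beta> {..<n}) i)"
    by (intro ext prod.cong) auto
  moreover have "restrict \<beta> {..<n} \<in> PiE {..<n} (\<lambda>_. {..N})" using assms by auto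
  ultimately show ?thesis unfolding bounded_polys_def by (intro fun_vs.span_base) blast
qed

lemma bounded_polys_induct:
  assumes "f \<in> bounded_polys n N" "fun_vs.subspace W"
    and "\<And>\<beta>. (\<And>i. i < n \<Longrightarrow> \<beta> i \<le> N) \<Longrightarrow> (\<lambda>t. \<Prod>i<n. t i ^ \<beta> i) \<in> W"
  shows "f \<in> W"
proof -
  have "bounded_polys n N \<subseteq> W"
    unfolding bounded_polys_def by (rule fun_vs.span_minimal) (use assms in \<open>auto simp: PiE_iff\<close>)
  then show ?thesis using assms(1) by blast
qed

lemma bounded_polys_subspace: "fun_vs.subspace (bounded_polys n N)"
  unfolding bounded_polys_def by (rule fun_vs.subspace_span)

lemma bounded_polys_mono:
  assumes "f \<in> bounded_polys n N" "N \<le> N'"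
  shows "f \<in> bounded_polys n N'"
  by (rule bounded_polys_induct[OF assms(1) bounded_polys_subspace])
    (intro bounded_polys_monom, use assms(2) order_trans in blast)

lemma bounded_polys_mult:
  fixes f g :: "(nat \<Rightarrow> 'k::field) \<Rightarrow> 'k"
  assumes "f \<in> bounded_polys n N" "g \<in> bounded_polys n N'"
  shows "f * g \<in> bounded_polys n (N + N')"
proof -
  let ?W = "bounded_polys n (N + N') :: ((nat \<Rightarrow> 'k) \<Rightarrow> 'k) set"
  have sub: "fun_vs.subspace {f. f * h \<in> ?W}" for h :: "(nat \<Rightarrow> 'k) \<Rightarrow> 'k"
  proof (rule fun_vs.subspaceI)
    show "0 \<in> {f. f * h \<in> ?W}" using fun_vs.subspace_0[OF bounded_polys_subspace] by simp
  next
    fix x y assume "x \<in> {f. f * h \<in> ?W}" "y \<in> {f. f * h \<in> ?W}"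
    then show "x + y \<in> {f. f * h \<in> ?W}"
      using fun_vs.subspace_add[OF bounded_polys_subspace] by (simp add: distrib_right)
  next
    fix c x assume "x \<in> {f. f * h \<in> ?W}"
    moreover have "scale_fun c x * h = scale_fun c (x * h)" by (simp add: fun_eq_iff)
    ultimately show "scale_fun c x \<in> {f. f * h \<in> ?W}"
      using fun_vs.subspace_scale[OF bounded_polys_subspace] by simp
  qed
  have mm: "(\<lambda>t. \<Prod>i<n. t i ^ \<beta> i) * (\<lambda>t. \<Prod>i<n. t i ^ \<beta>' i) \<in> ?W"
    if "\<And>i. i < n \<Longrightarrow> \<beta> i \<le> N" "\<And>i. i < n \<Longrightarrow> \<beta>' i \<le> N'" for \<beta> \<beta>'
  proof -
    have "(\<lambda>t::nat \<Rightarrow> 'k. \<Prod>i<n. t i ^ \<beta> i) * (\<lambda>t. \<Prod>i<n. t i ^ \<beta>' i) = (\<lambda>t. \<Prod>i<n. t i ^ (\<beta> i + \<beta>' i))"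
      by (simp add: fun_eq_iff power_add prod.distrib)
    then show ?thesis using that bounded_polys_monom[of n "\<lambda>i. \<beta> i + \<beta>' i" "N + N'"] by (simp add: add_mono)
  qed
  have "g \<in> {g. (\<lambda>t. \<Prod>i<n. t i ^ \<beta> i) * g \<in> ?W}" if "\<And>i. i < n \<Longrightarrow> \<beta> i \<le> N" for \<beta>
    using assms(2)
  proof (rule bounded_polys_induct)
    show "fun_vs.subspace {g. (\<lambda>t. \<Prod>i<n. t i ^ \<beta> i) * g \<in> ?W}"
      using sub[of "\<lambda>t. \<Prod>i<n. t i ^ \<beta> i"] by (simp only: mult.commute)
  qed (use mm that in blast)
  then have "f \<in> {f. f * g \<in> ?W}"
    using bounded_polys_induct[OF assms(1) sub[of g]] by blast
  then show ?thesis by blast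
qed

lemma bounded_polys_const: "(\<lambda>t. c) \<in> bounded_polys n N"
proof -
  have "scale_fun c (\<lambda>t. \<Prod>i<n. t i ^ 0) \<in> bounded_polys n N"
    by (rule fun_vs.subspace_scale[OF bounded_polys_subspace bounded_polys_monom]) simp
  moreover have "scale_fun c (\<lambda>t. \<Prod>i<n. t i ^ 0) = (\<lambda>t. c)" by (simp add: fun_eq_iff)
  ultimately show ?thesis by metis
qed

lemma polynomial_function_bounded:
  fixes f :: "(nat \<Rightarrow> 'k::field) \<Rightarrow> 'k"
  assumes "f \<in> polynomial_functions n"
  shows "\<exists>N. f \<in> bounded_polys n N"
  using assms
proof induction
  case (const c) then show ?case using bounded_polys_const by blast
next
  case (coord i)
  have "(\<lambda>t::nat \<Rightarrow> 'k. t i) = (\<lambda>t. \<Prod>j<n. t j ^ (if j = i then 1 else 0))"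
  proof
    fix t :: "nat \<Rightarrow> 'k"
    have "(\<Prod>j<n. t j ^ (if j = i then 1 else 0)) = (\<Prod>j<n. if j = i then t i else 1)"
      by (rule prod.cong) auto
    then show "t i = (\<Prod>j<n. t j ^ (if j = i then 1 else 0))" using coord by simp
  qed
  moreover have "(\<lambda>t::nat \<Rightarrow> 'k. \<Prod>j<n. t j ^ (if j = i then 1 else 0)) \<in> bounded_polys n 1"
    by (rule bounded_polys_monom) simp
  ultimately show ?case by metis
next
  case (add p q)
  then obtain N N' where "p \<in> bounded_polys n N" "q \<in> bounded_polys n N'" by blast
  then have "p \<in> bounded_polys n (max N N')" "q \<in> bounded_polys n (max N N')"
    by (auto intro: bounded_polys_mono)
  from fun_vs.subspace_add[OF bounded_polys_subspace this] show ?case by (auto simp: plus_fun_def)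
next
  case (mult p q)
  then obtain N N' where "p \<in> bounded_polys n N" "q \<in> bounded_polys n N'" by blast
  from bounded_polys_mult[OF this] show ?case by (auto simp: times_fun_def)
qed

lemma bounded_polys_power:
  assumes "f \<in> bounded_polys n N"
  shows "(\<lambda>t. f t ^ k) \<in> bounded_polys n (k * N)"
proof (induction k)
  case 0 then show ?case using bounded_polys_const[of 1] by simp
next
  case (Suc k)
  from bounded_polys_mult[OF assms this] show ?case by (simp add: times_fun_def)
qed

lemma bounded_polys_prod:
  assumes "\<And>j. j < m \<Longrightarrow> f j \<in> bounded_polys n N"
  shows "(\<lambda>t. \<Prod>j<m. f j t) \<in> bounded_polys n (m * N)"
  using assms
proof (induction m)
  case 0 then show ?case using bounded_polys_const[of 1] by simp
next
  case (Suc m)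
  have "(\<lambda>t. \<Prod>j<m. f j t) \<in> bounded_polys n (m * N)" using Suc by simp
  from bounded_polys_mult[OF this Suc.prems[of m]] show ?case by (simp add: times_fun_def add.commute)
qed

lemma digits_inj:
  fixes \<alpha> \<beta> :: "nat \<Rightarrow> nat"
  assumes "\<And>j. j < m \<Longrightarrow> \<alpha> j < b" "\<And>j. j < m \<Longrightarrow> \<beta> j < b"
    "(\<Sum>j<m. \<alpha> j * b ^ j) = (\<Sum>j<m. \<beta> j * b ^ j)" "j < m"
  shows "\<alpha> j = \<beta> j"
  using assms
proof (induction m arbitrary: \<alpha> \<beta> j)
  case 0 then show ?case by simp
next
  case (Suc m)
  have e: "(\<Sum>j<Suc m. \<gamma> j * b ^ j) = \<gamma> 0 + b * (\<Sum>j<m. \<gamma> (Suc j) * b ^ j)" for \<gamma> :: "nat \<Rightarrow> nat"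
    by (subst sum.lessThan_Suc_shift) (simp add: sum_distrib_left mult_ac)
  have eq: "\<alpha> 0 + b * (\<Sum>j<m. \<alpha> (Suc j) * b ^ j) = \<beta> 0 + b * (\<Sum>j<m. \<beta> (Suc j) * b ^ j)"
    using Suc.prems(3) unfolding e .
  have b: "\<alpha> 0 < b" "\<beta> 0 < b" using Suc.prems by auto
  have 0: "\<alpha> 0 = \<beta> 0" using arg_cong[OF eq, of "\<lambda>x. x mod b"] b by simp
  then have "(\<Sum>j<m. \<alpha> (Suc j) * b ^ j) = (\<Sum>j<m. \<beta> (Suc j) * b ^ j)" using eq b by simp
  then have "\<alpha> (Suc i) = \<beta> (Suc i)" if "i < m" for i
    using Suc.IH[of "\<lambda>j. \<alpha> (Suc j)" "\<lambda>j. \<beta> (Suc j)" i] Suc.prems that by auto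
  then show ?case using 0 Suc.prems(4) by (cases j) auto
qed

section \<open>Tangent vectors of curves\<close>

lemma coeff_mult_1: "coeff (p * q) 1 = coeff p 0 * coeff q 1 + coeff p 1 * coeff q 0"
  by (simp add: coeff_mult)

lemma coeff_mult_0: "coeff (p * q) 0 = coeff p 0 * coeff q 0"
  by (simp add: coeff_mult)

lemma coeff_power_01:
  assumes "coeff q 0 = 1"
  shows "coeff (q ^ m) 0 = 1" "coeff (q ^ m) 1 = of_nat m * coeff (q :: 'k::comm_ring_1 poly) 1"
proof -
  have "coeff (q ^ m) 0 = 1 \<and> coeff (q ^ m) 1 = of_nat m * coeff q 1"
    by (induction m) (simp_all only: power.simps coeff_mult_0 coeff_mult_1 assms, auto simp: algebra_simps)
  then show "coeff (q ^ m) 0 = 1" "coeff (q ^ m) 1 = of_nat m * coeff q 1" by auto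
qed

lemma tangent_closed_sum:
  "A \<in> tangent_space X x \<Longrightarrow> B \<in> tangent_space X x \<Longrightarrow> A + B \<in> tangent_space X x"
  by (auto simp: tangent_space_def algebra_simps)

lemma tangent_subspace: "fun_vs.subspace (tangent_space X x)"
proof (rule fun_vs.subspaceI)
  show "0 \<in> tangent_space X x" by (simp add: tangent_space_def)
next
  fix A c assume "A \<in> tangent_space X x"
  then show "scale_fun c A \<in> tangent_space X x" by (simp add: tangent_space_def algebra_simps)
qed (rule tangent_closed_sum)

context affine
begin

text \<open>A curve that is regular away from the zeros of \<open>q\<close> has a velocity at \<open>t = 0\<close>. With
  \<open>F (\<gamma> t) = p / q ^ n\<close> and \<open>q 0 = 1\<close> the derivative of the quotient at \<open>0\<close> is \<open>p' - n q' p\<close>.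
  Denominators are needed for curves in the multiplicative group.\<close>

lemma curve_tangent:
  assumes q: "coeff q 0 = 1" and e: "\<gamma> 0 = e" "e \<in> points X"
    and curve: "\<And>F. F \<in> regular X \<Longrightarrow> \<exists>n p. \<forall>t. poly q t \<noteq> 0 \<longrightarrow> poly q t ^ n * F (\<gamma> t) = poly p t"
  shows "\<exists>A\<in>tangent_space X e. \<forall>F\<in>regular X. \<forall>n p.
    (\<forall>t. poly q t \<noteq> 0 \<longrightarrow> poly q t ^ n * F (\<gamma> t) = poly p t) \<longrightarrow>
      A F = coeff p 1 - of_nat n * coeff q 1 * coeff p 0"
proof -
  define rep where "rep = (\<lambda>F n p. \<forall>t. poly q t \<noteq> 0 \<longrightarrow> poly q t ^ n * F (\<gamma> t) = poly p t)"
  define d where "d = (\<lambda>n p. coeff p 1 - of_nat n * coeff q 1 * coeff p 0)"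
  have qnz: "q \<noteq> 0" using q by auto
  have uniq: "d n p = d m r" if "rep F n p" "rep F m r" for F n p m r
  proof -
    have "q * (q ^ m * p) = q * (q ^ n * r)"
    proof (rule poly_eqI_all)
      fix t show "poly (q * (q ^ m * p)) t = poly (q * (q ^ n * r)) t"
      proof (cases "poly q t = 0")
        case False
        then have e: "poly p t = poly q t ^ n * F (\<gamma> t)" "poly r t = poly q t ^ m * F (\<gamma> t)"
          using that by (simp_all add: rep_def)
        show ?thesis unfolding poly_mult poly_power e by (simp add: mult_ac)
      qed simp
    qed
    then have eq: "q ^ m * p = q ^ n * r" using qnz by simp
    have c0: "coeff p 0 = coeff r 0"
      using arg_cong[OF eq, of "\<lambda>p. coeff p 0"] by (simp add: coeff_mult_0 coeff_power_01[OF q])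
    have "of_nat m * coeff q 1 * coeff p 0 + coeff p 1 = of_nat n * coeff q 1 * coeff r 0 + coeff r 1"
      using arg_cong[OF eq, of "\<lambda>p. coeff p 1"] unfolding coeff_mult_1 coeff_power_01[OF q] by (simp add: algebra_simps)
    then show ?thesis unfolding d_def c0 by (simp add: algebra_simps eq_diff_eq)
  qed
  define A where "A = (\<lambda>F. if F \<in> regular X then (SOME v. \<exists>n p. rep F n p \<and> v = d n p) else 0)"
  have A: "A F = d n p" if "F \<in> regular X" "rep F n p" for F n p
  proof -
    have "\<exists>v n p. rep F n p \<and> v = d n p" using that by blast
    from someI_ex[OF this] obtain m r where
      mr: "rep F m r" "(SOME v. \<exists>n p. rep F n p \<and> v = d n p) = d m r" by blast
    have "A F = d m r" using that(1) mr(2) by (simp add: A_def)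
    with mr(1) show ?thesis using uniq[OF that(2)] by simp
  qed
  have ex: "\<exists>n p. rep F n p" if "F \<in> regular X" for F using curve[OF that] by (simp add: rep_def)
  have p0: "coeff p 0 = F e" if "rep F n p" for F n p
    proof -
    have "poly q 0 ^ n * F (\<gamma> 0) = poly p 0"
      using that[unfolded rep_def, rule_format, of 0] q by (simp add: poly_0_coeff_0)
    then show ?thesis using q e(1) by (simp add: poly_0_coeff_0)
  qed
  have "A \<in> tangent_space X e"
    unfolding tangent_space_def
  proof (intro CollectI conjI allI impI ballI)
    fix F assume "F \<notin> regular X" then show "A F = 0" by (simp add: A_def)
  next
    fix F G assume F: "F \<in> regular X" and G: "G \<in> regular X"
    obtain n p where p: "rep F n p" using ex[OF F] by blast
    obtain m r where r: "rep G m r" using ex[OF G] by blast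
    have "rep (F + G) (n + m) (q ^ m * p + q ^ n * r)"
      unfolding rep_def
    proof (intro allI impI)
      fix t assume t: "poly q t \<noteq> 0"
      have "poly q t ^ (n + m) * (F + G) (\<gamma> t) = poly q t ^ m * (poly q t ^ n * F (\<gamma> t)) + poly q t ^ n * (poly q t ^ m * G (\<gamma> t))"
        by (simp add: power_add algebra_simps)
      also have "\<dots> = poly (q ^ m * p + q ^ n * r) t" using p r t unfolding rep_def by simp
      finally show "poly q t ^ (n + m) * (F + G) (\<gamma> t) = poly (q ^ m * p + q ^ n * r) t" .
    qed
    then have "A (F + G) = d (n + m) (q ^ m * p + q ^ n * r)" by (intro A add_closed F G)
    also have "\<dots> = d n p + d m r"
      unfolding d_def coeff_add coeff_mult_1 coeff_mult_0 coeff_power_01[OF q] by (simp add: algebra_simps)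
    finally show "A (F + G) = A F + A G" using A F G p r by simp
    have "rep (F * G) (n + m) (p * r)"
      unfolding rep_def
    proof (intro allI impI)
      fix t assume t: "poly q t \<noteq> 0"
      have "poly q t ^ (n + m) * (F * G) (\<gamma> t) = (poly q t ^ n * F (\<gamma> t)) * (poly q t ^ m * G (\<gamma> t))"
        by (simp add: power_add algebra_simps)
      also have "\<dots> = poly (p * r) t" using p r t unfolding rep_def by simp
      finally show "poly q t ^ (n + m) * (F * G) (\<gamma> t) = poly (p * r) t" .
    qed
    then have "A (F * G) = d (n + m) (p * r)" by (intro A mult_closed F G)
    also have "\<dots> = F e * d m r + d n p * G e"
      unfolding d_def coeff_mult_1 coeff_mult_0 p0[OF p] p0[OF r] by (simp add: algebra_simps)
    finally show "A (F * G) = F e * A G + A F * G e" using A F G p r by simp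
  next
    fix c F assume F: "F \<in> regular X"
    obtain n p where p: "rep F n p" using ex[OF F] by blast
    then have "rep (scale_fun c F) n (smult c p)" by (simp add: rep_def algebra_simps)
    then have "A (scale_fun c F) = d n (smult c p)" by (intro A scale_closed F)
    then show "A (scale_fun c F) = c * A F" using A[OF F p] by (simp add: d_def right_diff_distrib mult_ac)
  qed
  then show ?thesis using A unfolding rep_def d_def by blast
qed

text \<open>The velocity at \<open>0\<close> of a polynomial curve. It is zero off the regular functions because tangent
  vectors are required to be.\<close>

definition curve_deriv :: "('k \<Rightarrow> 'a) \<Rightarrow> ('a \<Rightarrow> 'k) \<Rightarrow> 'k"
  where "curve_deriv \<gamma> F = (if F \<in> regular X then coeff (THE p. \<forall>t. F (\<gamma> t) = poly p t) 1 else 0)"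

lemma curve_deriv_eq:
  assumes "F \<in> regular X" "\<And>t. F (\<gamma> t) = poly p t"
  shows "curve_deriv \<gamma> F = coeff p 1"
proof -
  have "(THE p. \<forall>t. F (\<gamma> t) = poly p t) = p"
    by (rule the_equality) (use assms(2) in \<open>auto intro: poly_eqI_all\<close>)
  then show ?thesis using assms(1) by (simp add: curve_deriv_def)
qed

lemma curve_deriv_tangent:
  assumes "\<gamma> 0 \<in> points X" "\<And>F. F \<in> regular X \<Longrightarrow> \<exists>p. \<forall>t. F (\<gamma> t) = poly p t"
  shows "curve_deriv \<gamma> \<in> tangent_space X (\<gamma> 0)"
proof -
  have "\<exists>A\<in>tangent_space X (\<gamma> 0). \<forall>F\<in>regular X. \<forall>n p.
    (\<forall>t. poly 1 t \<noteq> 0 \<longrightarrow> poly 1 t ^ n * F (\<gamma> t) = poly p t) \<longrightarrow>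
      A F = coeff p 1 - of_nat n * coeff 1 1 * coeff p 0"
    by (rule curve_tangent) (use assms in auto)
  then obtain A where A: "A \<in> tangent_space X (\<gamma> 0)"
    and d: "\<And>F p. F \<in> regular X \<Longrightarrow> (\<forall>t. F (\<gamma> t) = poly p t) \<Longrightarrow> A F = coeff p 1"
    by fastforce
  have "curve_deriv \<gamma> F = A F" for F
  proof (cases "F \<in> regular X")
    case True
    then obtain p where "\<forall>t. F (\<gamma> t) = poly p t" using assms(2) by blast
    then show ?thesis using d curve_deriv_eq True by metis
  next
    case False then show ?thesis using A by (simp add: curve_deriv_def tangent_space_def)
  qed
  then have "curve_deriv \<gamma> = A" by (rule ext)
  then show ?thesis using A by simp
qed

lemma tangent_const:
  assumes "A \<in> tangent_space X e" "e \<in> points X"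
  shows "A (const_on (points X) c) = 0"
proof -
  let ?u = "const_on (points X) 1 :: 'a \<Rightarrow> 'k"
  have "?u * ?u = ?u" by (auto simp: const_on_def)
  moreover have "A (?u * ?u) = ?u e * A ?u + A ?u * ?u e"
    using assms(1) const_closed unfolding tangent_space_def by blast
  ultimately have "A ?u = A ?u + A ?u" using assms(2) by (simp add: const_on_def)
  then have "A ?u = 0" by simp
  moreover have "const_on (points X) c = scale_fun c ?u" by (auto simp: const_on_def)
  ultimately show ?thesis using assms(1) const_closed[of 1] by (simp add: tangent_space_def)
qed

lemma tangent_eqI:
  assumes A: "A \<in> tangent_space X e" "e \<in> points X" and gen: "regular X = gen_algebra (points X) S"
    and z: "\<And>f. f \<in> S \<Longrightarrow> A f = 0"
  shows "A = 0"
proof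
  fix f show "A f = 0 f"
  proof (cases "f \<in> regular X")
    case True
    then have "f \<in> gen_algebra (points X) S" using gen by simp
    then have "A f = 0"
    proof induction
      case (const c) then show ?case by (rule tangent_const[OF A])
    next
      case (gen f) then show ?case by (rule z)
    next
      case (add f g)
      then have "A (f + g) = A f + A g" using A(1) unfolding tangent_space_def assms(3) by blast
      also have "\<dots> = 0 + 0" by (intro arg_cong2[of _ _ _ _ plus] add.IH)
      also have "\<dots> = 0" by simp
      finally show ?case .
    next
      case (mult f g)
      then have "A (f * g) = f e * A g + A f * g e" using A(1) unfolding tangent_space_def assms(3) by blast
      also have "\<dots> = f e * 0 + 0 * g e"
        by (intro arg_cong2[of _ _ _ _ plus] arg_cong2[of _ _ _ _ times] mult.IH refl)
      also have "\<dots> = 0" by simp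
      finally show ?case .
    qed
    then show ?thesis by simp
  next
    case False then show ?thesis using A by (simp add: tangent_space_def)
  qed
qed

text \<open>A tangent vector is determined by its values on finitely many generators, so the tangent space
  is a finite-dimensional space of functions.\<close>

lemma tangent_dual_basis:
  assumes "e \<in> points X" "fun_vs.subspace U" "U \<subseteq> tangent_space X e"
  shows "\<exists>n w x. dual_basis U n w x"
proof -
  obtain S where S: "finite S" "regular X = gen_algebra (points X) S"
    using affine_varietyE[OF affine] by metis
  show ?thesis
    by (rule dual_basis_of_separating[OF S(1) assms(2)]) (use tangent_eqI[OF _ assms(1) S(2)] assms(3) in blast)
qed

lemma tangent_sum:
  assumes "A \<in> tangent_space X e" "\<And>i. i \<in> I \<Longrightarrow> f i \<in> regular X"
  shows "A (\<Sum>i\<in>I. scale_fun (c i) (f i)) = (\<Sum>i\<in>I. c i * A (f i))"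
  using assms(2)
proof (induction I rule: infinite_finite_induct)
  case (insert i I)
  have "A (scale_fun (c i) (f i) + (\<Sum>i\<in>I. scale_fun (c i) (f i)))
      = A (scale_fun (c i) (f i)) + A (\<Sum>i\<in>I. scale_fun (c i) (f i))"
    using assms(1) insert scale_closed sum_closed[of I "\<lambda>i. scale_fun (c i) (f i)"]
    unfolding tangent_space_def by auto
  moreover have "A (scale_fun (c i) (f i)) = c i * A (f i)"
    using assms(1) insert unfolding tangent_space_def by auto
  moreover have IH: "A (\<Sum>i\<in>I. scale_fun (c i) (f i)) = (\<Sum>i\<in>I. c i * A (f i))"
    by (rule insert.IH) (use insert.prems in auto)
  ultimately have "A (\<Sum>i\<in>insert i I. scale_fun (c i) (f i)) = (\<Sum>i\<in>insert i I. c i * A (f i))"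
    using insert.hyps by simp
  then show ?case .
next
  case empty
  have "A 0 = A (scale_fun 0 0)" by simp
  also have "\<dots> = 0 * A 0" using assms(1) zero_closed unfolding tangent_space_def by blast
  finally have "A 0 = 0" by simp
  then have "A (\<Sum>i\<in>{}. scale_fun (c i) (f i)) = (\<Sum>i\<in>{}. c i * A (f i))" by simp
  then show ?case .
next
  case (infinite I)
  have "A 0 = A (scale_fun 0 0)" by simp
  also have "\<dots> = 0 * A 0" using assms(1) zero_closed unfolding tangent_space_def by blast
  finally have "A 0 = 0" by simp
  then have "A (\<Sum>i\<in>I. scale_fun (c i) (f i)) = (\<Sum>i\<in>I. c i * A (f i))" using infinite by simp
  then show ?case .
qed

end

section \<open>Linear algebraic groups and their one-parameter subgroups\<close>

locale lin_group =
  fixes M :: "'g monoid" (structure) and V :: "('g, 'k::field_char_0) variety"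
  assumes lin: "linear_algebraic_group M V"
begin

sublocale group M using lin by (simp add: linear_algebraic_group_def)

sublocale affine V by unfold_locales (use lin in \<open>simp add: linear_algebraic_group_def\<close>)

lemma points_eq: "points V = carrier M"
  using lin by (simp add: linear_algebraic_group_def)

lemma comultE:
  assumes "F \<in> regular V"
  obtains n :: nat and a b where "\<And>i. i < n \<Longrightarrow> a i \<in> regular V" "\<And>i. i < n \<Longrightarrow> b i \<in> regular V"
    "\<And>g h. g \<in> carrier M \<Longrightarrow> h \<in> carrier M \<Longrightarrow> F (g \<otimes> h) = (\<Sum>i<n. a i g * b i h)"
proof -
  have "pullback (carrier M \<times> carrier M) (\<lambda>(g, h). g \<otimes> h) F \<in> tensors (regular V) (regular V)"
    using lin assms points_eq unfolding linear_algebraic_group_def morphism_def regular_product points_product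
    by metis
  then obtain n :: nat and a b where "\<And>i. i < n \<Longrightarrow> a i \<in> regular V" "\<And>i. i < n \<Longrightarrow> b i \<in> regular V"
    and e: "\<And>g h. pullback (carrier M \<times> carrier M) (\<lambda>(g, h). g \<otimes> h) F (g, h) = (\<Sum>i<n. a i g * b i h)"
    using tensorsE[OF _ subspace] by blast
  moreover have "F (g \<otimes> h) = (\<Sum>i<n. a i g * b i h)" if "g \<in> carrier M" "h \<in> carrier M" for g h
    using e[of g h] that by (simp add: pullback_def)
  ultimately show thesis using that by blast
qed

lemma comult3E:
  assumes "F \<in> regular V"
  obtains I :: "(nat \<times> nat) set" and a b c where "finite I"
    "\<And>i. i \<in> I \<Longrightarrow> a i \<in> regular V" "\<And>i. i \<in> I \<Longrightarrow> b i \<in> regular V" "\<And>i. i \<in> I \<Longrightarrow> c i \<in> regular V"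
    "\<And>x y z. x \<in> carrier M \<Longrightarrow> y \<in> carrier M \<Longrightarrow> z \<in> carrier M \<Longrightarrow>
      F (x \<otimes> (y \<otimes> z)) = (\<Sum>i\<in>I. a i x * b i y * c i z)"
proof -
  obtain n :: nat and a b where ab: "\<And>i. i < n \<Longrightarrow> a i \<in> regular V" "\<And>i. i < n \<Longrightarrow> b i \<in> regular V"
    "\<And>g h. g \<in> carrier M \<Longrightarrow> h \<in> carrier M \<Longrightarrow> F (g \<otimes> h) = (\<Sum>i<n. a i g * b i h)"
    using comultE[OF assms] by blast
  have "\<forall>i. \<exists>m c d. i < n \<longrightarrow> (\<forall>j<(m::nat). c j \<in> regular V \<and> d j \<in> regular V) \<and>
    (\<forall>g h. g \<in> carrier M \<longrightarrow> h \<in> carrier M \<longrightarrow> b i (g \<otimes> h) = (\<Sum>j<m. c j g * d j h))"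
  proof
    fix i show "\<exists>m c d. i < n \<longrightarrow> (\<forall>j<(m::nat). c j \<in> regular V \<and> d j \<in> regular V) \<and>
      (\<forall>g h. g \<in> carrier M \<longrightarrow> h \<in> carrier M \<longrightarrow> b i (g \<otimes> h) = (\<Sum>j<m. c j g * d j h))"
      (is "\<exists>m c d. ?P m c d")
    proof (cases "i < n")
      case True
      obtain m :: nat and c d where "\<And>j. j < m \<Longrightarrow> c j \<in> regular V" "\<And>j. j < m \<Longrightarrow> d j \<in> regular V"
        "\<And>g h. g \<in> carrier M \<Longrightarrow> h \<in> carrier M \<Longrightarrow> b i (g \<otimes> h) = (\<Sum>j<m. c j g * d j h)"
        using comultE[OF ab(2)[OF True]] by blast
      then have "?P m c d" by simp
      then show ?thesis by (intro exI)
    qed simp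
  qed
  from choice[OF this] obtain m where "\<forall>i. \<exists>c d. i < n \<longrightarrow> (\<forall>j<(m i::nat). c j \<in> regular V \<and> d j \<in> regular V) \<and>
    (\<forall>g h. g \<in> carrier M \<longrightarrow> h \<in> carrier M \<longrightarrow> b i (g \<otimes> h) = (\<Sum>j<m i. c j g * d j h))" by (rule exE)
  from choice[OF this] obtain c where "\<forall>i. \<exists>d. i < n \<longrightarrow> (\<forall>j<(m i::nat). c i j \<in> regular V \<and> d j \<in> regular V) \<and>
    (\<forall>g h. g \<in> carrier M \<longrightarrow> h \<in> carrier M \<longrightarrow> b i (g \<otimes> h) = (\<Sum>j<m i. c i j g * d j h))" by (rule exE)
  from choice[OF this] obtain d where mcd: "\<And>i. i < n \<Longrightarrow> (\<forall>j<(m i::nat). c i j \<in> regular V \<and> d i j \<in> regular V) \<and>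
    (\<forall>g h. g \<in> carrier M \<longrightarrow> h \<in> carrier M \<longrightarrow> b i (g \<otimes> h) = (\<Sum>j<m i. c i j g * d i j h))"
    by blast
  show thesis
  proof (rule that[of "Sigma {..<n} (\<lambda>i. {..<m i})" "\<lambda>(i, j). a i" "\<lambda>(i, j). c i j" "\<lambda>(i, j). d i j"])
    fix x y z assume g: "x \<in> carrier M" "y \<in> carrier M" "z \<in> carrier M"
    have "F (x \<otimes> (y \<otimes> z)) = (\<Sum>i<n. a i x * (\<Sum>j<m i. c i j y * d i j z))"
      using ab(3)[of x "y \<otimes> z"] g mcd by simp
    also have "\<dots> = (\<Sum>i<n. \<Sum>j<m i. a i x * c i j y * d i j z)"
      by (simp add: sum_distrib_left mult.assoc)
    also have "\<dots> = (\<Sum>(i, j)\<in>Sigma {..<n} (\<lambda>i. {..<m i}). a i x * c i j y * d i j z)"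
      by (simp add: sum.Sigma)
    finally show "F (x \<otimes> (y \<otimes> z)) = (\<Sum>i\<in>Sigma {..<n} (\<lambda>i. {..<m i}).
      (case i of (i, j) \<Rightarrow> a i) x * (case i of (i, j) \<Rightarrow> c i j) y * (case i of (i, j) \<Rightarrow> d i j) z)"
      by (simp add: split_def)
  qed (use ab mcd in auto)
qed

lemma antipode_closed: "F \<in> regular V \<Longrightarrow> pullback (carrier M) (\<lambda>g. inv g) F \<in> regular V"
  using lin points_eq unfolding linear_algebraic_group_def morphism_def by metis

lemma inv_cancel: "g \<in> carrier M \<Longrightarrow> x \<in> carrier M \<Longrightarrow> inv g \<otimes> (g \<otimes> x) = x"
  by (simp flip: m_assoc)

lemma conj_translate_closed:
  assumes F: "F \<in> regular V" and g: "x \<in> carrier M" "z \<in> carrier M"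
  shows "pullback (carrier M) (\<lambda>y. x \<otimes> (y \<otimes> z)) F \<in> regular V"
proof -
  obtain I :: "(nat \<times> nat) set" and a b c where I: "finite I"
    "\<And>i. i \<in> I \<Longrightarrow> a i \<in> regular V" "\<And>i. i \<in> I \<Longrightarrow> b i \<in> regular V" "\<And>i. i \<in> I \<Longrightarrow> c i \<in> regular V"
    "\<And>x y z. x \<in> carrier M \<Longrightarrow> y \<in> carrier M \<Longrightarrow> z \<in> carrier M \<Longrightarrow>
      F (x \<otimes> (y \<otimes> z)) = (\<Sum>i\<in>I. a i x * b i y * c i z)"
    using comult3E[OF F] by blast
  have "pullback (carrier M) (\<lambda>y. x \<otimes> (y \<otimes> z)) F y = (\<Sum>i\<in>I. scale_fun (a i x * c i z) (b i)) y" for y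
  proof (cases "y \<in> carrier M")
    case True
    then show ?thesis using I(5) g by (auto simp: pullback_def sum_scale_apply mult_ac intro!: sum.cong)
  next
    case False
    then have "b i y = 0" if "i \<in> I" for i using vanish[OF I(3)[OF that]] by (simp add: points_eq)
    then show ?thesis using False by (simp add: pullback_def sum_scale_apply)
  qed
  then have "pullback (carrier M) (\<lambda>y. x \<otimes> (y \<otimes> z)) F = (\<Sum>i\<in>I. scale_fun (a i x * c i z) (b i))" by (rule ext)
  also have "\<dots> \<in> regular V" using I by (intro sum_closed scale_closed)
  finally show ?thesis .
qed

lemma rtranslate_closed:
  assumes F: "F \<in> regular V" and g: "z \<in> carrier M"
  shows "pullback (carrier M) (\<lambda>y. y \<otimes> z) F \<in> regular V"
proof -
  have "pullback (carrier M) (\<lambda>y. y \<otimes> z) F = pullback (carrier M) (\<lambda>y. \<one> \<otimes> (y \<otimes> z)) F"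
    using g by (auto simp: pullback_def)
  then show ?thesis using conj_translate_closed[OF F one_closed g] by simp
qed

lemma ltranslate_closed:
  assumes F: "F \<in> regular V" and g: "x \<in> carrier M"
  shows "pullback (carrier M) (\<lambda>y. x \<otimes> y) F \<in> regular V"
proof -
  have "pullback (carrier M) (\<lambda>y. x \<otimes> y) F = pullback (carrier M) (\<lambda>y. x \<otimes> (y \<otimes> \<one>)) F"
    using g by (auto simp: pullback_def)
  then show ?thesis using conj_translate_closed[OF F g one_closed] by simp
qed

text \<open>The right-invariant vector field with value \<open>A\<close> at the identity.\<close>

definition conv :: "(('g \<Rightarrow> 'k) \<Rightarrow> 'k) \<Rightarrow> ('g \<Rightarrow> 'k) \<Rightarrow> 'g \<Rightarrow> 'k"
  where "conv A F = (\<lambda>g. if F \<in> regular V \<and> g \<in> carrier M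
     then A (pullback (carrier M) (\<lambda>h. h \<otimes> g) F) else 0)"

lemma conv_apply: "F \<in> regular V \<Longrightarrow> g \<in> carrier M \<Longrightarrow> conv A F g = A (pullback (carrier M) (\<lambda>h. h \<otimes> g) F)"
  by (simp add: conv_def)

lemma conv_one:
  assumes "F \<in> regular V"
  shows "conv A F \<one> = A F"
proof -
  have "pullback (carrier M) (\<lambda>h. h \<otimes> \<one>) F = F"
    using vanish[OF assms] by (auto simp: pullback_def points_eq)
  then show ?thesis using assms by (simp add: conv_apply)
qed

text \<open>Regularity comes from the comultiplication: \<open>F (h g)\<close> is a sum of products \<open>a h * b g\<close>, so
  \<open>conv A F\<close> is the combination of the functions \<open>b\<close> with coefficients \<open>A a\<close>.\<close>

lemma conv_Vec:
  assumes A: "A \<in> tangent_space V \<one>"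
  shows "conv A \<in> Vec V"
proof -
  have Aadd: "A (f + g) = A f + A g" and Amul: "A (f * g) = f \<one> * A g + A f * g \<one>"
    and Asc: "A (scale_fun c f) = c * A f"
    if "f \<in> regular V" "g \<in> regular V" for f g c
    using A that by (auto simp: tangent_space_def)
  have cl: "conv A F \<in> regular V" if F: "F \<in> regular V" for F
  proof -
    obtain n :: nat and a b where ab: "\<And>i. i < n \<Longrightarrow> a i \<in> regular V" "\<And>i. i < n \<Longrightarrow> b i \<in> regular V"
      "\<And>g h. g \<in> carrier M \<Longrightarrow> h \<in> carrier M \<Longrightarrow> F (g \<otimes> h) = (\<Sum>i<n. a i g * b i h)"
      using comultE[OF F] by blast
    have "conv A F g = (\<Sum>i<n. scale_fun (A (a i)) (b i)) g" for g
    proof (cases "g \<in> carrier M")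
      case True
      have "pullback (carrier M) (\<lambda>h. h \<otimes> g) F h = (\<Sum>i<n. scale_fun (b i g) (a i)) h" for h
      proof (cases "h \<in> carrier M")
        case h: True
        then show ?thesis using ab(3) True by (simp add: pullback_def sum_scale_apply mult.commute)
      next
        case False
        then have "a i h = 0" if "i < n" for i using vanish[OF ab(1)[OF that]] by (simp add: points_eq)
        then show ?thesis using False by (simp add: pullback_def sum_scale_apply)
      qed
      then have "pullback (carrier M) (\<lambda>h. h \<otimes> g) F = (\<Sum>i<n. scale_fun (b i g) (a i))" by (rule ext)
      then have "conv A F g = A (\<Sum>i<n. scale_fun (b i g) (a i))" using F True by (simp add: conv_apply)
      also have "\<dots> = (\<Sum>i<n. b i g * A (a i))" by (rule tangent_sum[OF A]) (use ab in auto)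
      finally show ?thesis by (simp add: sum_scale_apply mult.commute)
    next
      case False
      then have "b i g = 0" if "i < n" for i using vanish[OF ab(2)[OF that]] by (simp add: points_eq)
      then show ?thesis using False by (simp add: conv_def sum_scale_apply)
    qed
    then have "conv A F = (\<Sum>i<n. scale_fun (A (a i)) (b i))" by (rule ext)
    also have "\<dots> \<in> regular V" using ab by (intro sum_closed scale_closed) auto
    finally show ?thesis .
  qed
  have pm: "pullback (carrier M) (\<lambda>h. h \<otimes> g) f \<one> = f g" if "g \<in> carrier M" for f :: "'g \<Rightarrow> 'k" and g
    using that by (simp add: pullback_def)
  have "conv A (f + g) = conv A f + conv A g" if "f \<in> regular V" "g \<in> regular V" for f g
    using that by (auto simp: conv_def add_closed pullback_add Aadd rtranslate_closed fun_eq_iff)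
  moreover have "conv A (scale_fun c f) = scale_fun c (conv A f)" if "f \<in> regular V" for c f
  proof
    fix x show "conv A (scale_fun c f) x = scale_fun c (conv A f) x"
      using that Asc[OF rtranslate_closed rtranslate_closed] by (simp add: conv_def scale_closed pullback_scale)
  qed
  moreover have "conv A (f * g) = f * conv A g + conv A f * g" if "f \<in> regular V" "g \<in> regular V" for f g
    using that vanish by (auto simp: conv_def mult_closed pullback_mult Amul rtranslate_closed fun_eq_iff pm points_eq)
  moreover have "conv A f = 0" if "f \<notin> regular V" for f using that by (auto simp: conv_def)
  ultimately show ?thesis using cl unfolding Vec_def by blast
qed

lemma conv_lin:
  assumes "F \<in> regular V" "g \<in> carrier M"
  shows "conv (\<Sum>i\<in>I. scale_fun (c i) (A i)) F g = (\<Sum>i\<in>I. c i * conv (A i) F g)"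
  using assms by (simp add: conv_apply sum_scale_apply)

text \<open>A polynomial one-parameter subgroup, that is, a homomorphism from the additive group.\<close>

definition one_param :: "('k \<Rightarrow> 'g) \<Rightarrow> bool"
  where "one_param \<gamma> \<longleftrightarrow> (\<forall>t. \<gamma> t \<in> carrier M) \<and> (\<forall>s t. \<gamma> (s + t) = \<gamma> s \<otimes> \<gamma> t) \<and>
    (\<forall>F\<in>regular V. \<exists>p. \<forall>t. F (\<gamma> t) = poly p t)"

lemma one_param_zero:
  assumes "one_param \<gamma>" shows "\<gamma> 0 = \<one>"
proof -
  have "\<gamma> 0 \<otimes> \<gamma> 0 = \<gamma> 0" "\<gamma> 0 \<in> carrier M" using assms unfolding one_param_def by (metis add.right_neutral)+
  then show ?thesis using r_cancel_one by blast
qed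

lemma one_param_inv:
  assumes "one_param \<gamma>" shows "inv (\<gamma> t) = \<gamma> (- t)"
proof -
  have "\<gamma> (- t) \<otimes> \<gamma> t = \<gamma> (- t + t)" using assms unfolding one_param_def by metis
  also have "\<dots> = \<one>" using one_param_zero[OF assms] by simp
  finally show ?thesis using assms by (intro inv_equality) (auto simp: one_param_def)
qed

lemma one_param_tangent: "one_param \<gamma> \<Longrightarrow> curve_deriv \<gamma> \<in> tangent_space V \<one>"
  using curve_deriv_tangent[of \<gamma>] by (simp add: one_param_zero points_eq one_param_def)

lemma one_param_conv:
  assumes \<gamma>: "one_param \<gamma>" and F: "F \<in> regular V" and g: "g \<in> carrier M"
    and p: "\<And>t. F (\<gamma> t \<otimes> g) = poly p t"
  shows "conv (curve_deriv \<gamma>) F g = coeff p 1"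
proof -
  have "pullback (carrier M) (\<lambda>h. h \<otimes> g) F (\<gamma> t) = poly p t" for t
    using p \<gamma> by (simp add: pullback_def one_param_def)
  then show ?thesis unfolding conv_apply[OF F g] using curve_deriv_eq[OF rtranslate_closed[OF F g]] by blast
qed

lemma one_param_translate_poly:
  assumes \<gamma>: "one_param \<gamma>" and F: "F \<in> regular V" and g: "g \<in> carrier M"
  shows "\<exists>p. \<forall>t. F (\<gamma> t \<otimes> g) = poly p t"
proof -
  obtain p where "\<forall>t. pullback (carrier M) (\<lambda>h. h \<otimes> g) F (\<gamma> t) = poly p t"
    using \<gamma> rtranslate_closed[OF F g] unfolding one_param_def by blast
  then show ?thesis using \<gamma> by (auto simp: pullback_def one_param_def)
qed

lemma one_param_conj:
  assumes \<gamma>: "one_param \<gamma>" and g: "g \<in> carrier M"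
  shows "one_param (\<lambda>t. g \<otimes> (\<gamma> t \<otimes> inv g))"
  unfolding one_param_def
proof (intro conjI allI ballI)
  have \<gamma>c: "\<gamma> t \<in> carrier M" for t using \<gamma> by (simp add: one_param_def)
  fix s t
  show "g \<otimes> (\<gamma> t \<otimes> inv g) \<in> carrier M" using g \<gamma>c by simp
  have "g \<otimes> (\<gamma> s \<otimes> inv g) \<otimes> (g \<otimes> (\<gamma> t \<otimes> inv g)) = g \<otimes> (\<gamma> s \<otimes> (\<gamma> t \<otimes> inv g))"
    using g \<gamma>c by (simp add: m_assoc inv_cancel)
  also have "\<dots> = g \<otimes> (\<gamma> (s + t) \<otimes> inv g)" using g \<gamma>c \<gamma> by (simp add: m_assoc one_param_def)
  finally show "g \<otimes> (\<gamma> (s + t) \<otimes> inv g) = g \<otimes> (\<gamma> s \<otimes> inv g) \<otimes> (g \<otimes> (\<gamma> t \<otimes> inv g))" by simp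
next
  fix F assume F: "F \<in> regular V"
  obtain p where "\<forall>t. pullback (carrier M) (\<lambda>y. g \<otimes> (y \<otimes> inv g)) F (\<gamma> t) = poly p t"
    using \<gamma> conj_translate_closed[OF F g inv_closed[OF g]] unfolding one_param_def by blast
  then show "\<exists>p. \<forall>t. F (g \<otimes> (\<gamma> t \<otimes> inv g)) = poly p t" using \<gamma> by (auto simp: pullback_def one_param_def)
qed

lemma curve_deriv_conj:
  assumes \<gamma>: "one_param \<gamma>" and g: "g \<in> carrier M" and F: "F \<in> regular V"
  shows "curve_deriv (\<lambda>t. g \<otimes> (\<gamma> t \<otimes> inv g)) F = curve_deriv \<gamma> (pullback (carrier M) (\<lambda>y. g \<otimes> (y \<otimes> inv g)) F)"
proof -
  obtain p where p: "\<And>t. F (g \<otimes> (\<gamma> t \<otimes> inv g)) = poly p t"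
    using one_param_conj[OF \<gamma> g] F unfolding one_param_def by blast
  have "pullback (carrier M) (\<lambda>y. g \<otimes> (y \<otimes> inv g)) F (\<gamma> t) = poly p t" for t
    using p \<gamma> by (simp add: pullback_def one_param_def)
  then show ?thesis
    using curve_deriv_eq[OF F p] curve_deriv_eq[OF conj_translate_closed[OF F g inv_closed[OF g]]] by metis
qed

end

lemma coeff_1_shift:
  fixes p :: "'k::field poly"
  shows "coeff (pcompose p [:u, 1:]) 0 = poly p u" "coeff (pcompose p [:u, 1:]) 1 = poly (pderiv p) u"
proof -
  have "coeff (pcompose p [:u, 1:]) 0 = poly p u \<and> coeff (pcompose p [:u, 1:]) 1 = poly (pderiv p) u"
    by (induction p) (auto simp: pcompose_pCons pderiv_pCons)
  then show "coeff (pcompose p [:u, 1:]) 0 = poly p u" "coeff (pcompose p [:u, 1:]) 1 = poly (pderiv p) u" by auto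
qed

lemma poly_eq_0_derivs:
  fixes p :: "'k::field_char_0 poly"
  assumes "\<And>n. poly ((pderiv ^^ n) p) 0 = 0"
  shows "p = 0"
proof (rule poly_eqI)
  fix n
  have "coeff ((pderiv ^^ n) p) 0 = fact n * coeff p n"
  proof (induction n arbitrary: p)
    case (Suc n)
    have "coeff ((pderiv ^^ Suc n) p) 0 = coeff ((pderiv ^^ n) (pderiv p)) 0" by (simp only: funpow_Suc_right comp_apply)
    also have "\<dots> = fact n * coeff (pderiv p) n" by (rule Suc)
    finally show ?case by (simp add: coeff_pderiv algebra_simps)
  qed simp
  then show "coeff p n = coeff 0 n" using assms[of n] by (simp add: poly_0_coeff_0)
qed

text \<open>Closure under conjugation lets every velocity of a product of members be moved to the identity
  without leaving the family.\<close>

locale one_param_family = lin_group M V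
  for M :: "'g monoid" (structure) and V :: "('g, 'k::field_char_0) variety" +
  fixes \<Gamma> :: "('k \<Rightarrow> 'g) set"
  assumes \<Gamma>: "\<And>\<gamma>. \<gamma> \<in> \<Gamma> \<Longrightarrow> one_param \<gamma>"
    and \<Gamma>_conj: "\<And>\<gamma> \<gamma>' u. \<gamma> \<in> \<Gamma> \<Longrightarrow> \<gamma>' \<in> \<Gamma> \<Longrightarrow> (\<lambda>t. \<gamma>' u \<otimes> (\<gamma> t \<otimes> inv (\<gamma>' u))) \<in> \<Gamma>"
begin

inductive_set H where
  H_one: "\<one> \<in> H"
| H_step: "h \<in> H \<Longrightarrow> \<gamma> \<in> \<Gamma> \<Longrightarrow> \<gamma> t \<otimes> h \<in> H"

lemma \<Gamma>_carrier: "\<gamma> \<in> \<Gamma> \<Longrightarrow> \<gamma> t \<in> carrier M"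
  using \<Gamma> by (simp add: one_param_def)

lemma H_carrier: "h \<in> H \<Longrightarrow> h \<in> carrier M"
  by (induction rule: H.induct) (auto simp: \<Gamma>_carrier)

lemma H_mult: "g \<in> H \<Longrightarrow> h \<in> H \<Longrightarrow> g \<otimes> h \<in> H"
proof (induction g rule: H.induct)
  case H_one then show ?case using H_carrier by simp
next
  case (H_step g \<gamma> t)
  have "\<gamma> t \<otimes> g \<otimes> h = \<gamma> t \<otimes> (g \<otimes> h)"
    using H_step H_carrier \<Gamma>_carrier by (simp add: m_assoc)
  then show ?case using H.H_step[of "g \<otimes> h" \<gamma> t] H_step by simp
qed

lemma \<Gamma>_H: "\<gamma> \<in> \<Gamma> \<Longrightarrow> \<gamma> t \<in> H"
  using H_step[OF H_one, of \<gamma> t] \<Gamma>_carrier by simp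

lemma H_inv: "h \<in> H \<Longrightarrow> inv h \<in> H"
proof (induction rule: H.induct)
  case H_one then show ?case using H.H_one by simp
next
  case (H_step h \<gamma> t)
  have "inv (\<gamma> t \<otimes> h) = inv h \<otimes> \<gamma> (- t)"
    using H_step H_carrier \<Gamma>_carrier \<Gamma> by (simp add: inv_mult_group one_param_inv)
  then show ?case using H_step H_mult \<Gamma>_H by simp
qed

lemma \<Gamma>_conj_H: "h \<in> H \<Longrightarrow> \<gamma> \<in> \<Gamma> \<Longrightarrow> (\<lambda>t. h \<otimes> (\<gamma> t \<otimes> inv h)) \<in> \<Gamma>"
proof (induction rule: H.induct)
  case H_one then show ?case using \<Gamma>_carrier by simp
next
  case (H_step h \<gamma>' u)
  have "(\<lambda>t. \<gamma>' u \<otimes> ((h \<otimes> (\<gamma> t \<otimes> inv h)) \<otimes> inv (\<gamma>' u))) \<in> \<Gamma>"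
    using \<Gamma>_conj[OF H_step.IH[OF H_step.prems] H_step.hyps(2)] .
  moreover have "\<gamma>' u \<otimes> ((h \<otimes> (\<gamma> t \<otimes> inv h)) \<otimes> inv (\<gamma>' u)) = \<gamma>' u \<otimes> h \<otimes> (\<gamma> t \<otimes> inv (\<gamma>' u \<otimes> h))" for t
    using H_step H_carrier \<Gamma>_carrier by (simp add: inv_mult_group m_assoc)
  ultimately show ?case by simp
qed

lemma H_subgroup: "subgroup H M"
  by (rule subgroupI) (use H_carrier H_one H_inv H_mult in auto)

abbreviation "\<tau> \<equiv> curve_deriv"

definition I where "I = {F \<in> regular V. \<forall>h\<in>H. F h = 0}"

text \<open>\<open>I\<close> is the ideal of the Zariski closure \<open>K\<close> of \<open>H\<close>; the tangent vectors of the ambient group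
  that kill it are those of \<open>K\<close>.\<close>

definition closure_tangent where "closure_tangent = {A \<in> tangent_space V \<one>. \<forall>F\<in>I. A F = 0}"

fun partial_prod :: "(nat \<Rightarrow> 'k \<Rightarrow> 'g) \<Rightarrow> (nat \<Rightarrow> 'k) \<Rightarrow> nat \<Rightarrow> 'g" where
  "partial_prod w t 0 = \<one>"
| "partial_prod w t (Suc i) = partial_prod w t i \<otimes> w i (t i)"

text \<open>Conjugating the factor \<open>i\<close> by the factors in front of it turns a change of the parameter \<open>i\<close>
  into a left translation of the whole product (\<open>conj_curve_partial_prod\<close>). The velocities of
  these curves are therefore the partial derivatives of the product map, translated to the
  identity.\<close>

definition conj_curve :: "(nat \<Rightarrow> 'k \<Rightarrow> 'g) \<Rightarrow> (nat \<Rightarrow> 'k) \<Rightarrow> nat \<Rightarrow> 'k \<Rightarrow> 'g"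
  where "conj_curve w t i = (\<lambda>u. partial_prod w t i \<otimes> (w i u \<otimes> inv (partial_prod w t i)))"

lemma partial_prod_H: "(\<And>i. i < n \<Longrightarrow> w i \<in> \<Gamma>) \<Longrightarrow> partial_prod w t n \<in> H"
  by (induction n) (auto intro: H_one H_mult \<Gamma>_H)

lemma conj_curve_\<Gamma>: "(\<And>j. j \<le> i \<Longrightarrow> w j \<in> \<Gamma>) \<Longrightarrow> conj_curve w t i \<in> \<Gamma>"
  unfolding conj_curve_def by (rule \<Gamma>_conj_H[OF partial_prod_H]) auto

lemma partial_prod_cong: "(\<And>j. j < n \<Longrightarrow> w j (t j) = w' j (t' j)) \<Longrightarrow> partial_prod w t n = partial_prod w' t' n"
  by (induction n) auto

lemma conj_curve_partial_prod:
  assumes "\<And>j. j < n \<Longrightarrow> w j \<in> \<Gamma>" "i < n"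
  shows "conj_curve w t i u \<otimes> partial_prod w t n = partial_prod w (t(i := u + t i)) n"
  using assms
proof (induction n)
  case 0 then show ?case by simp
next
  case (Suc n)
  have c: "partial_prod w t m \<in> carrier M" if "m \<le> n" for m using partial_prod_H[of m w t] Suc.prems(1) H_carrier that by simp
  have wc: "w j s \<in> carrier M" if "j \<le> n" for j s using Suc.prems(1)[of j] \<Gamma>_carrier that by simp
  show ?case
  proof (cases "i = n")
    case True
    have "conj_curve w t n u \<otimes> (partial_prod w t n \<otimes> w n (t n)) = partial_prod w t n \<otimes> (w n u \<otimes> w n (t n))"
      unfolding conj_curve_def using c wc by (simp add: m_assoc inv_cancel)
    also have "w n u \<otimes> w n (t n) = w n (u + t n)" using \<Gamma>[OF Suc.prems(1)[of n]] by (simp add: one_param_def)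
    finally have "conj_curve w t n u \<otimes> (partial_prod w t n \<otimes> w n (t n)) = partial_prod w t n \<otimes> w n (u + t n)" .
    moreover have "partial_prod w (t(n := u + t n)) n = partial_prod w t n" by (rule partial_prod_cong) simp
    ultimately show ?thesis using True by (simp del: fun_upd_apply add: fun_upd_same)
  next
    case False
    then have i: "i < n" using Suc.prems by simp
    have "conj_curve w t i u \<in> carrier M" unfolding conj_curve_def using c[of i] wc[of i u] i by simp
    then have "conj_curve w t i u \<otimes> (partial_prod w t n \<otimes> w n (t n)) = (conj_curve w t i u \<otimes> partial_prod w t n) \<otimes> w n (t n)"
      using c[of n] wc[of n "t n"] by (simp add: m_assoc)
    then show ?thesis using Suc.IH Suc.prems i False by simp
  qed
qed

lemma partial_prod_polynomial:
  assumes "\<And>j. j < n \<Longrightarrow> w j \<in> \<Gamma>" "F \<in> regular V"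
  shows "(\<lambda>t. F (partial_prod w t n)) \<in> polynomial_functions n"
  using assms
proof (induction n arbitrary: F)
  case 0 then show ?case by (simp add: polynomial_functions.const)
next
  case (Suc n F)
  obtain m :: nat and a b where ab: "\<And>i. i < m \<Longrightarrow> a i \<in> regular V" "\<And>i. i < m \<Longrightarrow> b i \<in> regular V"
    "\<And>g h. g \<in> carrier M \<Longrightarrow> h \<in> carrier M \<Longrightarrow> F (g \<otimes> h) = (\<Sum>i<m. a i g * b i h)"
    using comultE[OF Suc.prems(2)] by blast
  have "partial_prod w t n \<in> carrier M" for t using partial_prod_H[of n w t] Suc.prems(1) H_carrier by simp
  moreover have "w n s \<in> carrier M" for s using Suc.prems(1)[of n] \<Gamma>_carrier by simp
  ultimately have e: "F (partial_prod w t (Suc n)) = (\<Sum>i<m. a i (partial_prod w t n) * b i (w n (t n)))" for t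
    by (simp add: ab(3))
  have "(\<lambda>t. a i (partial_prod w t n) * b i (w n (t n))) \<in> polynomial_functions (Suc n)" if i: "i < m" for i
  proof (rule polynomial_functions.mult)
    show "(\<lambda>t. a i (partial_prod w t n)) \<in> polynomial_functions (Suc n)"
      using polynomial_functions_mono[OF Suc.IH[OF Suc.prems(1) ab(1)[OF i]]] by simp
    obtain q where "\<forall>s. b i (w n s) = poly q s"
      using \<Gamma>[OF Suc.prems(1)[of n]] ab(2)[OF i] unfolding one_param_def by blast
    then show "(\<lambda>t. b i (w n (t n))) \<in> polynomial_functions (Suc n)"
      using polynomial_functions_poly[OF polynomial_functions.coord[of n "Suc n"], of q] by simp
  qed
  then show ?case unfolding e by (intro polynomial_functions_sum) auto
qed

text \<open>The adjoint action is polynomial, so the translated partial derivatives depend polynomially on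
  the parameters, and their independence is a generic property.\<close>

lemma \<tau>_conj_curve_polynomial:
  assumes w: "\<And>j. j \<le> i \<Longrightarrow> w j \<in> \<Gamma>" and F: "F \<in> regular V"
  shows "(\<lambda>t. \<tau> (conj_curve w t i) F) \<in> polynomial_functions i"
proof -
  obtain J :: "(nat \<times> nat) set" and a b c where J: "finite J"
    "\<And>i. i \<in> J \<Longrightarrow> a i \<in> regular V" "\<And>i. i \<in> J \<Longrightarrow> b i \<in> regular V" "\<And>i. i \<in> J \<Longrightarrow> c i \<in> regular V"
    "\<And>x y z. x \<in> carrier M \<Longrightarrow> y \<in> carrier M \<Longrightarrow> z \<in> carrier M \<Longrightarrow>
      F (x \<otimes> (y \<otimes> z)) = (\<Sum>i\<in>J. a i x * b i y * c i z)"
    using comult3E[OF F] by blast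
  let ?c' = "\<lambda>j. pullback (carrier M) (\<lambda>g. inv g) (c j)"
  have pc: "partial_prod w t i \<in> carrier M" for t using partial_prod_H[of i w t] w H_carrier by simp
  have "\<tau> (conj_curve w t i) F = (\<Sum>j\<in>J. a j (partial_prod w t i) * ?c' j (partial_prod w t i) * \<tau> (w i) (b j))" for t
  proof -
    have "\<tau> (conj_curve w t i) F = \<tau> (w i) (pullback (carrier M) (\<lambda>y. partial_prod w t i \<otimes> (y \<otimes> inv (partial_prod w t i))) F)"
      unfolding conj_curve_def by (rule curve_deriv_conj[OF \<Gamma>[OF w] pc F]) simp
    also have "pullback (carrier M) (\<lambda>y. partial_prod w t i \<otimes> (y \<otimes> inv (partial_prod w t i))) F
      = (\<Sum>j\<in>J. scale_fun (a j (partial_prod w t i) * ?c' j (partial_prod w t i)) (b j))"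
    proof
      fix y
      show "pullback (carrier M) (\<lambda>y. partial_prod w t i \<otimes> (y \<otimes> inv (partial_prod w t i))) F y
        = (\<Sum>j\<in>J. scale_fun (a j (partial_prod w t i) * ?c' j (partial_prod w t i)) (b j)) y"
      proof (cases "y \<in> carrier M")
        case True
        then show ?thesis using J(5) pc[of t] by (auto simp: pullback_def sum_scale_apply mult_ac intro!: sum.cong)
      next
        case False
        then have "b j y = 0" if "j \<in> J" for j using vanish[OF J(3)[OF that]] by (simp add: points_eq)
        then show ?thesis using False by (simp add: pullback_def sum_scale_apply)
      qed
    qed
    also have "\<tau> (w i) \<dots> = (\<Sum>j\<in>J. a j (partial_prod w t i) * ?c' j (partial_prod w t i) * \<tau> (w i) (b j))"
      by (rule tangent_sum[OF one_param_tangent[OF \<Gamma>[OF w]]]) (use J in auto)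
    finally show ?thesis .
  qed
  moreover have "(\<lambda>t. \<Sum>j\<in>J. a j (partial_prod w t i) * ?c' j (partial_prod w t i) * \<tau> (w i) (b j)) \<in> polynomial_functions i"
    by (intro polynomial_functions_sum polynomial_functions.mult polynomial_functions.const partial_prod_polynomial)
      (use w J antipode_closed in auto)
  ultimately show ?thesis by simp
qed

text \<open>The velocities are the partial derivatives of a product of \<open>n\<close> members, so \<open>n\<close> is the rank of
  that product map at \<open>t\<close>.\<close>

definition attained :: "nat \<Rightarrow> bool"
  where "attained n \<longleftrightarrow> (\<exists>w t. (\<forall>i<n. w i \<in> \<Gamma>) \<and> lin_indep n (\<lambda>i. \<tau> (conj_curve w t i)))"

lemma max_attained: "\<exists>e. attained e \<and> (\<forall>n. attained n \<longrightarrow> n \<le> e)"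
proof -
  obtain d A F where d: "dual_basis (tangent_space V \<one>) d A F"
    using tangent_dual_basis[OF _ tangent_subspace order_refl, of \<one>] points_eq by auto
  have "n \<le> d" if att: "attained n" for n
  proof -
    obtain w t where w: "\<forall>i<n. w i \<in> \<Gamma>" "lin_indep n (\<lambda>i. \<tau> (conj_curve w t i))" using att unfolding attained_def by blast
    show "n \<le> d"
      by (rule dual_basis_bound[OF d w(2)]) (use w(1) one_param_tangent \<Gamma> conj_curve_\<Gamma> in auto)
  qed
  moreover have "attained 0" by (simp add: attained_def lin_indep_def)
  ultimately show ?thesis using GreatestI_nat[of attained 0 d] Greatest_le_nat[of attained _ d] by blast
qed

end

section \<open>The Lie algebra of a group generated by one-parameter subgroups\<close>

lemma lin_indep_cong: "(\<And>i. i < n \<Longrightarrow> a i = b i) \<Longrightarrow> lin_indep n a = lin_indep n b"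
proof -
  assume e: "\<And>i. i < n \<Longrightarrow> a i = b i"
  have "(\<Sum>i<n. scale_fun (c i) (a i)) = (\<Sum>i<n. scale_fun (c i) (b i))" for c
    by (rule sum.cong) (auto simp: e)
  then show ?thesis by (simp only: lin_indep_def)
qed

context one_param_family
begin

text \<open>\<open>I\<close> is invariant under right translation by \<open>H\<close>, and \<open>conv A F\<close> at \<open>g\<close> applies \<open>A\<close> to the
  translate of \<open>F\<close> by \<open>g\<close>.\<close>

lemma I_conv_stable:
  assumes A: "A \<in> closure_tangent" and F: "F \<in> I"
  shows "conv A F \<in> I"
proof -
  have FR: "F \<in> regular V" using F by (simp add: I_def)
  have "conv A F g = 0" if g: "g \<in> H" for g
  proof -
    have gc: "g \<in> carrier M" using g by (rule H_carrier)
    have "pullback (carrier M) (\<lambda>h. h \<otimes> g) F \<in> I"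
      using rtranslate_closed[OF FR gc] F H_mult[OF _ g] H_carrier by (auto simp: I_def pullback_def)
    then show ?thesis using A unfolding conv_apply[OF FR gc] closure_tangent_def by blast
  qed
  moreover have "conv A F \<in> regular V" using A Vec_closed[OF conv_Vec] by (simp add: closure_tangent_def)
  ultimately show ?thesis by (simp add: I_def)
qed

lemma closure_tangent_subspace: "fun_vs.subspace closure_tangent"
proof -
  have "fun_vs.subspace {A. \<forall>F\<in>I. A F = 0}" by (auto simp: fun_vs.subspace_def)
  then have "fun_vs.subspace (tangent_space V \<one> \<inter> {A. \<forall>F\<in>I. A F = 0})"
    by (rule fun_vs.subspace_inter[OF tangent_subspace])
  moreover have "closure_tangent = tangent_space V \<one> \<inter> {A. \<forall>F\<in>I. A F = 0}" by (auto simp: closure_tangent_def)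
  ultimately show ?thesis by simp
qed

text \<open>The restriction of \<open>F\<close> to the formal integral curve of \<open>D\<close> through the identity. By the Leibniz
  rule it is a ring homomorphism into the power series.\<close>

definition taylor_fps :: "(('g \<Rightarrow> 'k) \<Rightarrow> 'g \<Rightarrow> 'k) \<Rightarrow> ('g \<Rightarrow> 'k) \<Rightarrow> 'k fps"
  where "taylor_fps D F = Abs_fps (taylor D F \<one>)"

lemma taylor_fps_mult:
  assumes "D \<in> Vec V" "f \<in> regular V" "g \<in> regular V"
  shows "taylor_fps D (f * g) = taylor_fps D f * taylor_fps D g"
  by (rule fps_ext) (simp add: taylor_fps_def taylor_mult[OF assms] fps_mult_nth atLeast0AtMost)

lemma taylor_fps_const_one:
  assumes "D \<in> Vec V"
  shows "taylor_fps D (const_on (carrier M) 1) = 1"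
proof (rule fps_ext)
  fix n
  have S: "(D ^^ Suc n) (const_on (carrier M) 1) = 0" for n
    using Vec_const[OF assms, of 1] Vec_pow_0[OF assms, of n] by (simp add: funpow_Suc_right points_eq del: funpow.simps)
  show "fps_nth (taylor_fps D (const_on (carrier M) 1)) n = fps_nth 1 n"
  proof (cases n)
    case 0 then show ?thesis by (simp add: taylor_fps_def taylor_def) (simp add: const_on_def)
  next
    case (Suc k) then show ?thesis using S[of k] by (simp add: taylor_fps_def taylor_def del: funpow.simps)
  qed
qed

definition monom_fun :: "(nat \<Rightarrow> 'g \<Rightarrow> 'k) \<Rightarrow> nat \<Rightarrow> (nat \<Rightarrow> nat) \<Rightarrow> 'g \<Rightarrow> 'k"
  where "monom_fun f k \<alpha> = (\<lambda>g. if g \<in> carrier M then \<Prod>j<k. f j g ^ \<alpha> j else 0)"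

lemma monom_fun_regular_taylor_fps:
  assumes f: "\<And>j. j < k \<Longrightarrow> f j \<in> regular V"
  shows "monom_fun f k \<alpha> \<in> regular V" and "D \<in> Vec V \<Longrightarrow> taylor_fps D (monom_fun f k \<alpha>) = (\<Prod>j<k. taylor_fps D (f j) ^ \<alpha> j)"
proof -
  define pw where "pw = (\<lambda>(h :: 'g \<Rightarrow> 'k) n. (\<lambda>g. if g \<in> carrier M then h g ^ n else 0))"
  have pw0: "pw h 0 = const_on (carrier M) 1" for h by (simp add: pw_def const_on_def fun_eq_iff)
  have pwS: "pw h (Suc n) = h * pw h n" for h n by (simp add: pw_def fun_eq_iff)
  have pw: "pw h n \<in> regular V \<and> (D \<in> Vec V \<longrightarrow> taylor_fps D (pw h n) = taylor_fps D h ^ n)" if h: "h \<in> regular V" for h n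
  proof (induction n)
    case 0 show ?case using const_closed[of 1] by (simp add: pw0 taylor_fps_const_one points_eq)
  next
    case (Suc n)
    then have "h * pw h n \<in> regular V \<and> (D \<in> Vec V \<longrightarrow> taylor_fps D (h * pw h n) = taylor_fps D h ^ Suc n)"
      using mult_closed[OF h] taylor_fps_mult[OF _ h] by (metis power_Suc)
    then show ?case unfolding pwS .
  qed
  have "monom_fun f k \<alpha> \<in> regular V \<and> (D \<in> Vec V \<longrightarrow> taylor_fps D (monom_fun f k \<alpha>) = (\<Prod>j<k. taylor_fps D (f j) ^ \<alpha> j))"
    using f
  proof (induction k)
    case 0
    have "monom_fun f 0 \<alpha> = const_on (carrier M) 1" by (simp add: monom_fun_def const_on_def fun_eq_iff)
    then show ?case using const_closed[of 1] by (simp add: taylor_fps_const_one points_eq)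
  next
    case (Suc k)
    have e: "monom_fun f (Suc k) \<alpha> = monom_fun f k \<alpha> * pw (f k) (\<alpha> k)" by (simp add: monom_fun_def pw_def fun_eq_iff)
    have IH: "monom_fun f k \<alpha> \<in> regular V" "D \<in> Vec V \<Longrightarrow> taylor_fps D (monom_fun f k \<alpha>) = (\<Prod>j<k. taylor_fps D (f j) ^ \<alpha> j)"
      using Suc by auto
    have p: "pw (f k) (\<alpha> k) \<in> regular V" "D \<in> Vec V \<Longrightarrow> taylor_fps D (pw (f k) (\<alpha> k)) = taylor_fps D (f k) ^ \<alpha> k"
      using pw[of "f k" "\<alpha> k"] Suc.prems by auto
    have "monom_fun f k \<alpha> * pw (f k) (\<alpha> k) \<in> regular V \<and> (D \<in> Vec V \<longrightarrow>
        taylor_fps D (monom_fun f k \<alpha> * pw (f k) (\<alpha> k)) = (\<Prod>j<Suc k. taylor_fps D (f j) ^ \<alpha> j))"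
      using mult_closed[OF IH(1) p(1)] taylor_fps_mult[OF _ IH(1) p(1)] IH(2) p(2) by simp
    then show ?case unfolding e .
  qed
  then show "monom_fun f k \<alpha> \<in> regular V" and "D \<in> Vec V \<Longrightarrow> taylor_fps D (monom_fun f k \<alpha>) = (\<Prod>j<k. taylor_fps D (f j) ^ \<alpha> j)"
    by auto
qed

lemma taylor_fps_sum:
  assumes D: "D \<in> Vec V" and f: "\<And>i. i \<in> J \<Longrightarrow> f i \<in> regular V"
  shows "taylor_fps D (\<Sum>i\<in>J. scale_fun (c i) (f i)) = (\<Sum>i\<in>J. fps_const (c i) * taylor_fps D (f i))"
proof (rule fps_ext)
  fix n
  have "(D ^^ n) (\<Sum>i\<in>J. scale_fun (c i) (f i)) = (\<Sum>i\<in>J. scale_fun (c i) ((D ^^ n) (f i)))"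
    using Vec_pow_sum[OF D, of J "\<lambda>i. scale_fun (c i) (f i)" n] f by (simp add: scale_closed Vec_pow_scale[OF D])
  then show "fps_nth (taylor_fps D (\<Sum>i\<in>J. scale_fun (c i) (f i))) n = fps_nth (\<Sum>i\<in>J. fps_const (c i) * taylor_fps D (f i)) n"
    by (simp add: taylor_fps_def taylor_def sum_scale_apply fps_sum_nth sum_divide_distrib)
qed

text \<open>Along the formal integral curve of \<open>\<Sum> y\<^sub>j A\<^sub>j\<close> the function \<open>f\<^sub>j\<close> is \<open>y\<^sub>j X\<close> plus terms of
  higher order. Hence in a relation on the closure of \<open>H\<close> the terms of lowest total degree give a
  polynomial in \<open>y\<close> that vanishes identically. The Kronecker substitution
  \<open>y\<^sub>j = z ^ ((n + 1) ^ j)\<close> makes it a polynomial in one variable with the same coefficients,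
  since the exponents in the box are digits in base \<open>n + 1\<close>.\<close>

lemma monomials_independent:
  assumes A: "\<And>i. i < m \<Longrightarrow> A i \<in> closure_tangent" and f: "\<And>j. j < m \<Longrightarrow> f j \<in> regular V"
    and f1: "\<And>j. j < m \<Longrightarrow> f j \<one> = 0" and Af: "\<And>i j. i < m \<Longrightarrow> j < m \<Longrightarrow> A i (f j) = (if i = j then 1 else 0)"
    and box: "box = PiE {..<m} (\<lambda>_. {..n})"
    and rel: "(\<Sum>\<alpha>\<in>box. scale_fun (c \<alpha>) (monom_fun f m \<alpha>)) \<in> I"
  shows "\<forall>\<alpha>\<in>box. c \<alpha> = 0"
proof (rule ccontr)
  assume "\<not> (\<forall>\<alpha>\<in>box. c \<alpha> = 0)"
  then obtain \<beta> where \<beta>: "\<beta> \<in> box \<and> c \<beta> \<noteq> 0" by blast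
  define sz where "sz = (\<lambda>\<alpha>::nat \<Rightarrow> nat. \<Sum>j<m. \<alpha> j)"
  obtain \<alpha>0 where \<alpha>0: "\<alpha>0 \<in> box" "c \<alpha>0 \<noteq> 0" and least: "\<And>\<alpha>. \<alpha> \<in> box \<Longrightarrow> c \<alpha> \<noteq> 0 \<Longrightarrow> sz \<alpha>0 \<le> sz \<alpha>"
    using ex_has_least_nat[of "\<lambda>\<alpha>. \<alpha> \<in> box \<and> c \<alpha> \<noteq> 0" \<beta> sz] \<beta> by blast
  \<comment> \<open>the exponent of z that the Kronecker substitution gives to a monomial\<close>
  define \<kappa> where "\<kappa> = (\<lambda>\<alpha>::nat \<Rightarrow> nat. \<Sum>j<m. \<alpha> j * (n + 1) ^ j)"
  have finb: "finite box" unfolding box by (rule finite_PiE) auto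
  define Q where "Q = (\<Sum>\<alpha>\<in>box. monom (if sz \<alpha> = sz \<alpha>0 then c \<alpha> else 0) (\<kappa> \<alpha>))"
  have "poly Q z = 0" for z
  proof -
    define y where "y = (\<lambda>j::nat. z ^ ((n + 1) ^ j))"
    define Az where "Az = (\<Sum>j<m. scale_fun (y j) (A j))"
    have Az: "Az \<in> closure_tangent" unfolding Az_def
      by (intro fun_vs.subspace_sum[OF closure_tangent_subspace] fun_vs.subspace_scale[OF closure_tangent_subspace] A) auto
    define D where "D = conv Az"
    have D: "D \<in> Vec V" unfolding D_def by (rule conv_Vec) (use Az in \<open>simp add: closure_tangent_def\<close>)
    define g where "g = (\<lambda>j. fps_shift 1 (taylor_fps D (f j)))"
    have g0: "fps_nth (g j) 0 = y j" and gX: "taylor_fps D (f j) = fps_X * g j" if j: "j < m" for j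
    proof -
      have "D (f j) \<one> = Az (f j)" unfolding D_def by (rule conv_one[OF f[OF j]])
      also have "\<dots> = (\<Sum>i<m. if i = j then y j else 0)"
        unfolding Az_def sum_scale_apply by (rule sum.cong) (use Af j in auto)
      finally show "fps_nth (g j) 0 = y j" using j by (simp add: g_def taylor_fps_def taylor_def)
      show "taylor_fps D (f j) = fps_X * g j"
        by (rule fps_ext) (use f1[OF j] in \<open>auto simp: g_def taylor_fps_def taylor_def\<close>)
    qed
    define G where "G = (\<Sum>\<alpha>\<in>box. scale_fun (c \<alpha>) (monom_fun f m \<alpha>))"
    have "(D ^^ r) G \<in> I" for r
      by (induction r) (use rel in \<open>auto simp: G_def D_def intro: I_conv_stable[OF Az]\<close>)
    then have "taylor_fps D G = 0" using H_one by (intro fps_ext) (auto simp: taylor_fps_def taylor_def I_def)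
    then have "0 = (\<Sum>\<alpha>\<in>box. fps_const (c \<alpha>) * taylor_fps D (monom_fun f m \<alpha>))"
      unfolding G_def by (subst (asm) taylor_fps_sum[OF D]) (auto intro: monom_fun_regular_taylor_fps f)
    also have "\<dots> = (\<Sum>\<alpha>\<in>box. fps_const (c \<alpha>) * (fps_X ^ sz \<alpha> * (\<Prod>j<m. g j ^ \<alpha> j)))"
    proof (rule sum.cong[OF refl])
      fix \<alpha>
      have "taylor_fps D (monom_fun f m \<alpha>) = (\<Prod>j<m. taylor_fps D (f j) ^ \<alpha> j)" by (rule monom_fun_regular_taylor_fps(2)[OF f D])
      also have "\<dots> = (\<Prod>j<m. (fps_X * g j) ^ \<alpha> j)" by (rule prod.cong) (auto simp: gX)
      also have "\<dots> = fps_X ^ sz \<alpha> * (\<Prod>j<m. g j ^ \<alpha> j)"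
        by (simp add: power_mult_distrib prod.distrib sz_def power_sum)
      finally show "fps_const (c \<alpha>) * taylor_fps D (monom_fun f m \<alpha>) = fps_const (c \<alpha>) * (fps_X ^ sz \<alpha> * (\<Prod>j<m. g j ^ \<alpha> j))"
        by simp
    qed
    finally have eq: "(\<Sum>\<alpha>\<in>box. fps_const (c \<alpha>) * (fps_X ^ sz \<alpha> * (\<Prod>j<m. g j ^ \<alpha> j))) = 0" by simp
    have prod0: "fps_nth (\<Prod>j<m'. g j ^ \<alpha> j) 0 = (\<Prod>j<m'. y j ^ \<alpha> j)" if "m' \<le> m" for \<alpha> m'
      using that by (induction m') (auto simp: g0 fps_power_zeroth)
    have "0 = fps_nth (\<Sum>\<alpha>\<in>box. fps_const (c \<alpha>) * (fps_X ^ sz \<alpha> * (\<Prod>j<m. g j ^ \<alpha> j))) (sz \<alpha>0)"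
      unfolding eq by simp
    also have "\<dots> = (\<Sum>\<alpha>\<in>box. c \<alpha> * (if sz \<alpha>0 < sz \<alpha> then 0 else fps_nth (\<Prod>j<m. g j ^ \<alpha> j) (sz \<alpha>0 - sz \<alpha>)))"
      by (simp add: fps_sum_nth fps_X_power_mult_nth)
    also have "\<dots> = (\<Sum>\<alpha>\<in>box. (if sz \<alpha> = sz \<alpha>0 then c \<alpha> else 0) * z ^ \<kappa> \<alpha>)"
    proof (rule sum.cong[OF refl])
      fix \<alpha> assume \<alpha>: "\<alpha> \<in> box"
      have "(\<Prod>j<m. y j ^ \<alpha> j) = z ^ \<kappa> \<alpha>"
        unfolding y_def \<kappa>_def power_sum by (rule prod.cong) (auto simp: power_mult[symmetric] mult.commute)
      then show "c \<alpha> * (if sz \<alpha>0 < sz \<alpha> then 0 else fps_nth (\<Prod>j<m. g j ^ \<alpha> j) (sz \<alpha>0 - sz \<alpha>)) =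
        (if sz \<alpha> = sz \<alpha>0 then c \<alpha> else 0) * z ^ \<kappa> \<alpha>"
        using least[OF \<alpha>] prod0[OF order_refl, of \<alpha>] by (cases "c \<alpha> = 0") auto
    qed
    finally show ?thesis by (simp add: Q_def poly_sum poly_monom)
  qed
  then have "Q = 0" by (intro poly_eqI_all) simp
  have inj: "\<alpha> = \<alpha>0" if "\<alpha> \<in> box" "\<kappa> \<alpha> = \<kappa> \<alpha>0" for \<alpha>
  proof (rule PiE_ext)
    show "\<alpha> \<in> PiE {..<m} (\<lambda>_. {..n})" "\<alpha>0 \<in> PiE {..<m} (\<lambda>_. {..n})" using that \<alpha>0 box by auto
    then have "\<alpha> j < n + 1" "\<alpha>0 j < n + 1" if "j < m" for j using that by (auto simp: PiE_iff less_Suc_eq_le)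
    then show "\<alpha> j = \<alpha>0 j" if "j \<in> {..<m}" for j
      using digits_inj[of m \<alpha> "n + 1" \<alpha>0 j] \<open>\<kappa> \<alpha> = \<kappa> \<alpha>0\<close> that unfolding \<kappa>_def by simp
  qed
  have "coeff Q (\<kappa> \<alpha>0) = (\<Sum>\<alpha>\<in>box. if \<alpha> = \<alpha>0 then c \<alpha>0 else 0)"
    unfolding Q_def coeff_sum by (rule sum.cong) (use inj in auto)
  then have "coeff Q (\<kappa> \<alpha>0) = c \<alpha>0" using \<alpha>0 finb by simp
  then show False using \<alpha>0 \<open>Q = 0\<close> by simp
qed

context
  fixes w :: "nat \<Rightarrow> 'k \<Rightarrow> 'g" and t0 :: "nat \<Rightarrow> 'k" and e :: nat
  assumes w: "\<And>i. i < e \<Longrightarrow> w i \<in> \<Gamma>"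
    and ind: "lin_indep e (\<lambda>i. \<tau> (conj_curve w t0 i))"
    and maximal: "\<And>n. attained n \<Longrightarrow> n \<le> e"
begin

text \<open>A velocity outside the span would extend the product to one of larger rank: append the conjugate
  of \<open>\<gamma>\<close> whose translated partial derivative is the velocity of \<open>\<gamma>\<close>.\<close>

lemma maximal_span:
  assumes ind: "lin_indep e (\<lambda>i. \<tau> (conj_curve w t i))" and \<gamma>: "\<gamma> \<in> \<Gamma>"
  shows "\<exists>c. \<tau> \<gamma> = (\<Sum>i<e. scale_fun (c i) (\<tau> (conj_curve w t i)))"
proof -
  define p where "p = partial_prod w t e"
  have p: "p \<in> H" "p \<in> carrier M" using partial_prod_H[OF w] H_carrier by (auto simp: p_def)
  \<comment> \<open>the new last factor is \<gamma> conjugated so that moving it to the front of the product p gives back \<gamma>\<close>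
  define w' where "w' = w(e := (\<lambda>u. inv p \<otimes> (\<gamma> u \<otimes> inv (inv p))))"
  have w'e: "w' e \<in> \<Gamma>" using \<Gamma>_conj_H[OF H_inv[OF p(1)] \<gamma>] by (simp add: w'_def)
  have prew': "partial_prod w' t i = partial_prod w t i" if "i \<le> e" for i
    by (rule partial_prod_cong) (use that in \<open>simp add: w'_def\<close>)
  have cj': "conj_curve w' t i = conj_curve w t i" if "i < e" for i
    using prew'[of i] that by (simp add: conj_curve_def w'_def)
  have cje: "conj_curve w' t e = \<gamma>"
  proof
    fix u
    have "p \<otimes> ((inv p \<otimes> (\<gamma> u \<otimes> p)) \<otimes> inv p) = (p \<otimes> inv p) \<otimes> (\<gamma> u \<otimes> (p \<otimes> inv p))"
      using p \<Gamma>_carrier[OF \<gamma>] by (simp only: m_assoc inv_closed m_closed)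
    also have "\<dots> = \<gamma> u" using p \<Gamma>_carrier[OF \<gamma>] by simp
    finally show "conj_curve w' t e u = \<gamma> u"
      unfolding conj_curve_def prew'[OF order_refl] p_def[symmetric] using p by (simp add: w'_def)
  qed
  define a where "a = (\<lambda>i. \<tau> (conj_curve w' t i))"
  have "lin_indep e a" using ind lin_indep_cong[of e a "\<lambda>i. \<tau> (conj_curve w t i)"] cj' by (simp add: a_def)
  moreover have "\<not> lin_indep (Suc e) a"
  proof
    assume "lin_indep (Suc e) a"
    moreover have "\<forall>i<Suc e. w' i \<in> \<Gamma>" using w w'e by (auto simp: less_Suc_eq w'_def)
    ultimately have "attained (Suc e)" unfolding attained_def a_def by blast
    then show False using maximal by fastforce
  qed
  ultimately obtain c where "a e = (\<Sum>i<e. scale_fun (c i) (a i))" using lin_indep_extend by blast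
  also have "\<dots> = (\<Sum>i<e. scale_fun (c i) (\<tau> (conj_curve w t i)))" by (rule sum.cong) (auto simp: a_def cj')
  finally show ?thesis by (auto simp: a_def cje)
qed

text \<open>The functions that vanish on the image of the product map \<open>t \<mapsto> w\<^sub>0(t\<^sub>0) ... w\<^bsub>e-1\<^esub>(t\<^bsub>e-1\<^esub>)\<close>.\<close>

definition image_ideal where "image_ideal = {F \<in> regular V. \<forall>t. F (partial_prod w t e) = 0}"

text \<open>Where the \<open>e\<close> translated partial derivatives are independent they span the velocity of \<open>\<gamma>\<close>, and
  the derivative of \<open>F\<close> along the image is zero. On the line from \<open>t0\<close> to a given parameter this
  holds for all but finitely many points, and the derivative is polynomial on the line.\<close>

lemma conv_image_ideal:
  assumes F: "F \<in> image_ideal" and \<gamma>: "\<gamma> \<in> \<Gamma>"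
  shows "conv (\<tau> \<gamma>) F \<in> image_ideal"
proof -
  have FR: "F \<in> regular V" and F0: "F (partial_prod w t e) = 0" for t using F by (auto simp: image_ideal_def)
  define G where "G = conv (\<tau> \<gamma>) F"
  have GR: "G \<in> regular V" unfolding G_def by (rule Vec_closed[OF conv_Vec[OF one_param_tangent[OF \<Gamma>[OF \<gamma>]]]])
  have "G (partial_prod w t e) = 0" for t
  proof -
    \<comment> \<open>the line from the good parameter t0 (u = 0) to t (u = 1)\<close>
    define line where "line = (\<lambda>u i. t0 i + u * (t i - t0 i))"
    have "(\<lambda>t. G (partial_prod w t e)) \<in> polynomial_functions e" by (rule partial_prod_polynomial[OF w GR])
    from polynomial_function_on_line[OF this, of t0 "\<lambda>i. t i - t0 i"]
    obtain P where P: "\<And>u. G (partial_prod w (line u) e) = poly P u" unfolding line_def by blast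
    define bad where "bad = {u. \<not> lin_indep e (\<lambda>i. \<tau> (conj_curve w (line u) i))}"
    have "finite bad" unfolding bad_def
    proof (rule lin_indep_poly_cofinite)
      fix i and F :: "'g \<Rightarrow> 'k" assume i: "i < e"
      show "\<exists>p. \<forall>u. \<tau> (conj_curve w (line u) i) F = poly p u"
      proof (cases "F \<in> regular V")
        case True
        then show ?thesis using polynomial_function_on_line[OF \<tau>_conj_curve_polynomial[of i w F]] w i
          unfolding line_def by fastforce
      next
        case False then show ?thesis by (intro exI[of _ 0]) (simp add: curve_deriv_def)
      qed
    next
      show "lin_indep e (\<lambda>i. \<tau> (conj_curve w (line 0) i))" using ind by (simp add: line_def)
    qed
    have "poly P u = 0" if "u \<notin> bad" for u
    proof -
      have li: "lin_indep e (\<lambda>i. \<tau> (conj_curve w (line u) i))" using that by (simp add: bad_def)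
      obtain c where c: "\<tau> \<gamma> = (\<Sum>i<e. scale_fun (c i) (\<tau> (conj_curve w (line u) i)))" using maximal_span[OF li \<gamma>] by (rule exE)
      have pc: "partial_prod w (line u) e \<in> carrier M" by (rule H_carrier[OF partial_prod_H[OF w]])
      have "conv (\<tau> (conj_curve w (line u) i)) F (partial_prod w (line u) e) = coeff 0 1" if "i < e" for i
      proof (rule one_param_conv[OF \<Gamma> FR pc])
        show "conj_curve w (line u) i \<in> \<Gamma>" by (rule conj_curve_\<Gamma>) (use w that in auto)
        show "F (conj_curve w (line u) i v \<otimes> partial_prod w (line u) e) = poly 0 v" for v
          using conj_curve_partial_prod[OF w that, where t = "line u" and u = v] F0 by simp
      qed
      then have "G (partial_prod w (line u) e) = 0"
        unfolding G_def c conv_lin[OF FR pc] by simp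
      then show ?thesis using P by simp
    qed
    then have "P = 0" by (rule poly_eq_0_cofinite[OF \<open>finite bad\<close>])
    moreover have "line 1 = t" by (simp add: line_def)
    ultimately show ?thesis using P[of 1] by simp
  qed
  then show ?thesis using GR unfolding image_ideal_def G_def by simp
qed

text \<open>All derivatives along \<open>\<gamma>\<close> vanish at \<open>u = 0\<close>, and \<open>F\<close> is polynomial along \<open>\<gamma>\<close>.\<close>

lemma image_ideal_translate:
  assumes F: "F \<in> image_ideal" and \<gamma>: "\<gamma> \<in> \<Gamma>"
  shows "F (\<gamma> u \<otimes> partial_prod w t e) = 0"
proof -
  define D where "D = conv (\<tau> \<gamma>)"
  define g where "g = partial_prod w t e"
  have g: "g \<in> carrier M" using partial_prod_H[OF w] H_carrier by (simp add: g_def)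
  have DF: "(D ^^ n) F \<in> image_ideal" for n by (induction n) (auto simp: F D_def intro: conv_image_ideal \<gamma>)
  obtain p where p: "\<And>u. F (\<gamma> u \<otimes> g) = poly p u"
    using one_param_translate_poly[OF \<Gamma>[OF \<gamma>] _ g, of F] F unfolding image_ideal_def by blast
  have der: "(D ^^ n) F (\<gamma> u \<otimes> g) = poly ((pderiv ^^ n) p) u" for n u
  proof (induction n arbitrary: u)
    case 0 then show ?case by (simp add: p)
  next
    case (Suc n)
    let ?q = "(pderiv ^^ n) p"
    have \<gamma>c: "\<gamma> v \<in> carrier M" for v using \<Gamma>_carrier[OF \<gamma>] .
    have "D ((D ^^ n) F) (\<gamma> u \<otimes> g) = coeff (pcompose ?q [:u, 1:]) 1"
      unfolding D_def
    proof (rule one_param_conv[OF \<Gamma>[OF \<gamma>]])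
      show "(conv (\<tau> \<gamma>) ^^ n) F \<in> regular V" using DF[of n] by (simp add: image_ideal_def D_def)
      show "\<gamma> u \<otimes> g \<in> carrier M" using g \<gamma>c by simp
      fix v
      have "\<gamma> v \<otimes> (\<gamma> u \<otimes> g) = \<gamma> (v + u) \<otimes> g" using \<Gamma>[OF \<gamma>] g \<gamma>c by (simp add: one_param_def m_assoc)
      then show "(conv (\<tau> \<gamma>) ^^ n) F (\<gamma> v \<otimes> (\<gamma> u \<otimes> g)) = poly (pcompose ?q [:u, 1:]) v"
        using Suc[of "v + u"] by (simp add: D_def poly_pcompose add.commute)
    qed
    then show ?case by (simp add: coeff_1_shift(2)[unfolded One_nat_def])
  qed
  have "p = 0"
  proof (rule poly_eq_0_derivs)
    fix n
    have "\<gamma> 0 \<otimes> g = g" using one_param_zero[OF \<Gamma>[OF \<gamma>]] g by simp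
    then show "poly ((pderiv ^^ n) p) 0 = 0" using der[of n 0] DF[of n] by (simp add: image_ideal_def g_def)
  qed
  then show ?thesis using p by (simp add: g_def)
qed

text \<open>Invariance under translation by the generators of \<open>H\<close> carries the vanishing from the image,
  which contains the identity, to all of \<open>H\<close>: the image is dense in the closure of \<open>H\<close>.\<close>

lemma image_ideal_eq: "image_ideal = I"
proof (intro equalityI subsetI)
  fix F assume F: "F \<in> image_ideal"
  have *: "\<forall>F\<in>image_ideal. \<forall>t. F (h \<otimes> partial_prod w t e) = 0" if "h \<in> H" for h
    using that
  proof induction
    case H_one
    have "partial_prod w t e \<in> carrier M" for t using partial_prod_H[OF w] H_carrier by simp
    then show ?case by (simp add: image_ideal_def)
  next
    case (H_step h \<gamma> s)
    show ?case
    proof (intro ballI allI)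
      fix F t assume F: "F \<in> image_ideal"
      have pc: "partial_prod w t e \<in> carrier M" for t using partial_prod_H[OF w] H_carrier by simp
      have \<gamma>c: "\<gamma> s \<in> carrier M" and hc: "h \<in> carrier M" using H_step \<Gamma>_carrier H_carrier by auto
      let ?F = "pullback (carrier M) (\<lambda>x. \<gamma> s \<otimes> x) F"
      have "?F \<in> image_ideal"
        using image_ideal_translate[OF F H_step(2)] F ltranslate_closed[OF _ \<gamma>c] pc by (auto simp: image_ideal_def pullback_def)
      then have "?F (h \<otimes> partial_prod w t e) = 0" using H_step.IH by blast
      then show "F (\<gamma> s \<otimes> h \<otimes> partial_prod w t e) = 0" using hc \<gamma>c pc by (simp add: pullback_def m_assoc)
    qed
  qed
  have "partial_prod w (\<lambda>_. 0) n = \<one>" if "n \<le> e" for n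
    using that by (induction n) (auto simp: one_param_zero[OF \<Gamma>[OF w]])
  then have p1: "partial_prod w (\<lambda>_. 0) e = \<one>" by simp
  have "F h = 0" if "h \<in> H" for h
    using *[OF that, rule_format, OF F, of "\<lambda>_. 0"] H_carrier[OF that] by (simp add: p1)
  then show "F \<in> I" using F by (simp add: image_ideal_def I_def)
next
  fix F assume "F \<in> I"
  then show "F \<in> image_ideal" using partial_prod_H[OF w] by (auto simp: image_ideal_def I_def)
qed

text \<open>Otherwise there are \<open>m = e + 1\<close> functions dual to tangent vectors. Pulled back along the product
  map they are polynomials in \<open>e\<close> variables of degree at most \<open>N\<close> in each variable, and this map
  is injective on the coordinate algebra. The \<open>(n + 1) ^ (e + 1)\<close> independent monomials with
  exponents at most \<open>n\<close> land in a space of dimension at most \<open>(m n N + 1) ^ e\<close>, which is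
  impossible for large \<open>n\<close>.\<close>

lemma closure_tangent_dim_bound:
  assumes d: "dual_basis closure_tangent d A Fs"
  shows "d \<le> e"
proof (rule ccontr)
  assume "\<not> d \<le> e"
  then have ed: "Suc e \<le> d" by simp
  define m where "m = Suc e"
  have A: "A i \<in> closure_tangent" if "i < m" for i using d that ed by (auto simp: dual_basis_def m_def)
  have AT: "A i \<in> tangent_space V \<one>" if "i < m" for i using A[OF that] by (simp add: closure_tangent_def)
  have AF: "A i (Fs j) = (if i = j then 1 else 0)" if "i < m" "j < m" for i j
    using d that ed by (auto simp: dual_basis_def m_def)
  have FR: "Fs j \<in> regular V" if j: "j < m" for j
  proof (rule ccontr)
    assume "Fs j \<notin> regular V"
    then have "A j (Fs j) = 0" using AT[OF j] by (simp add: tangent_space_def)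
    then show False using AF[OF j j] by simp
  qed
  \<comment> \<open>tangent vectors kill constants, so the dual functions may be normalized to vanish at the identity\<close>
  define f where "f = (\<lambda>j. Fs j - const_on (points V) (Fs j \<one>))"
  have f: "f j \<in> regular V" if "j < m" for j unfolding f_def by (intro diff_closed FR const_closed that)
  have f1: "f j \<one> = 0" for j by (simp add: f_def const_on_def points_eq)
  have Af: "A i (f j) = (if i = j then 1 else 0)" if "i < m" "j < m" for i j
  proof -
    have "A i (Fs j) = A i (f j + const_on (points V) (Fs j \<one>))" by (simp add: f_def)
    also have "\<dots> = A i (f j) + A i (const_on (points V) (Fs j \<one>))"
      using AT[OF that(1)] f[OF that(2)] const_closed unfolding tangent_space_def by blast
    also have "A i (const_on (points V) (Fs j \<one>)) = 0"
      by (rule tangent_const[OF AT[OF that(1)]]) (simp add: points_eq)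
    finally show ?thesis using AF[OF that] by simp
  qed
  have pc: "partial_prod w t e \<in> carrier M" for t using partial_prod_H[OF w] H_carrier by simp
  have "\<exists>N. (\<lambda>t. f j (partial_prod w t e)) \<in> bounded_polys e N" if "j < m" for j
    by (rule polynomial_function_bounded[OF partial_prod_polynomial[OF w f[OF that]]])
  then obtain Nj where Nj: "\<And>j. j < m \<Longrightarrow> (\<lambda>t. f j (partial_prod w t e)) \<in> bounded_polys e (Nj j)" by metis
  define N where "N = (\<Sum>j<m. Nj j)"
  have N: "(\<lambda>t. f j (partial_prod w t e)) \<in> bounded_polys e N" if "j < m" for j
    by (rule bounded_polys_mono[OF Nj[OF that]]) (use that in \<open>auto simp: N_def intro: member_le_sum\<close>)
  have count: "(n + 1) ^ m \<le> (m * (n * N) + 1) ^ e" for n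
  proof -
    define box where "box = PiE {..<m} (\<lambda>_. {..n})"
    define B where "B = (\<lambda>\<beta> (t :: nat \<Rightarrow> 'k). \<Prod>i<e. t i ^ \<beta> i) ` (PiE {..<e} (\<lambda>_. {..m * (n * N)}))"
    have finb: "finite box" unfolding box_def by (rule finite_PiE) auto
    have "card box \<le> card B"
    proof (rule card_le_of_independent_family[OF finb, of B "\<lambda>\<alpha> t. monom_fun f m \<alpha> (partial_prod w t e)"])
      show "finite B" unfolding B_def by (intro finite_imageI finite_PiE) auto
    next
      fix \<alpha> assume \<alpha>: "\<alpha> \<in> box"
      have "(\<lambda>t. \<Prod>j<m. f j (partial_prod w t e) ^ \<alpha> j) \<in> bounded_polys e (m * (n * N))"
      proof (rule bounded_polys_prod)
        fix j assume j: "j < m"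
        have "\<alpha> j \<le> n" using \<alpha> j by (auto simp: box_def PiE_iff)
        then show "(\<lambda>t. f j (partial_prod w t e) ^ \<alpha> j) \<in> bounded_polys e (n * N)"
          using bounded_polys_mono[OF bounded_polys_power[OF N[OF j], of "\<alpha> j"]] by simp
      qed
      then show "(\<lambda>t. monom_fun f m \<alpha> (partial_prod w t e)) \<in> fun_vs.span B"
        using pc by (simp add: monom_fun_def bounded_polys_def B_def)
    next
      fix c assume c: "(\<Sum>\<alpha>\<in>box. scale_fun (c \<alpha>) (\<lambda>t. monom_fun f m \<alpha> (partial_prod w t e))) = 0"
      have "(\<Sum>\<alpha>\<in>box. scale_fun (c \<alpha>) (monom_fun f m \<alpha>)) (partial_prod w t e) = 0" for t
        using fun_cong[OF c, of t] by (simp add: sum_scale_apply)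
      moreover have "(\<Sum>\<alpha>\<in>box. scale_fun (c \<alpha>) (monom_fun f m \<alpha>)) \<in> regular V"
        by (intro sum_closed scale_closed monom_fun_regular_taylor_fps(1) f)
      ultimately have "(\<Sum>\<alpha>\<in>box. scale_fun (c \<alpha>) (monom_fun f m \<alpha>)) \<in> I"
        unfolding image_ideal_eq[symmetric] image_ideal_def by blast
      from monomials_independent[OF A f f1 Af box_def this] show "\<forall>\<alpha>\<in>box. c \<alpha> = 0" by blast
    qed
    moreover have "card box = (n + 1) ^ m" by (simp add: box_def card_PiE)
    moreover have "card B \<le> (m * (n * N) + 1) ^ e"
    proof -
      have "card B \<le> card (PiE {..<e} (\<lambda>_. {..m * (n * N)}))"
        unfolding B_def by (intro card_image_le finite_PiE) auto
      also have "\<dots> = (m * (n * N) + 1) ^ e" by (simp add: card_PiE)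
      finally show ?thesis .
    qed
    ultimately show ?thesis by simp
  qed
  define C where "C = m * N + 1"
  \<comment> \<open>already large enough: (m n N + 1) ^ e is at most C ^ e * (n + 1) ^ e = n * (n + 1) ^ e\<close>
  define n where "n = C ^ e"
  have "(n + 1) ^ e * (n + 1) = (n + 1) ^ m" by (simp add: m_def)
  also have "\<dots> \<le> (m * (n * N) + 1) ^ e" by (rule count)
  also have "\<dots> \<le> (C * (n + 1)) ^ e" by (rule power_mono) (auto simp: C_def algebra_simps)
  also have "\<dots> = C ^ e * (n + 1) ^ e" by (rule power_mult_distrib)
  also have "\<dots> = (n + 1) ^ e * n" by (simp only: n_def[symmetric] mult.commute)
  finally show False by simp
qed

text \<open>The velocities of the \<open>e\<close> conjugates are \<open>e\<close> independent elements of a space of dimension at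
  most \<open>e\<close>.\<close>

lemma closure_tangent_subset_span: "closure_tangent \<subseteq> fun_vs.span (\<tau> ` \<Gamma>)"
proof
  fix A assume A: "A \<in> closure_tangent"
  have \<tau>closure_tangent: "\<tau> (conj_curve w t0 i) \<in> fun_vs.span (\<tau> ` \<Gamma>) \<and> \<tau> (conj_curve w t0 i) \<in> closure_tangent" if "i < e" for i
  proof -
    have c: "conj_curve w t0 i \<in> \<Gamma>" by (rule conj_curve_\<Gamma>) (use w that in auto)
    have "\<tau> (conj_curve w t0 i) F = coeff 0 1" if "F \<in> I" for F
      by (rule curve_deriv_eq) (use that \<Gamma>_H[OF c] in \<open>auto simp: I_def\<close>)
    then show ?thesis using c one_param_tangent[OF \<Gamma>[OF c]] by (auto simp: closure_tangent_def intro: fun_vs.span_base)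
  qed
  obtain d B Fs where d: "dual_basis closure_tangent d B Fs"
    using tangent_dual_basis[OF _ closure_tangent_subspace, of \<one>] by (auto simp: points_eq closure_tangent_def)
  define a where "a = (\<lambda>i. if i < e then \<tau> (conj_curve w t0 i) else A)"
  have "lin_indep e a" using ind lin_indep_cong[of e a "\<lambda>i. \<tau> (conj_curve w t0 i)"] by (simp add: a_def)
  moreover have "\<not> lin_indep (Suc e) a"
  proof
    assume "lin_indep (Suc e) a"
    then have "Suc e \<le> d" by (rule dual_basis_bound[OF d]) (use A \<tau>closure_tangent in \<open>auto simp: a_def\<close>)
    then show False using closure_tangent_dim_bound[OF d] by simp
  qed
  ultimately obtain c where "a e = (\<Sum>i<e. scale_fun (c i) (a i))" using lin_indep_extend by blast
  then have "A = (\<Sum>i<e. scale_fun (c i) (a i))" by (simp add: a_def)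
  also have "\<dots> \<in> fun_vs.span (\<tau> ` \<Gamma>)"
    by (intro fun_vs.span_sum fun_vs.span_scale) (use \<tau>closure_tangent in \<open>auto simp: a_def\<close>)
  finally show "A \<in> fun_vs.span (\<tau> ` \<Gamma>)" .
qed

end

theorem closure_tangent_eq_span: "closure_tangent = fun_vs.span (\<tau> ` \<Gamma>)"
proof
  obtain e where e: "attained e" "\<And>n. attained n \<Longrightarrow> n \<le> e" using max_attained by blast
  from e(1) obtain w t where "\<forall>i<e. w i \<in> \<Gamma>" "lin_indep e (\<lambda>i. \<tau> (conj_curve w t i))"
    unfolding attained_def by blast
  then show "closure_tangent \<subseteq> fun_vs.span (\<tau> ` \<Gamma>)" using closure_tangent_subset_span e(2) by blast
  have "\<tau> \<gamma> \<in> closure_tangent" if \<gamma>: "\<gamma> \<in> \<Gamma>" for \<gamma>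
  proof -
    have "\<tau> \<gamma> F = coeff 0 1" if "F \<in> I" for F
      by (rule curve_deriv_eq) (use that \<Gamma>_H[OF \<gamma>] in \<open>auto simp: I_def\<close>)
    then show ?thesis using one_param_tangent[OF \<Gamma>[OF \<gamma>]] by (auto simp: closure_tangent_def)
  qed
  then show "fun_vs.span (\<tau> ` \<Gamma>) \<subseteq> closure_tangent" by (intro fun_vs.span_minimal closure_tangent_subspace) auto
qed

end

section \<open>Zariski closures of subgroups\<close>

lemma gen_algebra_subset:
  assumes "\<And>c. const_on A c \<in> W" "S \<subseteq> W" "\<And>f g. f \<in> W \<Longrightarrow> g \<in> W \<Longrightarrow> f + g \<in> W"
    "\<And>f g. f \<in> W \<Longrightarrow> g \<in> W \<Longrightarrow> f * g \<in> W"
  shows "gen_algebra A S \<subseteq> W"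
proof
  fix f assume "f \<in> gen_algebra A S" then show "f \<in> W"
    by induction (use assms in blast)+
qed

lemma gen_algebra_agree:
  assumes "f \<in> gen_algebra A S" "x \<in> A" "y \<in> A" "\<And>f. f \<in> S \<Longrightarrow> f x = f y"
  shows "f x = f y"
  using assms(1) by induction (use assms in \<open>auto simp: const_on_def\<close>)

context lin_group
begin

definition vanishing :: "'g set \<Rightarrow> ('g \<Rightarrow> 'k) set"
  where "vanishing H = {F \<in> regular V. \<forall>h\<in>H. F h = 0}"

definition zclosure :: "'g set \<Rightarrow> 'g set"
  where "zclosure H = {g \<in> carrier M. \<forall>F\<in>vanishing H. F g = 0}"

definition subvar :: "'g set \<Rightarrow> ('g, 'k) variety"
  where "subvar K = \<lparr>points = K, regular = pullback K (\<lambda>g. g) ` regular V\<rparr>"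

lemma zclosure_carrier: "zclosure H \<subseteq> carrier M"
  by (auto simp: zclosure_def)

text \<open>Translation by an element of \<open>H\<close> and inversion preserve the functions that vanish on \<open>H\<close>.
  Products of two points of the closure need this twice: first with a left factor in \<open>H\<close>, then
  with a right factor in the closure.\<close>

lemma zclosure_subgroup:
  assumes H: "subgroup H M"
  shows "subgroup (zclosure H) M"
proof -
  have Hc: "h \<in> carrier M" if "h \<in> H" for h using subgroup.subset[OF H] that by blast
  have HK: "h \<in> zclosure H" if "h \<in> H" for h using that Hc by (auto simp: zclosure_def vanishing_def)
  have hk: "h \<otimes> k \<in> zclosure H" if h: "h \<in> H" and k: "k \<in> zclosure H" for h k
    unfolding zclosure_def
  proof (intro CollectI conjI ballI)
    have kc: "k \<in> carrier M" using k zclosure_carrier by blast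
    then show "h \<otimes> k \<in> carrier M" using Hc[OF h] by simp
    fix F assume F: "F \<in> vanishing H"
    have "pullback (carrier M) (\<lambda>y. h \<otimes> y) F \<in> vanishing H"
      using F ltranslate_closed[of F h] Hc h subgroup.m_closed[OF H h]
      by (auto simp: vanishing_def pullback_def)
    then have "pullback (carrier M) (\<lambda>y. h \<otimes> y) F k = 0" using k by (auto simp: zclosure_def)
    then show "F (h \<otimes> k) = 0" using kc by (simp add: pullback_def)
  qed
  have kk: "k \<otimes> l \<in> zclosure H" if k: "k \<in> zclosure H" and l: "l \<in> zclosure H" for k l
    unfolding zclosure_def
  proof (intro CollectI conjI ballI)
    have kc: "k \<in> carrier M" "l \<in> carrier M" using k l zclosure_carrier by blast+
    then show "k \<otimes> l \<in> carrier M" by simp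
    fix F assume F: "F \<in> vanishing H"
    have "F (h \<otimes> l) = 0" if "h \<in> H" for h using hk[OF that l] F by (auto simp: zclosure_def)
    then have "pullback (carrier M) (\<lambda>y. y \<otimes> l) F \<in> vanishing H"
      using F rtranslate_closed[of F l] kc Hc by (auto simp: vanishing_def pullback_def)
    then have "pullback (carrier M) (\<lambda>y. y \<otimes> l) F k = 0" using k by (auto simp: zclosure_def)
    then show "F (k \<otimes> l) = 0" using kc by (simp add: pullback_def)
  qed
  have ki: "inv k \<in> zclosure H" if k: "k \<in> zclosure H" for k
    unfolding zclosure_def
  proof (intro CollectI conjI ballI)
    have kc: "k \<in> carrier M" using k zclosure_carrier by blast
    then show "inv k \<in> carrier M" by simp
    fix F assume F: "F \<in> vanishing H"
    have "pullback (carrier M) (\<lambda>y. inv y) F \<in> vanishing H"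
      using F antipode_closed[of F] Hc subgroup.m_inv_closed[OF H] by (auto simp: vanishing_def pullback_def)
    then have "pullback (carrier M) (\<lambda>y. inv y) F k = 0" using k by (auto simp: zclosure_def)
    then show "F (inv k) = 0" using kc by (simp add: pullback_def)
  qed
  show ?thesis
    by (rule subgroupI) (use zclosure_carrier HK[OF subgroup.one_closed[OF H]] kk ki in auto)
qed

lemma res_apply: "pullback K (\<lambda>g. g) F g = (if g \<in> K then F g else 0)" for F :: "'g \<Rightarrow> 'k"
  by (simp add: pullback_def)

text \<open>A character of the restricted functions is a character of the ambient algebra, hence evaluation
  at a point, and this point lies in the closure because the functions that vanish on \<open>H\<close> restrict
  to zero.\<close>

lemma subvar_affine:
  shows "affine_variety (subvar (zclosure H))"
proof -
  let ?K = "zclosure H"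
  let ?r = "pullback ?K (\<lambda>g. g) :: ('g \<Rightarrow> 'k) \<Rightarrow> 'g \<Rightarrow> 'k"
  obtain S where S: "finite S" "regular V = gen_algebra (carrier M) S"
    "\<And>f x. f \<in> S \<Longrightarrow> x \<notin> carrier M \<Longrightarrow> f x = 0"
    using affine_varietyE[OF affine] points_eq by metis
  have rc: "?r (const_on (carrier M) c) = const_on ?K c" for c
    using zclosure_carrier by (auto simp: pullback_def const_on_def fun_eq_iff)
  have gen: "?r ` regular V = gen_algebra ?K (?r ` S)"
  proof
    have "gen_algebra (carrier M) S \<subseteq> {f. ?r f \<in> gen_algebra ?K (?r ` S)}"
      by (rule gen_algebra_subset)
        (auto simp: rc pullback_add pullback_mult intro: gen_algebra.intros)
    then show "?r ` regular V \<subseteq> gen_algebra ?K (?r ` S)" using S(2) by blast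
    show "gen_algebra ?K (?r ` S) \<subseteq> ?r ` regular V"
    proof (rule gen_algebra_subset)
      show "const_on ?K c \<in> ?r ` regular V" for c
        using rc[of c] const_closed[of c] points_eq by (metis image_eqI)
      show "?r ` S \<subseteq> ?r ` regular V" using S(2) gen_algebra.gen by blast
      fix f g assume "f \<in> ?r ` regular V" "g \<in> ?r ` regular V"
      then obtain F G where FG: "F \<in> regular V" "G \<in> regular V" "f = ?r F" "g = ?r G" by blast
      show "f + g \<in> ?r ` regular V" unfolding FG(3,4) pullback_add[symmetric] using add_closed[OF FG(1,2)] by (rule imageI)
      show "f * g \<in> ?r ` regular V" unfolding FG(3,4) pullback_mult[symmetric] using mult_closed[OF FG(1,2)] by (rule imageI)
    qed
  qed
  have "affine_variety \<lparr>points = ?K, regular = gen_algebra ?K (?r ` S)\<rparr>"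
  proof (rule affine_varietyI)
    show "finite (?r ` S)" using S(1) by simp
    show "f x = 0" if "f \<in> ?r ` S" "x \<notin> ?K" for f x using that by (auto simp: res_apply)
    show "x = y" if xy: "x \<in> ?K" "y \<in> ?K" "\<And>f. f \<in> ?r ` S \<Longrightarrow> f x = f y" for x y
    proof (rule affine_points_eqI[OF affine])
      have c: "x \<in> carrier M" "y \<in> carrier M" using xy zclosure_carrier by blast+
      then show "x \<in> points V" "y \<in> points V" by (simp_all add: points_eq)
      fix f assume "f \<in> regular V"
      then show "f x = f y" unfolding S(2)
      proof (rule gen_algebra_agree[OF _ c])
        fix f assume "f \<in> S" then show "f x = f y" using xy(3)[of "?r f"] xy(1,2) by (simp add: res_apply)
      qed
    qed
    fix \<chi> assume \<chi>: "character ?K (gen_algebra ?K (?r ` S)) \<chi>"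
    have rin: "?r F \<in> gen_algebra ?K (?r ` S)" if "F \<in> regular V" for F using that gen by blast
    have "character (points V) (regular V) (\<lambda>F. \<chi> (?r F))"
      using \<chi> rin unfolding character_def points_eq by (simp add: rc pullback_add pullback_mult)
    then obtain x where x: "x \<in> points V" "\<And>F. F \<in> regular V \<Longrightarrow> \<chi> (?r F) = F x"
      using affine_character_point[OF affine] by blast
    have "x \<in> ?K" unfolding zclosure_def
    proof (intro CollectI conjI ballI)
      show "x \<in> carrier M" using x(1) by (simp add: points_eq)
      fix F assume F: "F \<in> vanishing H"
      have "?r F = const_on ?K 0" using F by (auto simp: pullback_def const_on_def zclosure_def fun_eq_iff)
      then have "F x = \<chi> (const_on ?K 0)" using x(2)[of F] F by (simp add: vanishing_def)
      then show "F x = 0" using \<chi> by (simp add: character_def)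
    qed
    moreover have "\<chi> f = f x" if fS: "f \<in> ?r ` S" for f
    proof -
      obtain F where F: "F \<in> S" "f = ?r F" using fS by blast
      have "F \<in> regular V" unfolding S(2) using F(1) by (rule gen_algebra.gen)
      then show ?thesis using x(2)[of F] F(2) \<open>x \<in> ?K\<close> by (simp add: res_apply)
    qed
    ultimately show "\<exists>x\<in>?K. \<forall>f\<in>?r ` S. \<chi> f = f x" by blast
  qed
  then show ?thesis by (simp add: subvar_def gen)
qed

lemma subvar_inclusion:
  assumes "K \<subseteq> carrier M"
  shows "morphism (subvar K) V (\<lambda>g. g)"
  using assms by (auto simp: morphism_def subvar_def points_eq)

lemma subvar_group:
  assumes H: "subgroup H M"
  shows "linear_algebraic_group (M\<lparr>carrier := zclosure H\<rparr>) (subvar (zclosure H))"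
proof -
  let ?K = "zclosure H"
  let ?r = "pullback ?K (\<lambda>g. g) :: ('g \<Rightarrow> 'k) \<Rightarrow> 'g \<Rightarrow> 'k"
  have K: "subgroup ?K M" by (rule zclosure_subgroup[OF H])
  have pts: "points (subvar ?K) = ?K" and reg: "regular (subvar ?K) = ?r ` regular V"
    by (simp_all add: subvar_def)
  have "morphism (product_variety (subvar ?K) (subvar ?K)) (subvar ?K) (\<lambda>(g, h). g \<otimes> h)"
    unfolding morphism_def regular_product points_product pts
  proof (intro conjI ballI)
    show "(\<lambda>(g, h). g \<otimes> h) \<in> ?K \<times> ?K \<rightarrow> ?K" using subgroup.m_closed[OF K] by auto
    fix f assume "f \<in> regular (subvar ?K)"
    then obtain F where F: "F \<in> regular V" "f = ?r F" unfolding reg by blast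
    obtain n :: nat and a b where ab: "\<And>i. i < n \<Longrightarrow> a i \<in> regular V" "\<And>i. i < n \<Longrightarrow> b i \<in> regular V"
      "\<And>g h. g \<in> carrier M \<Longrightarrow> h \<in> carrier M \<Longrightarrow> F (g \<otimes> h) = (\<Sum>i<n. a i g * b i h)"
      using comultE[OF F(1)] by blast
    show "pullback (?K \<times> ?K) (\<lambda>(g, h). g \<otimes> h) f \<in> tensors (regular (subvar ?K)) (regular (subvar ?K))"
    proof (rule tensorsI[of "{..<n}" "\<lambda>i. ?r (a i)" _ "\<lambda>i. ?r (b i)"])
      show "?r (a i) \<in> regular (subvar ?K)" "?r (b i) \<in> regular (subvar ?K)" if "i \<in> {..<n}" for i
        using that ab unfolding reg by auto
      show "pullback (?K \<times> ?K) (\<lambda>(g, h). g \<otimes> h) f (x, y) = (\<Sum>i<n. ?r (a i) x * ?r (b i) y)" for x y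
        using ab(3)[of x y] subgroup.m_closed[OF K, of x y] zclosure_carrier[of H]
        by (auto simp: pullback_def F(2))
    qed
  qed
  moreover have "morphism (subvar ?K) (subvar ?K) (\<lambda>g. inv g)"
    unfolding morphism_def pts
  proof (intro conjI ballI)
    show "(\<lambda>g. inv g) \<in> ?K \<rightarrow> ?K" using subgroup.m_inv_closed[OF K] by auto
    fix f assume "f \<in> regular (subvar ?K)"
    then obtain F where F: "F \<in> regular V" "f = ?r F" unfolding reg by blast
    have "pullback ?K (\<lambda>g. inv g) f = ?r (pullback (carrier M) (\<lambda>g. inv g) F)"
      using subgroup.m_inv_closed[OF K] zclosure_carrier[of H] by (auto simp: pullback_def F(2) fun_eq_iff)
    then show "pullback ?K (\<lambda>g. inv g) f \<in> regular (subvar ?K)"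
      unfolding reg using antipode_closed[OF F(1)] by blast
  qed
  then have "morphism (subvar ?K) (subvar ?K) (\<lambda>g. inv\<^bsub>M\<lparr>carrier := ?K\<rparr>\<^esub> g)"
    by (rule morphism_cong) (simp add: pts m_inv_consistent[OF K])
  ultimately show ?thesis
    using subgroup.subgroup_is_group[OF K is_group] subvar_affine[of H]
    by (simp add: linear_algebraic_group_def pts)
qed

text \<open>A tangent vector of the ambient group that kills the ideal of the closure is well defined on
  restrictions.\<close>

lemma subvar_tangent:
  assumes H: "subgroup H M"
  shows "differential (subvar (zclosure H)) V (\<lambda>g. g) ` tangent_space (subvar (zclosure H)) \<one>
    = {A \<in> tangent_space V \<one>. \<forall>F\<in>vanishing H. A F = 0}"
proof (intro equalityI subsetI)
  let ?K = "zclosure H"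
  let ?r = "pullback ?K (\<lambda>g. g) :: ('g \<Rightarrow> 'k) \<Rightarrow> 'g \<Rightarrow> 'k"
  interpret K: affine "subvar ?K" by unfold_locales (rule subvar_affine)
  have pts: "points (subvar ?K) = ?K" and reg: "regular (subvar ?K) = ?r ` regular V"
    by (simp_all add: subvar_def)
  have one: "\<one> \<in> ?K" using subgroup.one_closed[OF zclosure_subgroup[OF H]] .
  {
    fix A assume "A \<in> differential (subvar ?K) V (\<lambda>g. g) ` tangent_space (subvar ?K) \<one>"
    then obtain B where B: "B \<in> tangent_space (subvar ?K) \<one>" and A: "A = differential (subvar ?K) V (\<lambda>g. g) B" by blast
    have "A \<in> tangent_space V \<one>" unfolding A
      by (rule differential_tangent[OF affine subvar_inclusion[OF zclosure_carrier] _ B]) (simp add: pts one)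
    moreover have "A F = 0" if F: "F \<in> vanishing H" for F
    proof -
      have "?r F = const_on (points (subvar ?K)) 0"
        using F by (auto simp: pullback_def const_on_def zclosure_def fun_eq_iff pts)
      moreover have "A F = B (?r F)" using F by (simp add: A differential_def vanishing_def pts)
      ultimately show ?thesis using K.tangent_const[OF B] one pts by simp
    qed
    ultimately show "A \<in> {A \<in> tangent_space V \<one>. \<forall>F\<in>vanishing H. A F = 0}" by blast
  next
    fix A assume "A \<in> {A \<in> tangent_space V \<one>. \<forall>F\<in>vanishing H. A F = 0}"
    then have A: "A \<in> tangent_space V \<one>" and A0: "\<And>F. F \<in> vanishing H \<Longrightarrow> A F = 0" by auto
    define B where "B = (\<lambda>f. if f \<in> regular (subvar ?K) then A (SOME F. F \<in> regular V \<and> ?r F = f) else 0)"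
    have wd: "A F = A G" if "F \<in> regular V" "G \<in> regular V" "?r F = ?r G" for F G
    proof -
      have "F h = G h" if "h \<in> H" for h
      proof -
        have "h \<in> ?K" using that subgroup.subset[OF H] by (auto simp: zclosure_def vanishing_def)
        then show ?thesis using fun_cong[OF \<open>?r F = ?r G\<close>, of h] by (simp add: res_apply)
      qed
      then have "F - G \<in> vanishing H" using that diff_closed by (auto simp: vanishing_def)
      then have z: "A (F - G) = 0" by (rule A0)
      have "A (F - G + G) = A (F - G) + A G"
        using A that diff_closed unfolding tangent_space_def by blast
      then show ?thesis using z by simp
    qed
    have B: "B (?r F) = A F" if F: "F \<in> regular V" for F
    proof -
      have "\<exists>G. G \<in> regular V \<and> ?r G = ?r F" using F by blast
      define G where "G = (SOME G. G \<in> regular V \<and> ?r G = ?r F)"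
      have G: "G \<in> regular V" "?r G = ?r F" using someI_ex[OF \<open>\<exists>G. G \<in> regular V \<and> ?r G = ?r F\<close>] by (simp_all add: G_def)
      have "B (?r F) = A G" unfolding B_def G_def reg using F by simp
      then show ?thesis using wd[OF G(1) F G(2)] by simp
    qed
    have "B \<in> tangent_space (subvar ?K) \<one>"
      unfolding tangent_space_def
    proof (intro CollectI conjI allI impI ballI)
      fix f assume "f \<notin> regular (subvar ?K)" then show "B f = 0" by (simp add: B_def)
    next
      fix f g assume "f \<in> regular (subvar ?K)" "g \<in> regular (subvar ?K)"
      then obtain F G where FG: "F \<in> regular V" "G \<in> regular V" "f = ?r F" "g = ?r G" unfolding reg by blast
      have "B (?r (F + G)) = A F + A G" using B[OF add_closed[OF FG(1,2)]] A FG unfolding tangent_space_def by auto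
      then show "B (f + g) = B f + B g" unfolding FG(3,4) pullback_add by (simp add: B FG)
      have "B (?r (F * G)) = F \<one> * A G + A F * G \<one>" using B[OF mult_closed[OF FG(1,2)]] A FG unfolding tangent_space_def by auto
      then show "B (f * g) = f \<one> * B g + B f * g \<one>" unfolding FG(3,4) pullback_mult by (simp add: B FG res_apply one)
    next
      fix c f assume "f \<in> regular (subvar ?K)"
      then obtain F where F: "F \<in> regular V" "f = ?r F" unfolding reg by blast
      have "B (?r (scale_fun c F)) = c * A F" using B[OF scale_closed[OF F(1)]] A F unfolding tangent_space_def by auto
      then show "B (scale_fun c f) = c * B f" unfolding F(2) pullback_scale by (simp add: B F)
    qed
    moreover have "differential (subvar ?K) V (\<lambda>g. g) B = A"
    proof
      fix F show "differential (subvar ?K) V (\<lambda>g. g) B F = A F"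
        using B A by (cases "F \<in> regular V") (auto simp: differential_def pts tangent_space_def)
    qed
    ultimately show "A \<in> differential (subvar ?K) V (\<lambda>g. g) ` tangent_space (subvar ?K) \<one>" by blast
  }
qed

end

lemma zclosure_algebraic_subgroup:
  fixes X :: "('a, 'k::field_char_0) variety"
  assumes X: "affine_variety X" and G: "algebraic_subgroup X G"
    and N: "N = (Aut X)\<lparr>carrier := points G\<rparr>" and H: "subgroup H N"
  shows "algebraic_subgroup X (lin_group.subvar G (lin_group.zclosure N G H))"
    and "Lie X (lin_group.subvar G (lin_group.zclosure N G H)) =
      fundamental_field G X (\<lambda>g. g) ` {A \<in> tangent_space G \<one>\<^bsub>N\<^esub>. \<forall>F\<in>lin_group.vanishing G H. A F = 0}"
proof -
  have lagN: "linear_algebraic_group N G" and act: "regular_action N G X (\<lambda>g. g)"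
    and sub: "subgroup (points G) (Aut X)"
    using G by (auto simp: algebraic_subgroup_def N)
  interpret L: lin_group N G by unfold_locales (rule lagN)
  let ?K = "L.zclosure H"
  let ?G = "L.subvar ?K"
  have pts: "points ?G = ?K" by (simp add: L.subvar_def)
  have K: "subgroup ?K N" by (rule L.zclosure_subgroup[OF H])
  have NK: "(Aut X)\<lparr>carrier := ?K\<rparr> = N\<lparr>carrier := ?K\<rparr>" by (simp add: N)
  have "subgroup ?K (Aut X)"
    using group.incl_subgroup[OF group_Aut[OF X] sub, of ?K] K N by simp
  moreover have lag: "linear_algebraic_group (N\<lparr>carrier := ?K\<rparr>) ?G" by (rule L.subvar_group[OF H])
  have inc: "morphism ?G G (\<lambda>g. g)" by (rule L.subvar_inclusion[OF L.zclosure_carrier])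
  have gh: "(\<lambda>g. g) \<in> hom N (BijGroup (points X))" "group (BijGroup (points X))"
    using act by (auto simp: regular_action_def group_action_def group_hom_def group_hom_axioms_def)
  have "group_action (N\<lparr>carrier := ?K\<rparr>) (points X) (\<lambda>g. g)"
    unfolding group_action_def group_hom_def group_hom_axioms_def
    using subgroup.subgroup_is_group[OF K L.is_group] gh L.zclosure_carrier[of H]
    by (auto simp: hom_def)
  moreover have "morphism (product_variety ?G X) X (\<lambda>(g, x). g x)"
  proof (rule morphism_cong)
    show "morphism (product_variety ?G X) X ((\<lambda>(g, x). g x) \<circ> map_prod (\<lambda>g. g) (\<lambda>x. x))"
      using act inc morphism_id[OF X] unfolding regular_action_def
      by (blast intro: morphism_comp morphism_product)
  qed auto
  ultimately have actK: "regular_action (N\<lparr>carrier := ?K\<rparr>) ?G X (\<lambda>g. g)" by (simp add: regular_action_def)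
  show "algebraic_subgroup X ?G"
    using \<open>subgroup ?K (Aut X)\<close> lag actK by (simp add: algebraic_subgroup_def pts NK)
  have ff: "fundamental_field G X (\<lambda>g. g) (differential ?G G (\<lambda>g. g) B) = fundamental_field ?G X (\<lambda>g. g) B" for B
    by (rule fundamental_field_differential[OF inc orbit_morphism[OF L.affine act]]) auto
  have "Lie X ?G = fundamental_field G X (\<lambda>g. g) ` differential ?G G (\<lambda>g. g) ` tangent_space ?G \<one>\<^bsub>N\<^esub>"
    unfolding Lie_def lie_of_action_def image_image ff pts NK by simp
  then show "Lie X ?G = fundamental_field G X (\<lambda>g. g) `
      {A \<in> tangent_space G \<one>\<^bsub>N\<^esub>. \<forall>F\<in>L.vanishing H. A F = 0}"
    unfolding L.subvar_tangent[OF H] .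
qed

section \<open>Lie algebras of algebraic subgroups are locally finite\<close>

text \<open>The comorphism of the action writes all translates of \<open>f\<close> as combinations of finitely many
  functions, so their span \<open>W\<close> is finite-dimensional. For \<open>h\<close> in \<open>W\<close> the translates of \<open>h\<close> are in
  \<open>W\<close>, with coordinates \<open>h (g x\<^sub>j)\<close> in a dual basis; differentiating these coordinates at the
  identity writes \<open>\<xi> h\<close> as an element of \<open>W\<close>.\<close>

lemma Lie_locally_finite:
  fixes X :: "('a, 'k::field_char_0) variety"
  assumes X: "affine_variety X" and G: "algebraic_subgroup X G"
  shows "locally_finite X (Lie X G)"
  unfolding locally_finite_def
proof (intro ballI)
  fix f assume f: "f \<in> regular X"
  define N where "N = (Aut X)\<lparr>carrier := points G\<rparr>"
  have lagN: "linear_algebraic_group N G" and act: "regular_action N G X (\<lambda>g. g)"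
    and sub: "subgroup (points G) (Aut X)"
    using G by (auto simp: algebraic_subgroup_def N_def)
  interpret X: affine X by unfold_locales (rule X)
  interpret L: lin_group N G by unfold_locales (rule lagN)
  have multN: "(g \<otimes>\<^bsub>N\<^esub> h) y = g (h y)" if "g \<in> points G" "h \<in> points G" "y \<in> points X" for g h y
  proof -
    have "g \<in> Bij (points X)" "h \<in> Bij (points X)"
      using that subgroup.subset[OF sub] by (auto simp: carrier_Aut)
    then show ?thesis using that by (simp add: N_def Aut_def BijGroup_def compose_def)
  qed
  have mapsto: "g y \<in> points X" if "g \<in> points G" "y \<in> points X" for g y
    using that subgroup.subset[OF sub] by (auto simp: carrier_Aut dest!: Bij_imp_funcset)
  define tr where "tr = (\<lambda>g. pullback (points X) g f)"
  define W where "W = fun_vs.span (tr ` points G)"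
  have "pullback (points G \<times> points X) (\<lambda>(g, x). g x) f \<in> tensors (regular G) (regular X)"
    using act f by (simp add: regular_action_def morphism_def regular_product points_product)
  then obtain n :: nat and a b where ab: "\<And>i. i < n \<Longrightarrow> a i \<in> regular G" "\<And>i. i < n \<Longrightarrow> b i \<in> regular X"
    and e: "\<And>g x. pullback (points G \<times> points X) (\<lambda>(g, x). g x) f (g, x) = (\<Sum>i<n. a i g * b i x)"
    using tensorsE[OF _ L.subspace] by blast
  have tr: "tr g = (\<Sum>i<n. scale_fun (a i g) (b i))" if "g \<in> points G" for g
  proof
    fix x show "tr g x = (\<Sum>i<n. scale_fun (a i g) (b i)) x"
      using e[of g x] that by (cases "x \<in> points X") (simp_all add: tr_def pullback_def sum_scale_apply)
  qed
  have Wb: "W \<subseteq> fun_vs.span (b ` {..<n})" unfolding W_def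
  proof (rule fun_vs.span_minimal[OF _ fun_vs.subspace_span], clarify)
    fix g assume "g \<in> points G"
    show "tr g \<in> fun_vs.span (b ` {..<n})" unfolding tr[OF \<open>g \<in> points G\<close>]
      by (intro fun_vs.span_sum fun_vs.span_scale fun_vs.span_base) auto
  qed
  have WR: "W \<subseteq> regular X" using Wb X.span_closed[of "b ` {..<n}"] ab(2) by blast
  have Wsub: "fun_vs.subspace W" unfolding W_def by (rule fun_vs.subspace_span)
  obtain m w x where d: "dual_basis W m w x" using dual_basis_of_finite_span[OF _ Wsub Wb] by auto
  have "W = fun_vs.span (w ` {..<m})"
  proof
    show "W \<subseteq> fun_vs.span (w ` {..<m})" using dual_basis_span[OF d] by blast
    show "fun_vs.span (w ` {..<m}) \<subseteq> W" by (rule fun_vs.span_minimal[OF _ Wsub]) (use d in \<open>auto simp: dual_basis_def\<close>)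
  qed
  have wW: "w j \<in> W" if "j < m" for j using d that by (simp add: dual_basis_def)
  have wR: "w j \<in> regular X" if "j < m" for j using wW[OF that] WR by blast
  have fW: "f \<in> W"
  proof -
    have "\<one>\<^bsub>N\<^esub> \<in> points G" using L.points_eq by simp
    moreover have "tr \<one>\<^bsub>N\<^esub> = f"
      using X.vanish[OF f] by (auto simp: tr_def pullback_def N_def Aut_def BijGroup_def)
    ultimately show ?thesis unfolding W_def by (metis fun_vs.span_base image_eqI)
  qed
  have Wtr: "pullback (points X) g h \<in> W" if g: "g \<in> points G" and h: "h \<in> W" for g h
  proof (rule span_image_subset[OF pullback_add pullback_scale Wsub])
    show "h \<in> fun_vs.span (tr ` points G)" using h by (simp add: W_def)
    fix u assume "u \<in> tr ` points G"
    then obtain k where k: "k \<in> points G" "u = tr k" by blast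
    have "k \<otimes>\<^bsub>N\<^esub> g \<in> points G" using L.m_closed[of k g] k g L.points_eq by simp
    moreover have "pullback (points X) g u = tr (k \<otimes>\<^bsub>N\<^esub> g)"
      using multN[OF k(1) g] mapsto[OF g] by (auto simp: k(2) tr_def pullback_def fun_eq_iff)
    ultimately show "pullback (points X) g u \<in> W" unfolding W_def by (auto intro: fun_vs.span_base)
  qed
  have xi: "\<xi> h \<in> W" if \<xi>: "\<xi> \<in> Lie X G" and h: "h \<in> W" for \<xi> h
  proof -
    obtain A where A: "A \<in> tangent_space G \<one>\<^bsub>N\<^esub>" and \<xi>: "\<xi> = fundamental_field G X (\<lambda>g. g) A"
      using \<xi> unfolding Lie_def lie_of_action_def N_def[symmetric] by blast
    have hR: "h \<in> regular X" using h WR by blast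
    have orb: "pullback (points G) (\<lambda>g. g y) h \<in> regular G" if "y \<in> points X" for y
      using orbit_morphism[OF L.affine act that] hR by (simp add: morphism_def)
    have "h (g y) = (\<Sum>j<m. h (g (x j)) * w j y)" if g: "g \<in> points G" and y: "y \<in> points X" "\<And>j. j < m \<Longrightarrow> x j \<in> points X" for g y
      using dual_basis_expand[OF d Wtr[OF g h], of y] y by (simp add: pullback_def)
    moreover have xp: "x j \<in> points X" if "j < m" for j
    proof (rule ccontr)
      assume "x j \<notin> points X"
      then have "w j (x j) = 0" using X.vanish[OF wR[OF that]] by simp
      then show False using d that by (auto simp: dual_basis_def)
    qed
    ultimately have ex: "pullback (points G) (\<lambda>g. g y) h = (\<Sum>j<m. scale_fun (w j y) (pullback (points G) (\<lambda>g. g (x j)) h))"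
      if "y \<in> points X" for y
      using that by (auto simp: fun_eq_iff pullback_def sum_scale_apply mult.commute)
    have "\<xi> h y = (\<Sum>j<m. scale_fun (A (pullback (points G) (\<lambda>g. g (x j)) h)) (w j)) y" for y
    proof (cases "y \<in> points X")
      case True
      have "\<xi> h y = A (pullback (points G) (\<lambda>g. g y) h)" using True hR by (simp add: \<xi> fundamental_field_def differential_def)
      also have "\<dots> = (\<Sum>j<m. w j y * A (pullback (points G) (\<lambda>g. g (x j)) h))"
        unfolding ex[OF True] by (rule L.tangent_sum[OF A]) (use orb xp in auto)
      finally show ?thesis by (simp add: sum_scale_apply mult.commute)
    next
      case False
      have "w j y = 0" if "j < m" for j using X.vanish[OF wR[OF that] False] .
      then show ?thesis using False by (simp add: \<xi> fundamental_field_def sum_scale_apply)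
    qed
    then have "\<xi> h = (\<Sum>j<m. scale_fun (A (pullback (points G) (\<lambda>g. g (x j)) h)) (w j))" by (rule ext)
    also have "\<dots> \<in> W" by (intro fun_vs.subspace_sum[OF Wsub] fun_vs.subspace_scale[OF Wsub] wW) auto
    finally show ?thesis .
  qed
  show "\<exists>W\<subseteq>regular X. f \<in> W \<and> (\<exists>B. finite B \<and> W = fun_vs.span B) \<and> (\<forall>\<delta>\<in>Lie X G. \<forall>w\<in>W. \<delta> w \<in> W)"
    using WR fW xi \<open>W = fun_vs.span (w ` {..<m})\<close> by (intro exI[of _ W]) blast
qed

section \<open>The automorphisms that preserve a generating space of functions\<close>

context affine
begin

definition alg_end :: "(('a \<Rightarrow> 'k) \<Rightarrow> 'a \<Rightarrow> 'k) \<Rightarrow> bool"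
  where "alg_end T \<longleftrightarrow> (\<forall>f\<in>regular X. T f \<in> regular X) \<and>
    (\<forall>c. T (const_on (points X) c) = const_on (points X) c) \<and>
    (\<forall>f\<in>regular X. \<forall>g\<in>regular X. T (f + g) = T f + T g) \<and>
    (\<forall>f\<in>regular X. \<forall>g\<in>regular X. T (f * g) = T f * T g)"

lemma Aut_maps:
  assumes "g \<in> carrier (Aut X)" "y \<in> points X"
  shows "g y \<in> points X" "inv_into (points X) g y \<in> points X"
    "g (inv_into (points X) g y) = y" "inv_into (points X) g (g y) = y"
proof -
  have g: "g \<in> Bij (points X)" using assms(1) by (simp add: carrier_Aut)
  then have im: "g ` points X = points X" and inj: "inj_on g (points X)"
    by (simp_all add: Bij_def bij_betw_def)
  show "g y \<in> points X" using im assms(2) by blast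
  show "inv_into (points X) g y \<in> points X" using im assms(2) by (metis inv_into_into)
  show "g (inv_into (points X) g y) = y" using im assms(2) by (metis f_inv_into_f)
  show "inv_into (points X) g (g y) = y" using inj assms(2) by simp
qed

lemma Aut_inv_into_eq:
  assumes "g \<in> carrier (Aut X)" "y \<in> points X" "g y = z"
  shows "inv_into (points X) g z = y"
  using Aut_maps(4)[OF assms(1,2)] assms(3) by simp

lemma Aut_pullback_closed:
  assumes "g \<in> carrier (Aut X)" "f \<in> regular X"
  shows "pullback (points X) g f \<in> regular X"
  using assms by (simp add: carrier_Aut morphism_def)

lemma Aut_of_inverse_maps:
  assumes a: "\<And>y. y \<in> points X \<Longrightarrow> a y \<in> points X" and b: "\<And>y. y \<in> points X \<Longrightarrow> b y \<in> points X"
    and ab: "\<And>y. y \<in> points X \<Longrightarrow> a (b y) = y" and ba: "\<And>y. y \<in> points X \<Longrightarrow> b (a y) = y"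
    and ra: "\<And>f. f \<in> regular X \<Longrightarrow> pullback (points X) a f \<in> regular X"
    and rb: "\<And>f. f \<in> regular X \<Longrightarrow> pullback (points X) b f \<in> regular X"
  shows "restrict a (points X) \<in> carrier (Aut X)"
    and "\<And>y. y \<in> points X \<Longrightarrow> inv_into (points X) (restrict a (points X)) y = b y"
proof -
  let ?a = "restrict a (points X)"
  have bij: "bij_betw ?a (points X) (points X)"
    by (rule bij_betwI[where g = b]) (use a b ab ba in auto)
  then have B: "?a \<in> Bij (points X)" by (simp add: Bij_def)
  show inv: "inv_into (points X) ?a y = b y" if "y \<in> points X" for y
    by (rule inv_into_f_eq) (use bij b ab that in \<open>auto simp: bij_betw_def\<close>)
  have "morphism X X a" "morphism X X b" using a b ra rb by (auto simp: morphism_def)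
  then show "?a \<in> carrier (Aut X)"
    unfolding carrier_Aut using B by (auto intro: morphism_cong simp: inv)
qed

lemma points_eqI:
  assumes "x \<in> points X" "y \<in> points X" "regular X = gen_algebra (points X) S" "\<And>f. f \<in> S \<Longrightarrow> f x = f y"
  shows "x = y"
  by (rule affine_points_eqI[OF affine assms(1,2)]) (use gen_algebra_agree[OF _ assms(1,2,4)] assms(3) in blast)

lemma automorphism_of_alg_ends:
  assumes T: "alg_end T" and T': "alg_end T'"
    and inv: "\<And>f. f \<in> regular X \<Longrightarrow> T (T' f) = f" "\<And>f. f \<in> regular X \<Longrightarrow> T' (T f) = f"
  shows "\<exists>g\<in>carrier (Aut X). \<forall>f\<in>regular X. \<forall>y\<in>points X.
    f (g y) = T f y \<and> f (inv_into (points X) g y) = T' f y"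
proof -
  have pm: "\<exists>\<phi>. \<forall>y\<in>points X. \<phi> y \<in> points X \<and> (\<forall>f\<in>regular X. f (\<phi> y) = T f y)" if "alg_end T" for T
    by (rule comorphism_point_map[OF affine]) (use that in \<open>auto simp: alg_end_def const_on_def\<close>)
  obtain a where a: "\<And>y. y \<in> points X \<Longrightarrow> a y \<in> points X" "\<And>y f. y \<in> points X \<Longrightarrow> f \<in> regular X \<Longrightarrow> f (a y) = T f y"
    using pm[OF T] by blast
  obtain b where b: "\<And>y. y \<in> points X \<Longrightarrow> b y \<in> points X" "\<And>y f. y \<in> points X \<Longrightarrow> f \<in> regular X \<Longrightarrow> f (b y) = T' f y"
    using pm[OF T'] by blast
  have reg: "T f \<in> regular X" "T' f \<in> regular X" if "f \<in> regular X" for f using T T' that by (auto simp: alg_end_def)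
  have ab: "a (b y) = y" if y: "y \<in> points X" for y
    by (rule affine_points_eqI[OF affine]) (use y in \<open>simp_all add: a b reg inv\<close>)
  have ba: "b (a y) = y" if y: "y \<in> points X" for y
    by (rule affine_points_eqI[OF affine]) (use y in \<open>simp_all add: a b reg inv\<close>)
  have pa: "pullback (points X) a f = T f" "pullback (points X) b f = T' f" if "f \<in> regular X" for f
    using a(2) b(2) that vanish[OF reg(1)[OF that]] vanish[OF reg(2)[OF that]] by (auto simp: pullback_def fun_eq_iff)
  note A = Aut_of_inverse_maps[of a b, OF a(1) b(1) ab ba]
  show ?thesis
    by (rule bexI[of _ "restrict a (points X)"]) (use A a b pa reg in auto)
qed

lemma Aut_inv:
  assumes "g \<in> carrier (Aut X)"
  shows "inv\<^bsub>Aut X\<^esub> g = (\<lambda>y\<in>points X. inv_into (points X) g y)"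
proof -
  have "inv\<^bsub>Aut X\<^esub> g = inv\<^bsub>BijGroup (points X)\<^esub> g"
    using group.m_inv_consistent[OF group_BijGroup subgroup_Aut[OF affine] assms] by (simp flip: Aut_eq)
  then show ?thesis using assms by (simp add: inv_BijGroup carrier_Aut)
qed

lemma Aut_mult:
  assumes "g \<in> carrier (Aut X)" "h \<in> carrier (Aut X)"
  shows "g \<otimes>\<^bsub>Aut X\<^esub> h = compose (points X) g h"
  using assms by (simp add: carrier_Aut) (simp add: Aut_def BijGroup_def)

lemma Aut_one: "\<one>\<^bsub>Aut X\<^esub> = (\<lambda>y\<in>points X. y)"
  by (simp add: Aut_def BijGroup_def)

lemma Aut_eqI:
  assumes "g \<in> carrier (Aut X)" "h \<in> carrier (Aut X)" "\<And>y. y \<in> points X \<Longrightarrow> g y = h y"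
  shows "g = h"
  using assms by (auto simp: carrier_Aut dest!: Bij_imp_extensional intro: extensionalityI)

end

locale stab = affine X for X :: "('a, 'k::field_char_0) variety" +
  fixes U :: "('a \<Rightarrow> 'k) set" and m :: nat and v :: "nat \<Rightarrow> 'a \<Rightarrow> 'k" and x :: "nat \<Rightarrow> 'a"
  assumes U_subspace: "fun_vs.subspace U" and U_regular: "U \<subseteq> regular X"
    and dual: "dual_basis U m v x" and gen: "regular X = gen_algebra (points X) U"
begin

definition S where "S = {g \<in> carrier (Aut X). \<forall>u\<in>U. pullback (points X) g u \<in> U \<and>
    pullback (points X) (inv_into (points X) g) u \<in> U}"

abbreviation iv where "iv \<equiv> inv_into (points X)"

text \<open>The matrix entries of the operators that \<open>S\<close> induces on functions, read off at the point \<open>y\<close>.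
  The parameter \<open>\<alpha>\<close> is either the identity or inversion, so that both halves of an argument about
  \<open>g\<close> and its inverse are proved at once.\<close>

definition ev :: "(('a \<Rightarrow> 'a) \<Rightarrow> 'a \<Rightarrow> 'a) \<Rightarrow> ('a \<Rightarrow> 'k) \<Rightarrow> 'a \<Rightarrow> ('a \<Rightarrow> 'a) \<Rightarrow> 'k"
  where "ev \<alpha> u y = (\<lambda>g. if g \<in> S then u (\<alpha> g y) else 0)"

definition gens where "gens = (\<lambda>(i, j). ev (\<lambda>g. g) (v i) (x j)) ` ({..<m} \<times> {..<m}) \<union>
   (\<lambda>(i, j). ev iv (v i) (x j)) ` ({..<m} \<times> {..<m})"

definition G0 :: "('a \<Rightarrow> 'a, 'k) variety" where "G0 = \<lparr>points = S, regular = gen_algebra S gens\<rparr>"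

text \<open>What the identity and inversion on \<open>S\<close> have in common.\<close>

definition good where "good \<alpha> \<longleftrightarrow> (\<forall>g\<in>S. \<forall>y\<in>points X. \<alpha> g y \<in> points X) \<and>
  (\<forall>g\<in>S. \<forall>u\<in>U. pullback (points X) (\<alpha> g) u \<in> U) \<and> (\<forall>i<m. \<forall>j<m. ev \<alpha> (v i) (x j) \<in> gens)"

lemma S_Aut: "g \<in> S \<Longrightarrow> g \<in> carrier (Aut X)" by (simp add: S_def)

lemma good_id: "good (\<lambda>g. g)"
  by (auto simp: good_def S_def Aut_maps gens_def)

lemma good_iv: "good iv"
  by (auto simp: good_def S_def Aut_maps gens_def)

lemma v_U: "i < m \<Longrightarrow> v i \<in> U" using dual by (simp add: dual_basis_def)

lemma v_regular: "i < m \<Longrightarrow> v i \<in> regular X" using v_U U_regular by blast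

lemma x_points: assumes "j < m" shows "x j \<in> points X"
proof (rule ccontr)
  assume "x j \<notin> points X"
  then have "v j (x j) = 0" using vanish[OF v_regular[OF assms]] by simp
  then show False using dual assms by (auto simp: dual_basis_def)
qed

lemma U_expand: "u \<in> U \<Longrightarrow> u y = (\<Sum>i<m. u (x i) * v i y)"
  by (rule dual_basis_expand[OF dual])

lemma good_expand:
  assumes "good \<alpha>" "g \<in> S" "u \<in> U" "y \<in> points X"
  shows "u (\<alpha> g y) = (\<Sum>l<m. u (\<alpha> g (x l)) * v l y)"
proof -
  have "pullback (points X) (\<alpha> g) u \<in> U" using assms by (simp add: good_def)
  from U_expand[OF this, of y] show ?thesis using assms(4) x_points by (simp add: pullback_def)
qed

sublocale G: function_algebra S "gen_algebra S gens"
  by (rule function_algebra_gen) (auto simp: gens_def ev_def)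

lemma ev_add: "ev \<alpha> (f + g) y = ev \<alpha> f y + ev \<alpha> g y" by (auto simp: ev_def)
lemma ev_mult: "ev \<alpha> (f * g) y = ev \<alpha> f y * ev \<alpha> g y" by (auto simp: ev_def)
lemma ev_const: "good \<alpha> \<Longrightarrow> y \<in> points X \<Longrightarrow> ev \<alpha> (const_on (points X) c) y = const_on S c"
  by (auto simp: ev_def const_on_def good_def)

lemma ev_expand:
  assumes "good \<alpha>" "u \<in> U" "y \<in> points X"
  shows "ev \<alpha> u y = (\<Sum>l<m. scale_fun (v l y) (ev \<alpha> u (x l)))"
proof
  fix g show "ev \<alpha> u y g = (\<Sum>l<m. scale_fun (v l y) (ev \<alpha> u (x l))) g"
    using good_expand[OF assms(1) _ assms(2,3)] by (simp add: ev_def sum_scale_apply mult.commute)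
qed

lemma ev_U_closed:
  assumes "good \<alpha>" "u \<in> U" "l < m"
  shows "ev \<alpha> u (x l) \<in> gen_algebra S gens"
proof -
  have "ev \<alpha> u (x l) = (\<Sum>i<m. scale_fun (u (x i)) (ev \<alpha> (v i) (x l)))"
  proof
    fix g show "ev \<alpha> u (x l) g = (\<Sum>i<m. scale_fun (u (x i)) (ev \<alpha> (v i) (x l))) g"
      using U_expand[OF assms(2), of "\<alpha> g (x l)"] by (simp add: ev_def sum_scale_apply)
  qed
  also have "\<dots> \<in> gen_algebra S gens"
    by (intro G.sum_closed G.scale_closed gen_algebra.gen) (use assms in \<open>auto simp: good_def\<close>)
  finally show ?thesis .
qed

text \<open>Orbit maps are regular on \<open>S\<close>: for functions in \<open>U\<close> by linear expansion in the matrix entries,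
  and in general because \<open>U\<close> generates.\<close>

lemma ev_closed:
  assumes \<alpha>: "good \<alpha>" and f: "f \<in> regular X" and y: "y \<in> points X"
  shows "ev \<alpha> f y \<in> gen_algebra S gens"
proof -
  have "gen_algebra (points X) U \<subseteq> {f. ev \<alpha> f y \<in> gen_algebra S gens}"
  proof (rule gen_algebra_subset)
    show "const_on (points X) c \<in> {f. ev \<alpha> f y \<in> gen_algebra S gens}" for c
      using ev_const[OF \<alpha> y] G.const_closed by simp
    show "U \<subseteq> {f. ev \<alpha> f y \<in> gen_algebra S gens}"
    proof
      fix u assume u: "u \<in> U"
      have "ev \<alpha> u y \<in> gen_algebra S gens"
        unfolding ev_expand[OF \<alpha> u y] by (intro G.sum_closed G.scale_closed ev_U_closed \<alpha> u) auto
      then show "u \<in> {f. ev \<alpha> f y \<in> gen_algebra S gens}" by blast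
    qed
  qed (auto simp: ev_add ev_mult intro: G.add_closed G.mult_closed)
  then show ?thesis using f gen by blast
qed

text \<open>Applying the character to the matrix entries of \<open>g\<close> and of its inverse gives two algebra
  endomorphisms, hence two maps \<open>a\<close> and \<open>b\<close> of \<open>X\<close>. The relation that the two matrices are inverse
  to each other is an identity in the algebra, so it survives the character and makes \<open>a\<close> and \<open>b\<close>
  inverse to each other.\<close>

lemma G0_character:
  assumes \<chi>: "character S (gen_algebra S gens) \<chi>"
  shows "\<exists>g\<in>S. \<forall>f\<in>gens. \<chi> f = f g"
proof -
  have \<chi>c: "\<chi> (const_on S c) = c" for c using \<chi> by (simp add: character_def)
  have \<chi>a: "\<chi> (f + g) = \<chi> f + \<chi> g" and \<chi>m: "\<chi> (f * g) = \<chi> f * \<chi> g"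
    if "f \<in> gen_algebra S gens" "g \<in> gen_algebra S gens" for f g
    using \<chi> that by (auto simp: character_def)
  have \<chi>s: "\<chi> (scale_fun c f) = c * \<chi> f" if "f \<in> gen_algebra S gens" for c f
    using \<chi>m[OF G.const_closed that] \<chi>c by (simp add: G.scale_eq[OF that])
  have \<chi>0: "\<chi> 0 = 0" using \<chi>s[OF G.zero_closed, of 0] by simp
  have \<chi>sum: "\<chi> (\<Sum>i<n. f i) = (\<Sum>i<n. \<chi> (f i))" if "\<And>i. i < n \<Longrightarrow> f i \<in> gen_algebra S gens" for f and n :: nat
    using that
  proof (induction n)
    case (Suc n)
    have "\<chi> ((\<Sum>i<n. f i) + f n) = \<chi> (\<Sum>i<n. f i) + \<chi> (f n)"
      by (rule \<chi>a) (use Suc.prems in \<open>auto intro: G.sum_closed\<close>)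
    also have "\<chi> (\<Sum>i<n. f i) = (\<Sum>i<n. \<chi> (f i))" by (rule Suc.IH) (use Suc.prems in auto)
    finally have e: "\<chi> ((\<Sum>i<n. f i) + f n) = (\<Sum>i<n. \<chi> (f i)) + \<chi> (f n)" .
    show ?case unfolding sum.lessThan_Suc by (rule e)
  next
    case 0
    have "\<chi> (\<Sum>i<0. f i) = (\<Sum>i<0. \<chi> (f i))" using \<chi>0 by simp
    then show ?case .
  qed
  have map: "\<exists>a. \<forall>y\<in>points X. a y \<in> points X \<and> (\<forall>f\<in>regular X. f (a y) = \<chi> (ev \<alpha> f y))" if \<alpha>: "good \<alpha>" for \<alpha>
    by (rule comorphism_point_map[OF affine])
      (simp_all add: ev_const[OF \<alpha>] \<chi>c ev_add ev_mult \<chi>a \<chi>m ev_closed[OF \<alpha>])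
  obtain a where a: "\<And>y. y \<in> points X \<Longrightarrow> a y \<in> points X"
    "\<And>y f. y \<in> points X \<Longrightarrow> f \<in> regular X \<Longrightarrow> f (a y) = \<chi> (ev (\<lambda>g. g) f y)"
    using map[OF good_id] by blast
  obtain b where b: "\<And>y. y \<in> points X \<Longrightarrow> b y \<in> points X"
    "\<And>y f. y \<in> points X \<Longrightarrow> f \<in> regular X \<Longrightarrow> f (b y) = \<chi> (ev iv f y)"
    using map[OF good_iv] by blast
  have comp: "a (b y) = y" if y: "y \<in> points X" and \<alpha>: "good \<alpha>" and \<beta>: "good \<beta>"
    and a: "\<And>y. y \<in> points X \<Longrightarrow> a y \<in> points X" "\<And>y f. y \<in> points X \<Longrightarrow> f \<in> regular X \<Longrightarrow> f (a y) = \<chi> (ev \<alpha> f y)"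
    and b: "\<And>y. y \<in> points X \<Longrightarrow> b y \<in> points X" "\<And>y f. y \<in> points X \<Longrightarrow> f \<in> regular X \<Longrightarrow> f (b y) = \<chi> (ev \<beta> f y)"
    and inv: "\<And>g y. g \<in> S \<Longrightarrow> y \<in> points X \<Longrightarrow> \<alpha> g (\<beta> g y) = y" for a b \<alpha> \<beta> y
  proof (rule points_eqI[OF _ y gen])
    show "a (b y) \<in> points X" using a b y by simp
    fix u assume u: "u \<in> U"
    then have ur: "u \<in> regular X" using U_regular by blast
    have c1: "ev \<alpha> u (x l) \<in> gen_algebra S gens" "ev \<beta> (v l) y \<in> gen_algebra S gens" if "l < m" for l
      using ev_U_closed[OF \<alpha> u that] ev_closed[OF \<beta> v_regular[OF that] y] by auto
    have "u (a (b y)) = \<chi> (\<Sum>l<m. scale_fun (v l (b y)) (ev \<alpha> u (x l)))"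
      using a(2)[OF b(1)[OF y] ur] ev_expand[OF \<alpha> u b(1)[OF y]] by simp
    also have "\<dots> = (\<Sum>l<m. v l (b y) * \<chi> (ev \<alpha> u (x l)))"
      using c1 by (subst \<chi>sum) (auto intro: G.scale_closed simp: \<chi>s)
    also have "\<dots> = (\<Sum>l<m. \<chi> (ev \<beta> (v l) y * ev \<alpha> u (x l)))"
      by (rule sum.cong) (use b(2)[OF y v_regular] c1 \<chi>m in auto)
    also have "\<dots> = \<chi> (\<Sum>l<m. ev \<beta> (v l) y * ev \<alpha> u (x l))"
      by (rule \<chi>sum[symmetric]) (use c1 G.mult_closed in auto)
    also have "(\<Sum>l<m. ev \<beta> (v l) y * ev \<alpha> u (x l)) = const_on S (u y)"
    proof
      fix g show "(\<Sum>l<m. ev \<beta> (v l) y * ev \<alpha> u (x l)) g = const_on S (u y) g"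
      proof (cases "g \<in> S")
        case True
        have "\<beta> g y \<in> points X" using \<beta> True y by (simp add: good_def)
        from good_expand[OF \<alpha> True u this] show ?thesis
          using True inv[OF True y] by (simp add: ev_def sum_fun_apply const_on_def mult.commute)
      qed (simp add: ev_def sum_fun_apply const_on_def)
    qed
    finally show "u (a (b y)) = u y" by (simp add: \<chi>c)
  qed
  have ab: "a (b y) = y" if "y \<in> points X" for y
    by (rule comp[OF that good_id good_iv a b]) (use Aut_maps S_Aut in auto)
  have ba: "b (a y) = y" if "y \<in> points X" for y
    by (rule comp[OF that good_iv good_id b a]) (use Aut_maps S_Aut in auto)
  have pU: "pullback (points X) a u \<in> U" if u: "u \<in> U" and \<alpha>: "good \<alpha>"
    and a: "\<And>y f. y \<in> points X \<Longrightarrow> f \<in> regular X \<Longrightarrow> f (a y) = \<chi> (ev \<alpha> f y)" for a u \<alpha>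
  proof -
    have ur: "u \<in> regular X" using u U_regular by blast
    have "pullback (points X) a u = (\<Sum>l<m. scale_fun (\<chi> (ev \<alpha> u (x l))) (v l))"
    proof
      fix y show "pullback (points X) a u y = (\<Sum>l<m. scale_fun (\<chi> (ev \<alpha> u (x l))) (v l)) y"
      proof (cases "y \<in> points X")
        case True
        have "u (a y) = (\<Sum>l<m. v l y * \<chi> (ev \<alpha> u (x l)))"
          unfolding a[OF True ur] ev_expand[OF \<alpha> u True]
          using ev_U_closed[OF \<alpha> u] by (subst \<chi>sum) (auto intro: G.scale_closed simp: \<chi>s)
        then show ?thesis using True by (simp add: pullback_def sum_scale_apply mult.commute)
      next
        case False
        then show ?thesis using vanish[OF v_regular] by (simp add: pullback_def sum_scale_apply)
      qed
    qed
    also have "\<dots> \<in> U" by (intro fun_vs.subspace_sum[OF U_subspace] fun_vs.subspace_scale[OF U_subspace] v_U) auto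
    finally show ?thesis .
  qed
  have pR: "pullback (points X) a f \<in> regular X" if f: "f \<in> regular X" and \<alpha>: "good \<alpha>"
    and a: "\<And>y. y \<in> points X \<Longrightarrow> a y \<in> points X" "\<And>y f. y \<in> points X \<Longrightarrow> f \<in> regular X \<Longrightarrow> f (a y) = \<chi> (ev \<alpha> f y)" for a f \<alpha>
  proof -
    have "gen_algebra (points X) U \<subseteq> {f. pullback (points X) a f \<in> regular X}"
    proof (rule gen_algebra_subset)
      show "const_on (points X) c \<in> {f. pullback (points X) a f \<in> regular X}" for c
      proof -
        have "pullback (points X) a (const_on (points X) c) = const_on (points X) c"
          using a(1) by (auto simp: pullback_def const_on_def)
        then show ?thesis using const_closed by simp
      qed
    qed (use pU[OF _ \<alpha> a(2)] U_regular in \<open>auto simp: pullback_add pullback_mult intro: add_closed mult_closed\<close>)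
    then show ?thesis using f gen by blast
  qed
  let ?g = "restrict a (points X)"
  have g: "?g \<in> carrier (Aut X)" and ig: "\<And>y. y \<in> points X \<Longrightarrow> iv ?g y = b y"
  proof -
    have pa: "pullback (points X) a f \<in> regular X" if "f \<in> regular X" for f
      by (rule pR[OF that good_id a])
    have pb: "pullback (points X) b f \<in> regular X" if "f \<in> regular X" for f
      by (rule pR[OF that good_iv b])
    show "?g \<in> carrier (Aut X)" by (rule Aut_of_inverse_maps(1)[of a b, OF a(1) b(1) ab ba pa pb])
    show "iv ?g y = b y" if "y \<in> points X" for y
      by (rule Aut_of_inverse_maps(2)[of a b, OF a(1) b(1) ab ba pa pb that])
  qed
  have "pullback (points X) ?g u = pullback (points X) a u" "pullback (points X) (iv ?g) u = pullback (points X) b u" for u :: "'a \<Rightarrow> 'k"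
    using ig by (auto simp: pullback_def fun_eq_iff)
  moreover have "pullback (points X) a u \<in> U" "pullback (points X) b u \<in> U" if "u \<in> U" for u
    by (rule pU[OF that good_id a(2)], assumption+, rule pU[OF that good_iv b(2)], assumption+)
  ultimately have gS: "?g \<in> S" unfolding S_def using g by simp
  have "\<chi> f = f ?g" if fg: "f \<in> gens" for f
  proof -
    obtain i j where ij: "i < m" "j < m" and "f = ev (\<lambda>g. g) (v i) (x j) \<or> f = ev iv (v i) (x j)"
      using fg by (auto simp: gens_def)
    then show ?thesis
      using a(2)[OF x_points[OF ij(2)] v_regular[OF ij(1)]] b(2)[OF x_points[OF ij(2)] v_regular[OF ij(1)]]
        gS x_points[OF ij(2)] ig[OF x_points[OF ij(2)]] by (auto simp: ev_def)
  qed
  then show ?thesis using gS by blast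
qed

lemma G0_affine: "affine_variety G0"
  unfolding G0_def
proof (rule affine_varietyI)
  show "finite gens" by (simp add: gens_def)
  show "f g = 0" if "f \<in> gens" "g \<notin> S" for f g using that by (auto simp: gens_def ev_def)
  show "g = h" if gh: "g \<in> S" "h \<in> S" "\<And>f. f \<in> gens \<Longrightarrow> f g = f h" for g h
  proof (rule Aut_eqI[OF S_Aut[OF gh(1)] S_Aut[OF gh(2)]])
    fix y assume y: "y \<in> points X"
    show "g y = h y"
    proof (rule affine_points_eqI[OF affine])
      show "g y \<in> points X" "h y \<in> points X" using Aut_maps S_Aut gh y by auto
      fix f assume "f \<in> regular X"
      then have "ev (\<lambda>g. g) f y \<in> gen_algebra S gens" by (rule ev_closed[OF good_id _ y])
      then have "ev (\<lambda>g. g) f y g = ev (\<lambda>g. g) f y h" by (rule gen_algebra_agree) (use gh in auto)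
      then show "f (g y) = f (h y)" using gh by (simp add: ev_def)
    qed
  qed
qed (rule G0_character)

lemma S_mult:
  assumes "g \<in> S" "h \<in> S"
  shows "compose (points X) g h \<in> S" "\<And>y. y \<in> points X \<Longrightarrow> iv (compose (points X) g h) y = iv h (iv g y)"
proof -
  have gh: "g \<in> carrier (Aut X)" "h \<in> carrier (Aut X)" using assms S_Aut by auto
  have c: "compose (points X) g h \<in> carrier (Aut X)"
    using group.subgroup_self[OF group_Aut[OF affine]] subgroup.m_closed[of _ "Aut X" g h] gh by (simp add: Aut_mult)
  show i: "iv (compose (points X) g h) y = iv h (iv g y)" if "y \<in> points X" for y
  proof (rule Aut_inv_into_eq[OF c])
    have iy: "iv g y \<in> points X" by (rule Aut_maps(2)[OF gh(1) that])
    then show "iv h (iv g y) \<in> points X" by (rule Aut_maps(2)[OF gh(2)])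
    then show "compose (points X) g h (iv h (iv g y)) = y"
      by (simp add: compose_def Aut_maps(3)[OF gh(2) iy] Aut_maps(3)[OF gh(1) that])
  qed
  have "pullback (points X) (compose (points X) g h) u = pullback (points X) h (pullback (points X) g u)"
    "pullback (points X) (iv (compose (points X) g h)) u = pullback (points X) (iv g) (pullback (points X) (iv h) u)"
    for u :: "'a \<Rightarrow> 'k"
    using gh Aut_maps i by (auto simp: pullback_def compose_def fun_eq_iff)
  then show "compose (points X) g h \<in> S" using c assms by (auto simp: S_def)
qed

lemma S_inv:
  assumes "g \<in> S"
  shows "restrict (iv g) (points X) \<in> S" "\<And>y. y \<in> points X \<Longrightarrow> iv (restrict (iv g) (points X)) y = g y"
proof -
  have g: "g \<in> carrier (Aut X)" using assms S_Aut by auto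
  have c: "restrict (iv g) (points X) \<in> carrier (Aut X)"
    using group.inv_closed[OF group_Aut[OF affine] g] by (simp add: Aut_inv[OF g])
  show i: "iv (restrict (iv g) (points X)) y = g y" if "y \<in> points X" for y
    by (rule Aut_inv_into_eq[OF c]) (use g that Aut_maps in auto)
  have "pullback (points X) (restrict (iv g) (points X)) u = pullback (points X) (iv g) u"
    "pullback (points X) (iv (restrict (iv g) (points X))) u = pullback (points X) g u"
    for u :: "'a \<Rightarrow> 'k"
    using i by (auto simp: pullback_def fun_eq_iff)
  then show "restrict (iv g) (points X) \<in> S" using c assms by (auto simp: S_def)
qed

lemma S_subgroup: "subgroup S (Aut X)"
proof -
  interpret A: group "Aut X" by (rule group_Aut[OF affine])
  show ?thesis
  proof (rule A.subgroupI)
    show "S \<subseteq> carrier (Aut X)" using S_Aut by blast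
    have i: "iv \<one>\<^bsub>Aut X\<^esub> y = y" if "y \<in> points X" for y
      by (rule Aut_inv_into_eq[OF A.one_closed that]) (use that in \<open>simp add: Aut_one\<close>)
    have "pullback (points X) \<one>\<^bsub>Aut X\<^esub> u = u" "pullback (points X) (iv \<one>\<^bsub>Aut X\<^esub>) u = u" if "u \<in> U" for u
    proof -
      have "u \<in> regular X" using that U_regular by blast
      then show "pullback (points X) \<one>\<^bsub>Aut X\<^esub> u = u" "pullback (points X) (iv \<one>\<^bsub>Aut X\<^esub>) u = u"
        using i vanish by (auto simp: pullback_def Aut_one[symmetric] fun_eq_iff) (simp add: Aut_one)
    qed
    then have "\<one>\<^bsub>Aut X\<^esub> \<in> S" by (simp add: S_def)
    then show "S \<noteq> {}" by blast
    show "inv\<^bsub>Aut X\<^esub> g \<in> S" if "g \<in> S" for g using S_inv(1)[OF that] Aut_inv[OF S_Aut[OF that]] by simp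
    show "g \<otimes>\<^bsub>Aut X\<^esub> h \<in> S" if "g \<in> S" "h \<in> S" for g h
      using S_mult(1)[OF that] Aut_mult[OF S_Aut S_Aut] that by simp
  qed
qed

abbreviation N where "N \<equiv> (Aut X)\<lparr>carrier := S\<rparr>"

lemma N_mult: "g \<in> S \<Longrightarrow> h \<in> S \<Longrightarrow> g \<otimes>\<^bsub>N\<^esub> h = compose (points X) g h"
  using Aut_mult[OF S_Aut S_Aut] by simp

lemma N_inv: "g \<in> S \<Longrightarrow> inv\<^bsub>N\<^esub> g = restrict (iv g) (points X)"
  using group.m_inv_consistent[OF group_Aut[OF affine] S_subgroup] Aut_inv[OF S_Aut] by simp

lemma G0_group: "linear_algebraic_group N G0"
proof -
  let ?R = "gen_algebra S gens"
  have pts: "points G0 = S" and reg: "regular G0 = ?R" by (simp_all add: G0_def)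
  have grp: "group N" by (rule subgroup.subgroup_is_group[OF S_subgroup group_Aut[OF affine]])
  let ?c = "pullback (S \<times> S) (\<lambda>(g, h). g \<otimes>\<^bsub>N\<^esub> h)"
  have "?R \<subseteq> {f. ?c f \<in> tensors ?R ?R}"
  proof (rule gen_algebra_subset)
    fix c :: 'k
    have "?c (const_on S c) \<in> tensors ?R ?R"
      by (rule tensorsI[of "{()}" "\<lambda>_. const_on S c" _ "\<lambda>_. const_on S 1"])
        (use S_mult(1) N_mult G.const_closed in \<open>auto simp: pullback_def const_on_def\<close>)
    then show "const_on S c \<in> {f. ?c f \<in> tensors ?R ?R}" by blast
  next
    show "gens \<subseteq> {f. ?c f \<in> tensors ?R ?R}"
    proof
      fix f assume "f \<in> gens"
      then obtain i j where ij: "i < m" "j < m" and f: "f = ev (\<lambda>g. g) (v i) (x j) \<or> f = ev iv (v i) (x j)"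
        by (auto simp: gens_def)
      have xj: "x j \<in> points X" by (rule x_points[OF ij(2)])
      have 1: "?c (ev (\<lambda>g. g) (v i) (x j)) \<in> tensors ?R ?R"
      proof (rule tensorsI[of "{..<m}" "\<lambda>l. ev (\<lambda>g. g) (v i) (x l)" _ "\<lambda>l. ev (\<lambda>g. g) (v l) (x j)"])
        show "?c (ev (\<lambda>g. g) (v i) (x j)) (g, h) = (\<Sum>l<m. ev (\<lambda>g. g) (v i) (x l) g * ev (\<lambda>g. g) (v l) (x j) h)" for g h
        proof (cases "g \<in> S \<and> h \<in> S")
          case True
          then have "v i (g (h (x j))) = (\<Sum>l<m. v i (g (x l)) * v l (h (x j)))"
            using good_expand[OF good_id _ v_U[OF ij(1)], of g "h (x j)"] Aut_maps(1)[OF S_Aut xj] by simp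
          moreover have "compose (points X) g h \<in> S" "compose (points X) g h (x j) = g (h (x j))"
            using True S_mult(1) xj by (blast, simp add: compose_def)
          ultimately show ?thesis using True xj by (simp add: pullback_def ev_def Aut_mult[OF S_Aut S_Aut])
        qed (auto simp: pullback_def ev_def)
      qed (use ij ev_closed[OF good_id v_regular x_points] xj in auto)
      have 2: "?c (ev iv (v i) (x j)) \<in> tensors ?R ?R"
      proof (rule tensorsI[of "{..<m}" "\<lambda>l. ev iv (v l) (x j)" _ "\<lambda>l. ev iv (v i) (x l)"])
        show "?c (ev iv (v i) (x j)) (g, h) = (\<Sum>l<m. ev iv (v l) (x j) g * ev iv (v i) (x l) h)" for g h
        proof (cases "g \<in> S \<and> h \<in> S")
          case True
          then have "v i (iv h (iv g (x j))) = (\<Sum>l<m. v i (iv h (x l)) * v l (iv g (x j)))"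
            using good_expand[OF good_iv _ v_U[OF ij(1)], of h "iv g (x j)"] Aut_maps(2)[OF S_Aut xj] by simp
          moreover have "compose (points X) g h \<in> S" "iv (compose (points X) g h) (x j) = iv h (iv g (x j))"
            using True S_mult xj by blast+
          ultimately show ?thesis using True xj by (simp add: pullback_def ev_def Aut_mult[OF S_Aut S_Aut] mult.commute)
        qed (auto simp: pullback_def ev_def)
      qed (use ij ev_closed[OF good_iv v_regular x_points] xj in auto)
      show "f \<in> {f. ?c f \<in> tensors ?R ?R}" using f 1 2 by blast
    qed
  next
    fix f g assume "f \<in> {f. ?c f \<in> tensors ?R ?R}" "g \<in> {f. ?c f \<in> tensors ?R ?R}"
    then show "f + g \<in> {f. ?c f \<in> tensors ?R ?R}" "f * g \<in> {f. ?c f \<in> tensors ?R ?R}"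
      using tensors_add tensors_mult[OF _ _ G.subspace G.mult_closed G.mult_closed]
      by (simp_all add: pullback_add pullback_mult)
  qed
  then have "morphism (product_variety G0 G0) G0 (\<lambda>(g, h). g \<otimes>\<^bsub>N\<^esub> h)"
    unfolding morphism_def regular_product points_product pts reg
    using S_mult(1) N_mult by auto
  moreover have "?R \<subseteq> {f. pullback S (\<lambda>g. inv\<^bsub>N\<^esub> g) f \<in> ?R}"
  proof (rule gen_algebra_subset)
    fix c :: 'k
    have "pullback S (\<lambda>g. inv\<^bsub>N\<^esub> g) (const_on S c) = const_on S c"
      using S_inv(1) N_inv by (auto simp: pullback_def const_on_def)
    then show "const_on S c \<in> {f. pullback S (\<lambda>g. inv\<^bsub>N\<^esub> g) f \<in> ?R}" using G.const_closed by simp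
  next
    show "gens \<subseteq> {f. pullback S (\<lambda>g. inv\<^bsub>N\<^esub> g) f \<in> ?R}"
    proof
      fix f assume "f \<in> gens"
      then obtain i j where ij: "i < m" "j < m" and f: "f = ev (\<lambda>g. g) (v i) (x j) \<or> f = ev iv (v i) (x j)"
        by (auto simp: gens_def)
      have xj: "x j \<in> points X" by (rule x_points[OF ij(2)])
      have "pullback S (\<lambda>g. inv\<^bsub>N\<^esub> g) (ev (\<lambda>g. g) (v i) (x j)) = ev iv (v i) (x j)"
        "pullback S (\<lambda>g. inv\<^bsub>N\<^esub> g) (ev iv (v i) (x j)) = ev (\<lambda>g. g) (v i) (x j)"
        using S_inv xj by (auto simp: pullback_def ev_def N_inv fun_eq_iff)
      then show "f \<in> {f. pullback S (\<lambda>g. inv\<^bsub>N\<^esub> g) f \<in> ?R}"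
        using f ev_closed[OF good_iv v_regular[OF ij(1)] xj] ev_closed[OF good_id v_regular[OF ij(1)] xj] by auto
    qed
  qed (auto simp: pullback_add pullback_mult intro: G.add_closed G.mult_closed)
  then have "morphism G0 G0 (\<lambda>g. inv\<^bsub>N\<^esub> g)"
    unfolding morphism_def pts reg using S_inv(1) N_inv by auto
  ultimately show ?thesis
    unfolding linear_algebraic_group_def using grp G0_affine by (simp add: pts)
qed

lemma G0_algebraic: "algebraic_subgroup X G0"
proof -
  let ?R = "gen_algebra S gens"
  have pts: "points G0 = S" and reg: "regular G0 = ?R" by (simp_all add: G0_def)
  have "group_hom N (BijGroup (points X)) (\<lambda>g. g)"
    unfolding group_hom_def group_hom_axioms_def
    using G0_group group_BijGroup subgroup.subset[OF S_subgroup] subgroup.subset[OF subgroup_Aut[OF affine]]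
    by (auto simp: linear_algebraic_group_def hom_def Aut_def)
  then have ga: "group_action N (points X) (\<lambda>g. g)" by (simp add: group_action_def)
  let ?c = "pullback (S \<times> points X) (\<lambda>(g, y). g y)"
  have "gen_algebra (points X) U \<subseteq> {f. ?c f \<in> tensors ?R (regular X)}"
  proof (rule gen_algebra_subset)
    fix c :: 'k
    have "?c (const_on (points X) c) \<in> tensors ?R (regular X)"
      by (rule tensorsI[of "{()}" "\<lambda>_. const_on S c" _ "\<lambda>_. const_on (points X) 1"])
        (use S_Aut Aut_maps G.const_closed const_closed in \<open>auto simp: pullback_def const_on_def\<close>)
    then show "const_on (points X) c \<in> {f. ?c f \<in> tensors ?R (regular X)}" by blast
  next
    show "U \<subseteq> {f. ?c f \<in> tensors ?R (regular X)}"
    proof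
      fix u assume u: "u \<in> U"
      have "?c u \<in> tensors ?R (regular X)"
      proof (rule tensorsI[of "{..<m}" "\<lambda>l. ev (\<lambda>g. g) u (x l)" _ v])
        show "?c u (g, y) = (\<Sum>l<m. ev (\<lambda>g. g) u (x l) g * v l y)" for g y
          using good_expand[OF good_id _ u] vanish[OF v_regular, of _ y] by (auto simp: pullback_def ev_def)
      qed (use ev_U_closed[OF good_id u] v_regular in auto)
      then show "u \<in> {f. ?c f \<in> tensors ?R (regular X)}" by blast
    qed
  next
    fix f g assume "f \<in> {f. ?c f \<in> tensors ?R (regular X)}" "g \<in> {f. ?c f \<in> tensors ?R (regular X)}"
    then show "f + g \<in> {f. ?c f \<in> tensors ?R (regular X)}" "f * g \<in> {f. ?c f \<in> tensors ?R (regular X)}"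
      using tensors_add tensors_mult[OF _ _ G.subspace G.mult_closed mult_closed]
      by (simp_all add: pullback_add pullback_mult)
  qed
  then have "morphism (product_variety G0 X) X (\<lambda>(g, y). g y)"
    unfolding morphism_def regular_product points_product pts reg
    using gen S_Aut Aut_maps(1) by auto
  then show ?thesis
    using S_subgroup G0_group ga by (simp add: algebraic_subgroup_def regular_action_def pts)
qed

text \<open>A vector field that preserves \<open>U\<close> is determined by its values on \<open>U\<close> at the points \<open>x j\<close>.\<close>

lemma field_eq:
  assumes A: "A \<in> tangent_space G0 \<one>\<^bsub>N\<^esub>" and D: "D \<in> Vec X" and DU: "\<And>u. u \<in> U \<Longrightarrow> D u \<in> U"
    and AD: "\<And>u l. u \<in> U \<Longrightarrow> l < m \<Longrightarrow> A (ev (\<lambda>g. g) u (x l)) = D u (x l)"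
  shows "fundamental_field G0 X (\<lambda>g. g) A = D"
proof (rule Vec_eqI[OF _ D gen])
  have pts: "points G0 = S" and reg: "regular G0 = gen_algebra S gens" by (simp_all add: G0_def)
  interpret G0: affine G0 by unfold_locales (rule G0_affine)
  have "fundamental_field G0 X (\<lambda>g. g) A \<in> Lie X G0"
    unfolding Lie_def lie_of_action_def pts using A by blast
  then show "fundamental_field G0 X (\<lambda>g. g) A \<in> Vec X"
    using Lie_subset_Vec[OF affine G0_algebraic] by blast
  fix u assume u: "u \<in> U"
  have ur: "u \<in> regular X" using u U_regular by blast
  show "fundamental_field G0 X (\<lambda>g. g) A u = D u"
  proof
    fix y show "fundamental_field G0 X (\<lambda>g. g) A u y = D u y"
    proof (cases "y \<in> points X")
      case True
      have "pullback S (\<lambda>g. g y) u = ev (\<lambda>g. g) u y" by (auto simp: pullback_def ev_def)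
      then have "fundamental_field G0 X (\<lambda>g. g) A u y = A (\<Sum>l<m. scale_fun (v l y) (ev (\<lambda>g. g) u (x l)))"
        using True ur ev_expand[OF good_id u True] by (simp add: fundamental_field_def differential_def pts)
      also have "\<dots> = (\<Sum>l<m. v l y * A (ev (\<lambda>g. g) u (x l)))"
        by (rule G0.tangent_sum[OF A]) (use ev_U_closed[OF good_id u] in \<open>auto simp: reg\<close>)
      also have "\<dots> = (\<Sum>l<m. D u (x l) * v l y)" using AD[OF u] by (simp add: mult.commute)
      also have "\<dots> = D u y" using U_expand[OF DU[OF u], of y] by simp
      finally show ?thesis .
    next
      case False
      then show ?thesis using vanish[OF Vec_closed[OF D]] by (simp add: fundamental_field_def)
    qed
  qed
qed

lemma S_of_alg_ends:
  assumes "alg_end T" "alg_end T'"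
    and "\<And>f. f \<in> regular X \<Longrightarrow> T (T' f) = f" "\<And>f. f \<in> regular X \<Longrightarrow> T' (T f) = f"
    and TU: "\<And>u. u \<in> U \<Longrightarrow> T u \<in> U" "\<And>u. u \<in> U \<Longrightarrow> T' u \<in> U"
  shows "\<exists>g\<in>S. \<forall>f\<in>regular X. \<forall>y\<in>points X. f (g y) = T f y \<and> f (iv g y) = T' f y"
proof -
  obtain g where g: "g \<in> carrier (Aut X)" and e: "\<And>f y. f \<in> regular X \<Longrightarrow> y \<in> points X \<Longrightarrow>
    f (g y) = T f y \<and> f (iv g y) = T' f y"
    using automorphism_of_alg_ends[OF assms(1-4)] by blast
  have "pullback (points X) g u = T u" "pullback (points X) (iv g) u = T' u" if u: "u \<in> U" for u
  proof -
    have "u \<in> regular X" "T u \<in> regular X" "T' u \<in> regular X" using u TU U_regular by auto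
    then show "pullback (points X) g u = T u" "pullback (points X) (iv g) u = T' u"
      using e vanish by (auto simp: pullback_def fun_eq_iff)
  qed
  then have "g \<in> S" using g TU by (simp add: S_def)
  then show ?thesis using e by blast
qed

end

section \<open>Jordan decomposition of locally finite derivations\<close>

lemma common_denominator:
  fixes Q :: "rat set"
  assumes "finite Q"
  shows "\<exists>d::int. d > 0 \<and> (\<forall>q\<in>Q. of_int d * q \<in> \<int>)"
  using assms
proof (induction Q)
  case empty then show ?case by (intro exI[of _ 1]) auto
next
  case (insert q Q)
  then obtain d :: int where d: "d > 0" "\<And>q. q \<in> Q \<Longrightarrow> of_int d * q \<in> \<int>" by blast
  obtain a b :: int where q: "q = of_int a / of_int b" "b > 0"
    by (metis Fract_of_int_quotient Rat_cases)
  have "of_int (d * b) * q = of_int (d * a)" using q by simp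
  then have "of_int (d * b) * q \<in> \<int>" by (metis Ints_of_int)
  moreover have "of_int (d * b) * r \<in> \<int>" if "r \<in> Q" for r
    using Ints_mult[OF d(2)[OF that] Ints_of_int[of b]] by (simp add: mult_ac)
  ultimately show ?case using d(1) q(2) by (intro exI[of _ "d * b"]) auto
qed

text \<open>\<open>B\<close> is a basis of the rational span of \<open>E\<close>, and \<open>\<Lambda>\<close> consists of the elements whose coordinates
  become integers after multiplication by a common denominator \<open>d\<close>. The set \<open>\<Lambda>\<close> is closed under
  addition so that it can contain all eigenvalues on the coordinate algebra, not only those on the
  generators; \<open>r b\<close> are the integer coordinates and \<open>\<kappa> b = b / d\<close>.\<close>

lemma rational_coordinates:
  fixes E :: "'k::field_char_0 set"
  assumes "finite E"
  shows "\<exists>\<Lambda> B \<kappa> (r :: 'k \<Rightarrow> 'k \<Rightarrow> int). finite B \<and> E \<subseteq> \<Lambda> \<and> 0 \<in> \<Lambda> \<and>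
    (\<forall>l\<in>\<Lambda>. \<forall>m\<in>\<Lambda>. l + m \<in> \<Lambda> \<and> (\<forall>b\<in>B. r b (l + m) = r b l + r b m)) \<and>
    (\<forall>l\<in>\<Lambda>. l = (\<Sum>b\<in>B. \<kappa> b * of_int (r b l)))"
proof -
  interpret Q: vector_space "\<lambda>(q::rat) (a::'k). of_rat q * a"
    by unfold_locales (auto simp: algebra_simps of_rat_add of_rat_mult)
  obtain B where B: "B \<subseteq> E" "Q.independent B" "E \<subseteq> Q.span B"
    using Q.maximal_independent_subset[of E] by blast
  have finB: "finite B" using B(1) assms finite_subset by blast
  let ?rep = "Q.representation B"
  have "finite ((\<lambda>(l, b). ?rep l b) ` (E \<times> B))" using assms finB by simp
  from common_denominator[OF this] obtain d :: int where d: "d > 0"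
    "\<And>l b. l \<in> E \<Longrightarrow> b \<in> B \<Longrightarrow> of_int d * ?rep l b \<in> \<int>" by fastforce
  define \<Lambda> where "\<Lambda> = {l \<in> Q.span B. \<forall>b\<in>B. of_int d * ?rep l b \<in> \<int>}"
  define r where "r = (\<lambda>b l. \<lfloor>of_int d * ?rep l b\<rfloor>)"
  have r: "of_int (r b l) = of_int d * ?rep l b" if "l \<in> \<Lambda>" "b \<in> B" for l b
    using that by (simp add: r_def \<Lambda>_def)
  have add: "l + m \<in> \<Lambda> \<and> (\<forall>b\<in>B. r b (l + m) = r b l + r b m)" if l: "l \<in> \<Lambda>" and m: "m \<in> \<Lambda>" for l m
  proof -
    have rep: "?rep (l + m) b = ?rep l b + ?rep m b" for b
      using l m by (simp add: \<Lambda>_def Q.representation_add[OF B(2)])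
    have lm: "l + m \<in> \<Lambda>"
      using l m Q.span_add[of l B m] by (auto simp: \<Lambda>_def rep distrib_left)
    have "(of_int (r b (l + m)) :: rat) = of_int (r b l + r b m)" if b: "b \<in> B" for b
      using r[OF lm b] r[OF l b] r[OF m b] by (simp add: rep distrib_left)
    then have "r b (l + m) = r b l + r b m" if "b \<in> B" for b using that by (metis of_int_eq_iff)
    with lm show ?thesis by blast
  qed
  have coord: "l = (\<Sum>b\<in>B. (b / of_int d) * of_int (r b l))" if l: "l \<in> \<Lambda>" for l
  proof -
    have "l = (\<Sum>b\<in>B. of_rat (?rep l b) * b)"
      using Q.sum_representation_eq[OF B(2) _ finB subset_refl, of l] l by (simp add: \<Lambda>_def)
    also have "\<dots> = (\<Sum>b\<in>B. (b / of_int d) * of_int (r b l))"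
    proof (rule sum.cong[OF refl])
      fix b assume b: "b \<in> B"
      have "of_rat (of_int d * ?rep l b) = (of_rat (of_int (r b l)) :: 'k)" using r[OF l b] by simp
      then have "of_int d * of_rat (?rep l b) = (of_int (r b l) :: 'k)" by (simp add: of_rat_mult)
      then show "of_rat (?rep l b) * b = (b / of_int d) * of_int (r b l)"
        using d(1) by (simp add: field_simps)
    qed
    finally show ?thesis .
  qed
  have E\<Lambda>: "E \<subseteq> \<Lambda>" using B(3) d(2) by (auto simp: \<Lambda>_def)
  have zero: "0 \<in> \<Lambda>" by (simp add: \<Lambda>_def Q.representation_zero Q.span_zero)
  show ?thesis
  proof (rule exI[of _ \<Lambda>], rule exI[of _ B], rule exI[of _ "\<lambda>b. b / of_int d"], rule exI[of _ r], intro conjI ballI)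
    fix l assume "l \<in> \<Lambda>"
    then show "l = (\<Sum>b\<in>B. (b / of_int d) * of_int (r b l))" by (rule coord)
  qed (use finB E\<Lambda> zero add in blast)+
qed

context affine
begin

definition linear_op :: "(('a \<Rightarrow> 'k) \<Rightarrow> 'a \<Rightarrow> 'k) \<Rightarrow> bool"
  where "linear_op P \<longleftrightarrow> (\<forall>f\<in>regular X. \<forall>g\<in>regular X. P (f + g) = P f + P g) \<and>
    (\<forall>c. \<forall>f\<in>regular X. P (scale_fun c f) = scale_fun c (P f))"

lemma linear_op_add: "linear_op P \<Longrightarrow> f \<in> regular X \<Longrightarrow> g \<in> regular X \<Longrightarrow> P (f + g) = P f + P g"
  by (simp add: linear_op_def)

lemma linear_op_scale: "linear_op P \<Longrightarrow> f \<in> regular X \<Longrightarrow> P (scale_fun c f) = scale_fun c (P f)"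
  by (simp add: linear_op_def)

lemma linear_op_0: "linear_op P \<Longrightarrow> P 0 = 0"
  using linear_op_scale[of P 0 0] zero_closed by simp

lemma linear_op_Vec: "D \<in> Vec X \<Longrightarrow> linear_op D"
  unfolding linear_op_def by (blast intro: Vec_add Vec_scale)

lemma linear_op_eq_subspace:
  assumes "linear_op P" "linear_op Q"
  shows "fun_vs.subspace {f \<in> regular X. P f = Q f}"
proof (rule fun_vs.subspaceI)
  show "0 \<in> {f \<in> regular X. P f = Q f}" using linear_op_0 assms zero_closed by simp
next
  fix f g assume "f \<in> {f \<in> regular X. P f = Q f}" "g \<in> {f \<in> regular X. P f = Q f}"
  then show "f + g \<in> {f \<in> regular X. P f = Q f}" using linear_op_add assms add_closed by simp
next
  fix c f assume "f \<in> {f \<in> regular X. P f = Q f}"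
  then show "scale_fun c f \<in> {f \<in> regular X. P f = Q f}" using linear_op_scale assms scale_closed by simp
qed

lemma linear_op_pow:
  assumes P: "linear_op P" "\<And>f. f \<in> regular X \<Longrightarrow> P f \<in> regular X"
  shows "f \<in> regular X \<Longrightarrow> (P ^^ n) f \<in> regular X" "linear_op (P ^^ n)"
proof -
  show cl: "(P ^^ n) f \<in> regular X" if "f \<in> regular X" for n f using that by (induction n) (auto intro: P)
  have "(P ^^ n) (f + g) = (P ^^ n) f + (P ^^ n) g" if "f \<in> regular X" "g \<in> regular X" for f g
    using that by (induction n) (simp_all only: funpow.simps comp_apply id_apply linear_op_add[OF P(1)] cl)
  moreover have "(P ^^ n) (scale_fun c f) = scale_fun c ((P ^^ n) f)" if "f \<in> regular X" for f c
    using that by (induction n) (simp_all only: funpow.simps comp_apply id_apply linear_op_scale[OF P(1)] cl)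
  ultimately show "linear_op (P ^^ n)" by (simp add: linear_op_def)
qed

lemma pow_eq_0_mono:
  assumes "linear_op P" "(P ^^ n) f = 0" "n \<le> k"
  shows "(P ^^ k) f = 0"
proof -
  have z: "(P ^^ i) 0 = 0" for i by (induction i) (simp_all only: funpow.simps comp_apply id_apply linear_op_0[OF assms(1)])
  have "(P ^^ k) f = (P ^^ (k - n)) ((P ^^ n) f)"
    using assms(3) by (simp flip: funpow_add comp_apply[of "P ^^ (k - n)" "P ^^ n" f])
  then show ?thesis using assms(2) z by simp
qed

lemma nil_subspace:
  assumes P: "linear_op P" "\<And>f. f \<in> regular X \<Longrightarrow> P f \<in> regular X"
  shows "fun_vs.subspace {f \<in> regular X. \<exists>n. (P ^^ n) f = 0}"
proof (rule fun_vs.subspaceI)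
  have "(P ^^ 1) 0 = 0" using linear_op_0[OF P(1)] by simp
  then show "0 \<in> {f \<in> regular X. \<exists>n. (P ^^ n) f = 0}" using zero_closed by blast
next
  fix f g assume "f \<in> {f \<in> regular X. \<exists>n. (P ^^ n) f = 0}" "g \<in> {f \<in> regular X. \<exists>n. (P ^^ n) f = 0}"
  then obtain n k where f: "f \<in> regular X" "(P ^^ n) f = 0" and g: "g \<in> regular X" "(P ^^ k) g = 0" by blast
  have "(P ^^ max n k) (f + g) = (P ^^ max n k) f + (P ^^ max n k) g"
    by (rule linear_op_add[OF linear_op_pow(2)[OF P] f(1) g(1)])
  also have "\<dots> = 0"
    using pow_eq_0_mono[OF P(1) f(2), of "max n k"] pow_eq_0_mono[OF P(1) g(2), of "max n k"] by simp
  finally show "f + g \<in> {f \<in> regular X. \<exists>n. (P ^^ n) f = 0}" using add_closed f g by blast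
next
  fix c f assume "f \<in> {f \<in> regular X. \<exists>n. (P ^^ n) f = 0}"
  then obtain n where f: "f \<in> regular X" "(P ^^ n) f = 0" by blast
  have "(P ^^ n) (scale_fun c f) = 0" using linear_op_scale[OF linear_op_pow(2)[OF P] f(1)] f(2) by simp
  then show "scale_fun c f \<in> {f \<in> regular X. \<exists>n. (P ^^ n) f = 0}" using scale_closed f by blast
qed

definition shift :: "(('a \<Rightarrow> 'k) \<Rightarrow> 'a \<Rightarrow> 'k) \<Rightarrow> 'k \<Rightarrow> ('a \<Rightarrow> 'k) \<Rightarrow> 'a \<Rightarrow> 'k"
  where "shift D l f = D f - scale_fun l f"

text \<open>Taken in the whole coordinate algebra: products of generalized eigenvectors may leave \<open>U\<close>, but
  they are again generalized eigenvectors (\<open>geneig_mult\<close>).\<close>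

definition geneig :: "(('a \<Rightarrow> 'k) \<Rightarrow> 'a \<Rightarrow> 'k) \<Rightarrow> 'k \<Rightarrow> ('a \<Rightarrow> 'k) set"
  where "geneig D l = {f \<in> regular X. \<exists>n. (shift D l ^^ n) f = 0}"

context
  fixes D assumes D: "D \<in> Vec X"
begin

lemma shift_closed: "f \<in> regular X \<Longrightarrow> shift D l f \<in> regular X"
  unfolding shift_def by (intro diff_closed Vec_closed[OF D] scale_closed)

lemma shift_lin: "linear_op (shift D l)"
  by (simp add: linear_op_def shift_def Vec_add[OF D] Vec_scale[OF D] fun_eq_iff algebra_simps)

lemma geneig_subspace: "fun_vs.subspace (geneig D l)"
  unfolding geneig_def by (rule nil_subspace[OF shift_lin shift_closed])

lemma geneig_regular: "f \<in> geneig D l \<Longrightarrow> f \<in> regular X" by (simp add: geneig_def)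

lemma shift_commute:
  assumes "f \<in> regular X"
  shows "shift D l (shift D k f) = shift D k (shift D l f)"
  using assms
  by (simp add: shift_def Vec_diff[OF D] Vec_scale[OF D] Vec_closed[OF D] scale_closed fun_eq_iff algebra_simps)

lemma shift_pow_commute:
  assumes "f \<in> regular X"
  shows "(shift D l ^^ n) (shift D k f) = shift D k ((shift D l ^^ n) f)"
proof (induction n)
  case (Suc n)
  have "(shift D l ^^ Suc n) (shift D k f) = shift D l (shift D k ((shift D l ^^ n) f))"
    by (simp only: funpow.simps comp_apply Suc)
  also have "\<dots> = shift D k (shift D l ((shift D l ^^ n) f))"
    by (rule shift_commute[OF linear_op_pow(1)[OF shift_lin shift_closed assms]])
  finally show ?case by (simp only: funpow.simps comp_apply)
qed simp

lemma geneig_shift: "f \<in> geneig D l \<Longrightarrow> shift D k f \<in> geneig D l"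
proof -
  assume f: "f \<in> geneig D l"
  then obtain n where n: "f \<in> regular X" "(shift D l ^^ n) f = 0" by (auto simp: geneig_def)
  have "(shift D l ^^ n) (shift D k f) = 0" using shift_pow_commute[OF n(1)] n(2) linear_op_0[OF shift_lin] by simp
  then show ?thesis using shift_closed[OF n(1)] by (auto simp: geneig_def)
qed

text \<open>The shifted operators satisfy \<open>(D - l - k)(f g) = (D - l) f * g + f * (D - k) g\<close>.\<close>

lemma geneig_mult:
  assumes "f \<in> geneig D l" "g \<in> geneig D k"
  shows "f * g \<in> geneig D (l + k)"
proof -
  obtain n where n: "f \<in> regular X" "(shift D l ^^ n) f = 0" using assms(1) by (auto simp: geneig_def)
  obtain n' where n': "g \<in> regular X" "(shift D k ^^ n') g = 0" using assms(2) by (auto simp: geneig_def)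
  have "(shift D (l + k) ^^ (n + n')) (f * g) = (\<Sum>i\<le>n + n'. of_nat ((n + n') choose i) *
    ((shift D l ^^ i) f * (shift D k ^^ (n + n' - i)) g))"
  proof (rule iterated_leibniz[of "regular X" "shift D l" "regular X" "shift D k" "(*)" "regular X"])
    fix f g assume "f \<in> regular X" "g \<in> regular X"
    then show "shift D (l + k) (f * g) = shift D l f * g + f * shift D k g"
      by (simp add: shift_def Vec_mult[OF D] fun_eq_iff algebra_simps)
  qed (use n n' shift_closed mult_closed linear_op_add[OF shift_lin] in auto)
  also have "\<dots> = 0"
  proof (rule sum.neutral, rule ballI)
    fix i assume "i \<in> {..n + n'}"
    have "(shift D l ^^ i) f = 0 \<or> (shift D k ^^ (n + n' - i)) g = 0"
    proof (cases "n \<le> i")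
      case True then show ?thesis using pow_eq_0_mono[OF shift_lin n(2)] by blast
    next
      case False
      then have "n' \<le> n + n' - i" by simp
      then show ?thesis using pow_eq_0_mono[OF shift_lin n'(2)] by blast
    qed
    then show "of_nat ((n + n') choose i) * ((shift D l ^^ i) f * (shift D k ^^ (n + n' - i)) g) = 0"
      by auto
  qed
  finally show ?thesis using mult_closed[OF n(1) n'(1)] by (auto simp: geneig_def)
qed

lemma geneig_const: "const_on (points X) c \<in> geneig D 0"
proof -
  have "(shift D 0 ^^ 1) (const_on (points X) c) = 0" by (simp add: shift_def Vec_const[OF D])
  then show ?thesis using const_closed by (auto simp: geneig_def simp del: funpow.simps)
qed

text \<open>On the generalized eigenspace of \<open>k\<close> the operator \<open>D - l\<close> is a nonzero scalar plus a nilpotent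
  operator; its inverse is found by induction on the order of nilpotency.\<close>

lemma geneig_solve:
  assumes U: "fun_vs.subspace U" "\<And>u. u \<in> U \<Longrightarrow> D u \<in> U"
    and g: "g \<in> geneig D k" "g \<in> U" and lk: "l \<noteq> k"
  shows "\<exists>h \<in> geneig D k \<inter> U. shift D l h = g"
proof -
  have shU: "shift D l u \<in> U" if "u \<in> U" for u l
    unfolding shift_def using that by (intro fun_vs.subspace_diff[OF U(1)] U(2) fun_vs.subspace_scale[OF U(1)])
  obtain n where "(shift D k ^^ n) g = 0" using g(1) by (auto simp: geneig_def)
  then show ?thesis using g
  proof (induction n arbitrary: g)
    case 0
    have "g = 0" using "0.prems"(1) by (simp only: funpow.simps id_apply)
    then have "shift D l 0 = g" using linear_op_0[OF shift_lin] by metis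
    moreover have "0 \<in> geneig D k \<inter> U"
      by (intro IntI fun_vs.subspace_0[OF geneig_subspace] fun_vs.subspace_0[OF U(1)])
    ultimately show ?case by blast
  next
    case (Suc n)
    have gR: "g \<in> regular X" using Suc.prems by (simp add: geneig_def)
    have "(shift D k ^^ n) (shift D k g) = 0"
      using Suc.prems(1) by (simp only: funpow_Suc_right comp_apply)
    from Suc.IH[OF this geneig_shift[OF Suc.prems(2)] shU[OF Suc.prems(3)]]
    obtain h' where h': "h' \<in> geneig D k" "h' \<in> U" "shift D l h' = shift D k g" by blast
    define h where "h = scale_fun (1 / (k - l)) (g - h')"
    have hR: "h' \<in> regular X" using h'(1) by (rule geneig_regular)
    have "h \<in> geneig D k \<inter> U" unfolding h_def
      using Suc.prems h' by (intro IntI fun_vs.subspace_scale[OF geneig_subspace] fun_vs.subspace_diff[OF geneig_subspace]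
        fun_vs.subspace_scale[OF U(1)] fun_vs.subspace_diff[OF U(1)])
    moreover have "shift D l h = g"
    proof -
      have "shift D l (g - h') = shift D l g - shift D l h'"
        using gR hR by (simp add: shift_def Vec_diff[OF D] fun_eq_iff algebra_simps)
      also have "\<dots> = scale_fun (k - l) g"
        unfolding h'(3) by (simp add: shift_def fun_eq_iff algebra_simps)
      finally show ?thesis unfolding h_def
        using linear_op_scale[OF shift_lin diff_closed[OF gR hR], of l "1 / (k - l)"] lk by simp
    qed
    ultimately show ?case by blast
  qed
qed

lemma geneig_shift_inj:
  assumes "g \<in> geneig D k" "shift D l g = 0" "l \<noteq> k"
  shows "g = 0"
proof -
  obtain n where n: "(shift D k ^^ n) g = 0" using assms(1) by (auto simp: geneig_def)
  have gR: "g \<in> regular X" using assms(1) by (rule geneig_regular)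
  have s: "shift D k g = scale_fun (l - k) g"
    using assms(2) by (simp add: shift_def fun_eq_iff algebra_simps)
  have "(shift D k ^^ n) g = scale_fun ((l - k) ^ n) g"
  proof (induction n)
    case (Suc n)
    have "(shift D k ^^ Suc n) g = shift D k (scale_fun ((l - k) ^ n) g)" by (simp only: funpow.simps comp_apply Suc)
    also have "\<dots> = scale_fun ((l - k) ^ n) (scale_fun (l - k) g)" using linear_op_scale[OF shift_lin gR] s by simp
    finally show ?case by (simp add: mult.commute)
  qed simp
  then show ?thesis using n assms(3) by (simp add: fun_eq_iff)
qed

lemma geneig_shift_pow_inj:
  assumes "g \<in> geneig D k" "(shift D l ^^ n) g = 0" "l \<noteq> k"
  shows "g = 0"
  using assms(1,2)
proof (induction n arbitrary: g)
  case (Suc n)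
  have "(shift D l ^^ n) (shift D l g) = 0"
    using Suc.prems(2) by (simp only: funpow_Suc_right comp_apply)
  then have "shift D l g = 0" using Suc.IH[OF geneig_shift[OF Suc.prems(1)]] by blast
  then show ?case using geneig_shift_inj[OF Suc.prems(1) _ assms(3)] by blast
qed simp

text \<open>A power of \<open>D - l\<close> removes one summand and is injective on the others.\<close>

lemma geneig_independent:
  assumes "finite J" "\<And>l. l \<in> J \<Longrightarrow> F l \<in> geneig D l" "(\<Sum>l\<in>J. F l) = 0" "k \<in> J"
  shows "F k = 0"
  using assms
proof (induction J arbitrary: F k rule: finite_induct)
  case (insert l J F k)
  obtain n where n: "(shift D l ^^ n) (F l) = 0" using insert.prems(1)[of l] by (auto simp: geneig_def)
  let ?P = "shift D l ^^ n"
  have FR: "F i \<in> regular X" if "i \<in> insert l J" for i using insert.prems(1)[OF that] by (rule geneig_regular)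
  have lin: "linear_op ?P" by (rule linear_op_pow(2)[OF shift_lin shift_closed])
  have Psum: "?P (\<Sum>i\<in>J'. F i) = (\<Sum>i\<in>J'. ?P (F i))" if "J' \<subseteq> J" for J'
  proof -
    have "finite J'" using that insert.hyps(1) finite_subset by blast
    then show ?thesis using that
    proof (induction J' rule: finite_induct)
      case empty show ?case using linear_op_0[OF lin] by (simp only: sum.empty)
    next
      case (insert i J')
      have "?P (F i + sum F J') = ?P (F i) + ?P (sum F J')"
        by (rule linear_op_add[OF lin]) (use insert.prems FR in \<open>auto intro!: sum_closed\<close>)
      then show ?case using insert by (simp only: sum.insert[OF insert.hyps(1,2)] insert_subset)
    qed
  qed
  have s0: "F l + sum F J = 0" using insert.prems(2) by (simp only: sum.insert[OF insert.hyps(1,2)])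
  have "?P (F l + sum F J) = 0" unfolding s0 by (rule linear_op_0[OF lin])
  moreover have "?P (F l + sum F J) = ?P (F l) + ?P (sum F J)"
    by (rule linear_op_add[OF lin]) (use FR in \<open>auto intro!: sum_closed\<close>)
  ultimately have z: "(\<Sum>i\<in>J. ?P (F i)) = 0" using n Psum[of J] by simp
  have Pg: "?P (F i) \<in> geneig D i" if "i \<in> J" for i
    using insert.prems(1)[of i] that by (induction n) (auto intro: geneig_shift)
  have "?P (F i) = 0" if "i \<in> J" for i by (rule insert.IH[OF Pg z that])
  then have J0: "F i = 0" if "i \<in> J" for i
    using geneig_shift_pow_inj[OF insert.prems(1)[of i], where l = l and n = n] that insert.hyps(2) by auto
  then have "sum F J = 0" by (intro sum.neutral) blast
  then have "F l = 0" using s0 by simp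
  then show ?case using J0 insert.prems(3) by blast
qed simp

text \<open>The polynomial \<open>p\<close> in \<open>D\<close> applied to \<open>f\<close>; \<open>M\<close> is any bound that exceeds the degree.\<close>

definition poly_op :: "nat \<Rightarrow> 'k poly \<Rightarrow> ('a \<Rightarrow> 'k) \<Rightarrow> 'a \<Rightarrow> 'k"
  where "poly_op M p f = (\<Sum>i<M. scale_fun (coeff p i) ((D ^^ i) f))"

lemma poly_op_root:
  assumes "degree q < M" "f \<in> regular X"
  shows "poly_op (Suc M) ([:- l, 1:] * q) f = poly_op M q (shift D l f)"
proof -
  have e: "coeff ([:- l, 1:] * q) i = (case i of 0 \<Rightarrow> 0 | Suc j \<Rightarrow> coeff q j) - l * coeff q i" for i
    by (simp add: coeff_pCons)
  have qM: "coeff q M = 0" using assms(1) by (rule coeff_eq_0)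
  have pw: "(D ^^ i) (shift D l f) = (D ^^ Suc i) f - scale_fun l ((D ^^ i) f)" for i
  proof -
    have e: "shift D l f = D f + scale_fun (- l) f" by (simp add: shift_def fun_eq_iff)
    have "(D ^^ i) (shift D l f) = (D ^^ i) (D f) + (D ^^ i) (scale_fun (- l) f)"
      unfolding e by (rule Vec_pow_add[OF D Vec_closed[OF D] scale_closed[OF assms(2)]])
    also have "(D ^^ i) (scale_fun (- l) f) = scale_fun (- l) ((D ^^ i) f)"
      by (rule Vec_pow_scale[OF D assms(2)])
    finally show ?thesis by (simp add: fun_eq_iff funpow_swap1)
  qed
  show ?thesis
  proof
    fix y
    have "poly_op (Suc M) ([:- l, 1:] * q) f y = (\<Sum>i<Suc M. (case i of 0 \<Rightarrow> 0 | Suc j \<Rightarrow> coeff q j) * (D ^^ i) f y)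
        - (\<Sum>i<Suc M. l * coeff q i * (D ^^ i) f y)"
      unfolding poly_op_def sum_scale_apply e by (simp only: left_diff_distrib sum_subtractf)
    also have "(\<Sum>i<Suc M. (case i of 0 \<Rightarrow> 0 | Suc j \<Rightarrow> coeff q j) * (D ^^ i) f y) = (\<Sum>i<M. coeff q i * (D ^^ Suc i) f y)"
      by (subst sum.lessThan_Suc_shift) (simp del: funpow.simps)
    also have "(\<Sum>i<Suc M. l * coeff q i * (D ^^ i) f y) = (\<Sum>i<M. l * coeff q i * (D ^^ i) f y)"
      by (simp add: qM)
    finally show "poly_op (Suc M) ([:- l, 1:] * q) f y = poly_op M q (shift D l f) y"
      unfolding poly_op_def sum_scale_apply pw
      by (simp add: sum_subtractf right_diff_distrib mult_ac del: funpow.simps)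
  qed
qed

end

end

text \<open>Some polynomial in \<open>D\<close> annihilates \<open>f\<close>, because \<open>U\<close> is finite-dimensional. Induction on its
  degree splits off one linear factor at a time: if \<open>(D - l) f\<close> is a sum of generalized
  eigenvectors, then so is \<open>f\<close>.\<close>

lemma (in affine) geneig_decomposition:
  fixes D
  assumes ac: "\<And>p :: 'k poly. degree p > 0 \<Longrightarrow> \<exists>z. poly p z = 0"
  assumes D: "D \<in> Vec X" and U: "fun_vs.subspace U" "U \<subseteq> regular X" "\<And>u. u \<in> U \<Longrightarrow> D u \<in> U"
    and dual: "dual_basis U m v x"
  shows "U \<subseteq> fun_vs.span (\<Union>l. geneig D l \<inter> U)"
proof
  let ?S = "fun_vs.span (\<Union>l. geneig D l \<inter> U)"
  have SU: "?S \<subseteq> U" by (rule fun_vs.span_minimal[OF _ U(1)]) auto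
  have shU: "shift D l u \<in> U" if "u \<in> U" for u l
    unfolding shift_def using that by (intro fun_vs.subspace_diff[OF U(1)] U(3) fun_vs.subspace_scale[OF U(1)])
  have base: "g \<in> ?S" if "g \<in> geneig D l" "g \<in> U" for g l using that by (intro fun_vs.span_base) blast
  have lift: "f \<in> ?S" if f: "f \<in> U" "shift D l f \<in> ?S" for f l
  proof -
    \<comment> \<open>the equation (D - l) h = g is solved modulo the generalized eigenspace of l itself, where D - l is not invertible\<close>
    define W where "W = {g \<in> U. \<exists>h\<in>?S. shift D l h - g \<in> geneig D l \<inter> U}"
    have glU: "fun_vs.subspace (geneig D l \<inter> U)" by (rule fun_vs.subspace_inter[OF geneig_subspace[OF D] U(1)])
    have lin: "linear_op (shift D l)" by (rule shift_lin[OF D])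
    have "fun_vs.subspace W"
    proof (rule fun_vs.subspaceI)
      show "0 \<in> W" unfolding W_def
        using fun_vs.span_zero[of "\<Union>l. geneig D l \<inter> U"] fun_vs.subspace_0[OF glU] fun_vs.subspace_0[OF U(1)] linear_op_0[OF lin]
        by (intro CollectI conjI bexI[of _ 0]) auto
    next
      fix g g' assume "g \<in> W" "g' \<in> W"
      then obtain h h' where h: "g \<in> U" "h \<in> ?S" "shift D l h - g \<in> geneig D l \<inter> U"
        and h': "g' \<in> U" "h' \<in> ?S" "shift D l h' - g' \<in> geneig D l \<inter> U" by (auto simp: W_def)
      have "h \<in> regular X" "h' \<in> regular X" using h h' SU U(2) by blast+
      then have e: "shift D l (h + h') - (g + g') = (shift D l h - g) + (shift D l h' - g')"
        using linear_op_add[OF lin] by simp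
      have "shift D l (h + h') - (g + g') \<in> geneig D l \<inter> U"
        unfolding e by (rule fun_vs.subspace_add[OF glU h(3) h'(3)])
      then show "g + g' \<in> W" unfolding W_def using fun_vs.span_add[OF h(2) h'(2)] fun_vs.subspace_add[OF U(1) h(1) h'(1)] by blast
    next
      fix c g assume "g \<in> W"
      then obtain h where h: "g \<in> U" "h \<in> ?S" "shift D l h - g \<in> geneig D l \<inter> U" by (auto simp: W_def)
      have "h \<in> regular X" using h SU U(2) by blast
      then have e: "shift D l (scale_fun c h) - scale_fun c g = scale_fun c (shift D l h - g)"
        using linear_op_scale[OF lin] by (simp add: fun_vs.scale_right_diff_distrib)
      have "shift D l (scale_fun c h) - scale_fun c g \<in> geneig D l \<inter> U"
        unfolding e by (rule fun_vs.subspace_scale[OF glU h(3)])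
      then show "scale_fun c g \<in> W" unfolding W_def using fun_vs.span_scale[OF h(2)] fun_vs.subspace_scale[OF U(1) h(1)] by blast
    qed
    moreover have "(\<Union>l. geneig D l \<inter> U) \<subseteq> W"
    proof clarify
      fix k g assume g: "g \<in> geneig D k" "g \<in> U"
      show "g \<in> W"
      proof (cases "k = l")
        case True
        have "shift D l 0 - g = scale_fun (-1) g" using linear_op_0[OF lin] by (simp add: fun_eq_iff)
        also have "\<dots> \<in> geneig D l \<inter> U" using g True by (intro fun_vs.subspace_scale[OF glU]) simp
        finally show ?thesis unfolding W_def using g fun_vs.span_zero by blast
      next
        case False
        then obtain h where "h \<in> geneig D k \<inter> U" "shift D l h = g" using geneig_solve[OF D U(1) _ g, of l] U(3) by blast
        then have "h \<in> ?S" "shift D l h - g \<in> geneig D l \<inter> U" using base fun_vs.subspace_0[OF glU] by auto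
        then show ?thesis unfolding W_def using g by blast
      qed
    qed
    ultimately have "shift D l f \<in> W" using f(2) fun_vs.span_minimal by blast
    then obtain h where h: "h \<in> ?S" "shift D l h - shift D l f \<in> geneig D l \<inter> U" by (auto simp: W_def)
    have hU: "h \<in> U" using h SU by blast
    have R: "h \<in> regular X" "f \<in> regular X" using hU f U(2) by auto
    have "shift D l (h - f) = shift D l h - shift D l f"
      using R by (simp add: shift_def Vec_diff[OF D] fun_eq_iff algebra_simps)
    then obtain n where "(shift D l ^^ n) (shift D l (h - f)) = 0" using h(2) by (auto simp: geneig_def)
    then have "(shift D l ^^ Suc n) (h - f) = 0" by (simp only: funpow_Suc_right comp_apply)
    then have "h - f \<in> geneig D l" using diff_closed[OF R] unfolding geneig_def by blast
    then have "h - f \<in> ?S" using base fun_vs.subspace_diff[OF U(1) hU f(1)] by blast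
    from fun_vs.span_diff[OF h(1) this] show "f \<in> ?S" by simp
  qed
  have main: "f \<in> ?S" if "p \<noteq> 0" "degree p < M" "f \<in> U" "poly_op D M p f = 0" for p M f
    using that
  proof (induction "degree p" arbitrary: p M f)
    case 0
    then obtain c where p: "p = [:c:]" "c \<noteq> 0" by (metis degree_eq_zeroE pCons_0_0)
    obtain M' where M: "M = Suc M'" using 0 by (cases M) auto
    have "poly_op D M p f = scale_fun c f"
      unfolding poly_op_def[OF D] M p(1) by (subst sum.lessThan_Suc_shift) (simp add: coeff_pCons)
    then have "f = 0" using 0 p(2) by (simp add: fun_eq_iff)
    then show ?case by (metis fun_vs.span_zero)
  next
    case (Suc n)
    have "degree p > 0" using Suc.hyps(2) by simp
    from ac[OF this] obtain l where "poly p l = 0" by blast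
    then obtain q where p: "p = [:- l, 1:] * q" by (auto simp: poly_eq_0_iff_dvd dvd_def)
    have qnz: "q \<noteq> 0" using p Suc.prems(1) by auto
    have "degree p = Suc (degree q)" unfolding p by (subst degree_mult_eq) (use qnz in auto)
    then have dq: "n = degree q" using Suc.hyps(2) by simp
    obtain M' where M: "M = Suc M'" "degree q < M'" using Suc.prems(2) \<open>degree p = Suc (degree q)\<close> by (cases M) auto
    have "f \<in> regular X" using Suc.prems(3) U(2) by blast
    from poly_op_root[OF D M(2) this] have "poly_op D M' q (shift D l f) = 0" using Suc.prems(4) p M(1) by simp
    from Suc.hyps(1)[OF dq qnz M(2) shU[OF Suc.prems(3)] this] have "shift D l f \<in> ?S" .
    then show ?case by (rule lift[OF Suc.prems(3)])
  qed
  fix f assume f: "f \<in> U"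
  define a where "a = (\<lambda>i. (D ^^ i) f)"
  have aU: "a i \<in> U" for i unfolding a_def using f by (induction i) (auto intro: U(3))
  have "\<not> lin_indep (Suc m) a"
  proof
    assume "lin_indep (Suc m) a"
    from dual_basis_bound[OF dual this aU] show False by simp
  qed
  then obtain c j where c: "(\<Sum>i<Suc m. scale_fun (c i) (a i)) = 0" "j < Suc m" "c j \<noteq> 0"
    unfolding lin_indep_def by blast
  define p where "p = (\<Sum>i<Suc m. monom (c i) i)"
  have cp: "coeff p i = (if i < Suc m then c i else 0)" for i
  proof -
    have "coeff p i = (\<Sum>k<Suc m. if k = i then c i else 0)"
      unfolding p_def coeff_sum by (rule sum.cong) auto
    then show ?thesis by (simp del: sum.lessThan_Suc)
  qed
  have "p \<noteq> 0" using c(2,3) cp[of j] by auto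
  moreover have "degree p < Suc m" using cp by (intro degree_lessI) (use \<open>p \<noteq> 0\<close> in auto)
  moreover have "poly_op D (Suc m) p f = 0"
  proof -
    have "poly_op D (Suc m) p f = (\<Sum>i<Suc m. scale_fun (c i) (a i))"
      unfolding poly_op_def[OF D] by (rule sum.cong) (auto simp: cp a_def)
    then show ?thesis using c(1) by simp
  qed
  ultimately show "f \<in> ?S" using main f by blast
qed

section \<open>Operators that act by scalars on generalized eigenspaces\<close>

lemma span_mult_closed:
  fixes S :: "('a \<Rightarrow> 'k::field) set"
  assumes S: "\<And>a b. a \<in> S \<Longrightarrow> b \<in> S \<Longrightarrow> a * b \<in> fun_vs.span S"
    and xy: "x \<in> fun_vs.span S" "y \<in> fun_vs.span S"
  shows "x * y \<in> fun_vs.span S"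
proof -
  have sub: "fun_vs.subspace {f. f * h \<in> fun_vs.span S}" for h
  proof (rule fun_vs.subspaceI)
    show "0 \<in> {f. f * h \<in> fun_vs.span S}" by (simp add: fun_vs.span_zero)
  next
    fix f g assume "f \<in> {f. f * h \<in> fun_vs.span S}" "g \<in> {f. f * h \<in> fun_vs.span S}"
    then show "f + g \<in> {f. f * h \<in> fun_vs.span S}" by (simp add: distrib_right fun_vs.span_add)
  next
    fix c f assume "f \<in> {f. f * h \<in> fun_vs.span S}"
    moreover have "scale_fun c f * h = scale_fun c (f * h)" by (simp add: fun_eq_iff)
    ultimately show "scale_fun c f \<in> {f. f * h \<in> fun_vs.span S}" by (simp add: fun_vs.span_scale)
  qed
  have 1: "x * b \<in> fun_vs.span S" if "b \<in> S" for b
    using fun_vs.span_minimal[OF _ sub[of b], of S] S that xy(1) by blast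
  have "fun_vs.span S \<subseteq> {f. f * x \<in> fun_vs.span S}"
    by (rule fun_vs.span_minimal[OF _ sub]) (use 1 in \<open>auto simp: mult.commute\<close>)
  then show ?thesis using xy(2) by (auto simp: mult.commute)
qed

lemma finite_subset_spanning:
  fixes B :: "('a \<Rightarrow> 'k::field) set"
  assumes "finite B" "B \<subseteq> fun_vs.span S"
  shows "\<exists>T. finite T \<and> T \<subseteq> S \<and> B \<subseteq> fun_vs.span T"
  using assms
proof (induction B rule: finite_induct)
  case empty then show ?case by (intro exI[of _ "{}"]) simp
next
  case (insert b B)
  then obtain T where T: "finite T" "T \<subseteq> S" "B \<subseteq> fun_vs.span T" by blast
  have "b \<in> fun_vs.span S" using insert.prems by blast
  then obtain t r where t: "finite t" "t \<subseteq> S" "b = (\<Sum>a\<in>t. scale_fun (r a) a)"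
    unfolding fun_vs.span_explicit by blast
  have "b \<in> fun_vs.span (T \<union> t)" unfolding t(3)
    by (intro fun_vs.span_sum fun_vs.span_scale fun_vs.span_base) blast
  moreover have "B \<subseteq> fun_vs.span (T \<union> t)" using T(3) fun_vs.span_mono[of T "T \<union> t"] by blast
  ultimately show ?case using T t by (intro exI[of _ "T \<union> t"]) blast
qed

text \<open>The coordinate algebra is the direct sum of the generalized eigenspaces of \<open>D\<close>. The set \<open>\<Lambda>\<close> is
  some set of scalars that contains enough eigenvalues.\<close>

locale graded = affine X for X :: "('a, 'k::field_char_0) variety" +
  fixes D :: "('a \<Rightarrow> 'k) \<Rightarrow> 'a \<Rightarrow> 'k" and \<Lambda> :: "'k set"
  assumes D: "D \<in> Vec X" and total: "regular X \<subseteq> fun_vs.span (\<Union>l\<in>\<Lambda>. geneig D l)"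
begin

lemma graded_induct:
  assumes "f \<in> regular X" "fun_vs.subspace W" "\<And>l f. l \<in> \<Lambda> \<Longrightarrow> f \<in> geneig D l \<Longrightarrow> f \<in> W"
  shows "f \<in> W"
proof -
  have "fun_vs.span (\<Union>l\<in>\<Lambda>. geneig D l) \<subseteq> W" by (rule fun_vs.span_minimal[OF _ assms(2)]) (use assms(3) in blast)
  then show ?thesis using assms(1) total by blast
qed

definition dec :: "('a \<Rightarrow> 'k) \<Rightarrow> ('k \<Rightarrow> 'a \<Rightarrow> 'k) \<Rightarrow> bool"
  where "dec f F \<longleftrightarrow> finite {l. F l \<noteq> 0} \<and> (\<forall>l. F l \<in> geneig D l) \<and> f = (\<Sum>l\<in>{l. F l \<noteq> 0}. F l)"

lemma dec_sum: "dec f F \<Longrightarrow> finite J \<Longrightarrow> {l. F l \<noteq> 0} \<subseteq> J \<Longrightarrow> f = (\<Sum>l\<in>J. F l)"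
proof -
  assume a: "dec f F" "finite J" "{l. F l \<noteq> 0} \<subseteq> J"
  have "(\<Sum>l\<in>{l. F l \<noteq> 0}. F l) = (\<Sum>l\<in>J. F l)" by (rule sum.mono_neutral_left) (use a in auto)
  then show "f = (\<Sum>l\<in>J. F l)" using a(1) by (simp add: dec_def)
qed

lemma decI: "finite J \<Longrightarrow> (\<And>l. F l \<in> geneig D l) \<Longrightarrow> {l. F l \<noteq> 0} \<subseteq> J \<Longrightarrow> f = (\<Sum>l\<in>J. F l) \<Longrightarrow> dec f F"
proof -
  assume a: "finite J" "\<And>l. F l \<in> geneig D l" "{l. F l \<noteq> 0} \<subseteq> J" "f = (\<Sum>l\<in>J. F l)"
  have "(\<Sum>l\<in>{l. F l \<noteq> 0}. F l) = (\<Sum>l\<in>J. F l)" by (rule sum.mono_neutral_left) (use a in auto)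
  then show "dec f F" using a finite_subset by (simp add: dec_def)
qed

lemma dec_single: "f \<in> geneig D l \<Longrightarrow> dec f (\<lambda>k. if k = l then f else 0)"
  by (rule decI[of "{l}"]) (use fun_vs.subspace_0[OF geneig_subspace[OF D]] in auto)

lemma dec_add:
  assumes "dec f F" "dec g G"
  shows "dec (f + g) (\<lambda>l. F l + G l)"
proof (rule decI)
  let ?J = "{l. F l \<noteq> 0} \<union> {l. G l \<noteq> 0}"
  show fin: "finite ?J" using assms by (simp add: dec_def)
  show "F l + G l \<in> geneig D l" for l
    using assms fun_vs.subspace_add[OF geneig_subspace[OF D]] by (simp add: dec_def)
  show "{l. F l + G l \<noteq> 0} \<subseteq> ?J" by auto
  have "f = (\<Sum>l\<in>?J. F l)" "g = (\<Sum>l\<in>?J. G l)"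
    by (rule dec_sum[OF assms(1) fin], blast, rule dec_sum[OF assms(2) fin], blast)
  then show "f + g = (\<Sum>l\<in>?J. F l + G l)" by (simp only: sum.distrib)
qed

lemma dec_scale:
  assumes "dec f F"
  shows "dec (scale_fun c f) (\<lambda>l. scale_fun c (F l))"
proof (rule decI)
  show "finite {l. F l \<noteq> 0}" using assms by (simp add: dec_def)
  show "scale_fun c (F l) \<in> geneig D l" for l
    using assms fun_vs.subspace_scale[OF geneig_subspace[OF D]] by (simp add: dec_def)
  show "{l. scale_fun c (F l) \<noteq> 0} \<subseteq> {l. F l \<noteq> 0}" by auto
  have "f = (\<Sum>l\<in>{l. F l \<noteq> 0}. F l)" using assms by (simp add: dec_def)
  then have "scale_fun c f = scale_fun c (\<Sum>l\<in>{l. F l \<noteq> 0}. F l)" by (rule arg_cong)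
  then show "scale_fun c f = (\<Sum>l\<in>{l. F l \<noteq> 0}. scale_fun c (F l))" by (simp only: fun_vs.scale_sum_right)
qed

lemma dec_exists: "f \<in> regular X \<Longrightarrow> \<exists>F. dec f F"
proof -
  assume f: "f \<in> regular X"
  have "fun_vs.subspace {f. \<exists>F. dec f F}"
  proof (rule fun_vs.subspaceI)
    show "0 \<in> {f. \<exists>F. dec f F}" using dec_single[OF fun_vs.subspace_0[OF geneig_subspace[OF D]]] by blast
  qed (use dec_add dec_scale in blast)+
  then have "f \<in> {f. \<exists>F. dec f F}" by (rule graded_induct[OF f]) (use dec_single in blast)
  then show ?thesis by blast
qed

lemma dec_unique:
  assumes "dec f F" "dec f G"
  shows "F = G"
proof
  fix k
  define J where "J = {l. F l \<noteq> 0} \<union> {l. G l \<noteq> 0} \<union> {k}"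
  have fin: "finite J" using assms by (simp add: dec_def J_def)
  have "f = (\<Sum>l\<in>J. F l)" "f = (\<Sum>l\<in>J. G l)"
    by (rule dec_sum[OF assms(1) fin], auto simp: J_def)[1] (rule dec_sum[OF assms(2) fin], auto simp: J_def)
  then have "(\<Sum>l\<in>J. F l - G l) = 0" by (simp add: sum_subtractf)
  then have "F k - G k = 0"
    using geneig_independent[OF D fin, of "\<lambda>l. F l - G l" k] assms fun_vs.subspace_diff[OF geneig_subspace[OF D]]
    by (simp add: dec_def J_def)
  then show "F k = G k" by simp
qed

text \<open>\<open>T c\<close> acts by the scalar \<open>c l\<close> on the generalized eigenspace of \<open>l\<close>. For additive \<open>c\<close> it is a
  derivation, for multiplicative \<open>c\<close> an algebra endomorphism; the semisimple part of \<open>D\<close> is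
  \<open>T (\<lambda>l. l)\<close>.\<close>

definition T :: "('k \<Rightarrow> 'k) \<Rightarrow> ('a \<Rightarrow> 'k) \<Rightarrow> 'a \<Rightarrow> 'k"
  where "T c f = (if f \<in> regular X then \<Sum>l\<in>{l. (THE F. dec f F) l \<noteq> 0}. scale_fun (c l) ((THE F. dec f F) l) else 0)"

lemma T_dec:
  assumes "f \<in> regular X" "dec f F" "finite J" "{l. F l \<noteq> 0} \<subseteq> J"
  shows "T c f = (\<Sum>l\<in>J. scale_fun (c l) (F l))"
proof -
  have "(THE F. dec f F) = F" using assms(2) dec_unique by blast
  then have "T c f = (\<Sum>l\<in>{l. F l \<noteq> 0}. scale_fun (c l) (F l))" using assms(1) by (simp add: T_def)
  also have "\<dots> = (\<Sum>l\<in>J. scale_fun (c l) (F l))" by (rule sum.mono_neutral_left) (use assms in auto)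
  finally show ?thesis .
qed

lemma T_geneig: "f \<in> geneig D l \<Longrightarrow> T c f = scale_fun (c l) f"
proof -
  assume f: "f \<in> geneig D l"
  have "{k. (if k = l then f else 0) \<noteq> 0} \<subseteq> {l}" by auto
  from T_dec[OF geneig_regular[OF D f] dec_single[OF f] _ this, of c] show "T c f = scale_fun (c l) f" by simp
qed

lemma T_lin: "linear_op (T c)"
  unfolding linear_op_def
proof (intro conjI ballI allI)
  fix f g assume f: "f \<in> regular X" and g: "g \<in> regular X"
  obtain F G where F: "dec f F" and G: "dec g G" using dec_exists f g by blast
  let ?J = "{l. F l \<noteq> 0} \<union> {l. G l \<noteq> 0}"
  have fin: "finite ?J" using F G by (simp add: dec_def)
  have "T c (f + g) = (\<Sum>l\<in>?J. scale_fun (c l) (F l + G l))"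
    by (rule T_dec[OF add_closed[OF f g] dec_add[OF F G] fin]) auto
  also have "\<dots> = (\<Sum>l\<in>?J. scale_fun (c l) (F l)) + (\<Sum>l\<in>?J. scale_fun (c l) (G l))"
    by (simp only: fun_vs.scale_right_distrib sum.distrib)
  also have "(\<Sum>l\<in>?J. scale_fun (c l) (F l)) = T c f" by (rule T_dec[OF f F fin, symmetric]) blast
  also have "(\<Sum>l\<in>?J. scale_fun (c l) (G l)) = T c g" by (rule T_dec[OF g G fin, symmetric]) blast
  finally show "T c (f + g) = T c f + T c g" .
next
  fix d f assume f: "f \<in> regular X"
  obtain F where F: "dec f F" using dec_exists f by blast
  have fin: "finite {l. F l \<noteq> 0}" using F by (simp add: dec_def)
  have "T c (scale_fun d f) = (\<Sum>l\<in>{l. F l \<noteq> 0}. scale_fun (c l) (scale_fun d (F l)))"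
    by (rule T_dec[OF scale_closed[OF f] dec_scale[OF F] fin]) auto
  also have "\<dots> = scale_fun d (\<Sum>l\<in>{l. F l \<noteq> 0}. scale_fun (c l) (F l))"
    unfolding fun_vs.scale_sum_right by (rule sum.cong) (simp_all add: mult.commute)
  also have "(\<Sum>l\<in>{l. F l \<noteq> 0}. scale_fun (c l) (F l)) = T c f" by (rule T_dec[OF f F fin, symmetric]) blast
  finally show "T c (scale_fun d f) = scale_fun d (T c f)" .
qed

lemma T_preserves:
  assumes U: "fun_vs.subspace U" "U \<subseteq> regular X" "U \<subseteq> fun_vs.span (\<Union>l. geneig D l \<inter> U)" and u: "u \<in> U"
  shows "T c u \<in> U"
proof -
  have "fun_vs.subspace {u \<in> regular X. T c u \<in> U}"
  proof (rule fun_vs.subspaceI)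
    show "0 \<in> {u \<in> regular X. T c u \<in> U}" using linear_op_0[OF T_lin] zero_closed fun_vs.subspace_0[OF U(1)] by simp
  next
    fix f g assume "f \<in> {u \<in> regular X. T c u \<in> U}" "g \<in> {u \<in> regular X. T c u \<in> U}"
    then show "f + g \<in> {u \<in> regular X. T c u \<in> U}"
      using linear_op_add[OF T_lin, of f g c] add_closed[of f g] fun_vs.subspace_add[OF U(1)] by simp
  next
    fix d f assume "f \<in> {u \<in> regular X. T c u \<in> U}"
    then show "scale_fun d f \<in> {u \<in> regular X. T c u \<in> U}"
      using linear_op_scale[OF T_lin, of f c d] scale_closed[of f d] fun_vs.subspace_scale[OF U(1)] by simp
  qed
  then have "fun_vs.span (\<Union>l. geneig D l \<inter> U) \<subseteq> {u \<in> regular X. T c u \<in> U}"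
  proof (rule fun_vs.span_minimal[rotated])
    show "(\<Union>l. geneig D l \<inter> U) \<subseteq> {u \<in> regular X. T c u \<in> U}"
    proof clarify
      fix f l assume "f \<in> geneig D l" "f \<in> U"
      then show "f \<in> regular X \<and> T c f \<in> U" using T_geneig[of f l c] U(2) fun_vs.subspace_scale[OF U(1)] by auto
    qed
  qed
  then show ?thesis using u U(3) by blast
qed

lemma T_closed: "f \<in> regular X \<Longrightarrow> T c f \<in> regular X"
proof (rule T_preserves[OF subspace order_refl])
  have "(\<Union>l\<in>\<Lambda>. geneig D l) \<subseteq> (\<Union>l. geneig D l \<inter> regular X)" using geneig_regular[OF D] by blast
  then show "regular X \<subseteq> fun_vs.span (\<Union>l. geneig D l \<inter> regular X)" using total fun_vs.span_mono by blast
qed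

lemma linear_op_mult:
  assumes "linear_op P" "g \<in> regular X"
  shows "linear_op (\<lambda>f. P (f * g))" "linear_op (\<lambda>f. P f * h)" "linear_op (\<lambda>f. h * P f)"
proof -
  have e: "scale_fun c f * g = scale_fun c (f * g)" for c and f g :: "'a \<Rightarrow> 'k" by (simp add: fun_eq_iff)
  show "linear_op (\<lambda>f. P (f * g))"
    unfolding linear_op_def e distrib_right
    using linear_op_add[OF assms(1)] linear_op_scale[OF assms(1)] mult_closed assms(2) by blast
  show "linear_op (\<lambda>f. P f * h)" "linear_op (\<lambda>f. h * P f)"
    using assms(1) by (simp_all add: linear_op_def distrib_right distrib_left) (simp_all add: fun_eq_iff)
qed

lemma linear_op_plus: "linear_op P \<Longrightarrow> linear_op Q \<Longrightarrow> linear_op (\<lambda>f. P f + Q f)"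
  by (simp add: linear_op_def fun_vs.scale_right_distrib add_ac)

text \<open>Identities that are bilinear in \<open>f\<close> and \<open>g\<close> need to be checked on homogeneous elements only.\<close>

lemma T_bilinear_rule:
  assumes lin: "\<And>g. g \<in> regular X \<Longrightarrow> linear_op (\<lambda>f. Q f g)" "\<And>f. f \<in> regular X \<Longrightarrow> linear_op (\<lambda>g. Q f g)"
    and eq: "\<And>l k f g. l \<in> \<Lambda> \<Longrightarrow> k \<in> \<Lambda> \<Longrightarrow> f \<in> geneig D l \<Longrightarrow> g \<in> geneig D k \<Longrightarrow> T c (f * g) = Q f g"
    and fg: "f \<in> regular X" "g \<in> regular X"
  shows "T c (f * g) = Q f g"
proof -
  have 1: "T c (f * g) = Q f g" if f: "f \<in> regular X" and g: "k \<in> \<Lambda>" "g \<in> geneig D k" for f g k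
  proof -
    have gR: "g \<in> regular X" by (rule geneig_regular[OF D g(2)])
    have "f \<in> {f \<in> regular X. T c (f * g) = Q f g}"
      by (rule graded_induct[OF f linear_op_eq_subspace[OF linear_op_mult(1)[OF T_lin gR] lin(1)[OF gR]]])
        (use eq g geneig_regular[OF D] in blast)
    then show ?thesis by blast
  qed
  have "linear_op (\<lambda>g. T c (f * g))" using linear_op_mult(1)[OF T_lin fg(1)] by (simp add: mult.commute)
  then have "g \<in> {g \<in> regular X. T c (f * g) = Q f g}"
    by (intro graded_induct[OF fg(2) linear_op_eq_subspace[OF _ lin(2)[OF fg(1)]]])
      (use 1 fg(1) geneig_regular[OF D] in auto)
  then show ?thesis by blast
qed

lemma T_alg_end:
  assumes c: "\<And>l k. l \<in> \<Lambda> \<Longrightarrow> k \<in> \<Lambda> \<Longrightarrow> c (l + k) = c l * c k" "c 0 = 1"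
  shows "alg_end (T c)"
proof -
  have "T c (f * g) = T c f * T c g" if fg: "f \<in> regular X" "g \<in> regular X" for f g
  proof (rule T_bilinear_rule[OF _ _ _ fg])
    fix l k f g assume lk: "l \<in> \<Lambda>" "k \<in> \<Lambda>" and fg: "f \<in> geneig D l" "g \<in> geneig D k"
    show "T c (f * g) = T c f * T c g"
      unfolding T_geneig[OF geneig_mult[OF D fg]] T_geneig[OF fg(1)] T_geneig[OF fg(2)] c(1)[OF lk] by (simp add: fun_eq_iff)
  next
    show "linear_op (\<lambda>f. T c f * T c g)" if "g \<in> regular X" for g by (rule linear_op_mult(2)[OF T_lin that])
    show "linear_op (\<lambda>g. T c f * T c g)" if "f \<in> regular X" for f by (rule linear_op_mult(3)[OF T_lin that])
  qed
  moreover have "T c (const_on (points X) d) = const_on (points X) d" for d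
    using T_geneig[OF geneig_const[OF D], of c d] c(2) by simp
  ultimately show ?thesis unfolding alg_end_def using T_closed linear_op_add[OF T_lin] by blast
qed

lemma T_derivation:
  assumes c: "\<And>l k. l \<in> \<Lambda> \<Longrightarrow> k \<in> \<Lambda> \<Longrightarrow> c (l + k) = c l + c k"
  shows "T c \<in> Vec X"
proof -
  have "T c (f * g) = f * T c g + T c f * g" if fg: "f \<in> regular X" "g \<in> regular X" for f g
  proof (rule T_bilinear_rule[OF _ _ _ fg])
    fix l k f g assume lk: "l \<in> \<Lambda>" "k \<in> \<Lambda>" and fg: "f \<in> geneig D l" "g \<in> geneig D k"
    show "T c (f * g) = f * T c g + T c f * g"
      unfolding T_geneig[OF geneig_mult[OF D fg]] T_geneig[OF fg(1)] T_geneig[OF fg(2)] c(1)[OF lk] by (simp add: fun_eq_iff algebra_simps)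
  next
    have id: "linear_op (\<lambda>f. f)" by (simp add: linear_op_def)
    show "linear_op (\<lambda>f. f * T c g + T c f * g)" if "g \<in> regular X" for g
      by (rule linear_op_plus[OF linear_op_mult(2)[OF id that] linear_op_mult(2)[OF T_lin that]])
    show "linear_op (\<lambda>g. f * T c g + T c f * g)" if "f \<in> regular X" for f
      by (rule linear_op_plus[OF linear_op_mult(3)[OF T_lin that] linear_op_mult(3)[OF id that]])
  qed
  moreover have "T c f = 0" if "f \<notin> regular X" for f using that by (simp add: T_def)
  ultimately show ?thesis unfolding Vec_def using T_closed linear_op_add[OF T_lin] linear_op_scale[OF T_lin] by blast
qed

lemma T_comp:
  assumes "\<And>l. l \<in> \<Lambda> \<Longrightarrow> c l * c' l = 1" "f \<in> regular X"
  shows "T c (T c' f) = f"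
proof -
  have "linear_op (\<lambda>f. T c (T c' f))" using T_lin T_closed by (simp add: linear_op_def)
  moreover have "linear_op (\<lambda>f. f)" by (simp add: linear_op_def)
  ultimately have "f \<in> {f \<in> regular X. T c (T c' f) = f}"
  proof (rule graded_induct[OF assms(2) linear_op_eq_subspace])
    fix l f assume l: "l \<in> \<Lambda>" and f: "f \<in> geneig D l"
    have "T c (T c' f) = scale_fun (c' l) (T c f)"
      unfolding T_geneig[OF f, of c'] using linear_op_scale[OF T_lin geneig_regular[OF D f]] by simp
    also have "\<dots> = f" unfolding T_geneig[OF f] using assms(1)[OF l] by (simp add: mult.commute[of "c' l"])
    finally show "f \<in> {f \<in> regular X. T c (T c' f) = f}" using geneig_regular[OF D f] by blast
  qed
  then show ?thesis by blast
qed

definition nil_part :: "('a \<Rightarrow> 'k) \<Rightarrow> 'a \<Rightarrow> 'k"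
  where "nil_part = D + (\<lambda>f. scale_fun (-1) (T (\<lambda>l. l) f))"

lemma nil_part_Vec: "nil_part \<in> Vec X"
  unfolding nil_part_def by (intro Vec_plus Vec_smult D T_derivation) simp

lemma nil_part_geneig: "f \<in> geneig D l \<Longrightarrow> nil_part f = shift D l f"
  by (simp add: nil_part_def T_geneig shift_def fun_eq_iff)

lemma nil_part_nilpotent: "locally_nilpotent X nil_part"
  unfolding locally_nilpotent_def
proof
  fix f assume f: "f \<in> regular X"
  have "f \<in> {f \<in> regular X. \<exists>n. (nil_part ^^ n) f = 0}"
  proof (rule graded_induct[OF f nil_subspace[OF linear_op_Vec[OF nil_part_Vec] Vec_closed[OF nil_part_Vec]]])
    fix l f assume f: "f \<in> geneig D l"
    have "(nil_part ^^ n) f = (shift D l ^^ n) f \<and> (shift D l ^^ n) f \<in> geneig D l" for n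
    proof (induction n)
      case (Suc n) then show ?case
        using nil_part_geneig[of "(shift D l ^^ n) f" l] geneig_shift[OF D] by simp
    qed (use f in simp)
    then show "f \<in> {f \<in> regular X. \<exists>n. (nil_part ^^ n) f = 0}" using f by (auto simp: geneig_def)
  qed
  then show "\<exists>n. (nil_part ^^ n) f = 0" by blast
qed

end

section \<open>Vector fields that preserve the generating space are tangent to its stabilizer\<close>

context stab
begin

sublocale LG: lin_group N G0
  by unfold_locales (rule G0_group)

lemma pts_G0: "points G0 = S" and reg_G0: "regular G0 = gen_algebra S gens"
  by (simp_all add: G0_def)

lemma one_eqI:
  assumes "g \<in> S" "\<And>f y. f \<in> regular X \<Longrightarrow> y \<in> points X \<Longrightarrow> f (g y) = f y"
  shows "g = \<one>\<^bsub>N\<^esub>"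
proof -
  have g: "g \<in> carrier (Aut X)" by (rule S_Aut[OF assms(1)])
  have "g = \<one>\<^bsub>Aut X\<^esub>"
  proof (rule Aut_eqI[OF g])
    show "\<one>\<^bsub>Aut X\<^esub> \<in> carrier (Aut X)" by (rule group.is_monoid[OF group_Aut[OF affine], THEN monoid.one_closed])
    fix y assume y: "y \<in> points X"
    have "g y = y" by (rule affine_points_eqI[OF affine Aut_maps(1)[OF g y] y]) (rule assms(2)[OF _ y])
    then show "g y = \<one>\<^bsub>Aut X\<^esub> y" using y by (simp add: Aut_one)
  qed
  then show ?thesis by simp
qed

text \<open>Regular functions are polynomials in the matrix entries, and functions with a power of \<open>q\<close> as
  denominator form an algebra.\<close>

lemma curve_regular:
  assumes \<gamma>: "\<And>t. poly q t \<noteq> 0 \<Longrightarrow> \<gamma> t \<in> S"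
    and u: "\<And>u y. u \<in> U \<Longrightarrow> y \<in> points X \<Longrightarrow> \<exists>n p. \<forall>t. poly q t \<noteq> 0 \<longrightarrow> poly q t ^ n * u (\<gamma> t y) = poly p t"
    and ui: "\<And>u y. u \<in> U \<Longrightarrow> y \<in> points X \<Longrightarrow> \<exists>n p. \<forall>t. poly q t \<noteq> 0 \<longrightarrow> poly q t ^ n * u (iv (\<gamma> t) y) = poly p t"
    and F: "F \<in> regular G0"
  shows "\<exists>n p. \<forall>t. poly q t \<noteq> 0 \<longrightarrow> poly q t ^ n * F (\<gamma> t) = poly p t"
proof -
  let ?W = "{F. \<exists>n p. \<forall>t. poly q t \<noteq> 0 \<longrightarrow> poly q t ^ n * F (\<gamma> t) = poly p t}"
  have "gen_algebra S gens \<subseteq> ?W"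
  proof (rule gen_algebra_subset)
    fix c show "const_on S c \<in> ?W" using \<gamma> by (intro CollectI exI[of _ 0] exI[of _ "[:c:]"]) (simp add: const_on_def)
  next
    show "gens \<subseteq> ?W"
    proof
      fix f assume "f \<in> gens"
      then obtain i j where ij: "i < m" "j < m" and f: "f = ev (\<lambda>g. g) (v i) (x j) \<or> f = ev iv (v i) (x j)"
        by (auto simp: gens_def)
      have "ev (\<lambda>g. g) (v i) (x j) \<in> ?W" "ev iv (v i) (x j) \<in> ?W"
        using u[OF v_U[OF ij(1)] x_points[OF ij(2)]] ui[OF v_U[OF ij(1)] x_points[OF ij(2)]] \<gamma>
        by (simp_all add: ev_def)
      then show "f \<in> ?W" using f by blast
    qed
  next
    fix F G assume "F \<in> ?W" "G \<in> ?W"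
    then obtain n p k r where F: "\<And>t. poly q t \<noteq> 0 \<Longrightarrow> poly q t ^ n * F (\<gamma> t) = poly p t"
      and G: "\<And>t. poly q t \<noteq> 0 \<Longrightarrow> poly q t ^ k * G (\<gamma> t) = poly r t" by blast
    have "poly q t ^ (n + k) * (F + G) (\<gamma> t) = poly (q ^ k * p + q ^ n * r) t" if "poly q t \<noteq> 0" for t
      using F[OF that, symmetric] G[OF that, symmetric] by (simp add: power_add algebra_simps)
    then show "F + G \<in> ?W" by blast
    have "poly q t ^ (n + k) * (F * G) (\<gamma> t) = poly (p * r) t" if "poly q t \<noteq> 0" for t
      using F[OF that, symmetric] G[OF that, symmetric] by (simp add: power_add algebra_simps)
    then show "F * G \<in> ?W" by blast
  qed
  then show ?thesis using F by (auto simp: reg_G0)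
qed

text \<open>The exponential of a locally nilpotent field is an algebra automorphism that preserves \<open>U\<close>,
  hence comes from an element of \<open>S\<close>, and it is polynomial in \<open>t\<close>.\<close>

lemma nilpotent_one_param:
  assumes s: "s \<in> Vec X" "locally_nilpotent X s" "\<And>u. u \<in> U \<Longrightarrow> s u \<in> U"
  shows "\<exists>\<gamma>. LG.one_param \<gamma> \<and> (\<forall>t. \<forall>f\<in>regular X. \<forall>y\<in>points X.
      f (\<gamma> t y) = expo s t f y \<and> f (iv (\<gamma> t) y) = expo s (- t) f y) \<and>
    (\<forall>u\<in>U. \<forall>l<m. LG.curve_deriv \<gamma> (ev (\<lambda>g. g) u (x l)) = s u (x l))"
proof -
  have ae: "alg_end (expo s t)" for t
    unfolding alg_end_def using expo_closed[OF s(1)] expo_const[OF s(1)] expo_add[OF s(1,2)] expo_mult[OF s(1,2)] by blast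
  have inv: "expo s t (expo s (- t) f) = f" "expo s (- t) (expo s t f) = f" if "f \<in> regular X" for t f
    using expo_plus[OF s(1,2) that, of t "- t"] expo_plus[OF s(1,2) that, of "- t" t] expo_0[OF s(1,2) that] by simp_all
  have eU: "expo s t u \<in> U" if "u \<in> U" for t u by (rule expo_in_subspace[OF U_subspace s(3) that])
  have "\<forall>t. \<exists>g. g \<in> S \<and> (\<forall>f\<in>regular X. \<forall>y\<in>points X. f (g y) = expo s t f y \<and> f (iv g y) = expo s (- t) f y)"
    using S_of_alg_ends[OF ae ae inv eU eU] by blast
  from choice[OF this] obtain \<gamma> where "\<forall>t. \<gamma> t \<in> S \<and> (\<forall>f\<in>regular X. \<forall>y\<in>points X.
    f (\<gamma> t y) = expo s t f y \<and> f (iv (\<gamma> t) y) = expo s (- t) f y)" by blast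
  note G = this
  have \<gamma>S: "\<And>t. \<gamma> t \<in> S" and \<gamma>: "\<And>t f y. f \<in> regular X \<Longrightarrow> y \<in> points X \<Longrightarrow> f (\<gamma> t y) = expo s t f y"
    and \<gamma>i: "\<And>t f y. f \<in> regular X \<Longrightarrow> y \<in> points X \<Longrightarrow> f (iv (\<gamma> t) y) = expo s (- t) f y"
    using G by blast+
  have reg: "\<exists>p. \<forall>t. F (\<gamma> t) = poly p t" if F: "F \<in> regular G0" for F
  proof -
    have "\<exists>n p. \<forall>t. poly 1 t \<noteq> 0 \<longrightarrow> poly 1 t ^ n * F (\<gamma> t) = poly p t"
    proof (rule curve_regular[OF _ _ _ F])
      fix u y assume u: "u \<in> U" and y: "y \<in> points X"
      have ur: "u \<in> regular X" using u U_regular by blast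
      obtain p where p: "\<forall>t. expo s t u y = poly p t" using expo_poly[OF s(1,2) ur] by blast
      show "\<exists>n p. \<forall>t. poly 1 t \<noteq> 0 \<longrightarrow> poly 1 t ^ n * u (\<gamma> t y) = poly p t"
        using p \<gamma>[OF ur y] by (intro exI[of _ 0] exI[of _ p]) simp
      show "\<exists>n p. \<forall>t. poly 1 t \<noteq> 0 \<longrightarrow> poly 1 t ^ n * u (iv (\<gamma> t) y) = poly p t"
        using p \<gamma>i[OF ur y] by (intro exI[of _ 0] exI[of _ "pcompose p [:0, -1:]"]) (simp add: poly_pcompose)
    qed (rule \<gamma>S)
    then show ?thesis by simp
  qed
  have "\<gamma> (a + t) = \<gamma> a \<otimes>\<^bsub>N\<^esub> \<gamma> t" for a t
  proof (rule Aut_eqI[OF S_Aut[OF \<gamma>S]])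
    have c: "\<gamma> a \<otimes>\<^bsub>N\<^esub> \<gamma> t = compose (points X) (\<gamma> a) (\<gamma> t)" by (rule N_mult[OF \<gamma>S \<gamma>S])
    show cA: "\<gamma> a \<otimes>\<^bsub>N\<^esub> \<gamma> t \<in> carrier (Aut X)" unfolding c by (rule S_Aut[OF S_mult(1)[OF \<gamma>S \<gamma>S]])
    fix y assume y: "y \<in> points X"
    have ty: "\<gamma> t y \<in> points X" by (rule Aut_maps(1)[OF S_Aut[OF \<gamma>S] y])
    show "\<gamma> (a + t) y = (\<gamma> a \<otimes>\<^bsub>N\<^esub> \<gamma> t) y"
    proof (rule affine_points_eqI[OF affine Aut_maps(1)[OF S_Aut[OF \<gamma>S] y] Aut_maps(1)[OF cA y]])
      fix f assume f: "f \<in> regular X"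
      have "f ((\<gamma> a \<otimes>\<^bsub>N\<^esub> \<gamma> t) y) = expo s a f (\<gamma> t y)" unfolding c using y \<gamma>[OF f ty] by (simp add: compose_def)
      also have "\<dots> = expo s t (expo s a f) y" by (rule \<gamma>[OF expo_closed[OF s(1) f] y])
      also have "\<dots> = f (\<gamma> (a + t) y)" using expo_plus[OF s(1,2) f, of t a] \<gamma>[OF f y] by (simp add: add.commute)
      finally show "f (\<gamma> (a + t) y) = f ((\<gamma> a \<otimes>\<^bsub>N\<^esub> \<gamma> t) y)" by simp
    qed
  qed
  then have op: "LG.one_param \<gamma>" unfolding LG.one_param_def using \<gamma>S reg by simp
  have "LG.curve_deriv \<gamma> (ev (\<lambda>g. g) u (x l)) = s u (x l)" if u: "u \<in> U" and l: "l < m" for u l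
  proof -
    have ur: "u \<in> regular X" using u U_regular by blast
    obtain p where p: "\<forall>t. expo s t u (x l) = poly p t" "coeff p 1 = s u (x l)" using expo_poly[OF s(1,2) ur] by blast
    have "LG.curve_deriv \<gamma> (ev (\<lambda>g. g) u (x l)) = coeff p 1"
      by (rule LG.curve_deriv_eq)
        (use ev_U_closed[OF good_id u l] \<gamma>S \<gamma>[OF ur x_points[OF l]] p(1) in \<open>auto simp: reg_G0 ev_def\<close>)
    then show ?thesis using p(2) by simp
  qed
  then show ?thesis using op \<gamma> \<gamma>i by blast
qed

end

lemma power_mult_power_int:
  fixes z :: "'k::field"
  assumes "z \<noteq> 0"
  shows "z ^ nat \<bar>r\<bar> * (z powi r) = z ^ nat (\<bar>r\<bar> + r)"
proof (cases "r \<ge> 0")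
  case True
  then have e: "nat (2 * r) = nat r + nat r" by linarith
  show ?thesis using True by (simp add: power_int_def e power_add)
next
  case False
  then show ?thesis using assms by (simp add: power_int_def power_inverse)
qed

lemma (in graded) T_one: "f \<in> regular X \<Longrightarrow> T (\<lambda>l. 1) f = f"
proof -
  assume f: "f \<in> regular X"
  obtain F where F: "dec f F" using dec_exists[OF f] by blast
  have fin: "finite {l. F l \<noteq> 0}" using F by (simp add: dec_def)
  have "T (\<lambda>l. 1) f = (\<Sum>l\<in>{l. F l \<noteq> 0}. F l)" using T_dec[OF f F fin, of "\<lambda>l. 1"] by simp
  then show "T (\<lambda>l. 1) f = f" using F by (simp add: dec_def)
qed

context stab
begin

lemma ev_scale: "ev \<alpha> (scale_fun c f) y = scale_fun c (ev \<alpha> f y)" by (auto simp: ev_def)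

text \<open>An integer grading is an action of the multiplicative group: the element \<open>z\<close> acts by \<open>z ^ \<sigma> l\<close>
  on the generalized eigenspace of \<open>l\<close>. The curve \<open>z = 1 + t\<close> passes through the identity at
  \<open>t = 0\<close>, and its velocity acts by the degree \<open>\<sigma> l\<close>. Negative degrees bring powers of \<open>1 + t\<close>
  into the denominators.\<close>

lemma grading_tangent:
  assumes g: "graded X D \<Lambda>" and U\<Lambda>: "U \<subseteq> fun_vs.span (\<Union>l\<in>\<Lambda>. geneig D l \<inter> U)" and \<Lambda>0: "0 \<in> \<Lambda>"
    and \<sigma>: "\<And>l k. l \<in> \<Lambda> \<Longrightarrow> k \<in> \<Lambda> \<Longrightarrow> \<sigma> (l + k) = \<sigma> l + (\<sigma> k :: int)"
  shows "\<exists>A\<in>tangent_space G0 \<one>\<^bsub>N\<^esub>. \<forall>l\<in>\<Lambda>. \<forall>u\<in>geneig D l \<inter> U. \<forall>j<m.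
    A (ev (\<lambda>g. g) u (x j)) = of_int (\<sigma> l) * u (x j)"
proof -
  interpret gr: graded X D \<Lambda> by (rule g)
  define q :: "'k poly" where "q = [:1, 1:]"
  have q0: "coeff q 0 = 1" and q1: "coeff q 1 = 1" by (simp_all add: q_def)
  have s0: "\<sigma> 0 = 0" using \<sigma>[OF \<Lambda>0 \<Lambda>0] by simp
  \<comment> \<open>e = 1 gives the action of q t, and e = - 1 that of its inverse\<close>
  define c where "c = (\<lambda>(e::int) t l. poly q t powi (e * \<sigma> l))"
  have UR: "U \<subseteq> fun_vs.span (\<Union>l. geneig D l \<inter> U)"
    using U\<Lambda> fun_vs.span_mono[of "\<Union>l\<in>\<Lambda>. geneig D l \<inter> U" "\<Union>l. geneig D l \<inter> U"] by blast
  have ae: "alg_end (gr.T (c e t))" if "poly q t \<noteq> 0" for e t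
    by (rule gr.T_alg_end) (use that \<sigma> s0 in \<open>auto simp: c_def distrib_left power_int_add\<close>)
  have inv: "gr.T (c e t) (gr.T (c (- e) t) f) = f" if "poly q t \<noteq> 0" "f \<in> regular X" for e t f
  proof (rule gr.T_comp[OF _ that(2)])
    fix l show "c e t l * c (- e) t l = 1"
      using that(1) by (simp add: c_def power_int_minus)
  qed
  have TU: "gr.T (c e t) u \<in> U" if "u \<in> U" for e t u
    by (rule gr.T_preserves[OF U_subspace U_regular UR that])
  have "\<forall>t. \<exists>g. poly q t \<noteq> 0 \<longrightarrow> g \<in> S \<and> (\<forall>f\<in>regular X. \<forall>y\<in>points X.
      f (g y) = gr.T (c 1 t) f y \<and> f (iv g y) = gr.T (c (- 1) t) f y)"
  proof
    fix t show "\<exists>g. poly q t \<noteq> 0 \<longrightarrow> g \<in> S \<and> (\<forall>f\<in>regular X. \<forall>y\<in>points X.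
      f (g y) = gr.T (c 1 t) f y \<and> f (iv g y) = gr.T (c (- 1) t) f y)"
    proof (cases "poly q t = 0")
      case False
      have "\<exists>g\<in>S. \<forall>f\<in>regular X. \<forall>y\<in>points X. f (g y) = gr.T (c 1 t) f y \<and> f (iv g y) = gr.T (c (- 1) t) f y"
        by (rule S_of_alg_ends[OF ae[OF False] ae[OF False]])
          (use inv[OF False, of _ 1] inv[OF False, of _ "- 1"] TU in simp_all)
      then show ?thesis by blast
    qed simp
  qed
  from choice[OF this] obtain \<gamma> where \<gamma>: "\<forall>t. poly q t \<noteq> 0 \<longrightarrow> \<gamma> t \<in> S \<and> (\<forall>f\<in>regular X. \<forall>y\<in>points X.
      f (\<gamma> t y) = gr.T (c 1 t) f y \<and> f (iv (\<gamma> t) y) = gr.T (c (- 1) t) f y)" by blast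
  have \<gamma>S: "\<gamma> t \<in> S" if "poly q t \<noteq> 0" for t using \<gamma> that by blast
  have \<gamma>1: "f (\<gamma> t y) = gr.T (c 1 t) f y" and \<gamma>2: "f (iv (\<gamma> t) y) = gr.T (c (- 1) t) f y"
    if "poly q t \<noteq> 0" "f \<in> regular X" "y \<in> points X" for t f y using \<gamma> that by blast+
  have homog: "poly q t ^ nat \<bar>e * \<sigma> l\<bar> * gr.T (c e t) u y = poly (smult (u y) (q ^ nat (\<bar>e * \<sigma> l\<bar> + e * \<sigma> l))) t"
    if "u \<in> geneig D l" "poly q t \<noteq> 0" for e t u l y
  proof -
    have "poly q t ^ nat \<bar>e * \<sigma> l\<bar> * gr.T (c e t) u y
        = (poly q t ^ nat \<bar>e * \<sigma> l\<bar> * (poly q t powi (e * \<sigma> l))) * u y"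
      unfolding gr.T_geneig[OF that(1)] by (simp add: c_def)
    then show ?thesis unfolding power_mult_power_int[OF that(2)] by simp
  qed
  have curve: "\<exists>n p. \<forall>t. poly q t \<noteq> 0 \<longrightarrow> poly q t ^ n * gr.T (c e t) u y = poly p t" if u: "u \<in> U" for e u y
  proof -
    let ?W = "{u \<in> regular X. \<exists>n p. \<forall>t. poly q t \<noteq> 0 \<longrightarrow> poly q t ^ n * gr.T (c e t) u y = poly p t}"
    have "fun_vs.subspace ?W"
    proof (rule fun_vs.subspaceI)
      show "0 \<in> ?W" using linear_op_0[OF gr.T_lin] zero_closed by (intro CollectI conjI exI[of _ 0]) simp_all
    next
      fix f g assume "f \<in> ?W" "g \<in> ?W"
      then obtain n p k r where f: "f \<in> regular X" "\<And>t. poly q t \<noteq> 0 \<Longrightarrow> poly q t ^ n * gr.T (c e t) f y = poly p t"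
        and g: "g \<in> regular X" "\<And>t. poly q t \<noteq> 0 \<Longrightarrow> poly q t ^ k * gr.T (c e t) g y = poly r t" by blast
      have "poly q t ^ (n + k) * gr.T (c e t) (f + g) y = poly (q ^ k * p + q ^ n * r) t" if "poly q t \<noteq> 0" for t
        using f(2)[OF that, symmetric] g(2)[OF that, symmetric] linear_op_add[OF gr.T_lin f(1) g(1)]
        by (simp add: power_add algebra_simps)
      then show "f + g \<in> ?W" using add_closed[OF f(1) g(1)] by blast
    next
      fix d f assume "f \<in> ?W"
      then obtain n p where f: "f \<in> regular X" "\<And>t. poly q t \<noteq> 0 \<Longrightarrow> poly q t ^ n * gr.T (c e t) f y = poly p t" by blast
      have "poly q t ^ n * gr.T (c e t) (scale_fun d f) y = poly (smult d p) t" if "poly q t \<noteq> 0" for t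
        using f(2)[OF that, symmetric] linear_op_scale[OF gr.T_lin f(1)] by simp
      then show "scale_fun d f \<in> ?W" using scale_closed[OF f(1)] by blast
    qed
    moreover have "(\<Union>l\<in>\<Lambda>. geneig D l \<inter> U) \<subseteq> ?W"
      using homog U_regular by blast
    ultimately show ?thesis using u U\<Lambda> fun_vs.span_minimal by blast
  qed
  have \<gamma>0: "\<gamma> 0 = \<one>\<^bsub>N\<^esub>"
  proof (rule one_eqI)
    have nz: "poly q 0 \<noteq> 0" by (simp add: q_def)
    then show "\<gamma> 0 \<in> S" by (rule \<gamma>S)
    fix f y assume "f \<in> regular X" "y \<in> points X"
    then show "f (\<gamma> 0 y) = f y"
      using \<gamma>1[OF nz] gr.T_one by (simp add: c_def q_def)
  qed
  have "\<exists>A\<in>tangent_space G0 \<one>\<^bsub>N\<^esub>. \<forall>F\<in>regular G0. \<forall>n p.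
    (\<forall>t. poly q t \<noteq> 0 \<longrightarrow> poly q t ^ n * F (\<gamma> t) = poly p t) \<longrightarrow>
      A F = coeff p 1 - of_nat n * coeff q 1 * coeff p 0"
  proof (rule LG.curve_tangent[where q = q and \<gamma> = \<gamma> and e = "\<one>\<^bsub>N\<^esub>"])
    show "coeff q 0 = 1" "\<gamma> 0 = \<one>\<^bsub>N\<^esub>" by (rule q0, rule \<gamma>0)
    show "\<one>\<^bsub>N\<^esub> \<in> points G0" unfolding pts_G0 \<gamma>0[symmetric] by (rule \<gamma>S) (simp add: q_def)
    fix F assume F: "F \<in> regular G0"
    show "\<exists>n p. \<forall>t. poly q t \<noteq> 0 \<longrightarrow> poly q t ^ n * F (\<gamma> t) = poly p t"
    proof (rule curve_regular[OF \<gamma>S _ _ F])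
      fix u y assume u: "u \<in> U" and y: "y \<in> points X"
      have ur: "u \<in> regular X" using u U_regular by blast
      show "\<exists>n p. \<forall>t. poly q t \<noteq> 0 \<longrightarrow> poly q t ^ n * u (\<gamma> t y) = poly p t"
        using curve[OF u, of 1 y] \<gamma>1[OF _ ur y] by simp
      show "\<exists>n p. \<forall>t. poly q t \<noteq> 0 \<longrightarrow> poly q t ^ n * u (iv (\<gamma> t) y) = poly p t"
        using curve[OF u, of "- 1" y] \<gamma>2[OF _ ur y] by simp
    qed
  qed
  then obtain A where A: "A \<in> tangent_space G0 \<one>\<^bsub>N\<^esub>" and Aeq: "\<And>F n p. F \<in> regular G0 \<Longrightarrow>
    (\<forall>t. poly q t \<noteq> 0 \<longrightarrow> poly q t ^ n * F (\<gamma> t) = poly p t) \<Longrightarrow>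
      A F = coeff p 1 - of_nat n * coeff q 1 * coeff p 0" by blast
  have "A (ev (\<lambda>g. g) u (x j)) = of_int (\<sigma> l) * u (x j)" if l: "l \<in> \<Lambda>" and u: "u \<in> geneig D l" "u \<in> U" and j: "j < m" for l u j
  proof -
    have ur: "u \<in> regular X" using u U_regular by blast
    let ?n = "nat \<bar>\<sigma> l\<bar>" and ?k = "nat (\<bar>\<sigma> l\<bar> + \<sigma> l)"
    have "A (ev (\<lambda>g. g) u (x j)) = coeff (smult (u (x j)) (q ^ ?k)) 1 - of_nat ?n * coeff q 1 * coeff (smult (u (x j)) (q ^ ?k)) 0"
    proof (rule Aeq)
      show "ev (\<lambda>g. g) u (x j) \<in> regular G0" using ev_U_closed[OF good_id u(2) j] by (simp add: reg_G0)
      show "\<forall>t. poly q t \<noteq> 0 \<longrightarrow> poly q t ^ ?n * ev (\<lambda>g. g) u (x j) (\<gamma> t) = poly (smult (u (x j)) (q ^ ?k)) t"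
        using homog[OF u(1), of _ 1 "x j"] \<gamma>S \<gamma>1[OF _ ur x_points[OF j]] by (simp add: ev_def)
    qed
    also have "\<dots> = u (x j) * (of_nat ?k - of_nat ?n)"
      unfolding coeff_smult coeff_power_01[OF q0] q1 by (simp add: algebra_simps)
    also have "(of_nat ?k - of_nat ?n :: 'k) = of_int (int ?k - int ?n)" by simp
    also have "int ?k - int ?n = \<sigma> l" by simp
    finally show ?thesis by (simp add: mult.commute)
  qed
  then show ?thesis using A by blast
qed

text \<open>The tangent vector is the velocity of the exponential of the nilpotent part plus the
  combination, with coefficients \<open>\<kappa> b\<close>, of the tangent vectors of the gradings by the integer
  coordinates \<open>r b\<close> of the eigenvalues. Both sides are compared on generalized eigenvectors in
  \<open>U\<close>.\<close>

lemma derivation_tangent: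
  assumes ac: "\<And>p :: 'k poly. degree p > 0 \<Longrightarrow> \<exists>z. poly p z = 0"
    and D: "D \<in> Vec X" and DU: "\<And>u. u \<in> U \<Longrightarrow> D u \<in> U"
  shows "\<exists>A\<in>tangent_space G0 \<one>\<^bsub>N\<^esub>. fundamental_field G0 X (\<lambda>g. g) A = D"
proof -
  have dec: "U \<subseteq> fun_vs.span (\<Union>l. geneig D l \<inter> U)"
    by (rule geneig_decomposition[OF ac D U_subspace U_regular DU dual])
  have vd: "v ` {..<m} \<subseteq> fun_vs.span (\<Union>l. geneig D l \<inter> U)" using dec v_U by (intro image_subsetI) auto
  from finite_subset_spanning[OF _ vd]
  obtain B0 where B0: "finite B0" "B0 \<subseteq> (\<Union>l. geneig D l \<inter> U)" "v ` {..<m} \<subseteq> fun_vs.span B0"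
    by (metis finite_imageI finite_lessThan)
  have "\<forall>f\<in>B0. \<exists>l. f \<in> geneig D l \<inter> U" using B0(2) by blast
  from bchoice[OF this] obtain lam where lam: "\<And>f. f \<in> B0 \<Longrightarrow> f \<in> geneig D (lam f) \<inter> U" by blast
  have "finite (lam ` B0)" using B0(1) by simp
  from rational_coordinates[OF this]
  obtain \<Lambda> B and \<kappa> :: "'k \<Rightarrow> 'k" and r :: "'k \<Rightarrow> 'k \<Rightarrow> int" where
    rc: "finite B \<and> lam ` B0 \<subseteq> \<Lambda> \<and> 0 \<in> \<Lambda> \<and>
    (\<forall>l\<in>\<Lambda>. \<forall>m\<in>\<Lambda>. l + m \<in> \<Lambda> \<and> (\<forall>b\<in>B. r b (l + m) = r b l + r b m)) \<and>
    (\<forall>l\<in>\<Lambda>. l = (\<Sum>b\<in>B. \<kappa> b * of_int (r b l)))"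
    by (elim exE) (rule that)
  have \<Lambda>: "0 \<in> \<Lambda>" "\<And>l k. l \<in> \<Lambda> \<Longrightarrow> k \<in> \<Lambda> \<Longrightarrow> l + k \<in> \<Lambda>" using rc by auto
  have coord: "l = (\<Sum>b\<in>B. \<kappa> b * of_int (r b l))" if "l \<in> \<Lambda>" for l using rc that by blast
  have "fun_vs.span (v ` {..<m}) \<subseteq> fun_vs.span B0" by (rule fun_vs.span_minimal[OF B0(3) fun_vs.subspace_span])
  moreover have "B0 \<subseteq> (\<Union>l\<in>\<Lambda>. geneig D l \<inter> U)" using lam rc by blast
  then have "fun_vs.span B0 \<subseteq> fun_vs.span (\<Union>l\<in>\<Lambda>. geneig D l \<inter> U)" by (rule fun_vs.span_mono)
  ultimately have U\<Lambda>: "U \<subseteq> fun_vs.span (\<Union>l\<in>\<Lambda>. geneig D l \<inter> U)" using dual_basis_span[OF dual] by blast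
  have g: "graded X D \<Lambda>"
  proof (unfold_locales, rule D)
    let ?W = "fun_vs.span (\<Union>l\<in>\<Lambda>. geneig D l)"
    have "gen_algebra (points X) U \<subseteq> ?W"
    proof (rule gen_algebra_subset)
      show "const_on (points X) c \<in> ?W" for c using geneig_const[OF D] \<Lambda>(1) by (intro fun_vs.span_base) blast
      have "(\<Union>l\<in>\<Lambda>. geneig D l \<inter> U) \<subseteq> (\<Union>l\<in>\<Lambda>. geneig D l)" by blast
      then show "U \<subseteq> ?W" using U\<Lambda> fun_vs.span_mono by blast
      show "f * h \<in> ?W" if "f \<in> ?W" "h \<in> ?W" for f h
      proof (rule span_mult_closed[OF _ that])
        fix a b assume "a \<in> (\<Union>l\<in>\<Lambda>. geneig D l)" "b \<in> (\<Union>l\<in>\<Lambda>. geneig D l)"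
        then obtain l k where "l \<in> \<Lambda>" "a \<in> geneig D l" "k \<in> \<Lambda>" "b \<in> geneig D k" by blast
        then show "a * b \<in> ?W" using geneig_mult[OF D, of a l b k] \<Lambda>(2) by (intro fun_vs.span_base) blast
      qed
    qed (rule fun_vs.span_add)
    then show "regular X \<subseteq> ?W" using gen by simp
  qed
  interpret gr: graded X D \<Lambda> by (rule g)
  have nU: "gr.nil_part u \<in> U" if "u \<in> U" for u
  proof -
    have "gr.T (\<lambda>l. l) u \<in> U" by (rule gr.T_preserves[OF U_subspace U_regular dec that])
    moreover have "gr.nil_part u = D u + scale_fun (-1) (gr.T (\<lambda>l. l) u)"
      by (simp add: gr.nil_part_def fun_eq_iff)
    ultimately show ?thesis by (simp only:)
      (intro fun_vs.subspace_add[OF U_subspace DU[OF that]] fun_vs.subspace_scale[OF U_subspace])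
  qed
  obtain \<gamma> where \<gamma>: "LG.one_param \<gamma>" "\<And>u l. u \<in> U \<Longrightarrow> l < m \<Longrightarrow> LG.curve_deriv \<gamma> (ev (\<lambda>g. g) u (x l)) = gr.nil_part u (x l)"
    using nilpotent_one_param[OF gr.nil_part_Vec gr.nil_part_nilpotent nU] by blast
  have "\<forall>b\<in>B. \<exists>A. A \<in> tangent_space G0 \<one>\<^bsub>N\<^esub> \<and> (\<forall>l\<in>\<Lambda>. \<forall>u\<in>geneig D l \<inter> U. \<forall>j<m.
    A (ev (\<lambda>g. g) u (x j)) = of_int (r b l) * u (x j))"
  proof
    fix b assume b: "b \<in> B"
    show "\<exists>A. A \<in> tangent_space G0 \<one>\<^bsub>N\<^esub> \<and> (\<forall>l\<in>\<Lambda>. \<forall>u\<in>geneig D l \<inter> U. \<forall>j<m.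
      A (ev (\<lambda>g. g) u (x j)) = of_int (r b l) * u (x j))"
      using grading_tangent[OF g U\<Lambda> \<Lambda>(1), of "r b"] rc b by blast
  qed
  from bchoice[OF this] obtain Ab where Ab: "\<And>b. b \<in> B \<Longrightarrow> Ab b \<in> tangent_space G0 \<one>\<^bsub>N\<^esub>"
    "\<And>b l u j. b \<in> B \<Longrightarrow> l \<in> \<Lambda> \<Longrightarrow> u \<in> geneig D l \<inter> U \<Longrightarrow> j < m \<Longrightarrow> Ab b (ev (\<lambda>g. g) u (x j)) = of_int (r b l) * u (x j)"
    by blast
  define A where "A = LG.curve_deriv \<gamma> + (\<Sum>b\<in>B. scale_fun (\<kappa> b) (Ab b))"
  have A: "A \<in> tangent_space G0 \<one>\<^bsub>N\<^esub>" unfolding A_def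
    by (intro fun_vs.subspace_add[OF tangent_subspace] fun_vs.subspace_sum[OF tangent_subspace]
      fun_vs.subspace_scale[OF tangent_subspace] Ab LG.one_param_tangent \<gamma>)
  have "A (ev (\<lambda>g. g) u (x j)) = D u (x j)" if u: "u \<in> U" and j: "j < m" for u j
  proof -
    let ?W = "{u \<in> U. A (ev (\<lambda>g. g) u (x j)) = D u (x j)}"
    have "fun_vs.subspace ?W"
    proof (rule fun_vs.subspaceI)
      have "A 0 = 0" using LG.tangent_sum[OF A, where I = "{} :: nat set"] by simp
      moreover have "ev (\<lambda>g. g) 0 (x j) = 0" by (auto simp: ev_def)
      ultimately show "0 \<in> ?W" using fun_vs.subspace_0[OF U_subspace] Vec_0[OF D] by simp
    next
      fix a b assume ab: "a \<in> ?W" "b \<in> ?W"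
      then have aU: "a \<in> U" "b \<in> U" by auto
      have "A (ev (\<lambda>g. g) a (x j) + ev (\<lambda>g. g) b (x j)) = A (ev (\<lambda>g. g) a (x j)) + A (ev (\<lambda>g. g) b (x j))"
        using A ev_U_closed[OF good_id aU(1) j] ev_U_closed[OF good_id aU(2) j] unfolding tangent_space_def reg_G0 by blast
      moreover have "D (a + b) = D a + D b" using Vec_add[OF D] aU U_regular by blast
      ultimately show "a + b \<in> ?W" using ab fun_vs.subspace_add[OF U_subspace aU] by (simp add: ev_add)
    next
      fix c a assume a: "a \<in> ?W"
      then have aU: "a \<in> U" by auto
      have "A (scale_fun c (ev (\<lambda>g. g) a (x j))) = c * A (ev (\<lambda>g. g) a (x j))"
        using A ev_U_closed[OF good_id aU j] unfolding tangent_space_def reg_G0 by blast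
      moreover have "D (scale_fun c a) = scale_fun c (D a)" using Vec_scale[OF D] aU U_regular by blast
      ultimately show "scale_fun c a \<in> ?W" using a fun_vs.subspace_scale[OF U_subspace aU] by (simp add: ev_scale)
    qed
    moreover have "(\<Union>l\<in>\<Lambda>. geneig D l \<inter> U) \<subseteq> ?W"
    proof
      fix f assume "f \<in> (\<Union>l\<in>\<Lambda>. geneig D l \<inter> U)"
      then obtain l where l: "l \<in> \<Lambda>" and f: "f \<in> geneig D l \<inter> U" by blast
      have "A (ev (\<lambda>g. g) f (x j)) = shift D l f (x j) + (\<Sum>b\<in>B. \<kappa> b * (of_int (r b l) * f (x j)))"
        unfolding A_def using f \<gamma>(2)[of f j] j gr.nil_part_geneig[of f l] Ab(2)[OF _ l f j]
        by (simp add: sum_scale_apply)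
      also have "(\<Sum>b\<in>B. \<kappa> b * (of_int (r b l) * f (x j))) = (\<Sum>b\<in>B. \<kappa> b * of_int (r b l)) * f (x j)"
        by (simp add: sum_distrib_right mult.assoc)
      also have "\<dots> = l * f (x j)" using coord[OF l] by simp
      finally show "f \<in> ?W" using f by (simp add: shift_def)
    qed
    ultimately show ?thesis using u U\<Lambda> fun_vs.span_minimal by blast
  qed
  then have "fundamental_field G0 X (\<lambda>g. g) A = D" by (intro field_eq[OF A D DU])
  then show ?thesis using A by blast
qed

end

section \<open>Lie algebras generated by locally nilpotent vector fields\<close>

text \<open>The leading coefficient is eliminated by rescaling the parameter: \<open>d (t z) - z ^ K d t\<close> is a
  curve of lower degree in \<open>W\<close>. The element \<open>z\<close> has pairwise different powers, for instance
  \<open>z = 2\<close> in characteristic zero.\<close>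

lemma (in vector_space) coefficients_in_subspace:
  assumes W: "subspace W" and z: "\<And>i j :: nat. (z :: 'a) ^ i = z ^ j \<Longrightarrow> i = j"
    and curve: "\<And>t. (\<Sum>n<K. t ^ n *s d n) \<in> W" and n: "n < K"
  shows "d n \<in> W"
  using curve n
proof (induction K arbitrary: d n)
  case 0 then show ?case by simp
next
  case (Suc K)
  define e where "e = (\<lambda>n. (z ^ n - z ^ K) *s d n)"
  have "(\<Sum>n<K. t ^ n *s e n) \<in> W" for t
  proof -
    have "(\<Sum>n<Suc K. (t * z) ^ n *s d n) - z ^ K *s (\<Sum>n<Suc K. t ^ n *s d n) \<in> W"
      by (intro subspace_diff[OF W] subspace_scale[OF W] Suc.prems)
    moreover have "(\<Sum>n<Suc K. (t * z) ^ n *s d n) - z ^ K *s (\<Sum>n<Suc K. t ^ n *s d n)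
      = (\<Sum>n<Suc K. ((t * z) ^ n - z ^ K * t ^ n) *s d n)"
      by (simp add: scale_sum_right scale_left_diff_distrib sum_subtractf scale_right_distrib)
    moreover have "\<dots> = (\<Sum>n<K. t ^ n *s e n)"
      by (simp add: e_def power_mult_distrib algebra_simps)
    ultimately show ?thesis by simp
  qed
  then have eW: "e n \<in> W" if "n < K" for n using Suc.IH[of e n] that by blast
  have dW: "d n \<in> W" if "n < K" for n
  proof -
    have nz: "z ^ n - z ^ K \<noteq> 0" using z[of n K] that by auto
    have "(1 / (z ^ n - z ^ K)) *s e n \<in> W" by (rule subspace_scale[OF W eW[OF that]])
    then show ?thesis using nz by (simp add: e_def)
  qed
  have "(\<Sum>n<K. d n) + d K \<in> W" using Suc.prems(1)[of 1] by simp
  moreover have "(\<Sum>n<K. d n) \<in> W" using dW by (intro subspace_sum[OF W]) auto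
  ultimately have "(\<Sum>n<K. d n) + d K - (\<Sum>n<K. d n) \<in> W" by (rule subspace_diff[OF W])
  then have "d K \<in> W" by simp
  then show ?case using dW Suc.prems(2) by (cases "n = K") auto
qed

global_interpretation op_vs: vector_space "\<lambda>c (D :: ('a \<Rightarrow> 'k) \<Rightarrow> 'b \<Rightarrow> 'k::field) f. scale_fun c (D f)"
  by unfold_locales (auto simp: fun_eq_iff algebra_simps)

lemma op_subspace_iff:
  "op_vs.subspace W \<longleftrightarrow> 0 \<in> W \<and> (\<forall>D\<in>W. \<forall>E\<in>W. D + E \<in> W) \<and> (\<forall>c. \<forall>D\<in>W. (\<lambda>f. scale_fun c (D f)) \<in> W)"
  by (simp only: op_vs.subspace_def)

lemma op_sum_apply: "(\<Sum>n<(K::nat). (\<lambda>f. scale_fun (c n) (D n f))) f = (\<Sum>n<K. scale_fun (c n) (D n f))"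
  by (rule ext) (simp add: sum_fun_apply)

context affine
begin

text \<open>The adjoint action of automorphisms on vector fields, extended by zero off the regular functions
  because the elements of \<open>Vec X\<close> are.\<close>

definition Ad :: "('a \<Rightarrow> 'a) \<Rightarrow> (('a \<Rightarrow> 'k) \<Rightarrow> 'a \<Rightarrow> 'k) \<Rightarrow> ('a \<Rightarrow> 'k) \<Rightarrow> 'a \<Rightarrow> 'k"
  where "Ad g D = (\<lambda>f. if f \<in> regular X
    then pullback (points X) (inv_into (points X) g) (D (pullback (points X) g f)) else 0)"

lemma Aut_pullback_inv_closed:
  assumes "g \<in> carrier (Aut X)" "f \<in> regular X"
  shows "pullback (points X) (inv_into (points X) g) f \<in> regular X"
  using assms by (simp add: carrier_Aut morphism_def)

lemma Ad_Vec:
  assumes g: "g \<in> carrier (Aut X)" and D: "D \<in> Vec X"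
  shows "Ad g D \<in> Vec X"
proof -
  let ?p = "pullback (points X) g :: ('a \<Rightarrow> 'k) \<Rightarrow> 'a \<Rightarrow> 'k"
  let ?q = "pullback (points X) (inv_into (points X) g) :: ('a \<Rightarrow> 'k) \<Rightarrow> 'a \<Rightarrow> 'k"
  have pR: "?p f \<in> regular X" if "f \<in> regular X" for f by (rule Aut_pullback_closed[OF g that])
  have qp: "?q (?p f) = f" if "f \<in> regular X" for f
    using Aut_maps[OF g] vanish[OF that] by (auto simp: pullback_def fun_eq_iff)
  have A: "Ad g D f = ?q (D (?p f))" if "f \<in> regular X" for f using that by (simp add: Ad_def)
  have "Ad g D f \<in> regular X" if "f \<in> regular X" for f
    unfolding A[OF that] by (intro Aut_pullback_inv_closed[OF g] Vec_closed[OF D])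
  moreover have "Ad g D (f + h) = Ad g D f + Ad g D h" if "f \<in> regular X" "h \<in> regular X" for f h
    using that by (simp add: A add_closed pullback_add Vec_add[OF D] pR)
  moreover have "Ad g D (scale_fun c f) = scale_fun c (Ad g D f)" if "f \<in> regular X" for f c
    using that by (simp add: A scale_closed pullback_scale Vec_scale[OF D] pR)
  moreover have "Ad g D (f * h) = f * Ad g D h + Ad g D f * h" if "f \<in> regular X" "h \<in> regular X" for f h
    using that by (simp add: A mult_closed pullback_mult pullback_add Vec_mult[OF D] pR qp add.commute)
  moreover have "Ad g D f = 0" if "f \<notin> regular X" for f using that by (simp add: Ad_def)
  ultimately show ?thesis unfolding Vec_def by blast
qed

lemma Ad_add: "Ad g (D + E) = Ad g D + Ad g E"
  by (auto simp: Ad_def pullback_add fun_eq_iff)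

lemma Ad_smult: "Ad g (\<lambda>f. scale_fun c (D f)) = (\<lambda>f. scale_fun c (Ad g D f))"
  by (auto simp: Ad_def pullback_scale fun_eq_iff)

lemma Ad_0: "Ad g 0 = 0"
  by (auto simp: Ad_def pullback_def fun_eq_iff)

lemma lie_subalgebra_op_subspace: "lie_subalgebra X L \<Longrightarrow> op_vs.subspace L"
  unfolding op_subspace_iff lie_subalgebra_def by blast

lemma jacobi:
  assumes D: "D \<in> Vec X" and E: "E \<in> Vec X" and F: "F \<in> Vec X"
  shows "lie_bracket D (lie_bracket E F) = lie_bracket (lie_bracket D E) F + (\<lambda>f. scale_fun (-1) (lie_bracket (lie_bracket D F) E f))"
  by (rule ext) (simp add: lie_bracket_def Vec_diff[OF D] Vec_diff[OF E] Vec_diff[OF F]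
      Vec_closed[OF D] Vec_closed[OF E] Vec_closed[OF F] fun_eq_iff)

lemma bracket_add: "D \<in> Vec X \<Longrightarrow> E \<in> Vec X \<Longrightarrow> F \<in> Vec X \<Longrightarrow> lie_bracket D (E + F) = lie_bracket D E + lie_bracket D F"
proof
  fix f assume "D \<in> Vec X" "E \<in> Vec X" "F \<in> Vec X"
  then have "D (E f + F f) = D (E f) + D (F f)" by (intro Vec_add Vec_closed)
  then show "lie_bracket D (E + F) f = (lie_bracket D E + lie_bracket D F) f"
    unfolding lie_bracket_def plus_fun_apply[of _ _ f] plus_fun_apply[of _ _ "D f"] by (simp only: algebra_simps)
qed

lemma bracket_smult: "D \<in> Vec X \<Longrightarrow> E \<in> Vec X \<Longrightarrow>
    lie_bracket D (\<lambda>f. scale_fun c (E f)) = (\<lambda>f. scale_fun c (lie_bracket D E f))"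
proof
  fix f assume D: "D \<in> Vec X" and E: "E \<in> Vec X"
  show "lie_bracket D (\<lambda>f. scale_fun c (E f)) f = scale_fun c (lie_bracket D E f)"
    unfolding lie_bracket_def Vec_scale[OF D Vec_closed[OF E]] fun_vs.scale_right_diff_distrib ..
qed

lemma field_add: "fundamental_field G X \<theta> (A + B) = fundamental_field G X \<theta> A + fundamental_field G X \<theta> B"
  by (auto simp: fundamental_field_def differential_def fun_eq_iff)

lemma field_scale: "fundamental_field G X \<theta> (scale_fun c A) = (\<lambda>f. scale_fun c (fundamental_field G X \<theta> A f))"
  by (auto simp: fundamental_field_def differential_def fun_eq_iff)

end

context stab
begin

text \<open>The orbit map of \<open>y\<close> composed with conjugation by \<open>g\<close> sends \<open>k\<close> to \<open>g k (g\<^sup>-\<^sup>1 y)\<close>.\<close>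

lemma Ad_field:
  assumes \<gamma>: "LG.one_param \<gamma>" and g: "g \<in> S"
  shows "fundamental_field G0 X (\<lambda>g. g) (LG.curve_deriv (\<lambda>t. g \<otimes>\<^bsub>N\<^esub> (\<gamma> t \<otimes>\<^bsub>N\<^esub> inv\<^bsub>N\<^esub> g)))
    = Ad g (fundamental_field G0 X (\<lambda>g. g) (LG.curve_deriv \<gamma>))"
proof (intro ext)
  fix f y
  let ?\<xi> = "fundamental_field G0 X (\<lambda>g. g)"
  have gA: "g \<in> carrier (Aut X)" by (rule S_Aut[OF g])
  have gN: "g \<in> carrier N" using g by simp
  show "?\<xi> (LG.curve_deriv (\<lambda>t. g \<otimes>\<^bsub>N\<^esub> (\<gamma> t \<otimes>\<^bsub>N\<^esub> inv\<^bsub>N\<^esub> g))) f y = Ad g (?\<xi> (LG.curve_deriv \<gamma>)) f y"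
  proof (cases "f \<in> regular X \<and> y \<in> points X")
    case True
    then have f: "f \<in> regular X" and y: "y \<in> points X" by auto
    have iy: "iv g y \<in> points X" by (rule Aut_maps(2)[OF gA y])
    have pe: "pullback S (\<lambda>g. g y) h = ev (\<lambda>g. g) h y" for h :: "'a \<Rightarrow> 'k" and y by (auto simp: pullback_def ev_def)
    have "pullback S (\<lambda>k. g \<otimes>\<^bsub>N\<^esub> (k \<otimes>\<^bsub>N\<^esub> inv\<^bsub>N\<^esub> g)) (ev (\<lambda>g. g) f y) = ev (\<lambda>g. g) (pullback (points X) g f) (iv g y)"
    proof
      fix k show "pullback S (\<lambda>k. g \<otimes>\<^bsub>N\<^esub> (k \<otimes>\<^bsub>N\<^esub> inv\<^bsub>N\<^esub> g)) (ev (\<lambda>g. g) f y) k = ev (\<lambda>g. g) (pullback (points X) g f) (iv g y) k"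
      proof (cases "k \<in> S")
        case k: True
        have i: "inv\<^bsub>N\<^esub> g = restrict (iv g) (points X)" "restrict (iv g) (points X) \<in> S"
          using N_inv[OF g] S_inv(1)[OF g] by auto
        have ki: "k \<otimes>\<^bsub>N\<^esub> inv\<^bsub>N\<^esub> g = compose (points X) k (restrict (iv g) (points X))"
          "compose (points X) k (restrict (iv g) (points X)) \<in> S"
          using N_mult[OF k i(2)] S_mult(1)[OF k i(2)] i(1) by auto
        have c: "g \<otimes>\<^bsub>N\<^esub> (k \<otimes>\<^bsub>N\<^esub> inv\<^bsub>N\<^esub> g) = compose (points X) g (compose (points X) k (restrict (iv g) (points X)))"
          "compose (points X) g (compose (points X) k (restrict (iv g) (points X))) \<in> S"
          unfolding ki(1) using N_mult[OF g ki(2)] S_mult(1)[OF g ki(2)] by auto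
        have "k (iv g y) \<in> points X" by (rule Aut_maps(1)[OF S_Aut[OF k] iy])
        then have "f (compose (points X) g (compose (points X) k (restrict (iv g) (points X))) y) = pullback (points X) g f (k (iv g y))"
          using y iy by (simp add: compose_def pullback_def)
        then show ?thesis using k c(2) by (simp add: pullback_def[of S] ev_def c(1)[simplified])
      qed (simp add: pullback_def ev_def)
    qed
    moreover have "LG.curve_deriv (\<lambda>t. g \<otimes>\<^bsub>N\<^esub> (\<gamma> t \<otimes>\<^bsub>N\<^esub> inv\<^bsub>N\<^esub> g)) (ev (\<lambda>g. g) f y)
      = LG.curve_deriv \<gamma> (pullback (carrier N) (\<lambda>k. g \<otimes>\<^bsub>N\<^esub> (k \<otimes>\<^bsub>N\<^esub> inv\<^bsub>N\<^esub> g)) (ev (\<lambda>g. g) f y))"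
      by (rule LG.curve_deriv_conj[OF \<gamma> gN]) (use ev_closed[OF good_id f y] in \<open>simp add: reg_G0\<close>)
    ultimately have "LG.curve_deriv (\<lambda>t. g \<otimes>\<^bsub>N\<^esub> (\<gamma> t \<otimes>\<^bsub>N\<^esub> inv\<^bsub>N\<^esub> g)) (ev (\<lambda>g. g) f y)
      = LG.curve_deriv \<gamma> (ev (\<lambda>g. g) (pullback (points X) g f) (iv g y))" by simp
    moreover have ff: "?\<xi> B h z = B (ev (\<lambda>g. g) h z)" if "h \<in> regular X" "z \<in> points X" for B h z
      using that by (simp add: fundamental_field_def differential_def pts_G0 pe)
    moreover have "Ad g (?\<xi> B) f y = ?\<xi> B (pullback (points X) g f) (iv g y)" for B
      unfolding Ad_def pullback_def[of _ "iv g"] using f y by simp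
    ultimately show ?thesis using ff[OF f y] ff[OF Aut_pullback_closed[OF gA f] iy] by (simp only:)
  next
    case False
    then show ?thesis by (auto simp: fundamental_field_def differential_def Ad_def pullback_def)
  qed
qed

lemma Ad_mult:
  assumes "g \<in> S" "h \<in> S"
  shows "Ad (g \<otimes>\<^bsub>N\<^esub> h) D = Ad g (Ad h D)"
proof
  fix f
  have gh: "g \<in> carrier (Aut X)" "h \<in> carrier (Aut X)" using assms S_Aut by auto
  have c: "g \<otimes>\<^bsub>N\<^esub> h = compose (points X) g h" by (rule N_mult[OF assms])
  have 1: "pullback (points X) (compose (points X) g h) f = pullback (points X) h (pullback (points X) g f)" for f :: "'a \<Rightarrow> 'k"
    using Aut_maps(1)[OF gh(2)] by (auto simp: pullback_def compose_def fun_eq_iff)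
  have 2: "pullback (points X) (iv (compose (points X) g h)) F = pullback (points X) (iv g) (pullback (points X) (iv h) F)" for F :: "'a \<Rightarrow> 'k"
    using Aut_maps(2)[OF gh(1)] S_mult(2)[OF assms] by (auto simp: pullback_def fun_eq_iff)
  show "Ad (g \<otimes>\<^bsub>N\<^esub> h) D f = Ad g (Ad h D) f"
  proof (cases "f \<in> regular X")
    case True
    then show ?thesis unfolding c using Aut_pullback_closed[OF gh(1) True] by (simp add: Ad_def 1 2)
  qed (simp add: Ad_def)
qed

lemma Ad_one:
  assumes D: "D \<in> Vec X"
  shows "Ad \<one>\<^bsub>N\<^esub> D = D"
proof
  fix f
  have one: "\<one>\<^bsub>Aut X\<^esub> \<in> carrier (Aut X)" using S_Aut subgroup.one_closed[OF S_subgroup] by blast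
  have i: "iv \<one>\<^bsub>Aut X\<^esub> y = y" if "y \<in> points X" for y
    by (rule Aut_inv_into_eq[OF one that]) (use that in \<open>simp add: Aut_one\<close>)
  have p: "pullback (points X) \<one>\<^bsub>Aut X\<^esub> h = h" "pullback (points X) (iv \<one>\<^bsub>Aut X\<^esub>) h = h" if "h \<in> regular X" for h
  proof -
    show "pullback (points X) \<one>\<^bsub>Aut X\<^esub> h = h"
      using vanish[OF that] by (auto simp: pullback_def Aut_one fun_eq_iff)
    show "pullback (points X) (iv \<one>\<^bsub>Aut X\<^esub>) h = h"
      using vanish[OF that] i by (auto simp: pullback_def fun_eq_iff)
  qed
  show "Ad \<one>\<^bsub>N\<^esub> D f = D f"
    using p Vec_closed[OF D, of f] Vec_off[OF D] by (auto simp: Ad_def)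
qed

lemma uniformly_nilpotent:
  assumes s: "s \<in> Vec X" "locally_nilpotent X s"
  shows "\<exists>k>0. \<forall>u\<in>U. (s ^^ k) u = 0"
proof -
  have "\<forall>i. \<exists>n. i < m \<longrightarrow> (s ^^ n) (v i) = 0" using s(2) v_regular unfolding locally_nilpotent_def by blast
  from choice[OF this] obtain n where n: "\<And>i. i < m \<Longrightarrow> (s ^^ n i) (v i) = 0" by blast
  define k where "k = (\<Sum>i<m. n i) + 1"
  have z: "(s ^^ k) (v i) = 0" if "i < m" for i
    by (rule Vec_pow_eq_0[OF s(1) n[OF that]]) (use that in \<open>simp add: k_def le_SucI member_le_sum\<close>)
  have "(s ^^ k) u = 0" if u: "u \<in> U" for u
  proof -
    have "u = (\<Sum>i<m. scale_fun (u (x i)) (v i))" using dual u by (simp add: dual_basis_def)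
    then have "(s ^^ k) u = (s ^^ k) (\<Sum>i<m. scale_fun (u (x i)) (v i))" by (rule arg_cong)
    also have "\<dots> = (\<Sum>i<m. scale_fun (u (x i)) ((s ^^ k) (v i)))"
      using Vec_pow_sum[OF s(1), of "{..<m}" "\<lambda>i. scale_fun (u (x i)) (v i)" k] v_regular
      by (simp add: scale_closed Vec_pow_scale[OF s(1)])
    finally show ?thesis using z by simp
  qed
  then show ?thesis by (intro exI[of _ k]) (simp add: k_def)
qed

text \<open>Both sides are vector fields, so it suffices to compare them on the generating space \<open>U\<close>, where
  \<open>s\<close> is nilpotent and \<open>expo_conj\<close> applies.\<close>

lemma Ad_expansion:
  assumes s: "s \<in> Vec X" "locally_nilpotent X s" "\<And>u. u \<in> U \<Longrightarrow> s u \<in> U"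
    and \<gamma>: "LG.one_param \<gamma>" "\<And>t f y. f \<in> regular X \<Longrightarrow> y \<in> points X \<Longrightarrow> f (\<gamma> t y) = expo s t f y"
      "\<And>t f y. f \<in> regular X \<Longrightarrow> y \<in> points X \<Longrightarrow> f (iv (\<gamma> t) y) = expo s (- t) f y"
    and D: "D \<in> Vec X" "\<And>u. u \<in> U \<Longrightarrow> D u \<in> U"
    and k: "\<And>u. u \<in> U \<Longrightarrow> (s ^^ k) u = 0"
  shows "Ad (\<gamma> t) D = (\<Sum>n<2 * k. (\<lambda>f. scale_fun (t ^ n / fact n) (((\<lambda>E. lie_bracket E s) ^^ n) D f)))"
proof (rule Vec_eqI[OF _ _ gen])
  let ?L = "\<lambda>n. ((\<lambda>E. lie_bracket E s) ^^ n) D"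
  have LV: "?L n \<in> Vec X" for n by (induction n) (use D lie_bracket_Vec s(1) in auto)
  have sub: "op_vs.subspace (Vec X)"
    unfolding op_subspace_iff using Vec_plus Vec_smult zero_closed by (auto simp: Vec_def)
  have "\<gamma> t \<in> carrier N" using \<gamma>(1) unfolding LG.one_param_def by blast
  then have gA: "\<gamma> t \<in> carrier (Aut X)" using S_Aut by simp
  show "Ad (\<gamma> t) D \<in> Vec X" by (rule Ad_Vec[OF gA D(1)])
  show "(\<Sum>n<2 * k. (\<lambda>f. scale_fun (t ^ n / fact n) (?L n f))) \<in> Vec X"
    by (intro op_vs.subspace_sum[OF sub] op_vs.subspace_scale[OF sub] LV)
  fix u assume u: "u \<in> U"
  then have ur: "u \<in> regular X" using U_regular by blast
  have p: "pullback (points X) (\<gamma> t) f = expo s t f" "pullback (points X) (iv (\<gamma> t)) f = expo s (- t) f" if "f \<in> regular X" for f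
    using \<gamma>(2,3)[OF that] vanish[OF expo_closed[OF s(1) that]] by (auto simp: pullback_def fun_eq_iff)
  have "Ad (\<gamma> t) D u = expo s (- t) (D (expo s t u))"
    using ur p(1)[OF ur] p(2)[OF Vec_closed[OF D(1)]] by (simp add: Ad_def)
  also have "\<dots> = (\<Sum>n<2 * k. scale_fun (t ^ n / fact n) (?L n u))"
    by (rule expo_conj[OF s(1,2) D(1) U_regular U_subspace D(2) k s(3) u])
  finally show "Ad (\<gamma> t) D u = (\<Sum>n<2 * k. (\<lambda>f. scale_fun (t ^ n / fact n) (?L n f))) u"
    by (simp only: op_sum_apply)
qed

text \<open>The family \<open>\<Gamma>\<close> consists of the conjugates of the groups \<open>exp (t s)\<close> by all elements of \<open>G0\<close>
  whose adjoint action and its inverse preserve \<open>L\<close>. It is closed under conjugation, so the space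
  \<open>\<tt>\<close> of the fields of its velocities is the Lie algebra of the closure, and it is stable under
  the adjoint action of each \<open>exp (t s)\<close>. This action is polynomial in \<open>t\<close> with linear coefficient
  the bracket with \<open>s\<close>, so \<open>\<tt>\<close> is stable under that bracket. The elements of \<open>L\<close> whose bracket
  preserves \<open>\<tt>\<close> form a subalgebra, by the Jacobi identity; it contains the generators, so it is
  \<open>L\<close>.\<close>

theorem nilpotently_generated_algebraic:
  assumes L: "lie_subalgebra X L" and LU: "\<And>\<delta> u. \<delta> \<in> L \<Longrightarrow> u \<in> U \<Longrightarrow> \<delta> u \<in> U"
    and Sg: "Sg \<subseteq> L" "\<And>s. s \<in> Sg \<Longrightarrow> locally_nilpotent X s" "L = generated_lie_subalgebra X Sg"
  shows "\<exists>G. algebraic_subgroup X G \<and> L = Lie X G"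
proof -
  let ?\<xi> = "fundamental_field G0 X (\<lambda>g. g)"
  let ?\<tau> = "LG.curve_deriv"
  have LV: "\<delta> \<in> Vec X" if "\<delta> \<in> L" for \<delta> using L that by (auto simp: lie_subalgebra_def)
  have Lsub: "op_vs.subspace L" by (rule lie_subalgebra_op_subspace[OF L])
  have Lbr: "lie_bracket \<delta> \<epsilon> \<in> L" if "\<delta> \<in> L" "\<epsilon> \<in> L" for \<delta> \<epsilon> using L that by (auto simp: lie_subalgebra_def)
  have SgV: "s \<in> Vec X" if "s \<in> Sg" for s using Sg(1) LV that by blast
  have SgU: "s u \<in> U" if "s \<in> Sg" "u \<in> U" for s u using LU Sg(1) that by blast
  have "\<forall>s\<in>Sg. \<exists>\<gamma>. LG.one_param \<gamma> \<and> (\<forall>t. \<forall>f\<in>regular X. \<forall>y\<in>points X.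
      f (\<gamma> t y) = expo s t f y \<and> f (iv (\<gamma> t) y) = expo s (- t) f y) \<and>
    (\<forall>u\<in>U. \<forall>l<m. ?\<tau> \<gamma> (ev (\<lambda>g. g) u (x l)) = s u (x l))"
    by (intro ballI) (rule nilpotent_one_param[OF SgV Sg(2) SgU])
  from bchoice[OF this] obtain \<phi> where \<phi>: "\<forall>s\<in>Sg. LG.one_param (\<phi> s) \<and> (\<forall>t. \<forall>f\<in>regular X. \<forall>y\<in>points X.
      f (\<phi> s t y) = expo s t f y \<and> f (iv (\<phi> s t) y) = expo s (- t) f y) \<and>
    (\<forall>u\<in>U. \<forall>l<m. ?\<tau> (\<phi> s) (ev (\<lambda>g. g) u (x l)) = s u (x l))" by blast
  have \<phi>p: "LG.one_param (\<phi> s)" if "s \<in> Sg" for s using \<phi> that by blast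
  have \<phi>1: "f (\<phi> s t y) = expo s t f y" and \<phi>2: "f (iv (\<phi> s t) y) = expo s (- t) f y"
    if "s \<in> Sg" "f \<in> regular X" "y \<in> points X" for s t f y using \<phi> that by blast+
  have \<phi>\<xi>: "?\<xi> (?\<tau> (\<phi> s)) = s" if s: "s \<in> Sg" for s
    by (rule field_eq[OF LG.one_param_tangent[OF \<phi>p[OF s]] SgV[OF s] SgU[OF s]]) (use \<phi> s in blast)+
  have \<phi>S: "\<phi> s t \<in> S" if "s \<in> Sg" for s t using \<phi>p[OF that] by (simp add: LG.one_param_def)
  have expand: "\<exists>k>0. \<forall>t. Ad (\<phi> s t) D = (\<Sum>n<2 * k. (\<lambda>f. scale_fun (t ^ n / fact n) (((\<lambda>E. lie_bracket E s) ^^ n) D f)))"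
    if s: "s \<in> Sg" and D: "D \<in> L" for s D
  proof -
    obtain k where k: "k > 0" "\<And>u. u \<in> U \<Longrightarrow> (s ^^ k) u = 0" using uniformly_nilpotent[OF SgV[OF s] Sg(2)[OF s]] by blast
    have "Ad (\<phi> s t) D = (\<Sum>n<2 * k. (\<lambda>f. scale_fun (t ^ n / fact n) (((\<lambda>E. lie_bracket E s) ^^ n) D f)))" for t
      by (rule Ad_expansion[OF SgV[OF s] Sg(2)[OF s] SgU[OF s] \<phi>p[OF s] \<phi>1[OF s] \<phi>2[OF s] LV[OF D] LU[OF D] k(2)])
    then show ?thesis using k(1) by blast
  qed
  have Ad_L: "Ad (\<phi> s t) D \<in> L" if s: "s \<in> Sg" and D: "D \<in> L" for s t D
  proof -
    have "((\<lambda>E. lie_bracket E s) ^^ n) D \<in> L" for n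
      by (induction n) (use D Lbr Sg(1) s in auto)
    then have "(\<Sum>n<2 * k. (\<lambda>f. scale_fun (t ^ n / fact n) (((\<lambda>E. lie_bracket E s) ^^ n) D f))) \<in> L" for k
      by (intro op_vs.subspace_sum[OF Lsub] op_vs.subspace_scale[OF Lsub])
    note m = this
    obtain k where "\<And>t. Ad (\<phi> s t) D = (\<Sum>n<2 * k. (\<lambda>f. scale_fun (t ^ n / fact n) (((\<lambda>E. lie_bracket E s) ^^ n) D f)))"
      using expand[OF s D] by (elim exE conjE) blast
    then show ?thesis using m[of k] by (simp only:)
  qed
  \<comment> \<open>the elements of S whose adjoint action maps L onto itself\<close>
  define H where "H = {g \<in> S. \<forall>l\<in>L. Ad g l \<in> L \<and> Ad (inv\<^bsub>N\<^esub> g) l \<in> L}"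
  have iS: "inv\<^bsub>N\<^esub> g \<in> S" if "g \<in> S" for g using LG.inv_closed[of g] that by simp
  have mS: "g \<otimes>\<^bsub>N\<^esub> h \<in> S" if "g \<in> S" "h \<in> S" for g h using LG.m_closed[of g h] that by simp
  have H1: "\<one>\<^bsub>N\<^esub> \<in> H"
    using subgroup.one_closed[OF S_subgroup] Ad_one[OF LV] LG.inv_one by (simp add: H_def)
  have Hm: "g \<otimes>\<^bsub>N\<^esub> h \<in> H" if g: "g \<in> H" and h: "h \<in> H" for g h
  proof -
    have gS: "g \<in> S" "h \<in> S" using g h by (auto simp: H_def)
    have i: "inv\<^bsub>N\<^esub> (g \<otimes>\<^bsub>N\<^esub> h) = inv\<^bsub>N\<^esub> h \<otimes>\<^bsub>N\<^esub> inv\<^bsub>N\<^esub> g"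
      by (rule LG.inv_mult_group) (use gS in auto)
    show ?thesis unfolding H_def mem_Collect_eq i Ad_mult[OF gS] Ad_mult[OF iS[OF gS(2)] iS[OF gS(1)]]
      using mS[OF gS] g h by (simp only: H_def mem_Collect_eq) blast
  qed
  have \<phi>H: "\<phi> s t \<in> H" if s: "s \<in> Sg" for s t
    unfolding H_def using \<phi>S[OF s] Ad_L[OF s] LG.one_param_inv[OF \<phi>p[OF s]] by simp
  define \<Gamma> where "\<Gamma> = {\<lambda>t. h \<otimes>\<^bsub>N\<^esub> (\<phi> s t \<otimes>\<^bsub>N\<^esub> inv\<^bsub>N\<^esub> h) | h s. h \<in> H \<and> s \<in> Sg}"
  have HS: "h \<in> S" if "h \<in> H" for h using that by (simp add: H_def)
  have Hi: "inv\<^bsub>N\<^esub> h \<in> H" if "h \<in> H" for h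
    using that iS LG.inv_inv[of h] by (simp add: H_def)
  have \<Gamma>_one: "LG.one_param \<gamma>" if "\<gamma> \<in> \<Gamma>" for \<gamma>
    using that LG.one_param_conj[OF \<phi>p] HS by (auto simp: \<Gamma>_def)
  have \<Gamma>_H: "\<gamma> u \<in> H" if "\<gamma> \<in> \<Gamma>" for \<gamma> u
    using that Hm Hi \<phi>H by (auto simp: \<Gamma>_def)
  have \<Gamma>_conj: "(\<lambda>t. g \<otimes>\<^bsub>N\<^esub> (\<gamma> t \<otimes>\<^bsub>N\<^esub> inv\<^bsub>N\<^esub> g)) \<in> \<Gamma>" if g: "g \<in> H" and \<gamma>: "\<gamma> \<in> \<Gamma>" for g \<gamma>
  proof -
    obtain h s where hs: "h \<in> H" "s \<in> Sg" "\<gamma> = (\<lambda>t. h \<otimes>\<^bsub>N\<^esub> (\<phi> s t \<otimes>\<^bsub>N\<^esub> inv\<^bsub>N\<^esub> h))" using \<gamma> by (auto simp: \<Gamma>_def)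
    have c: "g \<in> carrier N" "h \<in> carrier N" "\<And>t. \<phi> s t \<in> carrier N" using HS g hs \<phi>S by auto
    have "g \<otimes>\<^bsub>N\<^esub> (\<gamma> t \<otimes>\<^bsub>N\<^esub> inv\<^bsub>N\<^esub> g) = (g \<otimes>\<^bsub>N\<^esub> h) \<otimes>\<^bsub>N\<^esub> (\<phi> s t \<otimes>\<^bsub>N\<^esub> inv\<^bsub>N\<^esub> (g \<otimes>\<^bsub>N\<^esub> h))" for t
      unfolding hs(3) using c by (simp only: LG.inv_mult_group LG.m_assoc LG.m_closed LG.inv_closed)
    then show ?thesis unfolding \<Gamma>_def using Hm[OF g hs(1)] hs(2) by blast
  qed
  interpret F: one_param_family N G0 \<Gamma>
    by unfold_locales (use \<Gamma>_one \<Gamma>_conj \<Gamma>_H in blast)+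
  define \<tt> where "\<tt> = ?\<xi> ` fun_vs.span (?\<tau> ` \<Gamma>)"
  have \<xi>0: "?\<xi> 0 = 0" by (auto simp: fundamental_field_def differential_def fun_eq_iff)
  have \<tt>sub: "op_vs.subspace \<tt>"
    unfolding op_subspace_iff \<tt>_def
  proof (intro conjI ballI allI)
    show "0 \<in> ?\<xi> ` fun_vs.span (?\<tau> ` \<Gamma>)" using \<xi>0 fun_vs.span_zero by (metis image_eqI)
  next
    fix D E assume "D \<in> ?\<xi> ` fun_vs.span (?\<tau> ` \<Gamma>)" "E \<in> ?\<xi> ` fun_vs.span (?\<tau> ` \<Gamma>)"
    then obtain A B where AB: "A \<in> fun_vs.span (?\<tau> ` \<Gamma>)" "B \<in> fun_vs.span (?\<tau> ` \<Gamma>)" "D = ?\<xi> A" "E = ?\<xi> B" by blast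
    show "D + E \<in> ?\<xi> ` fun_vs.span (?\<tau> ` \<Gamma>)"
      unfolding AB(3,4) field_add[symmetric] by (intro imageI fun_vs.span_add AB)
  next
    fix c D assume "D \<in> ?\<xi> ` fun_vs.span (?\<tau> ` \<Gamma>)"
    then obtain A where A: "A \<in> fun_vs.span (?\<tau> ` \<Gamma>)" "D = ?\<xi> A" by blast
    show "(\<lambda>f. scale_fun c (D f)) \<in> ?\<xi> ` fun_vs.span (?\<tau> ` \<Gamma>)"
      unfolding A(2) field_scale[symmetric] by (intro imageI fun_vs.span_scale A)
  qed
  have span_rule: "?\<xi> A \<in> W" if A: "A \<in> fun_vs.span (?\<tau> ` \<Gamma>)" and W: "op_vs.subspace W"
    and b: "\<And>\<gamma>. \<gamma> \<in> \<Gamma> \<Longrightarrow> ?\<xi> (?\<tau> \<gamma>) \<in> W" for A W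
  proof -
    have W': "0 \<in> W" "\<And>D E. D \<in> W \<Longrightarrow> E \<in> W \<Longrightarrow> D + E \<in> W" "\<And>c D. D \<in> W \<Longrightarrow> (\<lambda>f. scale_fun c (D f)) \<in> W"
      using W unfolding op_subspace_iff by auto
    have "fun_vs.subspace {A. ?\<xi> A \<in> W}"
      by (rule fun_vs.subspaceI) (use W' in \<open>simp_all only: mem_Collect_eq \<xi>0 field_add field_scale\<close>)
    then have "fun_vs.span (?\<tau> ` \<Gamma>) \<subseteq> {A. ?\<xi> A \<in> W}" by (rule fun_vs.span_minimal[rotated]) (use b in blast)
    then show ?thesis using A by blast
  qed
  have \<tt>L: "\<tt> \<subseteq> L"
  proof
    fix D assume "D \<in> \<tt>"
    then obtain A where A: "A \<in> fun_vs.span (?\<tau> ` \<Gamma>)" "D = ?\<xi> A" unfolding \<tt>_def by blast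
    show "D \<in> L" unfolding A(2)
    proof (rule span_rule[OF A(1) Lsub])
      fix \<gamma> assume "\<gamma> \<in> \<Gamma>"
      then obtain h s where hs: "h \<in> H" "s \<in> Sg" "\<gamma> = (\<lambda>t. h \<otimes>\<^bsub>N\<^esub> (\<phi> s t \<otimes>\<^bsub>N\<^esub> inv\<^bsub>N\<^esub> h))" by (auto simp: \<Gamma>_def)
      have "?\<xi> (?\<tau> \<gamma>) = Ad h s" unfolding hs(3) Ad_field[OF \<phi>p[OF hs(2)] HS[OF hs(1)]] \<phi>\<xi>[OF hs(2)] ..
      then show "?\<xi> (?\<tau> \<gamma>) \<in> L" using hs(1,2) Sg(1) by (auto simp: H_def)
    qed
  qed
  have \<tt>Ad: "Ad g D \<in> \<tt>" if g: "g \<in> H" and D: "D \<in> \<tt>" for g D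
  proof -
    obtain A where A: "A \<in> fun_vs.span (?\<tau> ` \<Gamma>)" "D = ?\<xi> A" using D unfolding \<tt>_def by blast
    have t': "0 \<in> \<tt>" "\<And>D E. D \<in> \<tt> \<Longrightarrow> E \<in> \<tt> \<Longrightarrow> D + E \<in> \<tt>" "\<And>c D. D \<in> \<tt> \<Longrightarrow> (\<lambda>f. scale_fun c (D f)) \<in> \<tt>"
      using \<tt>sub unfolding op_subspace_iff by auto
    have "?\<xi> A \<in> {D. Ad g D \<in> \<tt>}"
    proof (rule span_rule[OF A(1)])
      show "op_vs.subspace {D. Ad g D \<in> \<tt>}" unfolding op_subspace_iff
        using t' by (simp only: mem_Collect_eq Ad_0 Ad_add Ad_smult) blast
      fix \<gamma> assume \<gamma>: "\<gamma> \<in> \<Gamma>"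
      have "Ad g (?\<xi> (?\<tau> \<gamma>)) = ?\<xi> (?\<tau> (\<lambda>t. g \<otimes>\<^bsub>N\<^esub> (\<gamma> t \<otimes>\<^bsub>N\<^esub> inv\<^bsub>N\<^esub> g)))"
        by (rule Ad_field[OF \<Gamma>_one[OF \<gamma>] HS[OF g], symmetric])
      then have "Ad g (?\<xi> (?\<tau> \<gamma>)) \<in> \<tt>" unfolding \<tt>_def using \<Gamma>_conj[OF g \<gamma>] fun_vs.span_base by blast
      then show "?\<xi> (?\<tau> \<gamma>) \<in> {D. Ad g D \<in> \<tt>}" by blast
    qed
    then show ?thesis using A(2) by blast
  qed
  have \<tt>s: "lie_bracket D s \<in> \<tt>" if s: "s \<in> Sg" and D: "D \<in> \<tt>" for s D
  proof -
    let ?L = "\<lambda>n. ((\<lambda>E. lie_bracket E s) ^^ n) D"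
    obtain k where k: "k > 0" "\<And>t. Ad (\<phi> s t) D = (\<Sum>n<2 * k. (\<lambda>f. scale_fun (t ^ n / fact n) (?L n f)))"
      using expand[OF s] D \<tt>L by blast
    have "(\<Sum>n<2 * k. (\<lambda>f. scale_fun (t ^ n) (scale_fun (1 / fact n) (?L n f)))) \<in> \<tt>" for t
      using \<tt>Ad[OF \<phi>H[OF s, of t] D] unfolding k(2) by (simp add: divide_inverse)
    moreover have "i = j" if "(2::'k) ^ i = 2 ^ j" for i j :: nat
    proof -
      have "(of_nat (2 ^ i) :: 'k) = of_nat (2 ^ j)" using that by simp
      then have "(2::nat) ^ i = 2 ^ j" by (simp only: of_nat_eq_iff)
      then show ?thesis by simp
    qed
    ultimately have "(\<lambda>f. scale_fun (1 / fact 1) (?L 1 f)) \<in> \<tt>"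
      using op_vs.coefficients_in_subspace[OF \<tt>sub, where z = 2 and K = "2 * k" and d = "\<lambda>n f. scale_fun (1 / fact n) (?L n f)" and n = 1] k(1)
      by simp
    then show ?thesis by simp
  qed
  have \<tt>V: "D \<in> Vec X" if "D \<in> \<tt>" for D using that \<tt>L LV by blast
  have \<tt>': "0 \<in> \<tt>" "\<And>D E. D \<in> \<tt> \<Longrightarrow> E \<in> \<tt> \<Longrightarrow> D + E \<in> \<tt>" "\<And>c D. D \<in> \<tt> \<Longrightarrow> (\<lambda>f. scale_fun c (D f)) \<in> \<tt>"
    using \<tt>sub unfolding op_subspace_iff by auto
  \<comment> \<open>the normalizer of \<tt> in L\<close>
  define \<nn> where "\<nn> = {E \<in> L. \<forall>D\<in>\<tt>. lie_bracket D E \<in> \<tt>}"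
  have L': "0 \<in> L" "\<And>D E. D \<in> L \<Longrightarrow> E \<in> L \<Longrightarrow> D + E \<in> L" "\<And>c D. D \<in> L \<Longrightarrow> (\<lambda>f. scale_fun c (D f)) \<in> L"
    using L by (auto simp: lie_subalgebra_def)
  have "lie_subalgebra X \<nn>"
    unfolding lie_subalgebra_def
  proof (intro conjI ballI allI)
    show "\<nn> \<subseteq> Vec X" using LV by (auto simp: \<nn>_def)
    have "lie_bracket D 0 = 0" if "D \<in> \<tt>" for D
      using Vec_0[OF \<tt>V[OF that]] by (simp add: lie_bracket_def fun_eq_iff)
    then show "0 \<in> \<nn>" using L'(1) \<tt>'(1) by (simp add: \<nn>_def)
  next
    fix E F assume EF: "E \<in> \<nn>" "F \<in> \<nn>"
    then have EFL: "E \<in> L" "F \<in> L" by (auto simp: \<nn>_def)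
    have "lie_bracket D (E + F) \<in> \<tt>" if "D \<in> \<tt>" for D
      unfolding bracket_add[OF \<tt>V[OF that] LV[OF EFL(1)] LV[OF EFL(2)]]
      using EF that \<tt>'(2) by (simp add: \<nn>_def)
    then show "E + F \<in> \<nn>" using L'(2)[OF EFL] by (simp add: \<nn>_def)
    have "lie_bracket D (lie_bracket E F) \<in> \<tt>" if "D \<in> \<tt>" for D
      unfolding jacobi[OF \<tt>V[OF that] LV[OF EFL(1)] LV[OF EFL(2)]]
      using EF that by (intro \<tt>'(2,3)) (simp_all add: \<nn>_def)
    then show "lie_bracket E F \<in> \<nn>" using Lbr[OF EFL] by (simp add: \<nn>_def)
  next
    fix c E assume E: "E \<in> \<nn>"
    then have EL: "E \<in> L" by (auto simp: \<nn>_def)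
    have "lie_bracket D (\<lambda>f. scale_fun c (E f)) \<in> \<tt>" if "D \<in> \<tt>" for D
      unfolding bracket_smult[OF \<tt>V[OF that] LV[OF EL]] using E that \<tt>'(3) by (simp add: \<nn>_def)
    then show "(\<lambda>f. scale_fun c (E f)) \<in> \<nn>" using L'(3)[OF EL] by (simp add: \<nn>_def)
  qed
  moreover have "Sg \<subseteq> \<nn>" using Sg(1) \<tt>s by (auto simp: \<nn>_def)
  ultimately have Ln: "L \<subseteq> \<nn>" unfolding Sg(3) generated_lie_subalgebra_def by blast
  have "lie_subalgebra X \<tt>"
    unfolding lie_subalgebra_def using \<tt>V \<tt>' \<tt>L Ln by (auto simp: \<nn>_def)
  moreover have "Sg \<subseteq> \<tt>"
  proof
    fix s assume s: "s \<in> Sg"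
    have "\<phi> s = (\<lambda>t. \<one>\<^bsub>N\<^esub> \<otimes>\<^bsub>N\<^esub> (\<phi> s t \<otimes>\<^bsub>N\<^esub> inv\<^bsub>N\<^esub> \<one>\<^bsub>N\<^esub>))"
    proof
      fix t have "\<phi> s t \<in> carrier N" using \<phi>S[OF s] by simp
      then show "\<phi> s t = \<one>\<^bsub>N\<^esub> \<otimes>\<^bsub>N\<^esub> (\<phi> s t \<otimes>\<^bsub>N\<^esub> inv\<^bsub>N\<^esub> \<one>\<^bsub>N\<^esub>)" by (simp only: LG.inv_one LG.r_one LG.l_one)
    qed
    then have "\<phi> s \<in> \<Gamma>" unfolding \<Gamma>_def using H1 s by blast
    then have "?\<tau> (\<phi> s) \<in> fun_vs.span (?\<tau> ` \<Gamma>)" by (intro fun_vs.span_base imageI)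
    then show "s \<in> \<tt>" unfolding \<tt>_def using \<phi>\<xi>[OF s] by (metis image_eqI)
  qed
  ultimately have "L \<subseteq> \<tt>" unfolding Sg(3) generated_lie_subalgebra_def by blast
  then have L\<tt>: "L = \<tt>" using \<tt>L by blast
  let ?G = "LG.subvar (LG.zclosure F.H)"
  note Z = zclosure_algebraic_subgroup[OF affine G0_algebraic, of N F.H, unfolded pts_G0, OF refl F.H_subgroup]
  have closure_tangent: "{A \<in> tangent_space G0 \<one>\<^bsub>N\<^esub>. \<forall>F\<in>LG.vanishing F.H. A F = 0} = fun_vs.span (?\<tau> ` \<Gamma>)"
    unfolding F.closure_tangent_eq_span[symmetric] F.closure_tangent_def F.I_def LG.vanishing_def ..
  have "Lie X ?G = L" unfolding Z(2) closure_tangent L\<tt> \<tt>_def ..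
  then show ?thesis using Z(1) by blast
qed

end

section \<open>Locally finite Lie algebras of vector fields\<close>

text \<open>\<open>U\<close> is the sum of \<open>L\<close>-stable finite-dimensional spaces, one for each member of a finite
  generating set.\<close>

lemma (in affine) locally_finite_stab:
  assumes L: "L \<subseteq> Vec X" and lf: "locally_finite X L"
  shows "\<exists>U m v x. stab X U m v x \<and> (\<forall>\<delta>\<in>L. \<forall>u\<in>U. \<delta> u \<in> U)"
proof -
  obtain S where S: "finite S" "regular X = gen_algebra (points X) S"
    "\<And>f x. f \<in> S \<Longrightarrow> x \<notin> points X \<Longrightarrow> f x = 0"
    using affine_varietyE[OF affine] by blast
  have SR: "f \<in> regular X" if "f \<in> S" for f unfolding S(2) using that by (rule gen_algebra.gen)
  have "\<forall>f\<in>S. \<exists>B. finite B \<and> f \<in> fun_vs.span B \<and> fun_vs.span B \<subseteq> regular X \<and> (\<forall>\<delta>\<in>L. \<forall>w\<in>fun_vs.span B. \<delta> w \<in> fun_vs.span B)"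
    using lf SR unfolding locally_finite_def by metis
  from bchoice[OF this] obtain B where B': "\<forall>f\<in>S. finite (B f) \<and> f \<in> fun_vs.span (B f) \<and> fun_vs.span (B f) \<subseteq> regular X \<and>
    (\<forall>\<delta>\<in>L. \<forall>w\<in>fun_vs.span (B f). \<delta> w \<in> fun_vs.span (B f))" by (elim exE)
  have B: "finite (B f)" "f \<in> fun_vs.span (B f)" "fun_vs.span (B f) \<subseteq> regular X"
    "\<And>\<delta> w. \<delta> \<in> L \<Longrightarrow> w \<in> fun_vs.span (B f) \<Longrightarrow> \<delta> w \<in> fun_vs.span (B f)" if "f \<in> S" for f
    using bspec[OF B' that] by simp_all
  define C where "C = (\<Union>f\<in>S. B f)"
  define U where "U = fun_vs.span C"
  have finC: "finite C" unfolding C_def using S(1) B(1) by blast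
  have Usub: "fun_vs.subspace U" unfolding U_def by (rule fun_vs.subspace_span)
  have BU: "fun_vs.span (B f) \<subseteq> U" if "f \<in> S" for f
    unfolding U_def C_def using that by (intro fun_vs.span_mono) blast
  have "C \<subseteq> regular X" unfolding C_def using B(3) fun_vs.span_base by blast
  then have UR: "U \<subseteq> regular X" unfolding U_def by (rule span_closed)
  have SU: "S \<subseteq> U" using B(2) BU by blast
  have gen: "regular X = gen_algebra (points X) U"
  proof
    show "regular X \<subseteq> gen_algebra (points X) U" unfolding S(2)
      by (rule gen_algebra_subset) (use SU in \<open>auto intro: gen_algebra.intros\<close>)
    show "gen_algebra (points X) U \<subseteq> regular X"
      by (rule gen_algebra_subset) (use UR const_closed add_closed mult_closed in auto)
  qed
  obtain m v x where d: "dual_basis U m v x"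
    using dual_basis_of_finite_span[OF finC Usub] by (auto simp: U_def)
  have "\<delta> u \<in> U" if \<delta>: "\<delta> \<in> L" and u: "u \<in> U" for \<delta> u
  proof -
    have \<delta>V: "\<delta> \<in> Vec X" using \<delta> L by blast
    have "fun_vs.subspace {u \<in> regular X. \<delta> u \<in> U}"
    proof (rule fun_vs.subspaceI)
      show "0 \<in> {u \<in> regular X. \<delta> u \<in> U}" using Vec_0[OF \<delta>V] zero_closed fun_vs.subspace_0[OF Usub] by simp
    next
      fix f g assume "f \<in> {u \<in> regular X. \<delta> u \<in> U}" "g \<in> {u \<in> regular X. \<delta> u \<in> U}"
      then show "f + g \<in> {u \<in> regular X. \<delta> u \<in> U}"
        using Vec_add[OF \<delta>V, of f g] add_closed[of f g] fun_vs.subspace_add[OF Usub] by simp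
    next
      fix c f assume "f \<in> {u \<in> regular X. \<delta> u \<in> U}"
      then show "scale_fun c f \<in> {u \<in> regular X. \<delta> u \<in> U}"
        using Vec_scale[OF \<delta>V, of f c] scale_closed[of f c] fun_vs.subspace_scale[OF Usub] by simp
    qed
    moreover have "C \<subseteq> {u \<in> regular X. \<delta> u \<in> U}"
    proof
      fix b assume "b \<in> C"
      then obtain f where f: "f \<in> S" "b \<in> fun_vs.span (B f)" unfolding C_def using fun_vs.span_base by blast
      then show "b \<in> {u \<in> regular X. \<delta> u \<in> U}" using B(3,4) BU \<delta> by blast
    qed
    ultimately have "U \<subseteq> {u \<in> regular X. \<delta> u \<in> U}" unfolding U_def by (rule fun_vs.span_minimal[rotated])
    then show ?thesis using u by blast
  qed
  moreover have "stab X U m v x"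
    by unfold_locales (use Usub UR d gen in auto)
  ultimately show ?thesis by blast
qed

theorem theoremE:
  fixes X :: "('a, 'k::{alg_closed_field, field_char_0}) variety"
    and L :: "(('a \<Rightarrow> 'k) \<Rightarrow> ('a \<Rightarrow> 'k)) set"
  assumes "affine_variety X" and "lie_subalgebra X L"
  shows "((\<exists>G. algebraic_subgroup X G \<and> L \<subseteq> Lie X G) \<longleftrightarrow> locally_finite X L) \<and>
    (locally_finite X L \<and>
      (\<exists>S. S \<subseteq> L \<and> (\<forall>\<delta> \<in> S. locally_nilpotent X \<delta>) \<and> L = generated_lie_subalgebra X S)
      \<longrightarrow> (\<exists>G. algebraic_subgroup X G \<and> L = Lie X G))"
proof -
  interpret affine X by unfold_locales (rule assms(1))
  have LV: "L \<subseteq> Vec X" using assms(2) by (simp add: lie_subalgebra_def)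
  have "locally_finite X L" if G: "algebraic_subgroup X G" "L \<subseteq> Lie X G" for G
    using Lie_locally_finite[OF assms(1) G(1)] G(2) unfolding locally_finite_def by (meson subsetD)
  moreover have "\<exists>G. algebraic_subgroup X G \<and> L \<subseteq> Lie X G" if lf: "locally_finite X L"
  proof -
    obtain U m v x where st: "stab X U m v x" and LU: "\<And>\<delta> u. \<delta> \<in> L \<Longrightarrow> u \<in> U \<Longrightarrow> \<delta> u \<in> U"
      using locally_finite_stab[OF LV lf] by blast
    interpret stab X U m v x by (rule st)
    have "\<delta> \<in> Lie X G0" if \<delta>: "\<delta> \<in> L" for \<delta>
    proof -
      obtain A where "A \<in> tangent_space G0 \<one>\<^bsub>N\<^esub>" "fundamental_field G0 X (\<lambda>g. g) A = \<delta>"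
        using derivation_tangent[OF alg_closed_imp_poly_has_root subsetD[OF LV \<delta>] LU[OF \<delta>]] by blast
      then show ?thesis unfolding Lie_def lie_of_action_def pts_G0 by blast
    qed
    then show ?thesis using G0_algebraic by blast
  qed
  moreover have "\<exists>G. algebraic_subgroup X G \<and> L = Lie X G"
    if lf: "locally_finite X L" and Sg: "Sg \<subseteq> L" "\<forall>\<delta>\<in>Sg. locally_nilpotent X \<delta>" "L = generated_lie_subalgebra X Sg" for Sg
  proof -
    obtain U m v x where st: "stab X U m v x" and LU: "\<And>\<delta> u. \<delta> \<in> L \<Longrightarrow> u \<in> U \<Longrightarrow> \<delta> u \<in> U"
      using locally_finite_stab[OF LV lf] by blast
    show ?thesis
      using stab.nilpotently_generated_algebraic[OF st assms(2) _ Sg(1) _ Sg(3)] LU Sg(2) by blast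
  qed
  ultimately show ?thesis by blast
qed

end
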